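(* Let $g\in L^\infty(\mathbb{S}^2;\mathbb{R})$ and let $p\ge 3$ be an integer. Then there exist a constant $C_{g,p}>0$ and an orthonormal basis $b=(e_k)_{k\in\mathcal{T}_\infty}\in C^\infty(\mathbb{S}^2;\mathbb{R})^{\mathcal{T}_\infty}$ of $L^2(\mathbb{S}^2;\mathbb{R})$ such that, for all $k=(\ell,m)\in\mathcal{T}_\infty$, $$\Delta e_{\ell,m}=-\ell(\ell+1)\,e_{\ell,m},$$ and, for all $\mathbf{k}=(k_1,\dots,k_p)\in\mathcal{T}_\infty^p$, writing $k_j=(\ell_j,m_j)$, $$\left|\int_{\mathbb{S}^2}e_{k_1}(x)\cdots e_{k_p}(x)\,g(x)\,\mathrm{d}\mathrm{vol}_{\mathbb{S}^2}(x)\right|\le C_{g,p}\min\left\{1,\frac{\log^p(2+|\ell|_\infty)}{\sqrt{\Upsilon(\mathbf{k})}}\right\},$$ where $|\ell|_\infty=\max_{1\le j\le p}\ell_j$ and $$\Upsilon(\mathbf{k}):=\max\big(\{1\}\cup\{\langle\ell_j\rangle:\ 1\le j\le p,\ \forall j'\ne j,\ k_{j'}\ne k_j\}\big).$$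
   Context: $\mathbb{S}^2$ is the Euclidean unit sphere of $\mathbb{R}^3$ with its standard volume measure $\mathrm{vol}_{\mathbb{S}^2}$ and Laplace--Beltrami operator $\Delta$; $\langle y\rangle=\sqrt{1+y^2}$; $\mathbb{N}=\{0,1,2,\dots\}$; $\mathcal{T}_\infty=\{(\ell,m)\in\mathbb{N}\times\mathbb{Z}:\ -\ell\le m\le\ell\}$. *)

theory Defs
  imports "HOL-Analysis.Analysis"
begin

section \<open>The unit sphere in \<open>\<real>\<^sup>3\<close> and its volume measure\<close>

abbreviation S2 :: "(real ^ 3) set" where
  "S2 \<equiv> sphere 0 1"

text \<open>
  The surface measure is given by polar coordinates: \<open>vol A = 3 * Leb {t *\<^sub>R x | x \<in> A, 0 < t < 1}\<close>
  for Borel sets \<open>A \<subseteq> S2\<close>. Here \<open>sgn y = y /\<^sub>R norm y\<close> is the radial projection.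
  The measure is normalised to total mass \<open>4 * pi\<close> (lemma \<open>emeasure_vol_S2_space\<close>) and it is invariant
  under orthogonal maps (lemma \<open>emeasure_vol_S2_orthogonal\<close>).
\<close>
definition vol_S2 :: "(real ^ 3) measure" where
  "vol_S2 = scale_measure 3
     (distr (restrict_space lborel (ball 0 1 - {0})) (restrict_space borel S2) sgn)"

lemma space_vol_S2 [simp]: "space vol_S2 = S2"
  by (simp add: vol_S2_def space_scale_measure space_restrict_space)

lemma sets_vol_S2 [measurable_cong]: "sets vol_S2 = sets (restrict_space borel S2)"
  by (simp add: vol_S2_def)

lemma measurable_sgn_S2:
  "sgn \<in> restrict_space lborel (ball 0 1 - {0}) \<rightarrow>\<^sub>M restrict_space borel S2"
proof (rule measurable_restrict_space2)
  show "sgn \<in> space (restrict_space lborel (ball 0 1 - {0})) \<rightarrow> S2"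
    by (auto simp: space_restrict_space norm_sgn)
  have "continuous_on (ball 0 1 - {0}) (sgn :: real ^ 3 \<Rightarrow> _)"
    unfolding sgn_div_norm by (intro continuous_intros) auto
  then have "sgn \<in> borel_measurable (restrict_space borel (ball 0 1 - {0::real ^ 3}))"
    by (rule borel_measurable_continuous_on_restrict)
  then show "sgn \<in> restrict_space lborel (ball 0 1 - {0::real ^ 3}) \<rightarrow>\<^sub>M borel"
    by (subst measurable_cong_sets[OF sets_restrict_space_cong[OF sets_lborel] refl])
qed

lemma emeasure_vol_S2:
  assumes "A \<in> sets vol_S2"
  shows "emeasure vol_S2 A = 3 * emeasure lborel {y \<in> ball 0 1 - {0}. sgn y \<in> A}"
proof -
  have "emeasure vol_S2 A = 3 * emeasure (restrict_space lborel (ball 0 1 - {0}))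
      (sgn -` A \<inter> space (restrict_space lborel (ball 0 1 - {0})))"
    using assms unfolding vol_S2_def by (simp add: emeasure_distr measurable_sgn_S2)
  also have "sgn -` A \<inter> space (restrict_space lborel (ball 0 1 - {0})) =
      {y \<in> ball 0 1 - {0}. sgn y \<in> A}"
    by (auto simp: space_restrict_space)
  also have "emeasure (restrict_space lborel (ball 0 1 - {0})) \<dots> = emeasure lborel \<dots>"
    by (rule emeasure_restrict_space) auto
  finally show ?thesis .
qed

lemma emeasure_vol_S2_space: "emeasure vol_S2 S2 = ennreal (4 * pi)"
proof -
  have S: "S2 \<in> sets vol_S2"
    using sets.top[of vol_S2] by simp
  have "{y \<in> ball 0 1 - {0::real ^ 3}. sgn y \<in> S2} = ball 0 1 - {0}"
    by (auto simp: norm_sgn)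
  then have "emeasure vol_S2 S2 = 3 * emeasure lborel (ball 0 1 - {0::real ^ 3})"
    by (simp add: emeasure_vol_S2[OF S])
  also have "emeasure lborel (ball 0 1 - {0::real ^ 3}) = emeasure lborel (ball 0 1 :: (real ^ 3) set)"
    by (subst emeasure_Diff) auto
  also have "\<dots> = ennreal (4 / 3 * pi)"
    by (simp add: emeasure_ball unit_ball_vol_3 )
  also have "3 * ennreal (4 / 3 * pi) = ennreal (4 * pi)"
    by (simp flip: ennreal_mult' ennreal_numeral)
  finally show ?thesis .
qed

lemma emeasure_vol_S2_orthogonal:
  assumes f: "orthogonal_transformation f" and A: "A \<in> sets vol_S2"
  shows "emeasure vol_S2 (f ` A) = emeasure vol_S2 A"
proof -
  interpret f: linear f
    using f by (simp add: orthogonal_transformation_def)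
  define B where "B = {y \<in> ball 0 1 - {0}. sgn y \<in> A}"
  have norm_f: "norm (f x) = norm x" for x
    using f by (simp add: orthogonal_transformation_norm)
  have sgn_f: "sgn (f y) = f (sgn y)" for y
    by (simp add: sgn_div_norm norm_f f.scale)
  have inj: "inj f" and surj: "surj f"
    using f by (simp_all add: orthogonal_transformation_inj orthogonal_transformation_surj)
  have inv_f: "orthogonal_transformation (inv f)"
    using f by (rule orthogonal_transformation_inv)
  have A_borel: "A \<in> sets borel" and A_S2: "A \<subseteq> S2"
    using A by (auto simp: sets_vol_S2 sets_restrict_space_iff)
  have "inv f \<in> borel_measurable borel"
    using inv_f by (intro borel_measurable_continuous_onI linear_continuous_on
        linear_linear[THEN iffD2]) (simp add: orthogonal_transformation_def)
  then have "inv f -` A \<in> sets borel"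
    using A_borel by (metis measurable_sets_borel)
  moreover have "inv f -` A = f ` A"
    using inj surj by (auto simp: surj_f_inv_f image_iff intro!: bexI[of _ "inv f _"])
  ultimately have fA_borel: "f ` A \<in> sets borel"
    by simp
  have fA: "f ` A \<in> sets vol_S2"
    using fA_borel A_S2 by (auto simp: sets_vol_S2 sets_restrict_space_iff norm_f)
  have B_meas: "{y \<in> ball 0 1 - {0}. sgn y \<in> A'} \<in> lmeasurable \<and>
      {y \<in> ball 0 1 - {0}. sgn y \<in> A'} \<in> sets borel" if "A' \<in> sets vol_S2" for A'
  proof -
    have "sgn -` A' \<inter> space (restrict_space lborel (ball 0 1 - {0}))
        \<in> sets (restrict_space lborel (ball 0 1 - {0}))"
      using that measurable_sgn_S2 by (intro measurable_sets) (auto simp: sets_vol_S2)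
    then have "{y \<in> ball 0 1 - {0}. sgn y \<in> A'} \<in> sets borel"
      by (auto simp: sets_restrict_space_iff space_restrict_space vimage_def Int_def conj_commute
          cong: conj_cong)
    moreover have "{y \<in> ball 0 1 - {0}. sgn y \<in> A'} \<subseteq> ball 0 1"
      by auto
    ultimately show ?thesis
      by (intro conjI bounded_set_imp_lmeasurable) (auto intro: bounded_subset[OF bounded_ball])
  qed
  have "f y \<in> {y \<in> ball 0 1 - {0}. sgn y \<in> f ` A} \<longleftrightarrow> y \<in> B" for y
  proof -
    have "f y = 0 \<longleftrightarrow> y = 0"
      by (metis norm_f norm_eq_zero)
    then show ?thesis
      by (simp add: B_def norm_f sgn_f inj_image_mem_iff[OF inj])
  qed
  then have "{y \<in> ball 0 1 - {0}. sgn y \<in> f ` A} = f ` B"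
    using surj by (metis (no_types, lifting) surj_image_vimage_eq vimageI2 vimageE subset_antisym subsetI)
  moreover have "emeasure lborel (f ` B) = emeasure lborel B"
  proof -
    have fB: "f ` B \<in> lmeasurable" "f ` B \<in> sets borel"
      using B_meas[OF fA] calculation by auto
    have B: "B \<in> lmeasurable" "B \<in> sets borel"
      using B_meas[OF A] by (auto simp: B_def)
    have "emeasure lebesgue (f ` B) = emeasure lebesgue B"
      using measure_orthogonal_image[OF f B(1)] fB(1) B(1) by (simp add: emeasure_eq_measure2)
    then show ?thesis
      using fB(2) B(2) by simp
  qed
  ultimately show ?thesis
    by (simp add: emeasure_vol_S2 A fA B_def)
qed


section \<open>Smooth functions on the sphere\<close>

definition partial_deriv :: "'n \<Rightarrow> (real ^ 'n \<Rightarrow> real) \<Rightarrow> real ^ 'n \<Rightarrow> real" where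
  "partial_deriv i F x = frechet_derivative F (at x) (axis i 1)"

primrec C_k_on :: "nat \<Rightarrow> (real ^ 'n \<Rightarrow> real) \<Rightarrow> (real ^ 'n) set \<Rightarrow> bool" where
  "C_k_on 0 F U \<longleftrightarrow> continuous_on U F"
| "C_k_on (Suc k) F U \<longleftrightarrow>
     (\<forall>x\<in>U. F differentiable (at x)) \<and> (\<forall>i. C_k_on k (partial_deriv i F) U)"

text \<open>
  Functions on the sphere are represented by functions on \<open>\<real>\<^sup>3\<close> of which only the values on
  \<open>S2\<close> matter. As usual for a closed submanifold, \<open>f\<close> is smooth on \<open>S2\<close> if it is the restriction of
  a smooth function on an open neighbourhood of \<open>S2\<close>.
\<close>
definition smooth_on_S2 :: "(real ^ 3 \<Rightarrow> real) \<Rightarrow> bool" where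
  "smooth_on_S2 f \<longleftrightarrow>
     (\<exists>U F. open U \<and> S2 \<subseteq> U \<and> (\<forall>k. C_k_on k F U) \<and> (\<forall>x\<in>S2. F x = f x))"


section \<open>The Laplace--Beltrami operator\<close>

text \<open>
  The operator is the divergence of the gradient. For \<open>f\<close> on the sphere, \<open>f \<circ> sgn\<close> is its extension
  to \<open>\<real>\<^sup>3 - {0}\<close> that is constant on rays. At a point \<open>x\<close> of the sphere the radial derivative of such
  an extension vanishes and its derivative in a tangent direction is the derivative of \<open>f\<close>; so
  the Euclidean gradient of \<open>f \<circ> sgn\<close> is the tangential (Riemannian) gradient of \<open>f\<close>, and for a
  tangent field \<open>X\<close> the Euclidean divergence of \<open>X \<circ> sgn\<close> is the trace over the tangent plane
  of \<open>v \<mapsto> D\<^sub>v X\<close>, that is, the Riemannian divergence of \<open>X\<close>.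
\<close>
definition grad_S2 :: "(real ^ 3 \<Rightarrow> real) \<Rightarrow> real ^ 3 \<Rightarrow> real ^ 3" where
  "grad_S2 f x = (\<chi> i. partial_deriv i (\<lambda>y. f (sgn y)) x)"

definition div_S2 :: "(real ^ 3 \<Rightarrow> real ^ 3) \<Rightarrow> real ^ 3 \<Rightarrow> real" where
  "div_S2 X x = (\<Sum>i\<in>UNIV. partial_deriv i (\<lambda>y. X (sgn y) $ i) x)"

definition laplace_S2 :: "(real ^ 3 \<Rightarrow> real) \<Rightarrow> real ^ 3 \<Rightarrow> real" where
  "laplace_S2 f = div_S2 (grad_S2 f)"


section \<open>Real \<open>L\<^sup>2\<close> and \<open>L\<^sup>\<infinity>\<close> functions\<close>

definition L2_fun :: "'a measure \<Rightarrow> ('a \<Rightarrow> real) \<Rightarrow> bool" where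
  "L2_fun M f \<longleftrightarrow> f \<in> borel_measurable M \<and> integrable M (\<lambda>x. (f x)\<^sup>2)"

definition Linfty_fun :: "'a measure \<Rightarrow> ('a \<Rightarrow> real) \<Rightarrow> bool" where
  "Linfty_fun M f \<longleftrightarrow> f \<in> borel_measurable M \<and> (\<exists>B. AE x in M. \<bar>f x\<bar> \<le> B)"

definition L2_norm :: "'a measure \<Rightarrow> ('a \<Rightarrow> real) \<Rightarrow> real" where
  "L2_norm M f = sqrt (\<integral>x. (f x)\<^sup>2 \<partial>M)"

text \<open>Orthonormal (Hilbert) basis: an orthonormal family whose finite linear span is dense.\<close>
definition orthonormal_basis_L2 :: "'a measure \<Rightarrow> 'i set \<Rightarrow> ('i \<Rightarrow> 'a \<Rightarrow> real) \<Rightarrow> bool" where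
  "orthonormal_basis_L2 M I e \<longleftrightarrow>
     (\<forall>i\<in>I. L2_fun M (e i)) \<and>
     (\<forall>i\<in>I. \<forall>j\<in>I. (\<integral>x. e i x * e j x \<partial>M) = (if i = j then 1 else 0)) \<and>
     (\<forall>f. L2_fun M f \<longrightarrow> (\<forall>\<epsilon>>0. \<exists>J c. finite J \<and> J \<subseteq> I \<and>
        L2_norm M (\<lambda>x. f x - (\<Sum>j\<in>J. c j * e j x)) < \<epsilon>))"


section \<open>Index sets and weights\<close>

definition T_infty :: "(nat \<times> int) set" where
  "T_infty = {(l, m). - int l \<le> m \<and> m \<le> int l}"

definition jbracket :: "real \<Rightarrow> real" where
  "jbracket y = sqrt (1 + y\<^sup>2)"

text \<open>A \<open>p\<close>-tuple \<open>(k\<^sub>1, \<dots>, k\<^sub>p)\<close> is a function of which only the values on \<open>{1..p}\<close> matter.\<close>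

definition ell_max :: "nat \<Rightarrow> (nat \<Rightarrow> nat \<times> int) \<Rightarrow> nat" where
  "ell_max p k = Max ((\<lambda>j. fst (k j)) ` {1..p})"

definition Upsilon :: "nat \<Rightarrow> (nat \<Rightarrow> nat \<times> int) \<Rightarrow> real" where
  "Upsilon p k = Max ({1} \<union> {jbracket (real (fst (k j))) | j.
     j \<in> {1..p} \<and> (\<forall>j'\<in>{1..p}. j' \<noteq> j \<longrightarrow> k j' \<noteq> k j)})"

end

theory Submission
  imports Defs
begin

text \<open>
Fix a degree \<open>l\<close> and put \<open>n = 2 * l + 1\<close>. For every orthonormal basis of the \<open>n\<close>-dimensional space of
spherical harmonics of degree \<open>l\<close>, the sum of the squares of the basis functions is the constant
\<open>n / (4 * pi)\<close>. That identity alone does not give the estimate, but a random basis satisfies it. The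
randomness is elementary: from a basis \<open>f\<close> one forms
\<open>e m = (\<Sum>i<n. H m i * \<epsilon> i * f i)\<close> with independent signs \<open>\<epsilon> i\<close> and the discrete Hartley matrix
\<open>H\<close>, an orthogonal matrix all of whose entries are bounded by \<open>2 / sqrt n\<close>. At each point \<open>e m\<close> is a sum
of independent signs with bounded variance, so its moments are bounded independently of \<open>l\<close>.

The integral of \<open>g\<close> against a product of \<open>p\<close> basis functions is a polynomial of degree at most \<open>p\<close>
in the signs. If an index \<open>m\<close> of level \<open>l\<close> occurs exactly once in the tuple, the second moment of this
polynomial is \<open>O(1 / n)\<close> up to logarithms (\<open>level_second_moment\<close>). For the variance this is the
Poincare inequality on the cube combined with Bessel's inequality: flipping \<open>\<epsilon> i\<close> changes the integral,
to first order, by inner products of \<open>f i\<close> with functions that do not depend on \<open>i\<close>. For the mean one integrates by parts in the signs.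
What remains are the functions \<open>\<Sum>i. H m i * H m' i * (f i)\<^sup>2\<close> with \<open>m \<noteq> m'\<close>, and these are small
in \<open>L\<^sup>2\<close> as soon as \<open>f\<close> has itself been produced by a random rotation (\<open>good_block_basis\<close>).

Hypercontractivity (\<open>chaos_hypercontractive\<close>) bounds the moment of order \<open>2 * s\<close> by the second moment, at
the price of a factor of order \<open>s powr (p / 2)\<close> in the norm. Taking \<open>s\<close> of the size of \<open>ln (2 + L)\<close>, where
\<open>L\<close> is the largest level in the tuple, makes the probability of a bad tuple smaller than any fixed power of
\<open>L\<close>, and a union bound over all tuples costs only powers of \<open>ln (2 + L)\<close>. The bound by a constant,
without decay, follows in the same way from the concentration of the integrals of
\<open>e m ^ (2 * p)\<close> (\<open>variance_even_power_integral\<close>). The union bound is applied to the finitely many levels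
up to \<open>L\<close>, and a compactness argument (\<open>sets_cluster_point\<close>) lets \<open>L\<close> tend to infinity.

The harmonics themselves come from orthonormalising the monomials on the sphere in the order of their degree.
The Laplacian is symmetric, because it is a sum of squares of rotation fields, and on polynomials
of degree at most \<open>l\<close> it equals \<open>- l * (l + 1)\<close> up to polynomials of smaller degree. Hence a polynomial of
degree \<open>l\<close> that is orthogonal to all polynomials of smaller degree is an eigenfunction (\<open>harmonic_eigenfunction\<close>). The
constancy of the sum of squares follows from the invariance of the measure under rotations.
\<close>

section \<open>Averages over signs\<close>

text \<open>
A choice of signs is encoded by the set of the indices that carry the sign \<open>+1\<close>.
\<close>
definition sg :: "nat set \<Rightarrow> nat \<Rightarrow> real" where
  "sg S i = (if i \<in> S then 1 else -1)"

definition sign_avg :: "nat set \<Rightarrow> (nat set \<Rightarrow> real) \<Rightarrow> real" where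
  "sign_avg A F = (\<Sum>S\<in>Pow A. F S) / 2 ^ card A"

definition flip :: "nat \<Rightarrow> nat set \<Rightarrow> nat set" where
  "flip i S = (if i \<in> S then S - {i} else insert i S)"

lemma sg_square [simp]: "sg S i * sg S i = 1" "(sg S i)\<^sup>2 = 1" "sg S i * (sg S i * x) = x"
  by (auto simp: sg_def)

lemma abs_sg [simp]: "\<bar>sg S i\<bar> = 1"
  by (simp add: sg_def)

lemma sg_flip: "sg (flip i S) j = (if j = i then - sg S i else sg S j)"
  by (cases "i \<in> S"; cases "j = i") (simp_all add: sg_def flip_def)

lemma flip_flip [simp]: "flip i (flip i S) = S"
  by (auto simp: flip_def)

lemma flip_subset: "i \<in> A \<Longrightarrow> S \<subseteq> A \<Longrightarrow> flip i S \<subseteq> A"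
  by (auto simp: flip_def)

lemma sign_avg_add: "sign_avg A (\<lambda>S. F S + G S) = sign_avg A F + sign_avg A G"
  by (simp add: sign_avg_def sum.distrib add_divide_distrib)

lemma sign_avg_diff: "sign_avg A (\<lambda>S. F S - G S) = sign_avg A F - sign_avg A G"
  by (simp add: sign_avg_def sum_subtractf diff_divide_distrib)

lemma sign_avg_minus: "sign_avg A (\<lambda>S. - F S) = - sign_avg A F"
  by (simp add: sign_avg_def sum_negf)

lemma sign_avg_cmult: "sign_avg A (\<lambda>S. c * F S) = c * sign_avg A F"
  by (simp add: sign_avg_def sum_distrib_left)

lemma sign_avg_divide: "sign_avg A (\<lambda>S. F S / c) = sign_avg A F / c"
  by (simp add: sign_avg_def sum_divide_distrib mult.commute)

lemma sign_avg_sum: "sign_avg A (\<lambda>S. \<Sum>i\<in>I. F i S) = (\<Sum>i\<in>I. sign_avg A (F i))"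
proof -
  have "(\<Sum>S\<in>Pow A. \<Sum>i\<in>I. F i S) = (\<Sum>i\<in>I. \<Sum>S\<in>Pow A. F i S)"
    by (rule sum.swap)
  then show ?thesis by (simp add: sign_avg_def sum_divide_distrib)
qed

lemma sign_avg_const: "finite A \<Longrightarrow> sign_avg A (\<lambda>S. c) = c"
  by (simp add: sign_avg_def card_Pow)

lemma sign_avg_mono: "(\<And>S. S \<subseteq> A \<Longrightarrow> F S \<le> G S) \<Longrightarrow> sign_avg A F \<le> sign_avg A G"
  unfolding sign_avg_def by (intro divide_right_mono sum_mono) auto

lemma sign_avg_cong: "(\<And>S. S \<subseteq> A \<Longrightarrow> F S = G S) \<Longrightarrow> sign_avg A F = sign_avg A G"
  unfolding sign_avg_def by (intro arg_cong2[where f = "(/)"] sum.cong) auto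

lemma sign_avg_nonneg: "(\<And>S. S \<subseteq> A \<Longrightarrow> 0 \<le> F S) \<Longrightarrow> 0 \<le> sign_avg A F"
  unfolding sign_avg_def by (intro divide_nonneg_nonneg sum_nonneg) auto

lemma sign_avg_empty [simp]: "sign_avg {} F = F {}"
  by (simp add: sign_avg_def)

lemma sign_avg_flip:
  assumes "i \<in> A"
  shows "sign_avg A (\<lambda>S. F (flip i S)) = sign_avg A F"
proof -
  have "(\<Sum>S\<in>Pow A. F (flip i S)) = (\<Sum>S\<in>Pow A. F S)"
    by (rule sum.reindex_bij_witness[of _ "flip i" "flip i"])
      (use assms flip_subset in auto)
  then show ?thesis by (simp add: sign_avg_def)
qed

lemma sign_avg_insert:
  assumes "finite A" "k \<notin> A"
  shows "sign_avg (insert k A) F = sign_avg A (\<lambda>S. (F S + F (insert k S)) / 2)"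
proof -
  have "(\<Sum>S\<in>Pow (insert k A). F S) = (\<Sum>S\<in>Pow A. F S) + (\<Sum>S\<in>insert k ` Pow A. F S)"
    unfolding Pow_insert using assms by (intro sum.union_disjoint) auto
  also have "(\<Sum>S\<in>insert k ` Pow A. F S) = (\<Sum>S\<in>Pow A. F (insert k S))"
    using assms by (subst sum.reindex) (auto simp: inj_on_def)
  finally show ?thesis
    using assms by (simp add: sign_avg_def sum.distrib add_divide_distrib sum_divide_distrib)
qed

lemma sign_avg_Un:
  assumes "finite A" "finite B" "A \<inter> B = {}"
  shows "sign_avg (A \<union> B) F = sign_avg B (\<lambda>T. sign_avg A (\<lambda>S. F (S \<union> T)))"
proof -
  have "(\<Sum>S\<in>Pow (A \<union> B). F S) = (\<Sum>(T, S)\<in>Pow B \<times> Pow A. F (S \<union> T))"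
    by (rule sum.reindex_bij_witness[of _ "\<lambda>(T, S). S \<union> T" "\<lambda>S. (S \<inter> B, S \<inter> A)"])
      (use assms in \<open>auto simp: Int_Un_distrib2 intro!: arg_cong[where f = F]\<close>)
  also have "\<dots> = (\<Sum>T\<in>Pow B. \<Sum>S\<in>Pow A. F (S \<union> T))"
    by (simp add: sum.cartesian_product)
  finally show ?thesis
    using assms by (simp add: sign_avg_def card_Un_disjoint power_add sum_divide_distrib[symmetric] mult.commute)
qed

lemma sign_avg_ex_le:
  assumes "finite A"
  shows "\<exists>S\<subseteq>A. F S \<le> sign_avg A F"
proof (rule ccontr)
  assume "\<not> ?thesis"
  then have *: "sign_avg A F < F S" if "S \<in> Pow A" for S using that by (meson PowD not_le)
  have "(\<Sum>S\<in>Pow A. sign_avg A F) < (\<Sum>S\<in>Pow A. F S)"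
    by (rule sum_strict_mono) (use assms * in auto)
  then show False
    using assms by (simp add: sign_avg_def card_Pow)
qed

lemma sign_avg_sg_sg:
  assumes "finite A" "i \<in> A"
  shows "sign_avg A (\<lambda>S. sg S i * sg S j) = (if i = j then 1 else 0)"
proof (cases "i = j")
  case True then show ?thesis using assms by (simp add: sign_avg_const)
next
  case False
  have "sign_avg A (\<lambda>S. sg S i * sg S j) = sign_avg A (\<lambda>S. sg (flip i S) i * sg (flip i S) j)"
    by (rule sign_avg_flip[symmetric]) fact
  also have "\<dots> = - sign_avg A (\<lambda>S. sg S i * sg S j)"
    using False by (simp add: sg_flip sign_avg_minus)
  finally show ?thesis using False by simp
qed

text \<open>
Integration by parts in a single sign.
\<close>
lemma sign_avg_sg_mult:
  assumes "i \<in> A"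
  shows "sign_avg A (\<lambda>S. sg S i * F S) = sign_avg A (\<lambda>S. sg S i * (F S - F (flip i S))) / 2"
proof -
  have "sign_avg A (\<lambda>S. sg S i * F S) = sign_avg A (\<lambda>S. sg (flip i S) i * F (flip i S))"
    by (rule sign_avg_flip[symmetric]) fact
  also have "\<dots> = - sign_avg A (\<lambda>S. sg S i * F (flip i S))"
    by (simp add: sg_flip sign_avg_minus)
  finally show ?thesis
    by (simp add: right_diff_distrib sign_avg_diff)
qed

lemma sign_avg_linear_square:
  assumes "finite A"
  shows "sign_avg A (\<lambda>S. (\<Sum>i\<in>A. c i * sg S i)\<^sup>2) = (\<Sum>i\<in>A. (c i)\<^sup>2)"
proof -
  have "sign_avg A (\<lambda>S. (\<Sum>i\<in>A. c i * sg S i)\<^sup>2) =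
        (\<Sum>i\<in>A. \<Sum>j\<in>A. c i * c j * sign_avg A (\<lambda>S. sg S i * sg S j))"
    by (simp add: power2_eq_square sum_product sign_avg_sum flip: sign_avg_cmult)
      (intro sum.cong refl sign_avg_cong, simp)
  also have "\<dots> = (\<Sum>i\<in>A. \<Sum>j\<in>A. if i = j then (c i)\<^sup>2 else 0)"
    using assms by (intro sum.cong refl) (auto simp: sign_avg_sg_sg power2_eq_square)
  finally show ?thesis using assms by simp
qed

text \<open>
The Poincare inequality on the discrete cube. Adding one coordinate splits \<open>F\<close> into its mean and its half
difference in that coordinate. Averaging is a contraction of the other difference terms, and the half
difference is exactly the new term of the right-hand side.
\<close>
lemma sign_avg_poincare:
  assumes "finite A"
  shows "sign_avg A (\<lambda>S. (F S)\<^sup>2) \<le> (sign_avg A F)\<^sup>2 + (\<Sum>i\<in>A. sign_avg A (\<lambda>S. (F S - F (flip i S))\<^sup>2)) / 4"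
  using assms
proof (induction A arbitrary: F)
  case empty then show ?case by simp
next
  case (insert k A F)
  note fin = insert.hyps(1) and k = insert.hyps(2)
  define M where "M S = (F S + F (insert k S)) / 2" for S
  define D where "D S = (F S - F (insert k S)) / 2" for S
  have sq: "sign_avg (insert k A) (\<lambda>S. (F S)\<^sup>2) = sign_avg A (\<lambda>S. (M S)\<^sup>2) + sign_avg A (\<lambda>S. (D S)\<^sup>2)"
    unfolding sign_avg_insert[OF fin k] sign_avg_add[symmetric]
    by (rule sign_avg_cong) (simp add: M_def D_def power2_eq_square field_simps)
  have mean: "sign_avg (insert k A) F = sign_avg A M"
    unfolding sign_avg_insert[OF fin k] M_def ..
  have le: "sign_avg A (\<lambda>S. (M S - M (flip i S))\<^sup>2) \<le> sign_avg (insert k A) (\<lambda>S. (F S - F (flip i S))\<^sup>2)"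
    if i: "i \<in> A" for i
    unfolding sign_avg_insert[OF fin k]
  proof (rule sign_avg_mono)
    fix S assume S: "S \<subseteq> A"
    have "flip i (insert k S) = insert k (flip i S)"
      using i k by (auto simp: flip_def)
    moreover have "((x + y) / 2 - (x' + y') / 2)\<^sup>2 \<le> ((x - x')\<^sup>2 + (y - y')\<^sup>2) / 2" for x y x' y' :: real
      using zero_le_power2[of "(x - x') - (y - y')"] by (simp add: power2_eq_square field_simps)
    ultimately show "(M S - M (flip i S))\<^sup>2 \<le> ((F S - F (flip i S))\<^sup>2 +
         (F (insert k S) - F (flip i (insert k S)))\<^sup>2) / 2"
      by (simp add: M_def)
  qed
  have kk: "sign_avg (insert k A) (\<lambda>S. (F S - F (flip k S))\<^sup>2) = 4 * sign_avg A (\<lambda>S. (D S)\<^sup>2)"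
    unfolding sign_avg_insert[OF fin k] sign_avg_cmult[symmetric]
  proof (rule sign_avg_cong)
    fix S assume "S \<subseteq> A"
    then have "k \<notin> S" using k by auto
    then have "flip k S = insert k S" "flip k (insert k S) = S" by (auto simp: flip_def)
    then show "((F S - F (flip k S))\<^sup>2 + (F (insert k S) - F (flip k (insert k S)))\<^sup>2) / 2 = 4 * (D S)\<^sup>2"
      by (simp add: D_def power2_eq_square field_simps)
  qed
  have "sign_avg A (\<lambda>S. (M S)\<^sup>2) \<le> (sign_avg A M)\<^sup>2 + (\<Sum>i\<in>A. sign_avg A (\<lambda>S. (M S - M (flip i S))\<^sup>2)) / 4"
    by (rule insert.IH)
  also have "\<dots> \<le> (sign_avg A M)\<^sup>2 + (\<Sum>i\<in>A. sign_avg (insert k A) (\<lambda>S. (F S - F (flip i S))\<^sup>2)) / 4"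
    by (intro add_left_mono divide_right_mono sum_mono le) auto
  finally show ?case
    using fin k by (simp add: sq mean kk add_divide_distrib)
qed

section \<open>Hypercontractivity of sign polynomials\<close>

text \<open>
The graph of \<open>t ^ s\<close> lies above its tangent at \<open>x\<close>.
\<close>
lemma power_tangent:
  fixes x y :: real
  assumes "x \<ge> 0" "y \<ge> 0"
  shows "real s * x ^ (s - 1) * y \<le> (real s - 1) * x ^ s + y ^ s"
proof (induction s)
  case 0 then show ?case by simp
next
  case (Suc s)
  show ?case
  proof (cases s)
    case 0 then show ?thesis by simp
  next
    case (Suc s')
    have *: "real s * x ^ (s - 1) * y * y \<le> ((real s - 1) * x ^ s + y ^ s) * y"
      using Suc.IH assms by (intro mult_right_mono)
    have "real s * x ^ s' * (x - y)\<^sup>2 \<ge> 0" using assms by simp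
    then show ?thesis using * Suc
      by (simp add: power2_eq_square algebra_simps)
  qed
qed

text \<open>
Minkowski's inequality for the exponent \<open>s\<close>, by convexity: after normalisation \<open>u + v\<close> is a convex
combination of functions whose moments of order \<open>s\<close> are at most \<open>1\<close>.
\<close>
lemma sign_avg_minkowski:
  assumes A: "finite A" and s: "s \<ge> 1"
    and u: "\<And>S. S \<subseteq> A \<Longrightarrow> 0 \<le> u S" and v: "\<And>S. S \<subseteq> A \<Longrightarrow> 0 \<le> v S"
    and ab: "0 \<le> a" "0 \<le> b"
    and us: "sign_avg A (\<lambda>S. u S ^ s) \<le> a ^ s" and vs: "sign_avg A (\<lambda>S. v S ^ s) \<le> b ^ s"
  shows "sign_avg A (\<lambda>S. (u S + v S) ^ s) \<le> (a + b) ^ s"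
proof -
  have zero: "w S = 0" if "sign_avg A (\<lambda>S. w S ^ s) \<le> 0" "\<And>S. S \<subseteq> A \<Longrightarrow> 0 \<le> w S" "S \<subseteq> A" for w S
  proof -
    have "(\<Sum>S\<in>Pow A. w S ^ s) \<le> 0"
      using that(1) not_less[of "0 :: real" "2 ^ card A"] by (auto simp add: sign_avg_def divide_le_0_iff)
    moreover have "(\<Sum>S\<in>Pow A. w S ^ s) \<ge> 0" by (intro sum_nonneg) (use that in auto)
    ultimately have "(\<Sum>S\<in>Pow A. w S ^ s) = 0" by linarith
    then have "w S ^ s = 0"
      using A that by (subst (asm) sum_nonneg_eq_0_iff) auto
    then show ?thesis by simp
  qed
  consider "a = 0" | "b = 0" | "a > 0" "b > 0" using ab by linarith
  then show ?thesis
  proof cases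
    case 1
    then have "u S = 0" if "S \<subseteq> A" for S using zero[of u S] us u that s by (simp add: power_0_left)
    then have "sign_avg A (\<lambda>S. (u S + v S) ^ s) = sign_avg A (\<lambda>S. v S ^ s)" by (intro sign_avg_cong) simp
    then show ?thesis using vs 1 by simp
  next
    case 2
    then have "v S = 0" if "S \<subseteq> A" for S using zero[of v S] vs v that s by (simp add: power_0_left)
    then have "sign_avg A (\<lambda>S. (u S + v S) ^ s) = sign_avg A (\<lambda>S. u S ^ s)" by (intro sign_avg_cong) simp
    then show ?thesis using us 2 by simp
  next
    case 3
    \<comment> \<open>Both tangents are taken at \<open>t\<close>, the common value of \<open>x / a\<close> and \<open>y / b\<close> in the case of equality.\<close>
    have pt: "(x + y) ^ s \<le> (a + b) ^ (s - 1) * (x ^ s / a ^ (s - 1) + y ^ s / b ^ (s - 1))"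
      if "x \<ge> 0" "y \<ge> 0" for x y
    proof -
      define t where "t = (x + y) / (a + b)"
      have t: "t \<ge> 0" using that 3 by (simp add: t_def)
      have ss: "z ^ s = z ^ (s - 1) * z" for z :: real
        using s by (cases s) auto
      have "real s * t ^ (s - 1) * (x / a) \<le> (real s - 1) * t ^ s + (x / a) ^ s"
           "real s * t ^ (s - 1) * (y / b) \<le> (real s - 1) * t ^ s + (y / b) ^ s"
        using power_tangent[OF t, of "x / a" s] power_tangent[OF t, of "y / b" s] that 3 by simp_all
      then have "a * (real s * t ^ (s - 1) * (x / a)) + b * (real s * t ^ (s - 1) * (y / b)) \<le>
          a * ((real s - 1) * t ^ s + (x / a) ^ s) + b * ((real s - 1) * t ^ s + (y / b) ^ s)"
        using 3 by (intro add_mono mult_left_mono) auto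
      moreover have "a * (real s * t ^ (s - 1) * (x / a)) + b * (real s * t ^ (s - 1) * (y / b)) =
          real s * t ^ (s - 1) * (x + y)"
        using 3 by (simp add: field_simps)
      moreover have "t ^ (s - 1) * (x + y) = (a + b) * t ^ s"
        using 3 by (simp add: ss t_def)
      ultimately have "real s * ((a + b) * t ^ s) \<le>
          a * ((real s - 1) * t ^ s + (x / a) ^ s) + b * ((real s - 1) * t ^ s + (y / b) ^ s)"
        by (metis mult.assoc)
      then have "(a + b) * t ^ s \<le> a * (x / a) ^ s + b * (y / b) ^ s"
        by (simp add: algebra_simps)
      moreover have "a * (x / a) ^ s = x ^ s / a ^ (s - 1)" "b * (y / b) ^ s = y ^ s / b ^ (s - 1)"
        using 3 by (simp_all add: power_divide ss[of a] ss[of b])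
      moreover have "(x + y) ^ s = (a + b) ^ (s - 1) * ((a + b) * t ^ s)"
        using 3 by (simp add: t_def power_divide ss[of "a + b"])
      ultimately show ?thesis using 3 by (simp add: mult_left_mono)
    qed
    have "sign_avg A (\<lambda>S. (u S + v S) ^ s) \<le>
        sign_avg A (\<lambda>S. (a + b) ^ (s - 1) * (u S ^ s / a ^ (s - 1) + v S ^ s / b ^ (s - 1)))"
      by (rule sign_avg_mono) (use pt u v in auto)
    also have "\<dots> = (a + b) ^ (s - 1) * (sign_avg A (\<lambda>S. u S ^ s) / a ^ (s - 1) + sign_avg A (\<lambda>S. v S ^ s) / b ^ (s - 1))"
      by (simp add: sign_avg_cmult sign_avg_add sign_avg_divide)
    also have "\<dots> \<le> (a + b) ^ (s - 1) * (a ^ s / a ^ (s - 1) + b ^ s / b ^ (s - 1))"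
      using 3 us vs by (intro mult_left_mono add_mono divide_right_mono) auto
    also have "\<dots> = (a + b) ^ s"
      using 3 s by (cases s) auto
    finally show ?thesis .
  qed
qed

text \<open>
The quotient of consecutive terms on the left is
\<open>(s - i) / (i + 1) * ((2 * s - 2 * i - 1) / (2 * i + 1))\<close>, where the
first factor is the corresponding quotient of the \<open>s choose i\<close> and the second is at most \<open>2 * s - 1\<close>.
\<close>
lemma choose_even_le: "real (2 * s choose (2 * i)) \<le> real (s choose i) * (2 * real s - 1) ^ i"
  if "s \<ge> 1"
proof (induction i)
  case 0 then show ?case by simp
next
  case (Suc i)
  show ?case
  proof (cases "i < s")
    case False
    then show ?thesis using that by (simp add: binomial_eq_0)
  next
    case True
    have a: "real (Suc m) * real (n choose Suc m) = real (n choose m) * (real n - real m)"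
      if "m \<le> n" for n m
    proof -
      have "Suc m * (n choose Suc m) = (n choose m) * (n - m)"
        by (metis binomial_absorb_comp binomial_absorption mult.commute)
      then show ?thesis using that by (metis of_nat_diff of_nat_mult)
    qed
    have 1: "real (i + 1) * real (s choose Suc i) = real (s choose i) * (real s - real i)"
      using a[of i s] True by simp
    have 2: "real (2 * i + 1) * real (2 * s choose (2 * i + 1)) = real (2 * s choose (2 * i)) * (2 * real s - 2 * real i)"
      using a[of "2 * i" "2 * s"] True by simp
    have 3: "real (2 * i + 2) * real (2 * s choose (2 * i + 2)) = real (2 * s choose (2 * i + 1)) * (2 * real s - 2 * real i - 1)"
      using a[of "2 * i + 1" "2 * s"] True by (simp add: algebra_simps)
    have c: "real (2 * s choose (2 * i + 2)) = real (2 * s choose (2 * i)) * ((real s - real i) / (i + 1)) * ((2 * real s - 2 * real i - 1) / (2 * i + 1))"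
    proof -
      define B0 B1 B2 where "B0 = real (2 * s choose (2 * i))" and "B1 = real (2 * s choose (2 * i + 1))"
        and "B2 = real (2 * s choose (2 * i + 2))"
      have e1: "B1 = B0 * (2 * real s - 2 * real i) / (2 * i + 1)"
        using 2 unfolding B0_def[symmetric] B1_def[symmetric] by (simp add: field_simps)
      have "B2 = B1 * (2 * real s - 2 * real i - 1) / (2 * i + 2)"
        using 3 unfolding B1_def[symmetric] B2_def[symmetric] by (simp add: field_simps)
      then have "B2 = B0 * ((real s - real i) / (i + 1)) * ((2 * real s - 2 * real i - 1) / (2 * i + 1))"
        unfolding e1 by (simp add: divide_simps) (simp add: algebra_simps)
      then show ?thesis unfolding B0_def B2_def .
    qed
    have "(2 * real s - 2 * real i - 1) / (2 * i + 1) \<le> (2 * real s - 1)"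
      using that by (simp add: field_simps)
    then have "real (2 * s choose (2 * i + 2)) \<le> real (2 * s choose (2 * i)) * ((real s - real i) / (i + 1)) * (2 * real s - 1)"
      unfolding c using True by (intro mult_left_mono) auto
    also have "\<dots> \<le> (real (s choose i) * (2 * real s - 1) ^ i) * ((real s - real i) / (i + 1)) * (2 * real s - 1)"
      using Suc True by (intro mult_right_mono) auto
    also have "\<dots> = (real (s choose i) * (real s - real i) / (i + 1)) * (2 * real s - 1) ^ Suc i"
      by simp
    also have "real (s choose i) * (real s - real i) / (i + 1) = real (s choose Suc i)"
      using 1 by (simp add: field_simps)
    finally show ?thesis by simp
  qed
qed

text \<open>
The inequality of Bonami for one sign. The odd powers of \<open>h\<close> cancel on the left, and the even ones are compared
coefficient by coefficient.
\<close>
lemma two_point_hypercontractive: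
  fixes g h :: real
  assumes "s \<ge> 1"
  shows "((g + h) ^ (2 * s) + (g - h) ^ (2 * s)) / 2 \<le> (g\<^sup>2 + (2 * real s - 1) * h\<^sup>2) ^ s"
proof -
  define T where "T k = real (2 * s choose k) * h ^ k * g ^ (2 * s - k)" for k
  have "(g + h) ^ (2 * s) = (\<Sum>k\<le>2 * s. T k)"
    using binomial_ring[of h g "2 * s"] by (simp add: T_def add.commute)
  moreover have "(g - h) ^ (2 * s) = (\<Sum>k\<le>2 * s. (-1) ^ k * T k)"
    using binomial_ring[of "-h" g "2 * s"] by (simp add: T_def power_minus[of h] algebra_simps)
  ultimately have "((g + h) ^ (2 * s) + (g - h) ^ (2 * s)) / 2 = (\<Sum>k\<le>2 * s. (T k + (-1) ^ k * T k) / 2)"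
    by (simp add: sum.distrib sum_divide_distrib add_divide_distrib)
  also have "\<dots> = (\<Sum>k\<in>{k\<in>{..2 * s}. even k}. T k)"
    by (subst sum.inter_filter) (auto intro!: sum.cong)
  also have "\<dots> = (\<Sum>i\<le>s. T (2 * i))"
    by (rule sum.reindex_bij_witness[of _ "\<lambda>i. 2 * i" "\<lambda>k. k div 2"]) auto
  also have "\<dots> \<le> (\<Sum>i\<le>s. real (s choose i) * ((2 * real s - 1) * h\<^sup>2) ^ i * (g\<^sup>2) ^ (s - i))"
  proof (rule sum_mono)
    fix i assume "i \<in> {..s}"
    have "T (2 * i) = real (2 * s choose (2 * i)) * ((h\<^sup>2) ^ i * (g\<^sup>2) ^ (s - i))"
      by (simp add: T_def power_mult[symmetric] right_diff_distrib' )
    also have "\<dots> \<le> (real (s choose i) * (2 * real s - 1) ^ i) * ((h\<^sup>2) ^ i * (g\<^sup>2) ^ (s - i))"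
      using choose_even_le[OF assms] by (intro mult_right_mono) auto
    finally show "T (2 * i) \<le> real (s choose i) * ((2 * real s - 1) * h\<^sup>2) ^ i * (g\<^sup>2) ^ (s - i)"
      by (simp add: power_mult_distrib mult_ac)
  qed
  also have "\<dots> = (g\<^sup>2 + (2 * real s - 1) * h\<^sup>2) ^ s"
    using binomial_ring[of "(2 * real s - 1) * h\<^sup>2" "g\<^sup>2" s] by (simp add: add.commute)
  finally show ?thesis .
qed

text \<open>
The polynomials of degree at most \<open>d\<close> in the signs with indices in \<open>A\<close>. An inductive definition suffices,
since the expansion into products of distinct signs is needed for one coordinate at a time only.
\<close>
inductive chaos :: "nat set \<Rightarrow> nat \<Rightarrow> (nat set \<Rightarrow> real) \<Rightarrow> bool" for A where
  chaos_const: "chaos A d (\<lambda>S. c)"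
| chaos_sg: "i \<in> A \<Longrightarrow> chaos A d F \<Longrightarrow> chaos A (Suc d) (\<lambda>S. sg S i * F S)"
| chaos_add: "chaos A d F \<Longrightarrow> chaos A d G \<Longrightarrow> chaos A d (\<lambda>S. F S + G S)"

lemma chaos_cmult: "chaos A d F \<Longrightarrow> chaos A d (\<lambda>S. c * F S)"
proof (induction rule: chaos.induct)
  case (chaos_sg i d F)
  then show ?case using chaos.chaos_sg[of i A d "\<lambda>S. c * F S"] by (simp add: mult_ac)
next
  case (chaos_add d F G)
  then show ?case using chaos.chaos_add[of A d "\<lambda>S. c * F S" "\<lambda>S. c * G S"] by (simp add: algebra_simps)
qed (simp add: chaos.chaos_const)

lemma chaos_sum: "(\<And>i. i \<in> I \<Longrightarrow> chaos A d (F i)) \<Longrightarrow> chaos A d (\<lambda>S. \<Sum>i\<in>I. F i S)"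
  by (induction I rule: infinite_finite_induct) (auto intro: chaos.intros)

lemma chaos_Suc: "chaos A d F \<Longrightarrow> chaos A (Suc d) F"
  by (induction rule: chaos.induct) (auto intro: chaos.intros)

lemma chaos_cong_Int: "chaos A d F \<Longrightarrow> S \<inter> A = T \<inter> A \<Longrightarrow> F S = F T"
proof (induction rule: chaos.induct)
  case (chaos_sg i d F)
  then show ?case by (auto simp: sg_def)
qed auto

lemma chaos_diff_const: "chaos A d F \<Longrightarrow> chaos A d (\<lambda>S. F S - c)"
  using chaos_add[of A d F "\<lambda>S. - c"] chaos_const[of A d "- c"] by simp

lemma chaos_decomp:
  assumes "chaos B d F" "B = insert k A"
  shows "\<exists>G H. chaos A d G \<and> chaos A (d - 1) H \<and> (d = 0 \<longrightarrow> H = (\<lambda>S. 0)) \<and> F = (\<lambda>S. G S + sg S k * H S)"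
  using assms
proof (induction rule: chaos.induct)
  case (chaos_const d c)
  show ?case by (rule exI[of _ "\<lambda>S. c"], rule exI[of _ "\<lambda>S. 0"]) (auto intro: chaos.intros)
next
  case (chaos_sg i d F)
  then obtain G H where GH: "chaos A d G" "chaos A (d - 1) H" "d = 0 \<longrightarrow> H = (\<lambda>S. 0)" "F = (\<lambda>S. G S + sg S k * H S)"
    by blast
  show ?case
  proof (cases "i = k")
    case True
    have H: "chaos A (Suc d) H"
      using GH(2,3) by (cases d) (auto intro: chaos_Suc chaos_const)
    show ?thesis
      by (rule exI[of _ H], rule exI[of _ G]) (use GH H True in \<open>auto simp: algebra_simps fun_eq_iff\<close>)
  next
    case False
    then have i: "i \<in> A" using chaos_sg by auto
    have "chaos A d (\<lambda>S. sg S i * H S)"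
      using GH(2,3) i by (cases d) (auto intro: chaos.intros)
    moreover have "chaos A (Suc d) (\<lambda>S. sg S i * G S)"
      using GH(1) i by (rule chaos.chaos_sg[rotated])
    ultimately show ?thesis
      by (intro exI[of _ "\<lambda>S. sg S i * G S"] exI[of _ "\<lambda>S. sg S i * H S"])
        (simp add: GH(4) algebra_simps)
  qed
next
  case (chaos_add d F F')
  then obtain G H G' H' where
    GH: "chaos A d G" "chaos A (d - 1) H" "d = 0 \<longrightarrow> H = (\<lambda>S. 0)" "F = (\<lambda>S. G S + sg S k * H S)"
    "chaos A d G'" "chaos A (d - 1) H'" "d = 0 \<longrightarrow> H' = (\<lambda>S. 0)" "F' = (\<lambda>S. G' S + sg S k * H' S)"
    by blast
  show ?case
    by (intro exI[of _ "\<lambda>S. G S + G' S"] exI[of _ "\<lambda>S. H S + H' S"])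
      (use GH in \<open>auto intro: chaos.intros simp: algebra_simps fun_eq_iff\<close>)
qed

text \<open>
Hypercontractivity: the moments of a sign polynomial of degree \<open>d\<close> are controlled by its second moment. In the
induction, \<open>F = G + \<epsilon> * H\<close> for the new sign \<open>\<epsilon>\<close>, where \<open>H\<close> has degree \<open>d - 1\<close>. The two-point
inequality produces one factor \<open>2 * s - 1\<close> in front of \<open>H\<^sup>2\<close>, which is the factor lost by the lower
degree of \<open>H\<close>, and Minkowski's inequality recombines the two parts.
\<close>
theorem chaos_hypercontractive:
  assumes "finite A" "chaos A d F" "s \<ge> 1"
  shows "sign_avg A (\<lambda>S. F S ^ (2 * s)) \<le> (2 * real s - 1) ^ (d * s) * sign_avg A (\<lambda>S. (F S)\<^sup>2) ^ s"
  using assms(1,2)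
proof (induction A arbitrary: d F)
  case empty
  have "1 * (F {})\<^sup>2 ^ s \<le> (2 * real s - 1) ^ (d * s) * (F {})\<^sup>2 ^ s"
    using assms(3) by (intro mult_right_mono one_le_power) auto
  then show ?case by (simp add: power_mult)
next
  case (insert k A d F)
  define K where "K = 2 * real s - 1"
  have K: "K \<ge> 1" using assms(3) by (simp add: K_def)
  obtain G H where GH: "chaos A d G" "chaos A (d - 1) H" "d = 0 \<longrightarrow> H = (\<lambda>S. 0)" "F = (\<lambda>S. G S + sg S k * H S)"
    using chaos_decomp[OF insert.prems refl] by blast
  define a b where "a = sign_avg A (\<lambda>S. (G S)\<^sup>2)" and "b = sign_avg A (\<lambda>S. (H S)\<^sup>2)"
  have ab: "a \<ge> 0" "b \<ge> 0" by (auto simp: a_def b_def intro!: sign_avg_nonneg)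
  have ins: "G (insert k S) = G S" "H (insert k S) = H S" if "S \<subseteq> A" for S
    using that insert.hyps by (auto intro!: chaos_cong_Int[OF GH(1)] chaos_cong_Int[OF GH(2)])
  have F: "F S = G S - H S" "F (insert k S) = G S + H S" if "S \<subseteq> A" for S
    using ins[OF that] that insert.hyps by (auto simp: GH(4) sg_def)
  have "sign_avg (insert k A) (\<lambda>S. F S ^ (2 * s)) \<le> sign_avg A (\<lambda>S. ((G S)\<^sup>2 + K * (H S)\<^sup>2) ^ s)"
    unfolding sign_avg_insert[OF insert.hyps] K_def
    by (rule sign_avg_mono) (use two_point_hypercontractive[OF assms(3)] in \<open>simp add: F add.commute\<close>)
  also have "\<dots> \<le> (K ^ d * a + K ^ d * b) ^ s"
  proof (rule sign_avg_minkowski)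
    show "sign_avg A (\<lambda>S. (G S)\<^sup>2 ^ s) \<le> (K ^ d * a) ^ s"
      using insert.IH[OF GH(1)] by (simp add: K_def a_def power_mult power_mult_distrib)
    have "sign_avg A (\<lambda>S. (H S)\<^sup>2 ^ s) \<le> (K ^ (d - 1) * b) ^ s"
      using insert.IH[OF GH(2)] by (simp add: K_def b_def power_mult power_mult_distrib)
    then have "sign_avg A (\<lambda>S. (K * (H S)\<^sup>2) ^ s) \<le> (K * (K ^ (d - 1) * b)) ^ s"
      using K by (simp add: power_mult_distrib sign_avg_cmult)
    moreover have "K * (K ^ (d - 1) * b) = K ^ d * b"
      using GH(3) by (cases d) (auto simp: b_def sign_avg_const insert.hyps)
    ultimately show "sign_avg A (\<lambda>S. (K * (H S)\<^sup>2) ^ s) \<le> (K ^ d * b) ^ s" by metis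
  qed (use K ab insert.hyps assms(3) in auto)
  also have "\<dots> = K ^ (d * s) * (a + b) ^ s"
    by (simp add: power_mult power_mult_distrib flip: distrib_left)
  also have "a + b = sign_avg (insert k A) (\<lambda>S. (F S)\<^sup>2)"
    unfolding sign_avg_insert[OF insert.hyps] a_def b_def sign_avg_add[symmetric]
    by (rule sign_avg_cong) (simp add: F power2_eq_square field_simps)
  finally show ?case by (simp add: K_def)
qed

section \<open>Orthonormal systems of bounded functions\<close>

text \<open>
Over a finite measure the bounded measurable functions form an algebra of integrable functions, so integrability
reduces to closure properties that the simplifier can check.
\<close>
definition bdd_meas :: "'a measure \<Rightarrow> ('a \<Rightarrow> real) \<Rightarrow> bool" where
  "bdd_meas M f \<longleftrightarrow> f \<in> borel_measurable M \<and> (\<exists>B. \<forall>x\<in>space M. \<bar>f x\<bar> \<le> B)"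

lemma bdd_meas_measurable [measurable_dest]: "bdd_meas M f \<Longrightarrow> f \<in> borel_measurable M"
  by (simp add: bdd_meas_def)

lemma bdd_meas_const [simp, intro]: "bdd_meas M (\<lambda>x. c)"
  by (auto simp: bdd_meas_def)

lemma bdd_meas_add [simp, intro]: assumes "bdd_meas M f" "bdd_meas M g" shows "bdd_meas M (\<lambda>x. f x + g x)"
proof -
  obtain B C where "\<forall>x\<in>space M. \<bar>f x\<bar> \<le> B" "\<forall>x\<in>space M. \<bar>g x\<bar> \<le> C"
    using assms by (auto simp: bdd_meas_def)
  then have "\<forall>x\<in>space M. \<bar>f x + g x\<bar> \<le> B + C" by (meson abs_triangle_ineq add_mono order_trans)
  then show ?thesis using assms by (auto simp: bdd_meas_def)
qed

lemma bdd_meas_mult [simp, intro]: assumes "bdd_meas M f" "bdd_meas M g" shows "bdd_meas M (\<lambda>x. f x * g x)"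
proof -
  obtain B C where *: "\<forall>x\<in>space M. \<bar>f x\<bar> \<le> B" "\<forall>x\<in>space M. \<bar>g x\<bar> \<le> C"
    using assms by (auto simp: bdd_meas_def)
  have "\<forall>x\<in>space M. \<bar>f x * g x\<bar> \<le> B * C" 
    unfolding abs_mult using * by (meson abs_ge_zero mult_mono order_trans)
  then show ?thesis using assms by (auto simp: bdd_meas_def)
qed

lemma bdd_meas_uminus [simp, intro]: "bdd_meas M f \<Longrightarrow> bdd_meas M (\<lambda>x. - f x)"
  using bdd_meas_mult[of M "\<lambda>x. -1" f] by simp

lemma bdd_meas_diff [simp, intro]: "bdd_meas M f \<Longrightarrow> bdd_meas M g \<Longrightarrow> bdd_meas M (\<lambda>x. f x - g x)"
  using bdd_meas_add[of M f "\<lambda>x. - g x"] by simp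

lemma bdd_meas_abs [simp, intro]: "bdd_meas M f \<Longrightarrow> bdd_meas M (\<lambda>x. \<bar>f x\<bar>)"
  by (auto simp: bdd_meas_def)

lemma bdd_meas_divide [simp, intro]: "bdd_meas M f \<Longrightarrow> bdd_meas M (\<lambda>x. f x / c)"
  using bdd_meas_mult[of M f "\<lambda>x. 1 / c"] by simp

lemma bdd_meas_power [simp, intro]: "bdd_meas M f \<Longrightarrow> bdd_meas M (\<lambda>x. f x ^ k)"
  by (induction k) auto

lemma bdd_meas_sum [simp, intro]: "(\<And>i. i \<in> I \<Longrightarrow> bdd_meas M (f i)) \<Longrightarrow> bdd_meas M (\<lambda>x. \<Sum>i\<in>I. f i x)"
  by (induction I rule: infinite_finite_induct) auto

lemma bdd_meas_prod [simp, intro]: "(\<And>i. i \<in> I \<Longrightarrow> bdd_meas M (f i)) \<Longrightarrow> bdd_meas M (\<lambda>x. \<Prod>i\<in>I. f i x)"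
  by (induction I rule: infinite_finite_induct) auto

lemma bdd_meas_sign_avg [simp, intro]: "(\<And>S. S \<subseteq> A \<Longrightarrow> bdd_meas M (F S)) \<Longrightarrow> bdd_meas M (\<lambda>x. sign_avg A (\<lambda>S. F S x))"
  unfolding sign_avg_def by (intro bdd_meas_divide bdd_meas_sum) auto

context finite_measure
begin

lemma bdd_meas_integrable [simp, intro]: "bdd_meas M f \<Longrightarrow> integrable M f"
  unfolding bdd_meas_def by (elim conjE exE) (rule integrable_const_bound, auto)

lemma bdd_meas_integral_mono:
  assumes "bdd_meas M f" "bdd_meas M g" "\<And>x. x \<in> space M \<Longrightarrow> f x \<le> g x"
  shows "(\<integral>x. f x \<partial>M) \<le> (\<integral>x. g x \<partial>M)"
  using assms by (intro integral_mono) auto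

lemma integral_sign_avg:
  assumes "\<And>S. S \<subseteq> A \<Longrightarrow> bdd_meas M (F S)"
  shows "(\<integral>x. sign_avg A (\<lambda>S. F S x) \<partial>M) = sign_avg A (\<lambda>S. \<integral>x. F S x \<partial>M)"
  unfolding sign_avg_def using assms by (subst Bochner_Integration.integral_divide) (auto intro!: bdd_meas_sum)

lemma integral_Cauchy_Schwarz:
  assumes [simp]: "bdd_meas M f" "bdd_meas M g"
  shows "(\<integral>x. f x * g x \<partial>M)\<^sup>2 \<le> (\<integral>x. (f x)\<^sup>2 \<partial>M) * (\<integral>x. (g x)\<^sup>2 \<partial>M)"
proof -
  define a b c where "a = (\<integral>x. (f x)\<^sup>2 \<partial>M)" and "b = (\<integral>x. f x * g x \<partial>M)" and "c = (\<integral>x. (g x)\<^sup>2 \<partial>M)"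
  have q: "0 \<le> a - 2 * t * b + t\<^sup>2 * c" for t
  proof -
    have "0 \<le> (\<integral>x. (f x - t * g x)\<^sup>2 \<partial>M)" by simp
    also have "(\<lambda>x. (f x - t * g x)\<^sup>2) = (\<lambda>x. (f x)\<^sup>2 - 2 * t * (f x * g x) + t\<^sup>2 * (g x)\<^sup>2)"
      by (auto simp: power2_eq_square algebra_simps)
    also have "(\<integral>x. \<dots> x \<partial>M) = a - 2 * t * b + t\<^sup>2 * c"
      by (simp add: a_def b_def c_def)
    finally show ?thesis .
  qed
  have "c \<ge> 0" by (simp add: c_def)
  show ?thesis
  proof (cases "c = 0")
    case True
    have "b = 0"
    proof (rule ccontr)
      assume "b \<noteq> 0"
      then have "a - 2 * ((a + 1) / (2 * b)) * b + ((a + 1) / (2 * b))\<^sup>2 * c = -1"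
        using True by (simp add: field_simps)
      then show False using q[of "(a + 1) / (2 * b)"] by simp
    qed
    then show ?thesis using True by (simp add: a_def b_def c_def)
  next
    case False
    then have c: "c > 0" using \<open>c \<ge> 0\<close> by simp
    have "b\<^sup>2 \<le> a * c"
      using q[of "b / c"] c by (simp add: field_simps power2_eq_square)
    then show ?thesis by (simp add: a_def b_def c_def)
  qed
qed

definition orthonormal :: "nat set \<Rightarrow> (nat \<Rightarrow> 'a \<Rightarrow> real) \<Rightarrow> bool" where
  "orthonormal A f \<longleftrightarrow> (\<forall>i\<in>A. bdd_meas M (f i)) \<and> (\<forall>i\<in>A. \<forall>j\<in>A. (\<integral>x. f i x * f j x \<partial>M) = (if i = j then 1 else 0))"

lemma orthonormal_bdd_meas: "orthonormal A f \<Longrightarrow> i \<in> A \<Longrightarrow> bdd_meas M (f i)"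
  by (simp add: orthonormal_def)

lemma orthonormal_square: "orthonormal A f \<Longrightarrow> i \<in> A \<Longrightarrow> (\<integral>x. (f i x)\<^sup>2 \<partial>M) = 1"
  by (simp add: orthonormal_def power2_eq_square)

lemma orthonormal_subset: "orthonormal A f \<Longrightarrow> B \<subseteq> A \<Longrightarrow> orthonormal B f"
  unfolding orthonormal_def by (meson subsetD)

lemma orthonormal_integral_sums:
  assumes "orthonormal A f" "finite A"
  shows "(\<integral>x. (\<Sum>i\<in>A. a i * f i x) * (\<Sum>i\<in>A. b i * f i x) \<partial>M) = (\<Sum>i\<in>A. a i * b i)"
proof -
  have "(\<integral>x. (\<Sum>i\<in>A. a i * f i x) * (\<Sum>i\<in>A. b i * f i x) \<partial>M) =
      (\<integral>x. (\<Sum>i\<in>A. \<Sum>j\<in>A. (a i * b j) * (f i x * f j x)) \<partial>M)"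
    by (simp add: sum_product mult_ac)
  also have "\<dots> = (\<Sum>i\<in>A. \<Sum>j\<in>A. a i * b j * (\<integral>x. f i x * f j x \<partial>M))"
    using assms by (subst Bochner_Integration.integral_sum, force simp: orthonormal_def)
      (intro sum.cong refl, subst Bochner_Integration.integral_sum, auto simp: orthonormal_def)
  also have "\<dots> = (\<Sum>i\<in>A. \<Sum>j\<in>A. if i = j then a i * b i else 0)"
    using assms by (intro sum.cong refl) (auto simp: orthonormal_def)
  finally show ?thesis using assms by simp
qed

lemma bessel:
  assumes on: "orthonormal A f" and A: "finite A" and h [simp]: "bdd_meas M h"
  shows "(\<Sum>i\<in>A. (\<integral>x. h x * f i x \<partial>M)\<^sup>2) \<le> (\<integral>x. (h x)\<^sup>2 \<partial>M)"
proof -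
  define c where "c i = (\<integral>x. h x * f i x \<partial>M)" for i
  note [simp] = orthonormal_bdd_meas[OF on]
  have "0 \<le> (\<integral>x. (h x - (\<Sum>i\<in>A. c i * f i x))\<^sup>2 \<partial>M)" by simp
  also have "(\<lambda>x. (h x - (\<Sum>i\<in>A. c i * f i x))\<^sup>2) =
      (\<lambda>x. (h x)\<^sup>2 - 2 * (\<Sum>i\<in>A. c i * (h x * f i x)) + (\<Sum>i\<in>A. c i * f i x) * (\<Sum>i\<in>A. c i * f i x))"
    by (auto simp: power2_eq_square algebra_simps sum_distrib_left sum_distrib_right)
  also have "(\<integral>x. \<dots> x \<partial>M) = (\<integral>x. (h x)\<^sup>2 \<partial>M) - 2 * (\<Sum>i\<in>A. c i * c i) + (\<Sum>i\<in>A. c i * c i)"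
  proof -
    have "(\<integral>x. (\<Sum>i\<in>A. c i * (h x * f i x)) \<partial>M) = (\<Sum>i\<in>A. c i * c i)"
      by (subst Bochner_Integration.integral_sum) (auto simp: c_def)
    moreover have "bdd_meas M (\<lambda>x. \<Sum>i\<in>A. c i * (h x * f i x))" "bdd_meas M (\<lambda>x. (\<Sum>i\<in>A. c i * f i x) * (\<Sum>i\<in>A. c i * f i x))"
      by (intro bdd_meas_sum bdd_meas_mult bdd_meas_const h; simp)+
    ultimately show ?thesis
      by (subst Bochner_Integration.integral_add Bochner_Integration.integral_diff Bochner_Integration.integral_mult_right
          orthonormal_integral_sums[OF on A]; (intro bdd_meas_integrable bdd_meas_diff bdd_meas_mult bdd_meas_const bdd_meas_power h)?; simp)+
  qed
  finally show ?thesis by (simp add: c_def power2_eq_square)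
qed

text \<open>
Expanding the product one factor at a time moves the signs out of the integral, while the coefficient functions
are absorbed into the weight \<open>G\<close>.
\<close>
lemma chaos_integral:
  assumes "finite J" "bdd_meas M G" "\<And>i. i \<in> A \<Longrightarrow> bdd_meas M (f i)" "finite A"
  shows "chaos A (card J) (\<lambda>S. \<integral>x. G x * (\<Prod>j\<in>J. \<Sum>i\<in>A. c j i * sg S i * f i x) \<partial>M)"
  using assms(1,2)
proof (induction J arbitrary: G)
  case empty
  then show ?case by (simp add: chaos.chaos_const)
next
  case (insert k J G)
  let ?Q = "\<lambda>S x. \<Prod>j\<in>J. \<Sum>i\<in>A. c j i * sg S i * f i x"
  note [simp] = insert.prems assms(3)
  have "(\<integral>x. G x * (\<Prod>j\<in>insert k J. \<Sum>i\<in>A. c j i * sg S i * f i x) \<partial>M) =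
        (\<Sum>i\<in>A. c k i * (sg S i * (\<integral>x. (G x * f i x) * ?Q S x \<partial>M)))" for S
  proof -
    have "(\<integral>x. G x * (\<Prod>j\<in>insert k J. \<Sum>i\<in>A. c j i * sg S i * f i x) \<partial>M) =
        (\<integral>x. (\<Sum>i\<in>A. (c k i * sg S i) * ((G x * f i x) * ?Q S x)) \<partial>M)"
      using insert.hyps by (simp add: sum_distrib_left sum_distrib_right mult_ac)
    also have "\<dots> = (\<Sum>i\<in>A. \<integral>x. (c k i * sg S i) * ((G x * f i x) * ?Q S x) \<partial>M)"
      by (intro Bochner_Integration.integral_sum bdd_meas_integrable bdd_meas_mult bdd_meas_const bdd_meas_prod bdd_meas_sum) simp_all
    finally show ?thesis by (simp add: mult.assoc)
  qed
  moreover have "chaos A (Suc (card J)) (\<lambda>S. \<Sum>i\<in>A. c k i * (sg S i * (\<integral>x. (G x * f i x) * ?Q S x \<partial>M)))"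
    by (intro chaos_sum chaos_cmult chaos.chaos_sg insert.IH bdd_meas_mult) simp_all
  ultimately show ?case using insert.hyps by simp
qed

end

lemma chaos_linear: "chaos A 1 (\<lambda>S. \<Sum>i\<in>A. c i * sg S i)"
proof -
  have "chaos A (Suc 0) (\<lambda>S. \<Sum>i\<in>A. c i * (sg S i * 1))"
    by (intro chaos_sum chaos_cmult chaos.chaos_sg chaos.chaos_const)
  then show ?thesis by simp
qed

section \<open>Concentration of integrals of even powers\<close>

lemma sign_avg_linear_moment:
  assumes "finite A" "s \<ge> 1" "(\<Sum>i\<in>A. (c i)\<^sup>2) \<le> V"
  shows "sign_avg A (\<lambda>S. (\<Sum>i\<in>A. c i * sg S i) ^ (2 * s)) \<le> ((2 * real s - 1) * V) ^ s"
proof -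
  have "sign_avg A (\<lambda>S. (\<Sum>i\<in>A. c i * sg S i) ^ (2 * s)) \<le> (2 * real s - 1) ^ (1 * s) * sign_avg A (\<lambda>S. (\<Sum>i\<in>A. c i * sg S i)\<^sup>2) ^ s"
    by (rule chaos_hypercontractive[OF assms(1) chaos_linear assms(2)])
  also have "\<dots> = ((2 * real s - 1) * (\<Sum>i\<in>A. (c i)\<^sup>2)) ^ s"
    by (simp add: sign_avg_linear_square assms power_mult_distrib)
  also have "\<dots> \<le> ((2 * real s - 1) * V) ^ s"
    using assms by (intro power_mono mult_left_mono mult_nonneg_nonneg sum_nonneg) auto
  finally show ?thesis .
qed

lemma prod_le_prod_one_plus_abs:
  fixes a :: "'b \<Rightarrow> real"
  assumes "finite J" "I \<subseteq> J"
  shows "(\<Prod>b\<in>I. \<bar>a b\<bar>) \<le> (\<Prod>b\<in>J. 1 + \<bar>a b\<bar>)"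
proof -
  have "(\<Prod>b\<in>I. \<bar>a b\<bar>) * 1 \<le> (\<Prod>b\<in>I. 1 + \<bar>a b\<bar>) * (\<Prod>b\<in>J - I. 1 + \<bar>a b\<bar>)"
    by (intro mult_mono prod_mono prod_ge_1 prod_nonneg) auto
  also have "\<dots> = (\<Prod>b\<in>J. 1 + \<bar>a b\<bar>)"
    using assms by (metis prod.subset_diff mult.commute)
  finally show ?thesis by simp
qed

text \<open>
First-order Taylor expansion of a product with a quadratic remainder. The size of the remainder is measured by
\<open>\<Prod>(1 + \<bar>a b\<bar>)\<close>, which dominates all partial products of the \<open>a b\<close>.
\<close>
lemma prod_perturb:
  fixes a v :: "'b \<Rightarrow> real"
  assumes "finite J" "\<And>b. b \<in> J \<Longrightarrow> \<bar>v b\<bar> \<le> t" "0 \<le> t" "t \<le> T"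
  shows "\<bar>(\<Prod>b\<in>J. a b) - (\<Prod>b\<in>J. a b - v b) - (\<Sum>b\<in>J. v b * (\<Prod>b'\<in>J - {b}. a b'))\<bar>
          \<le> t\<^sup>2 * (2 + T) ^ card J * (\<Prod>b\<in>J. 1 + \<bar>a b\<bar>)"
  using assms(1,2)
proof (induction J)
  case empty then show ?case using assms by simp
next
  case (insert c J)
  define p where "p = (\<Prod>b\<in>J. a b)"
  define q where "q = (\<Prod>b\<in>J. a b - v b)"
  define s where "s = (\<Sum>b\<in>J. v b * (\<Prod>b'\<in>J - {b}. a b'))"
  define W where "W = (\<Prod>b\<in>J. 1 + \<bar>a b\<bar>)"
  define K where "K = (2 + T) ^ card J"
  have W: "W \<ge> 1" unfolding W_def by (intro prod_ge_1) auto
  have T: "T \<ge> 0" using assms by simp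
  have K: "real (card J) \<le> K"
  proof -
    have "real (card J) \<le> 2 ^ card J" using less_exp[of "card J"]
      by (metis less_imp_le of_nat_le_iff of_nat_numeral of_nat_power)
    also have "\<dots> \<le> K" unfolding K_def using T by (intro power_mono) auto
    finally show ?thesis .
  qed
  have R: "\<bar>p - q - s\<bar> \<le> t\<^sup>2 * K * W"
    using insert.IH insert.prems by (simp add: p_def q_def s_def W_def K_def)
  have s: "\<bar>s\<bar> \<le> t * K * W"
  proof -
    have "\<bar>s\<bar> \<le> (\<Sum>b\<in>J. t * W)"
      unfolding s_def
    proof (rule order_trans[OF sum_abs], rule sum_mono)
      fix b assume b: "b \<in> J"
      have "\<bar>v b\<bar> * \<bar>\<Prod>b'\<in>J - {b}. a b'\<bar> \<le> t * W"
        unfolding abs_prod W_def using insert.prems b insert.hyps assms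
        by (intro mult_mono prod_le_prod_one_plus_abs) (auto intro: prod_nonneg)
      then show "\<bar>v b * (\<Prod>b'\<in>J - {b}. a b')\<bar> \<le> t * W" by (simp add: abs_mult)
    qed
    also have "\<dots> = t * real (card J) * W" by simp
    also have "\<dots> \<le> t * K * W" using K W assms by (intro mult_right_mono mult_left_mono) auto
    finally show ?thesis .
  qed
  have vc: "\<bar>v c\<bar> \<le> t" using insert.prems by simp
  have sum': "(\<Sum>b\<in>insert c J. v b * (\<Prod>b'\<in>insert c J - {b}. a b')) = v c * p + a c * s"
  proof -
    have "(\<Sum>b\<in>J. v b * (\<Prod>b'\<in>insert c J - {b}. a b')) = (\<Sum>b\<in>J. a c * (v b * (\<Prod>b'\<in>J - {b}. a b')))"
    proof (intro sum.cong refl)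
      fix b assume b: "b \<in> J"
      then have "insert c J - {b} = insert c (J - {b})" using insert.hyps by auto
      then show "v b * (\<Prod>b'\<in>insert c J - {b}. a b') = a c * (v b * (\<Prod>b'\<in>J - {b}. a b'))"
        using insert.hyps by simp
    qed
    moreover have "insert c J - {c} = J" using insert.hyps by auto
    ultimately show ?thesis using insert.hyps by (simp add: p_def s_def sum_distrib_left)
  qed
  have "a c * p - (a c - v c) * q - (v c * p + a c * s) = a c * (p - q - s) - v c * (p - q - s) - v c * s"
    by (simp add: algebra_simps)
  then have "\<bar>a c * p - (a c - v c) * q - (v c * p + a c * s)\<bar> \<le> \<bar>a c\<bar> * \<bar>p - q - s\<bar> + \<bar>v c\<bar> * \<bar>p - q - s\<bar> + \<bar>v c\<bar> * \<bar>s\<bar>"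
    unfolding abs_mult[symmetric] by linarith
  also have "\<dots> \<le> \<bar>a c\<bar> * (t\<^sup>2 * K * W) + T * (t\<^sup>2 * K * W) + t * (t * K * W)"
    using R s vc assms T by (intro add_mono mult_mono) auto
  also have "\<dots> = t\<^sup>2 * K * W * (\<bar>a c\<bar> + T + 1)" by (simp add: algebra_simps power2_eq_square)
  also have "\<dots> \<le> t\<^sup>2 * K * W * ((2 + T) * (1 + \<bar>a c\<bar>))"
    using W T by (intro mult_left_mono) (auto simp: K_def algebra_simps)
  finally show ?case
    using insert.hyps sum' by (simp add: p_def q_def W_def K_def mult_ac)
qed

context finite_measure
begin

text \<open>
Since \<open>t ^ (2 * q)\<close> is convex, the increase of \<open>X\<close> under a flip of the sign \<open>i\<close> is bounded by a linear
expression in the inner product of \<open>e ^ (2 * q - 1)\<close> with \<open>f i\<close>. The decreases are accounted for by symmetry. Bessel's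
inequality sums the squares of these inner products, and each carries a factor \<open>(c i)\<^sup>2\<close> of order \<open>1 / N\<close>.
\<close>
lemma variance_even_power_integral:
  assumes on: "orthonormal A f" and A: "finite A" and N: "N \<ge> 1" and q: "q \<ge> 1"
    and c: "\<And>i. i \<in> A \<Longrightarrow> (c i)\<^sup>2 \<le> 4 / N"
  defines "e \<equiv> \<lambda>S x. \<Sum>i\<in>A. c i * sg S i * f i x"
  defines "X \<equiv> \<lambda>S. \<integral>x. e S x ^ (2 * q) \<partial>M"
  shows "sign_avg A (\<lambda>S. (X S - sign_avg A X)\<^sup>2) \<le> 32 * (real q)\<^sup>2 / N * sign_avg A (\<lambda>S. \<integral>x. e S x ^ (2 * (2 * q - 1)) \<partial>M)"
proof -
  note [simp] = orthonormal_bdd_meas[OF on]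
  have e [simp]: "bdd_meas M (e S)" for S unfolding e_def by (intro bdd_meas_sum bdd_meas_mult bdd_meas_const) simp
  define u where "u S i = (\<integral>x. e S x ^ (2 * q - 1) * f i x \<partial>M)" for S i
  have flip_e: "e (flip i S) x = e S x - 2 * sg S i * c i * f i x" if "i \<in> A" for i S x
  proof -
    have "e (flip i S) x = (\<Sum>j\<in>A. c j * sg S j * f j x - (if j = i then 2 * sg S i * c i * f i x else 0))"
      unfolding e_def by (intro sum.cong refl) (simp add: sg_flip)
    then show ?thesis using that A by (simp add: e_def sum_subtractf)
  qed
  have pow_tan: "a ^ (2 * q) - b ^ (2 * q) \<le> 2 * real q * a ^ (2 * q - 1) * (a - b)" for a b :: real
  proof -
    define k where "k = real (2 * q)"
    define u where "u = \<bar>a\<bar> ^ (2 * q - 1) * \<bar>b\<bar>"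
    define w where "w = a ^ (2 * q - 1) * b"
    have "k * \<bar>a\<bar> ^ (2 * q - 1) * \<bar>b\<bar> \<le> (k - 1) * \<bar>a\<bar> ^ (2 * q) + \<bar>b\<bar> ^ (2 * q)"
      unfolding k_def by (rule power_tangent) auto
    then have 1: "k * u \<le> (k - 1) * a ^ (2 * q) + b ^ (2 * q)"
      by (simp add: u_def power_even_abs mult.assoc)
    have "w \<le> u" unfolding u_def w_def by (metis abs_ge_self abs_mult power_abs)
    then have 2: "k * w \<le> k * u" unfolding k_def by (intro mult_left_mono) auto
    have 3: "a ^ (2 * q - 1) * a = a ^ (2 * q)" using q by (cases q) auto
    have "a ^ (2 * q) - b ^ (2 * q) \<le> k * a ^ (2 * q) - k * w"
      using 1 2 by (simp add: left_diff_distrib)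
    also have "\<dots> = k * (a ^ (2 * q - 1) * (a - b))"
      by (simp only: right_diff_distrib 3 w_def)
    finally show ?thesis by (simp add: k_def mult.assoc)
  qed
  have up: "X S - X (flip i S) \<le> 2 * real q * (2 * sg S i * c i * u S i)" if i: "i \<in> A" for i S
  proof -
    have "X S - X (flip i S) = (\<integral>x. e S x ^ (2 * q) - e (flip i S) x ^ (2 * q) \<partial>M)"
      unfolding X_def by (subst Bochner_Integration.integral_diff) auto
    also have "\<dots> \<le> (\<integral>x. 2 * real q * (2 * sg S i * c i * (e S x ^ (2 * q - 1) * f i x)) \<partial>M)"
    proof (rule bdd_meas_integral_mono)
      fix x
      show "e S x ^ (2 * q) - e (flip i S) x ^ (2 * q) \<le> 2 * real q * (2 * sg S i * c i * (e S x ^ (2 * q - 1) * f i x))"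
        using pow_tan[of "e S x" "e (flip i S) x"] by (simp add: flip_e[OF i] mult_ac)
    qed (use i in \<open>intro bdd_meas_diff bdd_meas_mult bdd_meas_const bdd_meas_power e; simp\<close>)+
    also have "\<dots> = 2 * real q * (2 * sg S i * c i * u S i)"
      by (simp add: u_def)
    finally show ?thesis .
  qed
  have pos: "(max 0 (X S - X (flip i S)))\<^sup>2 \<le> 64 * (real q)\<^sup>2 / N * (u S i)\<^sup>2" if i: "i \<in> A" for i S
  proof -
    have "(max 0 (X S - X (flip i S)))\<^sup>2 \<le> (2 * real q * (2 * sg S i * c i * u S i))\<^sup>2"
    proof -
      have "max 0 d \<le> \<bar>z\<bar>" if "d \<le> z" for d z :: real using that by linarith
      from power_mono[OF this[OF up[OF i, of S]], of 2] show ?thesis by simp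
    qed
    also have "\<dots> = 16 * (real q)\<^sup>2 * (u S i)\<^sup>2 * (c i)\<^sup>2" by (simp add: power_mult_distrib)
    also have "\<dots> \<le> 16 * (real q)\<^sup>2 * (u S i)\<^sup>2 * (4 / N)" using c[OF i] by (intro mult_left_mono) auto
    finally show ?thesis by (simp add: mult_ac)
  qed
  have sym: "sign_avg A (\<lambda>S. (X S - X (flip i S))\<^sup>2) = 2 * sign_avg A (\<lambda>S. (max 0 (X S - X (flip i S)))\<^sup>2)" if i: "i \<in> A" for i
  proof -
    have "sign_avg A (\<lambda>S. (X S - X (flip i S))\<^sup>2) =
      sign_avg A (\<lambda>S. (max 0 (X S - X (flip i S)))\<^sup>2) + sign_avg A (\<lambda>S. (max 0 (X (flip i S) - X (flip i (flip i S))))\<^sup>2)"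
      unfolding sign_avg_add[symmetric] by (rule sign_avg_cong) (auto simp: max_def power2_eq_square algebra_simps)
    also have "sign_avg A (\<lambda>S. (max 0 (X (flip i S) - X (flip i (flip i S))))\<^sup>2) = sign_avg A (\<lambda>S. (max 0 (X S - X (flip i S)))\<^sup>2)"
      using sign_avg_flip[OF i, of "\<lambda>S. (max 0 (X S - X (flip i S)))\<^sup>2"] by simp
    finally show ?thesis by simp
  qed
  have "sign_avg A (\<lambda>S. (X S - sign_avg A X)\<^sup>2) \<le> (sign_avg A (\<lambda>S. X S - sign_avg A X))\<^sup>2 +
     (\<Sum>i\<in>A. sign_avg A (\<lambda>S. (X S - sign_avg A X - (X (flip i S) - sign_avg A X))\<^sup>2)) / 4"
    by (rule sign_avg_poincare[OF A])
  also have "\<dots> = (\<Sum>i\<in>A. sign_avg A (\<lambda>S. (X S - X (flip i S))\<^sup>2)) / 4"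
    by (simp add: sign_avg_diff sign_avg_const[OF A])
  also have "\<dots> = (\<Sum>i\<in>A. sign_avg A (\<lambda>S. (max 0 (X S - X (flip i S)))\<^sup>2)) / 2"
    by (simp add: sym sum_distrib_left[symmetric])
  also have "\<dots> \<le> (\<Sum>i\<in>A. sign_avg A (\<lambda>S. 64 * (real q)\<^sup>2 / N * (u S i)\<^sup>2)) / 2"
    by (intro divide_right_mono sum_mono sign_avg_mono pos) auto
  also have "\<dots> = 32 * (real q)\<^sup>2 / N * sign_avg A (\<lambda>S. \<Sum>i\<in>A. (u S i)\<^sup>2)"
    unfolding sign_avg_sum sign_avg_cmult sum_distrib_left sum_divide_distrib by (intro sum.cong refl) simp
  also have "\<dots> \<le> 32 * (real q)\<^sup>2 / N * sign_avg A (\<lambda>S. \<integral>x. e S x ^ (2 * (2 * q - 1)) \<partial>M)"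
  proof (intro mult_left_mono sign_avg_mono)
    fix S
    show "(\<Sum>i\<in>A. (u S i)\<^sup>2) \<le> (\<integral>x. e S x ^ (2 * (2 * q - 1)) \<partial>M)"
      using bessel[OF on A, of "\<lambda>x. e S x ^ (2 * q - 1)"] by (simp add: u_def power_mult mult.commute[of 2])
  qed (use N in auto)
  finally show ?thesis .
qed

end

section \<open>The second moment of a multilinear integral\<close>

context finite_measure
begin

lemma integral_abs_le_sqrt:
  assumes "bdd_meas M f" "bdd_meas M g"
  shows "\<bar>\<integral>x. f x * g x \<partial>M\<bar> \<le> sqrt (\<integral>x. (f x)\<^sup>2 \<partial>M) * sqrt (\<integral>x. (g x)\<^sup>2 \<partial>M)"
  using real_sqrt_le_mono[OF integral_Cauchy_Schwarz[OF assms]] by (simp add: real_sqrt_mult)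

text \<open>
The central estimate. \<open>J\<close> is the set of positions of the tuple, \<open>m\<close> is a position whose basis function \<open>E m\<close> is
linear in the signs of the block \<open>A\<close>, and no other position carries that function. Positions from other blocks
are covered as well: for them \<open>c b\<close> vanishes on \<open>A\<close> and the flips have no effect.

The variance is bounded with the Poincare inequality. Here \<open>L\<close> is the first-order change of the product under a flip,
and \<open>R\<close> the remainder. The inner products in \<open>L\<close> are summed by Bessel's inequality, the remainder by
the bound on \<open>\<Sum>i. (f i)\<^sup>2\<close>. For the mean, integration by parts in the signs leaves the functions
\<open>\<Sum>i. c m i * c b i * (f i)\<^sup>2\<close> for \<open>b \<noteq> m\<close>, which are small by assumption, and a cubic remainder,
which is small by the bound on the fourth powers.
\<close>
lemma level_second_moment:
  fixes E :: "'b \<Rightarrow> nat set \<Rightarrow> 'a \<Rightarrow> real"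
  assumes on: "orthonormal A f" and A: "finite A" and N: "N \<ge> 1"
    and sumsq: "\<And>x. x \<in> space M \<Longrightarrow> (\<Sum>i\<in>A. (f i x)\<^sup>2) \<le> N"
    and four: "(\<Sum>i\<in>A. \<integral>x. (f i x) ^ 4 \<partial>M) \<le> C4 * N"
    and J: "finite J" "m \<in> J" and g: "bdd_meas M g"
    and Eb: "\<And>b S. b \<in> J \<Longrightarrow> bdd_meas M (E b S)"
    and flipE: "\<And>b S i x. b \<in> J \<Longrightarrow> i \<in> A \<Longrightarrow> S \<subseteq> A \<Longrightarrow> x \<in> space M \<Longrightarrow>
        E b (flip i S) x = E b S x - 2 * sg S i * (c b i * f i x)"
    and Em: "\<And>S x. S \<subseteq> A \<Longrightarrow> x \<in> space M \<Longrightarrow> E m S x = (\<Sum>i\<in>A. c m i * sg S i * f i x)"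
    and c: "\<And>b i. b \<in> J \<Longrightarrow> i \<in> A \<Longrightarrow> (c b i)\<^sup>2 \<le> 4 / N"
    and Y: "\<And>b. b \<in> J \<Longrightarrow> b \<noteq> m \<Longrightarrow> (\<integral>x. (\<Sum>i\<in>A. c m i * c b i * (f i x)\<^sup>2)\<^sup>2 \<partial>M) \<le> Y" and Y0: "Y \<ge> 0"
  defines "W \<equiv> \<lambda>S x. \<bar>g x\<bar> * (\<Prod>b\<in>J. 1 + \<bar>E b S x\<bar>)"
    and "p \<equiv> card J"
  shows "sign_avg A (\<lambda>S. (\<integral>x. g x * (\<Prod>b\<in>J. E b S x) \<partial>M)\<^sup>2)
    \<le> ((8 * (real p)\<^sup>2 + 128 * 36 ^ p + 512 * 36 ^ p * C4) / N + 2 * (real p)\<^sup>2 * Y) * sign_avg A (\<lambda>S. \<integral>x. (W S x)\<^sup>2 \<partial>M)"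
proof -
  note [simp] = orthonormal_bdd_meas[OF on] g Eb
  have Wb [simp]: "bdd_meas M (W S)" for S
    unfolding W_def by (intro bdd_meas_mult bdd_meas_abs bdd_meas_prod bdd_meas_add bdd_meas_const g Eb)
  have W0: "W S x \<ge> 0" for S x unfolding W_def by (intro mult_nonneg_nonneg prod_nonneg) auto
  have WJ: "\<bar>g x * (\<Prod>b\<in>I. E b S x)\<bar> \<le> W S x" if "I \<subseteq> J" for I S x
    unfolding W_def abs_mult abs_prod by (intro mult_left_mono prod_le_prod_one_plus_abs J that) auto
  define IW where "IW S = (\<integral>x. (W S x)\<^sup>2 \<partial>M)" for S
  have IW0: "IW S \<ge> 0" for S by (simp add: IW_def)
  have C4: "C4 \<ge> 0"
  proof -
    have "0 \<le> (\<Sum>i\<in>A. \<integral>x. (f i x) ^ 4 \<partial>M)"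
      by (intro sum_nonneg integral_nonneg_AE AE_I2) simp
    then have "0 \<le> C4 * N" using four by linarith
    then show ?thesis using N by (simp add: zero_le_mult_iff)
  qed
  have fi: "\<bar>f i x\<bar> \<le> sqrt N" if "i \<in> A" "x \<in> space M" for i x
  proof -
    have "(f i x)\<^sup>2 \<le> (\<Sum>i\<in>A. (f i x)\<^sup>2)" using A that by (intro member_le_sum) auto
    then have "(f i x)\<^sup>2 \<le> N" using sumsq that by force
    then show ?thesis by (metis real_sqrt_abs real_sqrt_le_mono)
  qed
  have cabs: "\<bar>c b i\<bar> \<le> 2 / sqrt N" if "b \<in> J" "i \<in> A" for b i
    using real_sqrt_le_mono[OF c[OF that]] by (simp add: real_sqrt_divide)
  define K where "K = (6::real) ^ p"
  have K0: "K \<ge> 0" by (simp add: K_def)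
  define L where "L I S i x = (\<Sum>b\<in>I. c b i * f i x * (\<Prod>b'\<in>I - {b}. E b' S x))" for I S i x
  define R where "R I S i x = (\<Prod>b\<in>I. E b S x) - (\<Prod>b\<in>I. E b (flip i S) x) - 2 * sg S i * L I S i x" for I S i x
  have Rb [simp]: "bdd_meas M (R I S i)" "bdd_meas M (L I S i)" if "I \<subseteq> J" "i \<in> A" for I S i
  proof -
    show "bdd_meas M (L I S i)" unfolding L_def by (intro bdd_meas_sum bdd_meas_mult bdd_meas_prod bdd_meas_const) (use that in auto)
    then show "bdd_meas M (R I S i)" unfolding R_def by (intro bdd_meas_diff bdd_meas_mult bdd_meas_prod bdd_meas_const) (use that in auto)
  qed
  have R: "\<bar>g x * R I S i x\<bar> \<le> 16 * K / N * ((f i x)\<^sup>2 * W S x)"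
    if "I \<subseteq> J" "i \<in> A" "S \<subseteq> A" "x \<in> space M" for I S i x
  proof -
    \<comment> \<open>A flip moves each factor by at most \<open>2 * \<bar>c b i * f i x\<bar> \<le> t\<close>, and \<open>t \<le> 4\<close> because \<open>(f i x)\<^sup>2 \<le> N\<close>.\<close>
    define t where "t = 4 / sqrt N * \<bar>f i x\<bar>"
    have t4: "t \<le> 4" unfolding t_def using fi[of i x] that N by (simp add: field_simps)
    have I: "finite I" using that J finite_subset by blast
    have "\<bar>(\<Prod>b\<in>I. E b S x) - (\<Prod>b\<in>I. E b S x - 2 * sg S i * (c b i * f i x)) -
        (\<Sum>b\<in>I. 2 * sg S i * (c b i * f i x) * (\<Prod>b'\<in>I - {b}. E b' S x))\<bar>
        \<le> t\<^sup>2 * (2 + 4) ^ card I * (\<Prod>b\<in>I. 1 + \<bar>E b S x\<bar>)"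
    proof (rule prod_perturb[OF I _ _ t4])
      fix b assume "b \<in> I"
      then have "\<bar>c b i\<bar> * \<bar>f i x\<bar> \<le> 2 / sqrt N * \<bar>f i x\<bar>"
        using cabs that by (intro mult_right_mono) auto
      then show "\<bar>2 * sg S i * (c b i * f i x)\<bar> \<le> t"
        by (simp add: abs_mult t_def)
    qed (use N in \<open>simp add: t_def\<close>)
    also have "(\<Prod>b\<in>I. E b S x - 2 * sg S i * (c b i * f i x)) = (\<Prod>b\<in>I. E b (flip i S) x)"
      using that by (intro prod.cong refl) (simp add: flipE subset_iff)
    also have "(\<Sum>b\<in>I. 2 * sg S i * (c b i * f i x) * (\<Prod>b'\<in>I - {b}. E b' S x)) = 2 * sg S i * L I S i x"
      by (simp add: L_def sum_distrib_left mult_ac)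
    finally have "\<bar>R I S i x\<bar> \<le> t\<^sup>2 * 6 ^ card I * (\<Prod>b\<in>I. 1 + \<bar>E b S x\<bar>)"
      by (simp add: R_def)
    also have "\<dots> \<le> t\<^sup>2 * K * (\<Prod>b\<in>J. 1 + \<bar>E b S x\<bar>)"
    proof (intro mult_mono mult_left_mono)
      show "(6::real) ^ card I \<le> K"
        unfolding K_def p_def using that J by (intro power_increasing card_mono) auto
      show "(\<Prod>b\<in>I. 1 + \<bar>E b S x\<bar>) \<le> (\<Prod>b\<in>J. 1 + \<bar>E b S x\<bar>)"
        using J that by (intro prod_mono2) auto
    qed (auto simp: K_def intro!: prod_nonneg)
    finally have "\<bar>g x\<bar> * \<bar>R I S i x\<bar> \<le> \<bar>g x\<bar> * (t\<^sup>2 * K * (\<Prod>b\<in>J. 1 + \<bar>E b S x\<bar>))"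
      by (intro mult_left_mono) auto
    also have "\<dots> = 16 * K / N * ((f i x)\<^sup>2 * W S x)"
      using N by (simp add: t_def W_def power_mult_distrib power_divide)
    finally show ?thesis by (simp add: abs_mult)
  qed
  define P where "P S = (\<integral>x. g x * (\<Prod>b\<in>J. E b S x) \<partial>M)" for S
  \<comment> \<open>The variance: squared differences under flips, with the second moment of \<open>W\<close> as the unit.\<close>
  have "(\<Sum>i\<in>A. (P S - P (flip i S))\<^sup>2) \<le> (32 * (real p)\<^sup>2 + 512 * 36 ^ p) / N * IW S" if S: "S \<subseteq> A" for S
  proof -
    define X where "X b i = (\<integral>x. (g x * (\<Prod>b'\<in>J - {b}. E b' S x)) * f i x \<partial>M)" for b i
    define r where "r i = (\<integral>x. g x * R J S i x \<partial>M)" for i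
    have dec: "P S - P (flip i S) = (\<Sum>b\<in>J. 2 * sg S i * c b i * X b i) + r i" if i: "i \<in> A" for i
    proof -
      have "P S - P (flip i S) = (\<integral>x. g x * (\<Prod>b\<in>J. E b S x) - g x * (\<Prod>b\<in>J. E b (flip i S) x) \<partial>M)"
        unfolding P_def by (subst Bochner_Integration.integral_diff) (auto intro!: bdd_meas_integrable bdd_meas_mult bdd_meas_prod)
      also have "\<dots> = (\<integral>x. (\<Sum>b\<in>J. 2 * sg S i * c b i * ((g x * (\<Prod>b'\<in>J - {b}. E b' S x)) * f i x)) + g x * R J S i x \<partial>M)"
        by (rule Bochner_Integration.integral_cong) (auto simp: R_def L_def sum_distrib_left algebra_simps)
      also have "\<dots> = (\<Sum>b\<in>J. 2 * sg S i * c b i * X b i) + r i"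
      proof -
        have b: "bdd_meas M (\<lambda>x. 2 * sg S i * c b i * ((g x * (\<Prod>b'\<in>J - {b}. E b' S x)) * f i x))" for b
          using i by (intro bdd_meas_mult bdd_meas_prod bdd_meas_const) auto
        have "(\<integral>x. (\<Sum>b\<in>J. 2 * sg S i * c b i * ((g x * (\<Prod>b'\<in>J - {b}. E b' S x)) * f i x)) \<partial>M) = (\<Sum>b\<in>J. 2 * sg S i * c b i * X b i)"
          unfolding X_def
          by (subst Bochner_Integration.integral_sum, rule bdd_meas_integrable, rule b)
            (simp only: integral_mult_right_zero)
        then show ?thesis unfolding r_def using i b
          by (subst Bochner_Integration.integral_add) auto
      qed
      finally show ?thesis .
    qed
    have X: "(\<Sum>i\<in>A. (X b i)\<^sup>2) \<le> IW S" if b: "b \<in> J" for b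
    proof -
      have "(\<Sum>i\<in>A. (X b i)\<^sup>2) \<le> (\<integral>x. (g x * (\<Prod>b'\<in>J - {b}. E b' S x))\<^sup>2 \<partial>M)"
        unfolding X_def by (rule bessel[OF on A]) (auto intro!: bdd_meas_mult bdd_meas_prod)
      also have "\<dots> \<le> IW S" unfolding IW_def
      proof (rule bdd_meas_integral_mono)
        fix x show "(g x * (\<Prod>b'\<in>J - {b}. E b' S x))\<^sup>2 \<le> (W S x)\<^sup>2"
          using WJ[of "J - {b}" x S] W0[of S x] by (intro power2_le_iff_abs_le[THEN iffD2]) auto
      qed (auto intro!: bdd_meas_mult bdd_meas_prod bdd_meas_power)
      finally show ?thesis .
    qed
    have r: "(r i)\<^sup>2 \<le> (16 * K / N)\<^sup>2 * (\<integral>x. (f i x)\<^sup>2 * (W S x)\<^sup>2 \<partial>M)" if i: "i \<in> A" for i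
    proof -
      have "\<bar>r i\<bar> \<le> (\<integral>x. \<bar>g x * R J S i x\<bar> \<partial>M)" unfolding r_def by (rule integral_abs_bound)
      also have "\<dots> \<le> (\<integral>x. 16 * K / N * (\<bar>f i x\<bar> * (\<bar>f i x\<bar> * W S x)) \<partial>M)"
      proof (rule bdd_meas_integral_mono)
        fix x assume "x \<in> space M"
        from R[OF _ i S this, of J] show "\<bar>g x * R J S i x\<bar> \<le> 16 * K / N * (\<bar>f i x\<bar> * (\<bar>f i x\<bar> * W S x))"
          by (simp add: power2_eq_square mult.assoc)
      qed (use i in \<open>auto intro!: bdd_meas_mult bdd_meas_abs\<close>)
      also have "\<dots> = 16 * K / N * (\<integral>x. \<bar>f i x\<bar> * (\<bar>f i x\<bar> * W S x) \<partial>M)" by simp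
      finally have "(r i)\<^sup>2 \<le> (16 * K / N * (\<integral>x. \<bar>f i x\<bar> * (\<bar>f i x\<bar> * W S x) \<partial>M))\<^sup>2"
        by (metis abs_ge_zero power2_abs power_mono)
      also have "\<dots> = (16 * K / N)\<^sup>2 * (\<integral>x. \<bar>f i x\<bar> * (\<bar>f i x\<bar> * W S x) \<partial>M)\<^sup>2" by (rule power_mult_distrib)
      also have "\<dots> \<le> (16 * K / N)\<^sup>2 * ((\<integral>x. \<bar>f i x\<bar>\<^sup>2 \<partial>M) * (\<integral>x. (\<bar>f i x\<bar> * W S x)\<^sup>2 \<partial>M))"
        using i by (intro mult_left_mono integral_Cauchy_Schwarz) auto
      also have "\<dots> = (16 * K / N)\<^sup>2 * (\<integral>x. (f i x)\<^sup>2 * (W S x)\<^sup>2 \<partial>M)"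
        using orthonormal_square[OF on i] by (simp add: power_mult_distrib)
      finally show ?thesis .
    qed
    have sumr: "(\<Sum>i\<in>A. (r i)\<^sup>2) \<le> 256 * 36 ^ p / N * IW S"
    proof -
      have "(\<Sum>i\<in>A. (r i)\<^sup>2) \<le> (\<Sum>i\<in>A. (16 * K / N)\<^sup>2 * (\<integral>x. (f i x)\<^sup>2 * (W S x)\<^sup>2 \<partial>M))"
        by (intro sum_mono r)
      also have "\<dots> = (16 * K / N)\<^sup>2 * (\<integral>x. (\<Sum>i\<in>A. (f i x)\<^sup>2) * (W S x)\<^sup>2 \<partial>M)"
      proof -
        have "(\<integral>x. (\<Sum>i\<in>A. (f i x)\<^sup>2) * (W S x)\<^sup>2 \<partial>M) = (\<Sum>i\<in>A. \<integral>x. (f i x)\<^sup>2 * (W S x)\<^sup>2 \<partial>M)"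
          unfolding sum_distrib_right by (rule Bochner_Integration.integral_sum) simp
        then show ?thesis by (simp only: sum_distrib_left)
      qed
      also have "\<dots> \<le> (16 * K / N)\<^sup>2 * (\<integral>x. N * (W S x)\<^sup>2 \<partial>M)"
        using sumsq by (intro mult_left_mono bdd_meas_integral_mono mult_right_mono) auto
      also have "\<dots> = 256 * K\<^sup>2 / N * IW S"
        using N by (simp add: IW_def power_divide power_mult_distrib power2_eq_square)
      also have "K\<^sup>2 = 36 ^ p" by (simp add: K_def power2_eq_square flip: power_mult_distrib)
      finally show ?thesis .
    qed
    have "(\<Sum>i\<in>A. (P S - P (flip i S))\<^sup>2) \<le> (\<Sum>i\<in>A. 2 * (real p * (\<Sum>b\<in>J. 16 / N * (X b i)\<^sup>2)) + 2 * (r i)\<^sup>2)"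
    proof (rule sum_mono)
      fix i assume i: "i \<in> A"
      have "(P S - P (flip i S))\<^sup>2 \<le> 2 * (\<Sum>b\<in>J. 2 * sg S i * c b i * X b i)\<^sup>2 + 2 * (r i)\<^sup>2"
        unfolding dec[OF i] using sum_squares_bound[of "\<Sum>b\<in>J. 2 * sg S i * c b i * X b i" "r i"]
        by (simp add: power2_sum)
      also have "(\<Sum>b\<in>J. 2 * sg S i * c b i * X b i)\<^sup>2 \<le> real p * (\<Sum>b\<in>J. (2 * sg S i * c b i * X b i)\<^sup>2)"
        unfolding p_def using Cauchy_Schwarz_ineq_sum[of "\<lambda>b. 1" "\<lambda>b. 2 * sg S i * c b i * X b i" J] by simp
      also have "(\<Sum>b\<in>J. (2 * sg S i * c b i * X b i)\<^sup>2) \<le> (\<Sum>b\<in>J. 16 / N * (X b i)\<^sup>2)"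
      proof (rule sum_mono)
        fix b assume b: "b \<in> J"
        have "(2 * sg S i * c b i * X b i)\<^sup>2 = 4 * (c b i)\<^sup>2 * (X b i)\<^sup>2" by (simp add: power_mult_distrib)
        also have "\<dots> \<le> 4 * (4 / N) * (X b i)\<^sup>2" using c[OF b i] by (intro mult_right_mono mult_left_mono) auto
        finally show "(2 * sg S i * c b i * X b i)\<^sup>2 \<le> 16 / N * (X b i)\<^sup>2" by simp
      qed
      finally show "(P S - P (flip i S))\<^sup>2 \<le> 2 * (real p * (\<Sum>b\<in>J. 16 / N * (X b i)\<^sup>2)) + 2 * (r i)\<^sup>2"
        by (simp add: mult_left_mono)
    qed
    also have "\<dots> = 32 * real p / N * (\<Sum>b\<in>J. \<Sum>i\<in>A. (X b i)\<^sup>2) + 2 * (\<Sum>i\<in>A. (r i)\<^sup>2)"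
    proof -
      have "(\<Sum>i\<in>A. \<Sum>b\<in>J. 16 / N * (X b i)\<^sup>2) = 16 / N * (\<Sum>b\<in>J. \<Sum>i\<in>A. (X b i)\<^sup>2)"
        unfolding sum_distrib_left by (rule sum.swap)
      then show ?thesis by (simp only: sum.distrib sum_distrib_left[symmetric]) simp
    qed
    also have "\<dots> \<le> 32 * real p / N * (\<Sum>b\<in>J. IW S) + 2 * (256 * 36 ^ p / N * IW S)"
      using N by (intro add_mono mult_left_mono sum_mono X sumr) auto
    also have "\<dots> = (32 * (real p)\<^sup>2 + 512 * 36 ^ p) / N * IW S"
      by (simp add: p_def[symmetric] power2_eq_square algebra_simps add_divide_distrib)
    finally show ?thesis .
  qed
  then have var: "(\<Sum>i\<in>A. sign_avg A (\<lambda>S. (P S - P (flip i S))\<^sup>2)) \<le> (32 * (real p)\<^sup>2 + 512 * 36 ^ p) / N * sign_avg A IW"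
    unfolding sign_avg_sum[symmetric] sign_avg_cmult[symmetric] by (intro sign_avg_mono)
  \<comment> \<open>The mean: \<open>Z\<close> is what integration by parts in each sign of \<open>E m\<close> leaves.\<close>
  define J' where "J' = J - {m}"
  have J': "J' \<subseteq> J" "finite J'" "m \<notin> J'" "J = insert m J'" using J by (auto simp: J'_def)
  define Q where "Q i S = (\<integral>x. g x * f i x * (\<Prod>b\<in>J'. E b S x) \<partial>M)" for i S
  define Z where "Z S = (\<Sum>i\<in>A. c m i * (\<integral>x. g x * f i x * (L J' S i x + sg S i * R J' S i x / 2) \<partial>M))" for S
  have PQ: "P S = (\<Sum>i\<in>A. c m i * (sg S i * Q i S))" if S: "S \<subseteq> A" for S
  proof -
    have "P S = (\<integral>x. (\<Sum>i\<in>A. c m i * (sg S i * (g x * f i x * (\<Prod>b\<in>J'. E b S x)))) \<partial>M)"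
      unfolding P_def J'(4) using J' S
      by (intro Bochner_Integration.integral_cong refl) (simp add: Em sum_distrib_left sum_distrib_right mult_ac)
    also have "\<dots> = (\<Sum>i\<in>A. c m i * (sg S i * Q i S))"
      unfolding Q_def by (subst Bochner_Integration.integral_sum)
        (use J' in \<open>auto intro!: bdd_meas_integrable bdd_meas_mult bdd_meas_prod\<close>)
    finally show ?thesis .
  qed
  have mean: "sign_avg A P = sign_avg A Z"
  proof -
    have "sign_avg A P = (\<Sum>i\<in>A. c m i * sign_avg A (\<lambda>S. sg S i * Q i S))"
      by (subst sign_avg_cong[OF PQ]) (auto simp: sign_avg_sum sign_avg_cmult)
    also have "\<dots> = (\<Sum>i\<in>A. c m i * sign_avg A (\<lambda>S. \<integral>x. g x * f i x * (L J' S i x + sg S i * R J' S i x / 2) \<partial>M))"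
    proof (intro sum.cong refl arg_cong2[where f = "(*)"])
      fix i assume i: "i \<in> A"
      have "sign_avg A (\<lambda>S. sg S i * Q i S) = sign_avg A (\<lambda>S. sg S i * (Q i S - Q i (flip i S)) / 2)"
        unfolding sign_avg_divide by (rule sign_avg_sg_mult[OF i])
      also have "\<dots> = sign_avg A (\<lambda>S. \<integral>x. g x * f i x * (L J' S i x + sg S i * R J' S i x / 2) \<partial>M)"
      proof (rule sign_avg_cong)
        fix S assume S: "S \<subseteq> A"
        have "Q i S - Q i (flip i S) = (\<integral>x. g x * f i x * (\<Prod>b\<in>J'. E b S x) - g x * f i x * (\<Prod>b\<in>J'. E b (flip i S) x) \<partial>M)"
          unfolding Q_def using J' i by (subst Bochner_Integration.integral_diff) (auto intro!: bdd_meas_integrable bdd_meas_mult bdd_meas_prod)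
        also have "\<dots> = (\<integral>x. (2 * sg S i) * (g x * f i x * (L J' S i x + sg S i * R J' S i x / 2)) \<partial>M)"
        proof (intro Bochner_Integration.integral_cong refl)
          fix x
          have "(2 * sg S i) * (g x * f i x * (L J' S i x + sg S i * R J' S i x / 2)) =
              g x * f i x * (2 * sg S i * L J' S i x + (sg S i * sg S i) * R J' S i x)"
            by (simp only: algebra_simps) simp
          also have "\<dots> = g x * f i x * ((\<Prod>b\<in>J'. E b S x) - (\<Prod>b\<in>J'. E b (flip i S) x))"
            by (simp add: R_def)
          finally show "g x * f i x * (\<Prod>b\<in>J'. E b S x) - g x * f i x * (\<Prod>b\<in>J'. E b (flip i S) x) =
              (2 * sg S i) * (g x * f i x * (L J' S i x + sg S i * R J' S i x / 2))"
            by (simp only: right_diff_distrib)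
        qed
        also have "\<dots> = (2 * sg S i) * (\<integral>x. (g x * f i x * (L J' S i x + sg S i * R J' S i x / 2)) \<partial>M)"
          by simp
        finally show "sg S i * (Q i S - Q i (flip i S)) / 2 = (\<integral>x. g x * f i x * (L J' S i x + sg S i * R J' S i x / 2) \<partial>M)"
          by (simp add: mult.assoc)
      qed
      finally show "sign_avg A (\<lambda>S. sg S i * Q i S) = sign_avg A (\<lambda>S. \<integral>x. g x * f i x * (L J' S i x + sg S i * R J' S i x / 2) \<partial>M)" .
    qed
    also have "\<dots> = sign_avg A Z" unfolding Z_def[abs_def] sign_avg_sum sign_avg_cmult ..
    finally show ?thesis .
  qed
  have Z2: "(Z S)\<^sup>2 \<le> (2 * (real p)\<^sup>2 * Y + 512 * 36 ^ p * C4 / N) * IW S" if S: "S \<subseteq> A" for S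
  proof -
    define B where "B b x = (\<Sum>i\<in>A. c m i * c b i * (f i x)\<^sup>2)" for b x
    define U where "U = (\<Sum>b\<in>J'. \<integral>x. B b x * (g x * (\<Prod>b'\<in>J' - {b}. E b' S x)) \<partial>M)"
    define V where "V = (\<integral>x. (\<Sum>i\<in>A. c m i * f i x * sg S i * (g x * R J' S i x)) \<partial>M) / 2"
    have Bb [simp]: "bdd_meas M (B b)" for b unfolding B_def by (intro bdd_meas_sum bdd_meas_mult bdd_meas_const bdd_meas_power) simp
    have "Z S = (\<integral>x. (\<Sum>i\<in>A. c m i * (g x * f i x * (L J' S i x + sg S i * R J' S i x / 2))) \<partial>M)"
      unfolding Z_def using J' by (subst Bochner_Integration.integral_sum) (auto intro!: bdd_meas_integrable bdd_meas_mult bdd_meas_add bdd_meas_divide)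
    also have "\<dots> = (\<integral>x. (\<Sum>b\<in>J'. B b x * (g x * (\<Prod>b'\<in>J' - {b}. E b' S x))) +
        (\<Sum>i\<in>A. c m i * f i x * sg S i * (g x * R J' S i x)) / 2 \<partial>M)"
    proof (intro Bochner_Integration.integral_cong refl)
      fix x
      have "(\<Sum>b\<in>J'. B b x * (g x * (\<Prod>b'\<in>J' - {b}. E b' S x))) = (\<Sum>i\<in>A. c m i * (g x * f i x * L J' S i x))"
        unfolding B_def L_def sum_distrib_left sum_distrib_right
        by (subst sum.swap) (simp add: power2_eq_square mult_ac)
      then show "(\<Sum>i\<in>A. c m i * (g x * f i x * (L J' S i x + sg S i * R J' S i x / 2))) =
        (\<Sum>b\<in>J'. B b x * (g x * (\<Prod>b'\<in>J' - {b}. E b' S x))) + (\<Sum>i\<in>A. c m i * f i x * sg S i * (g x * R J' S i x)) / 2"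
        by (simp add: sum.distrib algebra_simps sum_divide_distrib)
    qed
    also have "\<dots> = U + V"
    proof -
      have 1: "bdd_meas M (\<lambda>x. B b x * (g x * (\<Prod>b'\<in>J' - {b}. E b' S x)))" for b
        using J' by (intro bdd_meas_mult bdd_meas_prod Bb g Eb) auto
      have 2: "bdd_meas M (\<lambda>x. \<Sum>i\<in>A. c m i * f i x * sg S i * (g x * R J' S i x))"
        using J' by (intro bdd_meas_mult bdd_meas_sum bdd_meas_const Rb g) simp_all
      have "(\<integral>x. (\<Sum>b\<in>J'. B b x * (g x * (\<Prod>b'\<in>J' - {b}. E b' S x))) \<partial>M) = U"
        unfolding U_def by (rule Bochner_Integration.integral_sum, rule bdd_meas_integrable, rule 1)
      then show ?thesis unfolding V_def
        by (subst Bochner_Integration.integral_add)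
          (use 1 2 in \<open>simp_all only: bdd_meas_integrable bdd_meas_sum bdd_meas_divide integral_divide_zero\<close>)
    qed
    finally have ZUV: "Z S = U + V" .
    have "\<bar>U\<bar> \<le> (\<Sum>b\<in>J'. sqrt Y * sqrt (IW S))"
      unfolding U_def
    proof (rule order_trans[OF sum_abs], rule sum_mono)
      fix b assume b: "b \<in> J'"
      have "\<bar>\<integral>x. B b x * (g x * (\<Prod>b'\<in>J' - {b}. E b' S x)) \<partial>M\<bar> \<le>
        sqrt (\<integral>x. (B b x)\<^sup>2 \<partial>M) * sqrt (\<integral>x. (g x * (\<Prod>b'\<in>J' - {b}. E b' S x))\<^sup>2 \<partial>M)"
        using J' by (intro integral_abs_le_sqrt bdd_meas_mult bdd_meas_prod) auto
      also have "\<dots> \<le> sqrt Y * sqrt (IW S)"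
      proof (intro mult_mono real_sqrt_le_mono)
        show "(\<integral>x. (B b x)\<^sup>2 \<partial>M) \<le> Y" unfolding B_def using b J' by (intro Y) auto
        show "(\<integral>x. (g x * (\<Prod>b'\<in>J' - {b}. E b' S x))\<^sup>2 \<partial>M) \<le> IW S" unfolding IW_def
        proof (rule bdd_meas_integral_mono)
          fix x show "(g x * (\<Prod>b'\<in>J' - {b}. E b' S x))\<^sup>2 \<le> (W S x)\<^sup>2"
            using WJ[of "J' - {b}" x S] W0[of S x] J' by (intro power2_le_iff_abs_le[THEN iffD2]) auto
        qed (use J' in \<open>auto intro!: bdd_meas_mult bdd_meas_prod bdd_meas_power\<close>)
      qed (use Y0 in auto)
      finally show "\<bar>\<integral>x. B b x * (g x * (\<Prod>b'\<in>J' - {b}. E b' S x)) \<partial>M\<bar> \<le> sqrt Y * sqrt (IW S)" .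
    qed
    also have "\<dots> \<le> real p * (sqrt Y * sqrt (IW S))"
      unfolding sum_constant p_def using J J' Y0 IW0 by (intro mult_right_mono) (auto intro!: card_mono)
    finally have "\<bar>U\<bar>\<^sup>2 \<le> (real p * (sqrt Y * sqrt (IW S)))\<^sup>2" by (rule power_mono) simp
    then have U2: "U\<^sup>2 \<le> (real p)\<^sup>2 * (Y * IW S)"
      using Y0 IW0 by (simp add: power_mult_distrib)
    define D where "D x = (\<Sum>i\<in>A. \<bar>f i x\<bar> ^ 3)" for x
    have Db [simp]: "bdd_meas M D" unfolding D_def by (intro bdd_meas_sum bdd_meas_power bdd_meas_abs) simp
    have "\<bar>2 * V\<bar> \<le> (\<integral>x. \<bar>\<Sum>i\<in>A. c m i * f i x * sg S i * (g x * R J' S i x)\<bar> \<partial>M)"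
      unfolding V_def by (simp add: integral_abs_bound)
    also have "\<dots> \<le> (\<integral>x. 32 * K / (N * sqrt N) * (D x * W S x) \<partial>M)"
    proof (rule bdd_meas_integral_mono)
      fix x assume x: "x \<in> space M"
      have "\<bar>\<Sum>i\<in>A. c m i * f i x * sg S i * (g x * R J' S i x)\<bar> \<le>
          (\<Sum>i\<in>A. (2 / sqrt N) * \<bar>f i x\<bar> * (16 * K / N * ((f i x)\<^sup>2 * W S x)))"
      proof (rule order_trans[OF sum_abs], rule sum_mono)
        fix i assume i: "i \<in> A"
        have "\<bar>c m i * f i x * sg S i * (g x * R J' S i x)\<bar> = \<bar>c m i\<bar> * \<bar>f i x\<bar> * \<bar>g x * R J' S i x\<bar>"
          by (simp add: abs_mult)
        also have "\<dots> \<le> (2 / sqrt N) * \<bar>f i x\<bar> * (16 * K / N * ((f i x)\<^sup>2 * W S x))"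
          using cabs[OF J(2) i] R[OF J'(1) i S x] N
          by (intro mult_mono mult_nonneg_nonneg) (auto simp: abs_mult)
        finally show "\<bar>c m i * f i x * sg S i * (g x * R J' S i x)\<bar> \<le> \<dots>" .
      qed
      also have "\<dots> = 32 * K / (N * sqrt N) * (D x * W S x)"
      proof -
        have "\<bar>f i x\<bar> ^ 3 = \<bar>f i x\<bar> * (f i x)\<^sup>2" for i
          by (simp add: power3_eq_cube power2_eq_square)
        then show ?thesis
          unfolding D_def sum_distrib_left sum_distrib_right by (intro sum.cong refl) (simp add: field_simps)
      qed
      finally show "\<bar>\<Sum>i\<in>A. c m i * f i x * sg S i * (g x * R J' S i x)\<bar> \<le> 32 * K / (N * sqrt N) * (D x * W S x)" .
    qed (use J' in \<open>auto intro!: bdd_meas_mult bdd_meas_sum bdd_meas_abs\<close>)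
    also have "\<dots> = 32 * K / (N * sqrt N) * (\<integral>x. D x * W S x \<partial>M)" by simp
    finally have "\<bar>2 * V\<bar>\<^sup>2 \<le> (32 * K / (N * sqrt N) * (\<integral>x. D x * W S x \<partial>M))\<^sup>2" by (rule power_mono) simp
    also have "\<dots> = 1024 * K\<^sup>2 / N ^ 3 * (\<integral>x. D x * W S x \<partial>M)\<^sup>2"
    proof -
      have "(N * sqrt N)\<^sup>2 = N ^ 3"
        using N by (simp add: power_mult_distrib power3_eq_cube power2_eq_square)
      moreover have "(32 * K)\<^sup>2 = 1024 * K\<^sup>2" by (simp add: power_mult_distrib)
      ultimately show ?thesis by (simp only: power_mult_distrib[of "_ / _"] power_divide)
    qed
    also have "\<dots> \<le> 1024 * K\<^sup>2 / N ^ 3 * ((\<integral>x. (D x)\<^sup>2 \<partial>M) * IW S)"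
      unfolding IW_def using N by (intro mult_left_mono integral_Cauchy_Schwarz) auto
    also have "\<dots> \<le> 1024 * K\<^sup>2 / N ^ 3 * ((N * (C4 * N)) * IW S)"
    proof (intro mult_left_mono mult_right_mono IW0)
      have "(\<integral>x. (D x)\<^sup>2 \<partial>M) \<le> (\<integral>x. N * (\<Sum>i\<in>A. f i x ^ 4) \<partial>M)"
      proof (rule bdd_meas_integral_mono)
        fix x assume x: "x \<in> space M"
        have "(D x)\<^sup>2 = (\<Sum>i\<in>A. \<bar>f i x\<bar> * \<bar>f i x\<bar>\<^sup>2)\<^sup>2"
          unfolding D_def by (simp add: power_Suc[symmetric] numeral_3_eq_3 numeral_2_eq_2 del: power2_abs)
        also have "\<dots> \<le> (\<Sum>i\<in>A. \<bar>f i x\<bar>\<^sup>2) * (\<Sum>i\<in>A. (\<bar>f i x\<bar>\<^sup>2)\<^sup>2)"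
          by (rule Cauchy_Schwarz_ineq_sum)
        also have "\<dots> = (\<Sum>i\<in>A. (f i x)\<^sup>2) * (\<Sum>i\<in>A. f i x ^ 4)"
          by (simp add: power_mult[symmetric])
        also have "\<dots> \<le> N * (\<Sum>i\<in>A. f i x ^ 4)"
          using sumsq[OF x] by (intro mult_right_mono sum_nonneg) auto
        finally show "(D x)\<^sup>2 \<le> N * (\<Sum>i\<in>A. f i x ^ 4)" .
      qed (auto intro!: bdd_meas_mult bdd_meas_sum)
      also have "\<dots> = N * (\<Sum>i\<in>A. \<integral>x. f i x ^ 4 \<partial>M)" by (simp add: Bochner_Integration.integral_sum)
      also have "\<dots> \<le> N * (C4 * N)" using four N by (intro mult_left_mono) auto
      finally show "(\<integral>x. (D x)\<^sup>2 \<partial>M) \<le> N * (C4 * N)" .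
    qed (use N in auto)
    also have "\<dots> = 1024 * K\<^sup>2 * C4 / N * IW S" using N by (simp add: power3_eq_cube)
    also have "K\<^sup>2 = 36 ^ p" by (simp add: K_def power2_eq_square flip: power_mult_distrib)
    finally have V2: "V\<^sup>2 \<le> 256 * 36 ^ p * C4 / N * IW S" by (simp add: power_mult_distrib)
    have "(Z S)\<^sup>2 \<le> 2 * U\<^sup>2 + 2 * V\<^sup>2"
      unfolding ZUV using sum_squares_bound[of U V] by (simp add: power2_sum)
    also have "\<dots> \<le> 2 * ((real p)\<^sup>2 * (Y * IW S)) + 2 * (256 * 36 ^ p * C4 / N * IW S)"
      using U2 V2 by simp
    finally show ?thesis by (simp add: algebra_simps)
  qed
  have "(sign_avg A Z)\<^sup>2 \<le> sign_avg A (\<lambda>S. (Z S)\<^sup>2)"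
  proof -
    have "0 \<le> sign_avg A (\<lambda>S. (Z S - sign_avg A Z)\<^sup>2)" by (rule sign_avg_nonneg) simp
    also have "\<dots> = sign_avg A (\<lambda>S. (Z S)\<^sup>2 - 2 * sign_avg A Z * Z S + (sign_avg A Z)\<^sup>2)"
      by (rule sign_avg_cong) (simp add: power2_eq_square algebra_simps)
    also have "\<dots> = sign_avg A (\<lambda>S. (Z S)\<^sup>2) - (sign_avg A Z)\<^sup>2"
      by (simp add: sign_avg_add sign_avg_diff sign_avg_cmult sign_avg_const[OF A] power2_eq_square)
    finally show ?thesis by simp
  qed
  also have "\<dots> \<le> sign_avg A (\<lambda>S. (2 * (real p)\<^sup>2 * Y + 512 * 36 ^ p * C4 / N) * IW S)"
    by (rule sign_avg_mono) (rule Z2)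
  finally have mean2: "(sign_avg A P)\<^sup>2 \<le> (2 * (real p)\<^sup>2 * Y + 512 * 36 ^ p * C4 / N) * sign_avg A IW"
    by (simp add: mean sign_avg_cmult)
  have "sign_avg A (\<lambda>S. (P S)\<^sup>2) \<le> (sign_avg A P)\<^sup>2 + (\<Sum>i\<in>A. sign_avg A (\<lambda>S. (P S - P (flip i S))\<^sup>2)) / 4"
    by (rule sign_avg_poincare[OF A])
  also have "\<dots> \<le> (2 * (real p)\<^sup>2 * Y + 512 * 36 ^ p * C4 / N) * sign_avg A IW + (32 * (real p)\<^sup>2 + 512 * 36 ^ p) / N * sign_avg A IW / 4"
    using mean2 var by (intro add_mono divide_right_mono) auto
  also have "\<dots> = ((8 * (real p)\<^sup>2 + 128 * 36 ^ p + 512 * 36 ^ p * C4) / N + 2 * (real p)\<^sup>2 * Y) * sign_avg A IW"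
    by (simp add: algebra_simps add_divide_distrib)
  finally show ?thesis by (simp add: P_def IW_def[abs_def])
qed

end

section \<open>The Hartley matrix and random rotations\<close>

text \<open>
Geometric sums of the \<open>n\<close>-th root of unity \<open>cis (2 * pi * d / n)\<close>.
\<close>
lemma character_sums:
  fixes d :: int and n :: nat
  assumes n: "n > 0"
  shows "(\<Sum>k<n. cos (2 * pi * of_int d * real k / real n)) = (if int n dvd d then real n else 0)"
    and "(\<Sum>k<n. sin (2 * pi * of_int d * real k / real n)) = 0"
proof -
  define z where "z = cis (2 * pi * of_int d / real n)"
  have zk: "z ^ k = cis (2 * pi * of_int d * real k / real n)" for k
  proof -
    have "z ^ k = cis (real k * (2 * pi * of_int d / real n))" unfolding z_def by (rule Complex.DeMoivre)
    also have "real k * (2 * pi * of_int d / real n) = 2 * pi * of_int d * real k / real n" by simp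
    finally show ?thesis .
  qed
  have zn: "z ^ n = 1"
    unfolding zk using n cis_multiple_2pi[of "of_int d"] by (simp add: mult_ac)
  have re: "(\<Sum>k<n. cos (2 * pi * of_int d * real k / real n)) = Re (\<Sum>k<n. z ^ k)"
    and im: "(\<Sum>k<n. sin (2 * pi * of_int d * real k / real n)) = Im (\<Sum>k<n. z ^ k)"
    by (simp_all add: zk)
  have "(\<Sum>k<n. z ^ k) = (if int n dvd d then of_nat n else 0)"
  proof (cases "int n dvd d")
    case True
    then obtain e where "d = int n * e" by blast
    then have "z = 1" using n cis_multiple_2pi[of "of_int e"] by (simp add: z_def mult_ac)
    then show ?thesis using True by simp
  next
    case False
    have "z \<noteq> 1"
    proof
      assume "z = 1"
      then have "cos (2 * pi * of_int d / real n) = 1" by (simp add: z_def complex_eq_iff)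
      then obtain e :: int where "2 * pi * of_int d / real n = of_int e * 2 * pi"
        unfolding cos_one_2pi_int by blast
      then have "real_of_int d = of_int e * real n" using n by (simp add: field_simps)
      then have "d = e * int n" by (metis of_int_eq_iff of_int_mult of_int_of_nat_eq)
      then show False using False by simp
    qed
    then show ?thesis using False zn by (simp add: geometric_sum)
  qed
  then show "(\<Sum>k<n. cos (2 * pi * of_int d * real k / real n)) = (if int n dvd d then real n else 0)"
    and "(\<Sum>k<n. sin (2 * pi * of_int d * real k / real n)) = 0"
    unfolding re im by auto
qed

text \<open>
The discrete Hartley transform, the real form of the discrete Fourier transform. It is a symmetric orthogonal
matrix of every size \<open>n\<close> with entries of order \<open>1 / sqrt n\<close>; flat orthogonal matrices with entries
\<open>\<plusminus>1 / sqrt n\<close> do not exist for odd \<open>n > 1\<close>.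
\<close>
definition hartley :: "nat \<Rightarrow> nat \<Rightarrow> nat \<Rightarrow> real" where
  "hartley n i j = (cos (2 * pi * real i * real j / real n) + sin (2 * pi * real i * real j / real n)) / sqrt (real n)"

lemma hartley_commute: "hartley n i j = hartley n j i"
  by (simp add: hartley_def mult_ac)

lemma hartley_square_le: "(hartley n i j)\<^sup>2 \<le> 4 / real n"
proof -
  define t where "t = 2 * pi * real i * real j / real n"
  have "(cos t + sin t)\<^sup>2 \<le> 2\<^sup>2"
    using cos_le_one[of t] cos_ge_minus_one[of t] sin_le_one[of t] sin_ge_minus_one[of t]
    by (intro abs_le_square_iff[THEN iffD1]) linarith
  then show ?thesis unfolding hartley_def t_def[symmetric]
    by (simp add: power_divide divide_right_mono)
qed

lemma hartley_orthogonal: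
  assumes n: "n > 0" and ij: "i < n" "j < n"
  shows "(\<Sum>k<n. hartley n i k * hartley n j k) = (if i = j then 1 else 0)"
proof -
  have "hartley n i k * hartley n j k =
     (cos (2 * pi * of_int (int i - int j) * real k / real n) + sin (2 * pi * of_int (int i + int j) * real k / real n)) / real n" for k
  proof -
    define a b where "a = 2 * pi * real i * real k / real n" and "b = 2 * pi * real j * real k / real n"
    have "hartley n i k * hartley n j k = (cos a + sin a) * (cos b + sin b) / real n"
      using n by (simp add: hartley_def a_def b_def)
    also have "(cos a + sin a) * (cos b + sin b) = cos (a - b) + sin (a + b)"
      by (simp add: cos_diff sin_add algebra_simps)
    also have "a - b = 2 * pi * of_int (int i - int j) * real k / real n"
      by (simp add: a_def b_def field_simps diff_divide_distrib)
    also have "a + b = 2 * pi * of_int (int i + int j) * real k / real n"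
      by (simp add: a_def b_def field_simps add_divide_distrib)
    finally show ?thesis .
  qed
  then have "(\<Sum>k<n. hartley n i k * hartley n j k) = (if int n dvd int i - int j then real n else 0) / real n"
    by (simp only: sum_divide_distrib[symmetric] sum.distrib character_sums[OF n] add_0_right)
  moreover have "int n dvd int i - int j \<longleftrightarrow> i = j"
    using ij zdvd_imp_le[of "int n" "\<bar>int i - int j\<bar>"] by force
  ultimately show ?thesis using n by simp
qed

lemma hartley_parseval:
  assumes n: "n > 0"
  shows "(\<Sum>j<n. (\<Sum>i<n. a i * hartley n i j)\<^sup>2) = (\<Sum>i<n. (a i)\<^sup>2)"
proof -
  have "(\<Sum>j<n. (\<Sum>i<n. a i * hartley n i j)\<^sup>2) =
     (\<Sum>j<n. \<Sum>i<n. \<Sum>i'<n. a i * a i' * (hartley n i j * hartley n i' j))"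
    by (simp add: power2_eq_square sum_product mult_ac)
  also have "\<dots> = (\<Sum>i<n. \<Sum>i'<n. a i * a i' * (\<Sum>j<n. hartley n i j * hartley n i' j))"
    unfolding sum_distrib_left by (subst sum.swap, rule sum.cong[OF refl], rule sum.swap)
  also have "\<dots> = (\<Sum>i<n. \<Sum>i'<n. if i = i' then (a i)\<^sup>2 else 0)"
    using n by (intro sum.cong refl) (auto simp: hartley_orthogonal power2_eq_square)
  finally show ?thesis by simp
qed

text \<open>
The squared entries are \<open>(1 + sin (2 * \<theta>)) / n\<close>, where \<open>\<theta>\<close> is the angle of the entry. The constant part is annihilated by
\<open>w\<close>. The doubled angles again run through all frequencies because \<open>n\<close> is odd, so Parseval's identity bounds the
oscillating part.
\<close>
lemma hartley_square_parseval:
  assumes n: "odd n" and w: "(\<Sum>i<n. w i) = 0"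
  shows "(\<Sum>j<n. (\<Sum>i<n. w i * (hartley n i j)\<^sup>2)\<^sup>2) \<le> (\<Sum>i<n. (w i)\<^sup>2) / real n"
proof -
  have n0: "n > 0" using n by (simp add: odd_pos)
  define t where "t i j = 2 * pi * of_int (2 * int i) * real j / real n" for i j
  have sq: "(hartley n i j)\<^sup>2 = (1 + sin (t i j)) / real n" for i j
  proof -
    define a where "a = 2 * pi * real i * real j / real n"
    have "(hartley n i j)\<^sup>2 = (cos a + sin a)\<^sup>2 / real n"
      by (simp add: hartley_def a_def power_divide)
    also have "(cos a + sin a)\<^sup>2 = 1 + sin (2 * a)"
      using sin_cos_squared_add[of a] by (simp add: power2_sum sin_double)
    also have "2 * a = t i j" by (simp add: a_def t_def)
    finally show ?thesis .
  qed
  have lin: "(\<Sum>i<n. w i * (hartley n i j)\<^sup>2) = (\<Sum>i<n. w i * sin (t i j)) / real n" for j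
  proof -
    have "(\<Sum>i<n. w i * (hartley n i j)\<^sup>2) = ((\<Sum>i<n. w i) + (\<Sum>i<n. w i * sin (t i j))) / real n"
      by (simp add: sq sum.distrib[symmetric] sum_divide_distrib algebra_simps add_divide_distrib)
    then show ?thesis by (simp add: w)
  qed
  have "(\<Sum>j<n. (\<Sum>i<n. w i * sin (t i j))\<^sup>2) \<le>
      (\<Sum>j<n. (\<Sum>i<n. w i * cos (t i j))\<^sup>2 + (\<Sum>i<n. w i * sin (t i j))\<^sup>2)"
    by (intro sum_mono) simp
  also have "\<dots> = (\<Sum>j<n. \<Sum>i<n. \<Sum>i'<n. w i * w i' * cos (2 * pi * of_int (2 * (int i - int i')) * real j / real n))"
  proof (intro sum.cong refl)
    fix j
    have "(\<Sum>i<n. w i * cos (t i j))\<^sup>2 + (\<Sum>i<n. w i * sin (t i j))\<^sup>2 =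
      (\<Sum>i<n. \<Sum>i'<n. w i * w i' * cos (t i j - t i' j))"
      by (simp add: power2_eq_square sum_product sum.distrib[symmetric] cos_diff algebra_simps)
    moreover have "t i j - t i' j = 2 * pi * of_int (2 * (int i - int i')) * real j / real n" for i i'
      by (simp add: t_def algebra_simps diff_divide_distrib)
    ultimately show "(\<Sum>i<n. w i * cos (t i j))\<^sup>2 + (\<Sum>i<n. w i * sin (t i j))\<^sup>2 =
      (\<Sum>i<n. \<Sum>i'<n. w i * w i' * cos (2 * pi * of_int (2 * (int i - int i')) * real j / real n))"
      by (simp only:)
  qed
  also have "\<dots> = (\<Sum>i<n. \<Sum>i'<n. w i * w i' * (\<Sum>j<n. cos (2 * pi * of_int (2 * (int i - int i')) * real j / real n)))"
    unfolding sum_distrib_left by (subst sum.swap, rule sum.cong[OF refl], rule sum.swap)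
  also have "\<dots> = (\<Sum>i<n. \<Sum>i'<n. if i = i' then real n * (w i)\<^sup>2 else 0)"
  proof (intro sum.cong refl)
    fix i i' assume ii: "i \<in> {..<n}" "i' \<in> {..<n}"
    have "coprime (int n) 2" using n by (metis coprime_right_2_iff_odd even_of_nat_iff)
    then have "int n dvd 2 * (int i - int i') \<longleftrightarrow> int n dvd int i - int i'"
      by (rule coprime_dvd_mult_right_iff)
    also have "\<dots> \<longleftrightarrow> i = i'"
      using ii zdvd_imp_le[of "int n" "\<bar>int i - int i'\<bar>"] by force
    finally show "w i * w i' * (\<Sum>j<n. cos (2 * pi * of_int (2 * (int i - int i')) * real j / real n)) =
        (if i = i' then real n * (w i)\<^sup>2 else 0)"
      unfolding character_sums(1)[OF n0] by (simp add: power2_eq_square)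
  qed
  also have "\<dots> = real n * (\<Sum>i<n. (w i)\<^sup>2)" by (simp add: sum_distrib_left)
  finally have "(\<Sum>j<n. (\<Sum>i<n. w i * sin (t i j))\<^sup>2) / (real n)\<^sup>2 \<le> real n * (\<Sum>i<n. (w i)\<^sup>2) / (real n)\<^sup>2"
    by (intro divide_right_mono) auto
  moreover have "real n * (\<Sum>i<n. (w i)\<^sup>2) / (real n)\<^sup>2 = (\<Sum>i<n. (w i)\<^sup>2) / real n"
    using n0 by (simp add: power2_eq_square)
  ultimately show ?thesis by (simp only: lin power_divide sum_divide_distrib[symmetric])
qed

definition random_rotation :: "nat \<Rightarrow> nat set \<Rightarrow> (nat \<Rightarrow> 'a \<Rightarrow> real) \<Rightarrow> nat \<Rightarrow> 'a \<Rightarrow> real" where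
  "random_rotation n S f m x = (\<Sum>i<n. hartley n m i * sg S i * f i x)"

lemma random_rotation_inverse:
  assumes "n > 0" "j < n"
  shows "f j x = (\<Sum>m<n. hartley n m j * sg S j * random_rotation n S f m x)"
proof -
  have "(\<Sum>m<n. hartley n m j * sg S j * random_rotation n S f m x) =
    (\<Sum>m<n. \<Sum>i<n. sg S j * sg S i * f i x * (hartley n j m * hartley n i m))"
    unfolding random_rotation_def sum_distrib_left by (intro sum.cong refl) (simp add: mult_ac hartley_commute)
  also have "\<dots> = (\<Sum>i<n. sg S j * sg S i * f i x * (\<Sum>m<n. hartley n j m * hartley n i m))"
    unfolding sum_distrib_left by (rule sum.swap)
  also have "\<dots> = (\<Sum>i<n. if j = i then f j x else 0)"
    using assms by (intro sum.cong refl) (auto simp: hartley_orthogonal)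
  finally show ?thesis using assms by simp
qed

lemma random_rotation_sum_squares:
  assumes "n > 0"
  shows "(\<Sum>m<n. (random_rotation n S f m x)\<^sup>2) = (\<Sum>i<n. (f i x)\<^sup>2)"
proof -
  have "(\<Sum>m<n. (random_rotation n S f m x)\<^sup>2) = (\<Sum>m<n. (\<Sum>i<n. (sg S i * f i x) * hartley n i m)\<^sup>2)"
    unfolding random_rotation_def by (simp add: mult_ac hartley_commute)
  also have "\<dots> = (\<Sum>i<n. (f i x)\<^sup>2)"
    by (subst hartley_parseval[OF assms]) (simp add: power_mult_distrib)
  finally show ?thesis .
qed

lemma (in finite_measure) random_rotation_orthonormal:
  assumes n: "n > 0" and on: "orthonormal {..<n} f"
  shows "orthonormal {..<n} (random_rotation n S f)"
  unfolding orthonormal_def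
proof (intro conjI ballI)
  note [simp] = orthonormal_bdd_meas[OF on]
  fix i assume i: "i \<in> {..<n}"
  show "bdd_meas M (random_rotation n S f i)"
    unfolding random_rotation_def[abs_def] by (intro bdd_meas_sum bdd_meas_mult bdd_meas_const) simp
  fix j assume j: "j \<in> {..<n}"
  have "(\<integral>x. random_rotation n S f i x * random_rotation n S f j x \<partial>M) =
     (\<Sum>k<n. hartley n i k * sg S k * (hartley n j k * sg S k))"
    unfolding random_rotation_def by (rule orthonormal_integral_sums[OF on]) simp
  also have "\<dots> = (\<Sum>k<n. hartley n i k * hartley n j k)"
    by (intro sum.cong refl) (simp add: mult_ac)
  finally show "(\<integral>x. random_rotation n S f i x * random_rotation n S f j x \<partial>M) = (if i = j then 1 else 0)"
    using i j n by (simp add: hartley_orthogonal)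
qed

definition lin_equiv :: "nat \<Rightarrow> (nat \<Rightarrow> 'a \<Rightarrow> real) \<Rightarrow> (nat \<Rightarrow> 'a \<Rightarrow> real) \<Rightarrow> bool" where
  "lin_equiv n f f' \<longleftrightarrow> (\<exists>R R'. (\<forall>m<n. \<forall>x. f' m x = (\<Sum>i<n. R m i * f i x)) \<and> (\<forall>m<n. \<forall>x. f m x = (\<Sum>i<n. R' m i * f' i x)))"

lemma lin_equiv_trans:
  assumes "lin_equiv n f f'" "lin_equiv n f' f''"
  shows "lin_equiv n f f''"
proof -
  have comp: "g'' m x = (\<Sum>j<n. (\<Sum>i<n. Q m i * R i j) * g j x)"
    if "\<forall>m<n. \<forall>x. g' m x = (\<Sum>i<n. R m i * g i x)" "\<forall>m<n. \<forall>x. g'' m x = (\<Sum>i<n. Q m i * g' i x)" "m < n"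
    for g g' g'' :: "nat \<Rightarrow> 'a \<Rightarrow> real" and R Q m x
  proof -
    have "g'' m x = (\<Sum>i<n. Q m i * g' i x)" using that by blast
    also have "\<dots> = (\<Sum>i<n. \<Sum>j<n. Q m i * R i j * g j x)"
    proof (rule sum.cong[OF refl])
      fix i assume "i \<in> {..<n}"
      then have "g' i x = (\<Sum>j<n. R i j * g j x)" using that(1) by blast
      then show "Q m i * g' i x = (\<Sum>j<n. Q m i * R i j * g j x)" by (simp add: sum_distrib_left mult.assoc)
    qed
    also have "\<dots> = (\<Sum>j<n. (\<Sum>i<n. Q m i * R i j) * g j x)"
      unfolding sum_distrib_right by (rule sum.swap)
    finally show ?thesis .
  qed
  obtain R R' where 1: "\<forall>m<n. \<forall>x. f' m x = (\<Sum>i<n. R m i * f i x)" "\<forall>m<n. \<forall>x. f m x = (\<Sum>i<n. R' m i * f' i x)"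
    using assms(1) unfolding lin_equiv_def by blast
  obtain Q Q' where 2: "\<forall>m<n. \<forall>x. f'' m x = (\<Sum>i<n. Q m i * f' i x)" "\<forall>m<n. \<forall>x. f' m x = (\<Sum>i<n. Q' m i * f'' i x)"
    using assms(2) unfolding lin_equiv_def by blast
  show ?thesis
    unfolding lin_equiv_def
    by (intro exI[of _ "\<lambda>m j. \<Sum>i<n. Q m i * R i j"] exI[of _ "\<lambda>m j. \<Sum>i<n. R' m i * Q' i j"] conjI allI impI)
      (rule comp[OF 1(1) 2(1)], assumption, rule comp[OF 2(2) 1(2)])
qed

lemma lin_equiv_random_rotation: "n > 0 \<Longrightarrow> lin_equiv n f (random_rotation n S f)"
  unfolding lin_equiv_def
  by (intro exI[of _ "\<lambda>m i. hartley n m i * sg S i"] exI[of _ "\<lambda>j m. hartley n m j * sg S j"] conjI allI impI)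
    (simp add: random_rotation_def, rule random_rotation_inverse)

lemma sign_avg_power_mixed:
  assumes A: "finite A" and s: "s \<ge> 1"
    and u: "\<And>S. S \<subseteq> A \<Longrightarrow> 0 \<le> u S" and v: "\<And>S. S \<subseteq> A \<Longrightarrow> 0 \<le> v S"
    and a: "a > 0" and us: "sign_avg A (\<lambda>S. u S ^ s) \<le> a ^ s" 
    and b: "b > 0" and vs: "sign_avg A (\<lambda>S. v S ^ s) \<le> b ^ s"
  shows "sign_avg A (\<lambda>S. u S ^ (s - 1) * v S) \<le> a ^ (s - 1) * b"
proof -
  have "real s * (sign_avg A (\<lambda>S. u S ^ (s - 1) * v S) / (a ^ (s - 1) * b)) =
     sign_avg A (\<lambda>S. real s * (u S / a) ^ (s - 1) * (v S / b))"
    unfolding sign_avg_cmult[symmetric] sign_avg_divide[symmetric] by (rule sign_avg_cong) (simp add: power_divide)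
  also have "\<dots> \<le> sign_avg A (\<lambda>S. (real s - 1) * (u S / a) ^ s + (v S / b) ^ s)"
    using a b u v by (intro sign_avg_mono power_tangent) auto
  also have "\<dots> = (real s - 1) * (sign_avg A (\<lambda>S. u S ^ s) / a ^ s) + sign_avg A (\<lambda>S. v S ^ s) / b ^ s"
    by (simp only: power_divide sign_avg_add sign_avg_cmult sign_avg_divide)
  also have "\<dots> \<le> (real s - 1) * 1 + 1"
    using s a b us vs by (intro add_mono mult_left_mono) auto
  finally have "real s * (sign_avg A (\<lambda>S. u S ^ (s - 1) * v S) / (a ^ (s - 1) * b)) \<le> real s * 1" by simp
  then have "sign_avg A (\<lambda>S. u S ^ (s - 1) * v S) / (a ^ (s - 1) * b) \<le> 1"
    using s by (subst (asm) mult_le_cancel_left_pos) auto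
  then show ?thesis using a b by (simp add: divide_le_eq)
qed

text \<open>
Minkowski's inequality for integrals. One factor of the power is expanded as an integral, and Hoelder's
inequality (\<open>sign_avg_power_mixed\<close>) then bounds the \<open>s\<close>-th power of the norm \<open>\<alpha>\<close> by
\<open>\<alpha> ^ (s - 1)\<close> times the claimed bound.
\<close>
lemma (in finite_measure) sign_avg_integral_power_le:
  assumes A: "finite A" and s: "s \<ge> 1"
    and h: "\<And>S. S \<subseteq> A \<Longrightarrow> bdd_meas M (h S)" "\<And>S x. S \<subseteq> A \<Longrightarrow> x \<in> space M \<Longrightarrow> h S x \<ge> 0"
    and a: "bdd_meas M a" "\<And>x. x \<in> space M \<Longrightarrow> a x \<ge> 0"
    and le: "\<And>x. x \<in> space M \<Longrightarrow> sign_avg A (\<lambda>S. h S x ^ s) \<le> a x ^ s"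
  shows "sign_avg A (\<lambda>S. (\<integral>x. h S x \<partial>M) ^ s) \<le> (\<integral>x. a x \<partial>M) ^ s"
proof -
  define Y where "Y S = (\<integral>x. h S x \<partial>M)" for S
  have Y: "Y S \<ge> 0" if "S \<subseteq> A" for S
    unfolding Y_def using h(2)[OF that] by (intro integral_nonneg_AE AE_I2)
  have Ia: "(\<integral>x. a x \<partial>M) \<ge> 0" using a(2) by (intro integral_nonneg_AE AE_I2)
  have ge: "sign_avg A (\<lambda>S. Y S ^ s) \<ge> 0" using Y by (intro sign_avg_nonneg) auto
  define \<alpha> where "\<alpha> = root s (sign_avg A (\<lambda>S. Y S ^ s))"
  have \<alpha>s: "\<alpha> ^ s = sign_avg A (\<lambda>S. Y S ^ s)" unfolding \<alpha>_def using ge s by simp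
  have \<alpha>0: "\<alpha> \<ge> 0" unfolding \<alpha>_def using ge by (rule real_root_ge_zero)
  have "\<alpha> \<le> (\<integral>x. a x \<partial>M)"
  proof (cases "\<alpha> = 0")
    case True then show ?thesis using Ia by simp
  next
    case False
    then have \<alpha>: "\<alpha> > 0" using \<alpha>0 by simp
    have main: "\<alpha> \<le> (\<integral>x. a x \<partial>M) + e * measure M (space M)" if e: "e > 0" for e
    proof -
      have "\<alpha> ^ s = sign_avg A (\<lambda>S. \<integral>x. Y S ^ (s - 1) * h S x \<partial>M)"
        unfolding \<alpha>s using s by (intro sign_avg_cong) (cases s, auto simp: Y_def)
      also have "\<dots> = (\<integral>x. sign_avg A (\<lambda>S. Y S ^ (s - 1) * h S x) \<partial>M)"
        by (rule integral_sign_avg[symmetric]) (auto intro: h)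
      also have "\<dots> \<le> (\<integral>x. \<alpha> ^ (s - 1) * (a x + e) \<partial>M)"
      proof (rule bdd_meas_integral_mono)
        fix x assume x: "x \<in> space M"
        show "sign_avg A (\<lambda>S. Y S ^ (s - 1) * h S x) \<le> \<alpha> ^ (s - 1) * (a x + e)"
        proof (rule sign_avg_power_mixed[OF A s Y h(2)[OF _ x] \<alpha>])
          have "a x ^ s \<le> (a x + e) ^ s" using a(2)[OF x] e by (intro power_mono) auto
          then show "sign_avg A (\<lambda>S. h S x ^ s) \<le> (a x + e) ^ s" using le[OF x] by linarith
        qed (use a(2)[OF x] e \<alpha>s in auto)
      qed (auto intro!: bdd_meas_mult bdd_meas_add a h bdd_meas_sign_avg)
      also have "\<dots> = \<alpha> ^ (s - 1) * ((\<integral>x. a x \<partial>M) + e * measure M (space M))"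
        using a by simp
      finally have "\<alpha> ^ (s - 1) * \<alpha> \<le> \<alpha> ^ (s - 1) * ((\<integral>x. a x \<partial>M) + e * measure M (space M))"
        using s by (cases s) (auto simp: mult.commute)
      then show ?thesis using \<alpha> by simp
    qed
    show ?thesis
    proof (rule field_le_epsilon)
      fix e :: real assume e: "e > 0"
      have "e / (1 + measure M (space M)) * measure M (space M) \<le> e"
        using e measure_nonneg[of M "space M"] by (simp add: divide_le_eq add_pos_nonneg algebra_simps)
      moreover have "e / (1 + measure M (space M)) > 0" using e measure_nonneg[of M "space M"] by (simp add: add_pos_nonneg)
      ultimately show "\<alpha> \<le> (\<integral>x. a x \<partial>M) + e" using main[of "e / (1 + measure M (space M))"] by linarith
    qed
  qed
  then have "\<alpha> ^ s \<le> (\<integral>x. a x \<partial>M) ^ s" using \<alpha>0 by (rule power_mono)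
  then show ?thesis unfolding \<alpha>s Y_def .
qed

context finite_measure
begin

lemma random_rotation_moment:
  assumes "n > 0" "s \<ge> 1" and sq: "(\<Sum>i<n. (f i x)\<^sup>2) \<le> real n"
  shows "sign_avg {..<n} (\<lambda>S. random_rotation n S f m x ^ (2 * s)) \<le> ((2 * real s - 1) * 4) ^ s"
proof -
  have "(\<Sum>i<n. (hartley n m i * f i x)\<^sup>2) \<le> (\<Sum>i<n. 4 / real n * (f i x)\<^sup>2)"
    unfolding power_mult_distrib by (intro sum_mono mult_right_mono hartley_square_le) auto
  also have "\<dots> = 4 / real n * (\<Sum>i<n. (f i x)\<^sup>2)" by (simp add: sum_distrib_left)
  also have "\<dots> \<le> 4 / real n * real n" using sq by (intro mult_left_mono) auto
  finally have "(\<Sum>i<n. (hartley n m i * f i x)\<^sup>2) \<le> 4" using assms by simp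
  from sign_avg_linear_moment[OF _ assms(2) this] show ?thesis
    by (simp add: random_rotation_def mult_ac)
qed

lemma random_rotation_fourth:
  assumes n: "n > 0" and on: "orthonormal {..<n} f"
    and sq: "\<And>x. x \<in> space M \<Longrightarrow> (\<Sum>i<n. (f i x)\<^sup>2) \<le> real n"
  shows "sign_avg {..<n} (\<lambda>S. \<Sum>m<n. \<integral>x. random_rotation n S f m x ^ 4 \<partial>M) \<le> 144 * measure M (space M) * real n"
proof -
  note rb [simp] = orthonormal_bdd_meas[OF random_rotation_orthonormal[OF n on]]
  have "sign_avg {..<n} (\<lambda>S. \<Sum>m<n. \<integral>x. random_rotation n S f m x ^ 4 \<partial>M) =
     (\<Sum>m<n. sign_avg {..<n} (\<lambda>S. \<integral>x. random_rotation n S f m x ^ 4 \<partial>M))"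
    by (rule sign_avg_sum)
  also have "\<dots> = (\<Sum>m<n. \<integral>x. sign_avg {..<n} (\<lambda>S. random_rotation n S f m x ^ 4) \<partial>M)"
    by (intro sum.cong refl integral_sign_avg[symmetric]) simp
  also have "\<dots> \<le> (\<Sum>m<n. \<integral>x. 144 \<partial>M)"
  proof (intro sum_mono bdd_meas_integral_mono)
    fix m x assume "x \<in> space M"
    then show "sign_avg {..<n} (\<lambda>S. random_rotation n S f m x ^ 4) \<le> 144"
      using random_rotation_moment[OF n, of 2 f x m] sq by simp
  qed (auto intro!: bdd_meas_sign_avg)
  finally show ?thesis by (simp add: mult_ac)
qed

text \<open>
A weighted sum of squares of the rotated functions is quadratic in the signs, with coefficients
\<open>c k j * f k * f j\<close>. Its mean \<open>D\<close> is small because the weights sum to zero and the squared entries of the Hartley matrix are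
nearly constant (\<open>hartley_square_parseval\<close>). Its variance is at most a multiple of \<open>Q\<close> by the Poincare
inequality. Bounding the integral of \<open>Q\<close> by \<open>1 / n\<close> requires that the \<open>f k\<close> do not
concentrate, which is what the bound on the fourth powers expresses.
\<close>
lemma random_rotation_weighted_squares:
  fixes f :: "nat \<Rightarrow> 'a \<Rightarrow> real"
  assumes n: "odd n" and on: "orthonormal {..<n} f"
    and sq: "\<And>x. x \<in> space M \<Longrightarrow> (\<Sum>i<n. (f i x)\<^sup>2) \<le> real n"
    and four: "(\<Sum>i<n. \<integral>x. (f i x) ^ 4 \<partial>M) \<le> C4 * real n"
    and w0: "(\<Sum>i<n. w i) = 0" and w: "\<And>i. i < n \<Longrightarrow> (w i)\<^sup>2 \<le> 16 / (real n)\<^sup>2"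
  defines "Z \<equiv> \<lambda>S x. \<Sum>i<n. w i * (random_rotation n S f i x)\<^sup>2"
  shows "(\<integral>x. sign_avg {..<n} (\<lambda>S. (Z S x)\<^sup>2) \<partial>M) \<le> (16 + 1024 * C4) / real n"
proof -
  have n0: "n > 0" using n by (simp add: odd_pos)
  note rb [simp] = orthonormal_bdd_meas[OF random_rotation_orthonormal[OF n0 on]] orthonormal_bdd_meas[OF on]
  define c where "c k j = (\<Sum>i<n. w i * hartley n i k * hartley n i j)" for k j
  have c_sum: "(\<Sum>j<n. (c k j)\<^sup>2) \<le> 64 / (real n)\<^sup>2" for k
  proof -
    have "(\<Sum>j<n. (c k j)\<^sup>2) = (\<Sum>i<n. (w i * hartley n i k)\<^sup>2)"
      unfolding c_def by (rule hartley_parseval[OF n0])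
    also have "\<dots> \<le> (\<Sum>i<n. 16 / (real n)\<^sup>2 * (4 / real n))"
      unfolding power_mult_distrib by (intro sum_mono mult_mono w hartley_square_le) auto
    also have "\<dots> = 64 / (real n)\<^sup>2" using n0 by simp
    finally show ?thesis .
  qed
  have c_diag: "(\<Sum>j<n. (c j j)\<^sup>2) \<le> 16 / (real n)\<^sup>2"
  proof -
    have "(\<Sum>j<n. (c j j)\<^sup>2) = (\<Sum>j<n. (\<Sum>i<n. w i * (hartley n i j)\<^sup>2)\<^sup>2)"
      by (simp add: c_def power2_eq_square mult.assoc)
    also have "\<dots> \<le> (\<Sum>i<n. (w i)\<^sup>2) / real n" by (rule hartley_square_parseval[OF n w0])
    also have "\<dots> \<le> (\<Sum>i<n. 16 / (real n)\<^sup>2) / real n" by (intro divide_right_mono sum_mono w) auto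
    also have "\<dots> = 16 / (real n)\<^sup>2" using n0 by simp
    finally show ?thesis .
  qed
  define D where "D x = (\<Sum>j<n. c j j * (f j x)\<^sup>2)" for x
  define Q where "Q x = (\<Sum>k<n. \<Sum>j<n. (c k j)\<^sup>2 * ((f k x)\<^sup>2 * (f j x)\<^sup>2))" for x
  have Db [simp]: "bdd_meas M D" and Qb [simp]: "bdd_meas M Q"
    unfolding D_def Q_def by (intro bdd_meas_sum bdd_meas_mult bdd_meas_const bdd_meas_power; simp)+
  have pt: "sign_avg {..<n} (\<lambda>S. (Z S x)\<^sup>2) \<le> (D x)\<^sup>2 + 16 * Q x" for x
  proof -
    let ?r = "\<lambda>S i. random_rotation n S f i x"
    have mean: "sign_avg {..<n} (\<lambda>S. Z S x) = D x"
    proof -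
      have "sign_avg {..<n} (\<lambda>S. Z S x) = (\<Sum>i<n. w i * sign_avg {..<n} (\<lambda>S. (\<Sum>j<n. (hartley n i j * f j x) * sg S j)\<^sup>2))"
        unfolding Z_def sign_avg_sum sign_avg_cmult random_rotation_def by (simp add: mult_ac)
      also have "\<dots> = (\<Sum>i<n. \<Sum>j<n. w i * (hartley n i j * f j x)\<^sup>2)"
        by (simp add: sign_avg_linear_square sum_distrib_left)
      also have "\<dots> = D x"
        unfolding D_def c_def sum_distrib_right by (subst sum.swap) (simp add: power2_eq_square mult_ac)
      finally show ?thesis .
    qed
    define V where "V k S = (\<Sum>i<n. w i * hartley n i k * ?r S i)" for k S
    have dif: "Z S x - Z (flip k S) x = 4 * sg S k * f k x * V k S - 4 * (f k x)\<^sup>2 * c k k" if k: "k < n" for k S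
    proof -
      have r: "?r (flip k S) i = ?r S i - 2 * sg S k * hartley n i k * f k x" for i
      proof -
        have "?r (flip k S) i = (\<Sum>j<n. hartley n i j * sg S j * f j x - (if j = k then 2 * sg S k * hartley n i k * f k x else 0))"
          unfolding random_rotation_def by (intro sum.cong refl) (simp add: sg_flip)
        then show ?thesis using k by (simp add: random_rotation_def sum_subtractf)
      qed
      have "Z S x - Z (flip k S) x = (\<Sum>i<n. w i * ((?r S i)\<^sup>2 - (?r S i - 2 * sg S k * hartley n i k * f k x)\<^sup>2))"
        unfolding Z_def r by (simp add: sum_subtractf right_diff_distrib)
      also have "\<dots> = (\<Sum>i<n. 4 * sg S k * f k x * (w i * hartley n i k * ?r S i) - 4 * (f k x)\<^sup>2 * (w i * hartley n i k * hartley n i k))"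
      proof (intro sum.cong refl)
        fix i
        have "v * ((a::real)\<^sup>2 - (a - 2 * s * h * y)\<^sup>2) = 4 * s * y * (v * h * a) - 4 * y\<^sup>2 * (v * h * h) * s\<^sup>2" for v a s h y
          by (simp add: power2_eq_square algebra_simps)
        from this[of "w i" "?r S i" "sg S k" "hartley n i k" "f k x"] show "w i * ((?r S i)\<^sup>2 - (?r S i - 2 * sg S k * hartley n i k * f k x)\<^sup>2) =
          4 * sg S k * f k x * (w i * hartley n i k * ?r S i) - 4 * (f k x)\<^sup>2 * (w i * hartley n i k * hartley n i k)"
          by simp
      qed
      also have "\<dots> = 4 * sg S k * f k x * V k S - 4 * (f k x)\<^sup>2 * c k k"
        unfolding V_def c_def sum_distrib_left by (rule sum_subtractf)
      finally show ?thesis .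
    qed
    have V2: "sign_avg {..<n} (\<lambda>S. (V k S)\<^sup>2) = (\<Sum>j<n. (c k j)\<^sup>2 * (f j x)\<^sup>2)" for k
    proof -
      have "V k S = (\<Sum>j<n. (c k j * f j x) * sg S j)" for S
        unfolding V_def random_rotation_def c_def sum_distrib_left sum_distrib_right
        by (subst sum.swap) (simp add: mult_ac)
      then show ?thesis by (simp add: sign_avg_linear_square power_mult_distrib)
    qed
    have "sign_avg {..<n} (\<lambda>S. (Z S x - Z (flip k S) x)\<^sup>2) \<le> 64 * (\<Sum>j<n. (c k j)\<^sup>2 * ((f k x)\<^sup>2 * (f j x)\<^sup>2))" if k: "k < n" for k
    proof -
      have "sign_avg {..<n} (\<lambda>S. (Z S x - Z (flip k S) x)\<^sup>2) \<le> sign_avg {..<n} (\<lambda>S. 32 * (f k x)\<^sup>2 * (V k S)\<^sup>2 + 32 * (f k x)\<^sup>2 * ((c k k)\<^sup>2 * (f k x)\<^sup>2))"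
      proof (rule sign_avg_mono)
        fix S
        have "(Z S x - Z (flip k S) x)\<^sup>2 \<le> 2 * (4 * sg S k * f k x * V k S)\<^sup>2 + 2 * (4 * (f k x)\<^sup>2 * c k k)\<^sup>2"
          unfolding dif[OF k] using sum_squares_bound[of "4 * sg S k * f k x * V k S" "- (4 * (f k x)\<^sup>2 * c k k)"]
          by (simp add: power2_diff)
        then show "(Z S x - Z (flip k S) x)\<^sup>2 \<le> 32 * (f k x)\<^sup>2 * (V k S)\<^sup>2 + 32 * (f k x)\<^sup>2 * ((c k k)\<^sup>2 * (f k x)\<^sup>2)"
          by (simp add: power_mult_distrib power2_eq_square[of "(f k x)\<^sup>2"] mult_ac)
      qed
      also have "\<dots> = 32 * (f k x)\<^sup>2 * ((\<Sum>j<n. (c k j)\<^sup>2 * (f j x)\<^sup>2) + (c k k)\<^sup>2 * (f k x)\<^sup>2)"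
        by (simp only: sign_avg_add sign_avg_cmult sign_avg_const[OF finite_lessThan] V2 distrib_left)
      also have "\<dots> \<le> 32 * (f k x)\<^sup>2 * ((\<Sum>j<n. (c k j)\<^sup>2 * (f j x)\<^sup>2) + (\<Sum>j<n. (c k j)\<^sup>2 * (f j x)\<^sup>2))"
        using k by (intro mult_left_mono add_left_mono member_le_sum[of k "{..<n}" "\<lambda>j. (c k j)\<^sup>2 * (f j x)\<^sup>2"]) auto
      also have "\<dots> = 64 * (\<Sum>j<n. (c k j)\<^sup>2 * ((f k x)\<^sup>2 * (f j x)\<^sup>2))"
        by (simp add: sum_distrib_left mult_ac)
      finally show ?thesis .
    qed
    then have "(\<Sum>k<n. sign_avg {..<n} (\<lambda>S. (Z S x - Z (flip k S) x)\<^sup>2)) \<le> (\<Sum>k<n. 64 * (\<Sum>j<n. (c k j)\<^sup>2 * ((f k x)\<^sup>2 * (f j x)\<^sup>2)))"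
      by (intro sum_mono) auto
    then have "(\<Sum>k<n. sign_avg {..<n} (\<lambda>S. (Z S x - Z (flip k S) x)\<^sup>2)) / 4 \<le> 16 * Q x"
      by (simp add: Q_def sum_distrib_left[symmetric])
    then show ?thesis using sign_avg_poincare[of "{..<n}" "\<lambda>S. Z S x"] by (simp add: mean)
  qed
  have D2: "(\<integral>x. (D x)\<^sup>2 \<partial>M) \<le> 16 / real n"
  proof -
    have "(\<integral>x. (D x)\<^sup>2 \<partial>M) \<le> (\<integral>x. real n * (\<Sum>j<n. (c j j)\<^sup>2 * (f j x)\<^sup>2) \<partial>M)"
    proof (rule bdd_meas_integral_mono)
      fix x assume x: "x \<in> space M"
      have "(D x)\<^sup>2 = (\<Sum>j<n. f j x * (c j j * f j x))\<^sup>2" by (simp add: D_def power2_eq_square mult_ac)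
      also have "\<dots> \<le> (\<Sum>j<n. (f j x)\<^sup>2) * (\<Sum>j<n. (c j j * f j x)\<^sup>2)" by (rule Cauchy_Schwarz_ineq_sum)
      also have "\<dots> \<le> real n * (\<Sum>j<n. (c j j)\<^sup>2 * (f j x)\<^sup>2)"
        unfolding power_mult_distrib using sq[OF x] by (intro mult_right_mono sum_nonneg) auto
      finally show "(D x)\<^sup>2 \<le> real n * (\<Sum>j<n. (c j j)\<^sup>2 * (f j x)\<^sup>2)" .
    qed (auto intro!: bdd_meas_mult bdd_meas_sum)
    also have "\<dots> = real n * (\<Sum>j<n. \<integral>x. (c j j)\<^sup>2 * (f j x)\<^sup>2 \<partial>M)"
      unfolding integral_mult_right_zero by (subst Bochner_Integration.integral_sum) auto
    also have "\<dots> = real n * (\<Sum>j<n. (c j j)\<^sup>2)"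
      using orthonormal_square[OF on] by simp
    also have "\<dots> \<le> real n * (16 / (real n)\<^sup>2)" by (intro mult_left_mono c_diag) auto
    also have "\<dots> = 16 / real n" using n0 by (simp add: power2_eq_square)
    finally show ?thesis .
  qed
  have Q2: "(\<integral>x. Q x \<partial>M) \<le> 64 * C4 / real n"
  proof -
    have "(\<integral>x. Q x \<partial>M) \<le> (\<integral>x. (\<Sum>k<n. \<Sum>j<n. (c k j)\<^sup>2 * (f k x ^ 4)) \<partial>M)"
    proof (rule bdd_meas_integral_mono)
      fix x
      have "Q x \<le> (\<Sum>k<n. \<Sum>j<n. (c k j)\<^sup>2 * (f k x ^ 4) / 2 + (c k j)\<^sup>2 * (f j x ^ 4) / 2)"
        unfolding Q_def
      proof (intro sum_mono)
        fix k j
        have "(f k x)\<^sup>2 * (f j x)\<^sup>2 \<le> (f k x ^ 4) / 2 + (f j x ^ 4) / 2"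
          using sum_squares_bound[of "(f k x)\<^sup>2" "(f j x)\<^sup>2"] by (simp add: power_mult[symmetric])
        from mult_left_mono[OF this, of "(c k j)\<^sup>2"]
        show "(c k j)\<^sup>2 * ((f k x)\<^sup>2 * (f j x)\<^sup>2) \<le> (c k j)\<^sup>2 * (f k x ^ 4) / 2 + (c k j)\<^sup>2 * (f j x ^ 4) / 2"
          by (simp add: distrib_left)
      qed
      also have "\<dots> = (\<Sum>k<n. \<Sum>j<n. (c k j)\<^sup>2 * (f k x ^ 4)) / 2 + (\<Sum>k<n. \<Sum>j<n. (c k j)\<^sup>2 * (f j x ^ 4)) / 2"
        by (simp add: sum.distrib sum_divide_distrib)
      also have "(\<Sum>k<n. \<Sum>j<n. (c k j)\<^sup>2 * (f j x ^ 4)) = (\<Sum>k<n. \<Sum>j<n. (c k j)\<^sup>2 * (f k x ^ 4))"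
      proof -
        have "c k j = c j k" for k j unfolding c_def by (intro sum.cong refl) (simp add: mult_ac)
        then show ?thesis by (subst sum.swap) simp
      qed
      finally show "Q x \<le> (\<Sum>k<n. \<Sum>j<n. (c k j)\<^sup>2 * (f k x ^ 4))" by simp
    qed (auto intro!: bdd_meas_mult bdd_meas_sum)
    also have "\<dots> = (\<Sum>k<n. \<integral>x. (\<Sum>j<n. (c k j)\<^sup>2) * (f k x ^ 4) \<partial>M)"
      unfolding sum_distrib_right[symmetric] by (rule Bochner_Integration.integral_sum) simp
    also have "\<dots> \<le> (\<Sum>k<n. 64 / (real n)\<^sup>2 * (\<integral>x. f k x ^ 4 \<partial>M))"
      unfolding integral_mult_right_zero
      by (intro sum_mono mult_right_mono c_sum integral_nonneg_AE AE_I2) simp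
    also have "\<dots> \<le> 64 / (real n)\<^sup>2 * (C4 * real n)"
      unfolding sum_distrib_left[symmetric] by (intro mult_left_mono four) auto
    also have "\<dots> = 64 * C4 / real n" using n0 by (simp add: power2_eq_square)
    finally show ?thesis .
  qed
  have Zb [simp]: "bdd_meas M (Z S)" for S unfolding Z_def by (intro bdd_meas_sum bdd_meas_mult bdd_meas_const bdd_meas_power) simp
  have "(\<integral>x. sign_avg {..<n} (\<lambda>S. (Z S x)\<^sup>2) \<partial>M) \<le> (\<integral>x. (D x)\<^sup>2 + 16 * Q x \<partial>M)"
    by (rule bdd_meas_integral_mono) (auto intro!: bdd_meas_sign_avg bdd_meas_power bdd_meas_add bdd_meas_mult pt)
  also have "\<dots> = (\<integral>x. (D x)\<^sup>2 \<partial>M) + 16 * (\<integral>x. Q x \<partial>M)" by simp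
  also have "\<dots> \<le> 16 / real n + 16 * (64 * C4 / real n)" using D2 Q2 by (intro add_mono) auto
  also have "\<dots> = (16 + 1024 * C4) / real n" by (simp add: add_divide_distrib)
  finally show ?thesis .
qed

end

section \<open>Flat bases of a block\<close>

lemma finite_sign_avg_le_one_selection:
  assumes "finite A" "sign_avg A G \<le> 1" shows "\<exists>S\<subseteq>A. G S \<le> 1"
  using sign_avg_ex_le[OF assms(1), of G] assms(2) by (meson order_trans)

lemma hartley_product_sum_zero:
  assumes "n > 0" "m < n" "m' < n" "m \<noteq> m'"
  shows "(\<Sum>i<n. hartley n m i * hartley n m' i) = 0"
  using hartley_orthogonal[of n m m'] assms by simp

context finite_measure
begin

lemma random_rotation_weighted_squares_moment:
  fixes f :: "nat \<Rightarrow> 'a \<Rightarrow> real"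
  assumes n: "odd n" and on: "orthonormal {..<n} f"
    and sq: "\<And>x. x \<in> space M \<Longrightarrow> (\<Sum>i<n. (f i x)\<^sup>2) \<le> real n"
    and four: "(\<Sum>i<n. \<integral>x. (f i x) ^ 4 \<partial>M) \<le> C4 * real n"
    and w0: "(\<Sum>i<n. w i) = 0" and w: "\<And>i. i < n \<Longrightarrow> (w i)\<^sup>2 \<le> 16 / (real n)\<^sup>2"
    and s: "s \<ge> 1"
  defines "Z \<equiv> \<lambda>S x. \<Sum>i<n. w i * (random_rotation n S f i x)\<^sup>2"
  shows "sign_avg {..<n} (\<lambda>S. (\<integral>x. (Z S x)\<^sup>2 \<partial>M) ^ s) \<le> (4 * (real s)\<^sup>2 * ((16 + 1024 * C4) / real n)) ^ s"
proof -
  have n0: "n > 0" using n by (simp add: odd_pos)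
  note rb [simp] = orthonormal_bdd_meas[OF random_rotation_orthonormal[OF n0 on]] orthonormal_bdd_meas[OF on]
  have Zb [simp]: "bdd_meas M (Z S)" for S unfolding Z_def by (intro bdd_meas_sum bdd_meas_mult bdd_meas_const bdd_meas_power) simp
  have ch: "chaos {..<n} 2 (\<lambda>S. Z S x)" for x
  proof -
    have "chaos {..<n} (Suc 0) (\<lambda>S. random_rotation n S f i x)" for i
      using chaos_linear[of "{..<n}" "\<lambda>j. hartley n i j * f j x"] by (simp add: random_rotation_def mult_ac)
    then have "chaos {..<n} (Suc (Suc 0)) (\<lambda>S. \<Sum>j<n. (hartley n i j * f j x) * (sg S j * random_rotation n S f i x))" for i
      by (intro chaos_sum chaos_cmult chaos.chaos_sg) auto
    moreover have "(\<Sum>j<n. (hartley n i j * f j x) * (sg S j * random_rotation n S f i x)) = (random_rotation n S f i x)\<^sup>2" for i S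
      unfolding power2_eq_square by (subst (2) random_rotation_def) (simp add: sum_distrib_left mult_ac)
    ultimately have "chaos {..<n} 2 (\<lambda>S. (random_rotation n S f i x)\<^sup>2)" for i
      by (simp add: numeral_2_eq_2)
    then show ?thesis unfolding Z_def by (intro chaos_sum chaos_cmult)
  qed
  define a where "a x = (2 * real s - 1)\<^sup>2 * sign_avg {..<n} (\<lambda>S. (Z S x)\<^sup>2)" for x
  have "sign_avg {..<n} (\<lambda>S. (\<integral>x. (Z S x)\<^sup>2 \<partial>M) ^ s) \<le> (\<integral>x. a x \<partial>M) ^ s"
  proof (rule sign_avg_integral_power_le[OF _ s])
    fix x
    show "sign_avg {..<n} (\<lambda>S. ((Z S x)\<^sup>2) ^ s) \<le> a x ^ s"
      using chaos_hypercontractive[OF _ ch s, of x] by (simp add: a_def power_mult_distrib power_mult)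
  qed (auto simp: a_def intro!: bdd_meas_mult bdd_meas_sign_avg sign_avg_nonneg mult_nonneg_nonneg)
  also have "\<dots> \<le> (4 * (real s)\<^sup>2 * ((16 + 1024 * C4) / real n)) ^ s"
  proof (rule power_mono)
    have "(\<integral>x. a x \<partial>M) = (2 * real s - 1)\<^sup>2 * (\<integral>x. sign_avg {..<n} (\<lambda>S. (Z S x)\<^sup>2) \<partial>M)" by (simp add: a_def)
    also have "\<dots> \<le> (2 * real s)\<^sup>2 * ((16 + 1024 * C4) / real n)"
    proof (rule mult_mono)
      show "(2 * real s - 1)\<^sup>2 \<le> (2 * real s)\<^sup>2" using s by (intro power_mono) auto
      show "(\<integral>x. sign_avg {..<n} (\<lambda>S. (Z S x)\<^sup>2) \<partial>M) \<le> (16 + 1024 * C4) / real n"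
        unfolding Z_def by (rule random_rotation_weighted_squares[OF n on sq four w0 w])
    qed (auto intro!: integral_nonneg_AE AE_I2 sign_avg_nonneg)
    finally show "(\<integral>x. a x \<partial>M) \<le> 4 * (real s)\<^sup>2 * ((16 + 1024 * C4) / real n)" by (simp add: power_mult_distrib)
    show "0 \<le> (\<integral>x. a x \<partial>M)" unfolding a_def by (intro integral_nonneg_AE AE_I2 mult_nonneg_nonneg sign_avg_nonneg) auto
  qed
  finally show ?thesis .
qed

text \<open>
For an orthonormal system \<open>f\<close>, the product \<open>e m * e m'\<close> of two randomly rotated functions has the
mean \<open>\<Sum>i. H m i * H m' i * (f i)\<^sup>2\<close> over the signs. Flatness says that these means are small in \<open>L\<^sup>2\<close>.
\<close>
definition pair_flat :: "nat \<Rightarrow> real \<Rightarrow> (nat \<Rightarrow> 'a \<Rightarrow> real) \<Rightarrow> bool" where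
  "pair_flat n Y f \<longleftrightarrow> (\<forall>m<n. \<forall>m'<n. m \<noteq> m' \<longrightarrow>
     (\<integral>x. (\<Sum>i<n. hartley n m i * hartley n m' i * (f i x)\<^sup>2)\<^sup>2 \<partial>M) \<le> Y)"

text \<open>
Two random rotations are applied in succession. The first one bounds the integrals of the fourth powers on average over the block. This
bound is the hypothesis under which the second rotation produces a pair-flat system. There are fewer than
\<open>n\<^sup>2\<close> pairs, so moments of order \<open>s \<approx> ln n\<close> suffice for the union bound, and they cost the factor
\<open>(1 + ln n)\<^sup>2\<close>.
\<close>
lemma good_block_basis:
  "\<exists>T>0. \<forall>n f. odd n \<longrightarrow> orthonormal {..<n} f \<longrightarrow> (\<forall>x\<in>space M. (\<Sum>i<n. (f i x)\<^sup>2) \<le> real n) \<longrightarrow>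
    (\<exists>f'. orthonormal {..<n} f' \<and> (\<forall>x. (\<Sum>i<n. (f' i x)\<^sup>2) = (\<Sum>i<n. (f i x)\<^sup>2)) \<and> lin_equiv n f f' \<and>
      (\<Sum>i<n. \<integral>x. (f' i x) ^ 4 \<partial>M) \<le> T * real n \<and> pair_flat n (T * (1 + ln (real n))\<^sup>2 / real n) f')"
proof -
  define \<nu> where "\<nu> = 1 + measure M (space M)"
  have \<nu>: "\<nu> \<ge> 1" "measure M (space M) \<le> \<nu>" by (auto simp: \<nu>_def)
  define a0 where "a0 = 16 + 1024 * (144 * \<nu>)"
  have a0: "a0 > 0" using \<nu> by (simp add: a0_def add_pos_pos)
  define T where "T = 288 * \<nu> + 36 * a0 * exp 3"
  have T: "T > 0" "288 * \<nu> \<le> T" "36 * a0 * exp 3 \<le> T" using \<nu> a0 by (auto simp: T_def add_pos_pos)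
  show ?thesis
  proof (rule exI[of _ T], intro conjI allI impI T(1))
    fix n and f :: "nat \<Rightarrow> 'a \<Rightarrow> real"
    assume n: "odd n" and on: "orthonormal {..<n} f" and "\<forall>x\<in>space M. (\<Sum>i<n. (f i x)\<^sup>2) \<le> real n"
    then have sq: "\<And>x. x \<in> space M \<Longrightarrow> (\<Sum>i<n. (f i x)\<^sup>2) \<le> real n" by blast
    have n0: "n > 0" using n by (simp add: odd_pos)
    obtain S1 where S1: "(\<Sum>m<n. \<integral>x. random_rotation n S1 f m x ^ 4 \<partial>M) \<le> 144 * measure M (space M) * real n"
      using sign_avg_ex_le[OF finite_lessThan, of n "\<lambda>S. \<Sum>m<n. \<integral>x. random_rotation n S f m x ^ 4 \<partial>M"]
        random_rotation_fourth[OF n0 on sq] order_trans by blast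
    define h where "h = random_rotation n S1 f"
    have h_on: "orthonormal {..<n} h" unfolding h_def by (rule random_rotation_orthonormal[OF n0 on])
    have h_sq: "(\<Sum>i<n. (h i x)\<^sup>2) = (\<Sum>i<n. (f i x)\<^sup>2)" for x
      unfolding h_def by (rule random_rotation_sum_squares[OF n0])
    have h_le: "\<And>x. x \<in> space M \<Longrightarrow> (\<Sum>i<n. (h i x)\<^sup>2) \<le> real n" using sq h_sq by simp
    have h4: "(\<Sum>i<n. \<integral>x. (h i x) ^ 4 \<partial>M) \<le> (144 * \<nu>) * real n"
    proof -
      have "144 * measure M (space M) * real n \<le> 144 * \<nu> * real n"
        using \<nu> by (intro mult_right_mono) auto
      then show ?thesis using S1 unfolding h_def by linarith
    qed
    \<comment> \<open>With this order of the moments the factor \<open>exp 3\<close> in \<open>\<tau>\<close> beats the number of pairs.\<close>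
    define s where "s = nat \<lceil>ln (real n + 1)\<rceil> + 1"
    have ln0: "ln (real n) \<ge> 0" using n0 by simp
    have s1: "s \<ge> 1" by (simp add: s_def)
    have s_ge: "ln (real n + 1) \<le> real s" unfolding s_def by linarith
    have s_le: "real s \<le> 3 * (1 + ln (real n))"
    proof -
      have "ln (real n + 1) \<ge> 0" by simp
      then have "real s \<le> ln (real n + 1) + 2" unfolding s_def by linarith
      also have "ln (real n + 1) \<le> ln (2 * real n)" using n0 by (subst ln_le_cancel_iff) auto
      also have "\<dots> = ln 2 + ln (real n)" using n0 by (subst ln_mult) auto
      finally have "real s \<le> ln 2 + ln (real n) + 2" by simp
      also have "\<dots> \<le> 1 + ln (real n) + 2" using ln_2_less_1 by (intro add_right_mono) simp
      also have "\<dots> \<le> 3 * (1 + ln (real n))" using ln0 by (simp add: algebra_simps)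
      finally show ?thesis .
    qed
    define \<tau> where "\<tau> = exp 3 * (4 * (real s)\<^sup>2 * (a0 / real n))"
    have \<tau>: "\<tau> > 0" unfolding \<tau>_def using a0 n0 s1 by (intro mult_pos_pos) auto
    define Y where "Y S m m' = (\<integral>x. (\<Sum>i<n. hartley n m i * hartley n m' i * (random_rotation n S h i x)\<^sup>2)\<^sup>2 \<partial>M)" for S m m'
    have Y0: "Y S m m' \<ge> 0" for S m m' unfolding Y_def by simp
    define F where "F S = (\<Sum>m<n. \<integral>x. random_rotation n S h m x ^ 4 \<partial>M)" for S
    have F0: "F S \<ge> 0" for S unfolding F_def by (intro sum_nonneg integral_nonneg_AE AE_I2) simp
    define I where "I = {(m, m'). m < n \<and> m' < n \<and> m \<noteq> m'}"
    have I: "I \<subseteq> {..<n} \<times> {..<n}" by (auto simp: I_def)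
    then have finI: "finite I" by (rule finite_subset) simp
    have cardI: "real (card I) \<le> (real n)\<^sup>2"
    proof -
      have "card I \<le> card ({..<n} \<times> {..<n})" using I by (intro card_mono) auto
      then have "card I \<le> n * n" by simp
      then show ?thesis by (metis of_nat_le_iff of_nat_mult power2_eq_square)
    qed
    define G where "G S = F S / (288 * \<nu> * real n) + (\<Sum>(m, m')\<in>I. (Y S m m' / \<tau>) ^ s)" for S
    have avgF: "sign_avg {..<n} F / (288 * \<nu> * real n) \<le> 1 / 2"
    proof -
      have "sign_avg {..<n} F \<le> 144 * measure M (space M) * real n"
        unfolding F_def by (rule random_rotation_fourth[OF n0 h_on h_le])
      also have "\<dots> \<le> 144 * \<nu> * real n" using \<nu> by (intro mult_right_mono) auto
      finally show ?thesis using \<nu> n0 by (simp add: divide_le_eq)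
    qed
    have avgY: "sign_avg {..<n} (\<lambda>S. (Y S m m' / \<tau>) ^ s) \<le> 1 / (real n + 1) ^ 3" if "(m, m') \<in> I" for m m'
    proof -
      have mm: "m < n" "m' < n" "m \<noteq> m'" using that by (auto simp: I_def)
      have "sign_avg {..<n} (\<lambda>S. Y S m m' ^ s) \<le> (4 * (real s)\<^sup>2 * ((16 + 1024 * (144 * \<nu>)) / real n)) ^ s"
        unfolding Y_def
      proof (rule random_rotation_weighted_squares_moment[OF n h_on h_le h4 _ _ s1])
        show "(\<Sum>i<n. hartley n m i * hartley n m' i) = 0"
          by (rule hartley_product_sum_zero[OF n0 mm])
        fix i
        have "(hartley n m i * hartley n m' i)\<^sup>2 \<le> (4 / real n) * (4 / real n)"
          unfolding power_mult_distrib by (intro mult_mono hartley_square_le) auto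
        then show "(hartley n m i * hartley n m' i)\<^sup>2 \<le> 16 / (real n)\<^sup>2" by (simp add: power2_eq_square)
      qed
      then have "sign_avg {..<n} (\<lambda>S. Y S m m' ^ s) \<le> (\<tau> / exp 3) ^ s" by (simp add: \<tau>_def a0_def)
      then have "sign_avg {..<n} (\<lambda>S. (Y S m m' / \<tau>) ^ s) \<le> (\<tau> / exp 3) ^ s / \<tau> ^ s"
        unfolding power_divide[of "Y _ _ _"] sign_avg_divide using \<tau> by (intro divide_right_mono) auto
      also have "\<dots> = exp (- (3 * real s))"
      proof -
        have "exp 3 ^ s = exp (3 * real s)" by (simp add: exp_of_nat_mult mult.commute)
        then show ?thesis using \<tau> unfolding exp_minus power_divide by (simp add: divide_inverse)
      qed
      also have "\<dots> \<le> exp (- (3 * ln (real n + 1)))" using s_ge by simp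
      also have "\<dots> = 1 / (real n + 1) ^ 3"
      proof -
        have "exp (3 * ln (real n + 1)) = (real n + 1) ^ 3"
          by (metis exp_ln exp_of_nat_mult of_nat_numeral of_nat_0_le_iff add_nonneg_pos zero_less_one)
        then show ?thesis by (simp add: exp_minus divide_inverse)
      qed
      finally show ?thesis .
    qed
    have "sign_avg {..<n} G = sign_avg {..<n} F / (288 * \<nu> * real n) + (\<Sum>(m, m')\<in>I. sign_avg {..<n} (\<lambda>S. (Y S m m' / \<tau>) ^ s))"
      unfolding G_def by (simp add: sign_avg_add sign_avg_divide sign_avg_sum case_prod_beta')
    also have "\<dots> \<le> 1 / 2 + (\<Sum>(m, m')\<in>I. 1 / (real n + 1) ^ 3)"
      using avgY by (intro add_mono avgF sum_mono) auto
    also have "(\<Sum>(m, m')\<in>I. 1 / (real n + 1) ^ 3) = real (card I) * (1 / (real n + 1) ^ 3)" by (simp add: case_prod_beta')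
    also have "\<dots> \<le> (real n)\<^sup>2 * (1 / (real n + 1) ^ 3)" by (intro mult_right_mono cardI) auto
    also have "\<dots> \<le> 1 / 2"
    proof -
      have "2 * (real n)\<^sup>2 \<le> (real n + 1) ^ 3" by (simp add: power2_eq_square power3_eq_cube algebra_simps)
      then show ?thesis by (simp add: field_simps)
    qed
    finally have "sign_avg {..<n} G \<le> 1" by simp
    then obtain S where S: "G S \<le> 1" using finite_sign_avg_le_one_selection[of "{..<n}" G] by blast
    have nn: "(\<Sum>(m, m')\<in>I. (Y S m m' / \<tau>) ^ s) \<ge> 0"
      using Y0 \<tau> by (intro sum_nonneg) (auto simp: case_prod_beta')
    define f' where "f' = random_rotation n S h"
    show "\<exists>f'. orthonormal {..<n} f' \<and> (\<forall>x. (\<Sum>i<n. (f' i x)\<^sup>2) = (\<Sum>i<n. (f i x)\<^sup>2)) \<and> lin_equiv n f f' \<and>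
      (\<Sum>i<n. \<integral>x. (f' i x) ^ 4 \<partial>M) \<le> T * real n \<and> pair_flat n (T * (1 + ln (real n))\<^sup>2 / real n) f'"
    proof (intro exI[of _ f'] conjI allI)
      show "orthonormal {..<n} f'" unfolding f'_def by (rule random_rotation_orthonormal[OF n0 h_on])
      show "(\<Sum>i<n. (f' i x)\<^sup>2) = (\<Sum>i<n. (f i x)\<^sup>2)" for x
        unfolding f'_def by (simp add: random_rotation_sum_squares[OF n0] h_sq)
      show "lin_equiv n f f'"
        unfolding f'_def h_def by (intro lin_equiv_trans[OF lin_equiv_random_rotation lin_equiv_random_rotation] n0)
      have "F S / (288 * \<nu> * real n) \<le> 1" using S nn unfolding G_def by linarith
      then have "F S \<le> 288 * \<nu> * real n" using \<nu> n0 by (simp add: divide_le_eq)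
      also have "\<dots> \<le> T * real n" using T by (intro mult_right_mono) auto
      finally show "(\<Sum>i<n. \<integral>x. (f' i x) ^ 4 \<partial>M) \<le> T * real n" by (simp add: F_def f'_def)
      show "pair_flat n (T * (1 + ln (real n))\<^sup>2 / real n) f'"
        unfolding pair_flat_def
      proof (intro allI impI)
        fix m m' assume mm: "m < n" "m' < n" "m \<noteq> m'"
        then have mI: "(m, m') \<in> I" by (simp add: I_def)
        have "(case (m, m') of (m, m') \<Rightarrow> (Y S m m' / \<tau>) ^ s) \<le> (\<Sum>(m, m')\<in>I. (Y S m m' / \<tau>) ^ s)"
          using Y0 \<tau> by (intro member_le_sum mI finI) (auto simp: case_prod_beta')
        also have "\<dots> \<le> 1" using S F0[of S] \<nu> unfolding G_def
          by (smt (verit) divide_nonneg_nonneg mult_nonneg_nonneg of_nat_0_le_iff)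
        finally have "(Y S m m' / \<tau>) ^ s \<le> 1" by simp
        then have "Y S m m' / \<tau> \<le> 1"
          using s1 Y0 \<tau> by (subst (asm) power_le_one_iff) auto
        then have "Y S m m' \<le> \<tau>" using \<tau> by (simp add: divide_le_eq)
        also have "\<tau> \<le> exp 3 * (4 * (3 * (1 + ln (real n)))\<^sup>2 * (a0 / real n))"
          unfolding \<tau>_def using s_le a0 by (intro mult_left_mono mult_right_mono power_mono) auto
        also have "\<dots> = (36 * a0 * exp 3) * ((1 + ln (real n))\<^sup>2 / real n)"
          by (simp only: power_mult_distrib) simp
        also have "\<dots> \<le> T * ((1 + ln (real n))\<^sup>2 / real n)" using T by (intro mult_right_mono) auto
        finally show "(\<integral>x. (\<Sum>i<n. hartley n m i * hartley n m' i * (f' i x)\<^sup>2)\<^sup>2 \<partial>M) \<le> T * (1 + ln (real n))\<^sup>2 / real n"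
          by (simp add: Y_def f'_def)
      qed
    qed
  qed
qed

end

section \<open>Enumeration by blocks\<close>

text \<open>
The functions of all degrees are enumerated by natural numbers, degree \<open>l\<close> occupying the \<open>2 * l + 1\<close> numbers
from \<open>l\<^sup>2\<close> to \<open>(l + 1)\<^sup>2 - 1\<close>. The degree of the \<open>k\<close>-th function is therefore the integer part of \<open>sqrt k\<close>.
\<close>
definition level :: "nat \<Rightarrow> nat" where "level k = nat \<lfloor>sqrt (real k)\<rfloor>"

definition block :: "nat \<Rightarrow> nat set" where "block l = {l\<^sup>2..<(l + 1)\<^sup>2}"

lemma level_eq_iff: "level k = l \<longleftrightarrow> k \<in> block l"
proof
  assume "k \<in> block l"
  then have "l\<^sup>2 \<le> k" "k < (l + 1)\<^sup>2" by (auto simp: block_def)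
  then have "(real l)\<^sup>2 \<le> real k" "real k < (real l + 1)\<^sup>2"
    by (metis of_nat_le_iff of_nat_power, metis of_nat_1 of_nat_add of_nat_less_iff of_nat_power)
  then have "real l \<le> sqrt (real k)" "sqrt (real k) < real l + 1"
    by (auto intro: real_le_rsqrt real_less_lsqrt)
  then have "\<lfloor>sqrt (real k)\<rfloor> = int l" by linarith
  then show "level k = l" by (simp add: level_def)
next
  assume l: "level k = l"
  have "\<lfloor>sqrt (real k)\<rfloor> = int l" using l by (auto simp: level_def)
  then have "real l \<le> sqrt (real k)" "sqrt (real k) < real l + 1" by linarith+
  then have "(real l)\<^sup>2 \<le> (sqrt (real k))\<^sup>2" "(sqrt (real k))\<^sup>2 < (real l + 1)\<^sup>2"
    by (intro power_mono power_strict_mono; simp)+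
  then have "(real l)\<^sup>2 \<le> real k" "real k < (real l + 1)\<^sup>2" by simp_all
  then have "l\<^sup>2 \<le> k" "k < (l + 1)\<^sup>2"
    by (metis of_nat_le_iff of_nat_power, metis of_nat_1 of_nat_add of_nat_less_iff of_nat_power)
  then show "k \<in> block l" by (simp add: block_def)
qed

lemma level_block [simp]: "k \<in> block (level k)" using level_eq_iff by blast

lemma finite_block [simp]: "finite (block l)" by (simp add: block_def)

lemma block_eq: "block l = (\<lambda>i. l\<^sup>2 + i) ` {..<2 * l + 1}"
proof -
  have "(l + 1)\<^sup>2 = l\<^sup>2 + (2 * l + 1)" by (simp add: power2_eq_square)
  then show ?thesis unfolding block_def lessThan_atLeast0
    by (metis add.commute add_0 image_add_atLeastLessThan)
qed

lemma sum_block: "(\<Sum>i\<in>block l. h i) = (\<Sum>i<2 * l + 1. h (l\<^sup>2 + i))"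
  unfolding block_eq by (subst sum.reindex) auto

lemma less_square_level: "k < (L + 1)\<^sup>2 \<longleftrightarrow> level k \<le> L"
proof
  assume "k < (L + 1)\<^sup>2"
  moreover have "(level k)\<^sup>2 \<le> k" using level_block[of k] by (simp add: block_def)
  ultimately have "(level k)\<^sup>2 < (L + 1)\<^sup>2" by linarith
  then have "level k < L + 1" by (rule power_less_imp_less_base) simp
  then show "level k \<le> L" by simp
next
  assume "level k \<le> L"
  then have "(level k + 1)\<^sup>2 \<le> (L + 1)\<^sup>2" by (intro power_mono) auto
  moreover have "k < (level k + 1)\<^sup>2" using level_block[of k] by (simp add: block_def)
  ultimately show "k < (L + 1)\<^sup>2" by linarith
qed

lemma block_subset: "l \<le> L \<Longrightarrow> block l \<subseteq> {..<(L + 1)\<^sup>2}"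
  by (rule subsetI) (simp only: level_eq_iff[symmetric] lessThan_iff less_square_level)

lemma sum_square_blocks:
  "(\<Sum>k<(L + 1)\<^sup>2. h k) = (\<Sum>l\<le>L. \<Sum>k\<in>block l. (h k :: real))"
proof -
  have "(\<Sum>k<(L + 1)\<^sup>2. h k) = (\<Sum>l\<le>L. sum h {k \<in> {..<(L + 1)\<^sup>2}. level k = l})"
    by (rule sum.group[symmetric]) (use less_square_level in auto)
  also have "\<dots> = (\<Sum>l\<le>L. \<Sum>k\<in>block l. h k)"
  proof (intro sum.cong refl)
    fix l assume "l \<in> {..L}"
    then show "{k \<in> {..<(L + 1)\<^sup>2}. level k = l} = block l"
      using block_subset[of l L] by (auto simp: level_eq_iff)
  qed
  finally show ?thesis .
qed

lemma level_add: "i < 2 * l + 1 \<Longrightarrow> level (l\<^sup>2 + i) = l"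
  by (simp add: level_eq_iff block_eq)

lemma (in finite_measure) orthonormal_blockI:
  assumes on: "orthonormal UNIV f"
    and lin: "\<And>k x. G k x = (\<Sum>i\<in>block (level k). R k i * f i x)"
    and blk: "\<And>l. orthonormal (block l) G"
  shows "orthonormal UNIV G"
  unfolding orthonormal_def
proof (intro conjI ballI)
  fix k show "bdd_meas M (G k)" using blk[of "level k"] by (auto simp: orthonormal_def)
  fix k' show "(\<integral>x. G k x * G k' x \<partial>M) = (if k = k' then 1 else 0)"
  proof (cases "level k = level k'")
    case True
    then have "k' \<in> block (level k)" by (simp add: level_eq_iff[symmetric])
    then show ?thesis using blk[of "level k"] by (auto simp: orthonormal_def)
  next
    case False
    define B where "B = block (level k) \<union> block (level k')"
    have disj: "i \<notin> block (level k')" if "i \<in> block (level k)" for i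
      using that False by (simp add: level_eq_iff[symmetric])
    have 1: "G k x = (\<Sum>i\<in>B. (if i \<in> block (level k) then R k i else 0) * f i x)" for x
      unfolding lin by (rule sum.mono_neutral_cong_left) (auto simp: B_def)
    have 2: "G k' x = (\<Sum>i\<in>B. (if i \<in> block (level k') then R k' i else 0) * f i x)" for x
      unfolding lin by (rule sum.mono_neutral_cong_left) (auto simp: B_def)
    have "(\<integral>x. G k x * G k' x \<partial>M) = (\<Sum>i\<in>B. (if i \<in> block (level k) then R k i else 0) * (if i \<in> block (level k') then R k' i else 0))"
      unfolding 1 2 by (rule orthonormal_integral_sums[OF orthonormal_subset[OF on]]) (auto simp: B_def)
    also have "\<dots> = 0" using disj by (intro sum.neutral) auto
    finally show ?thesis using False by auto
  qed
qed

text \<open>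
Compactness of the space of sign choices. The set \<open>R\<close> is built one element at a time, keeping at each step infinitely
many members of the sequence in agreement with it.
\<close>
lemma sets_cluster_point:
  fixes S :: "nat \<Rightarrow> nat set"
  shows "\<exists>R. \<forall>N. \<exists>L\<ge>N. S L \<inter> {..<N} = R \<inter> {..<N}"
proof -
  let ?P = "\<lambda>N R. R \<subseteq> {..<N} \<and> infinite {L. S L \<inter> {..<N} = R}"
  have step: "\<exists>R'. ?P (Suc N) R' \<and> R' \<inter> {..<N} = R" if "?P N R" for N R
  proof -
    have "{L. S L \<inter> {..<N} = R} \<subseteq> {L. S L \<inter> {..<Suc N} = R} \<union> {L. S L \<inter> {..<Suc N} = insert N R}"
      by (auto simp: less_Suc_eq)
    then have "infinite {L. S L \<inter> {..<Suc N} = R} \<or> infinite {L. S L \<inter> {..<Suc N} = insert N R}"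
      using that by (meson finite_UnI finite_subset)
    then show ?thesis
    proof
      assume "infinite {L. S L \<inter> {..<Suc N} = R}"
      then show ?thesis using that by (intro exI[of _ R]) auto
    next
      assume "infinite {L. S L \<inter> {..<Suc N} = insert N R}"
      then show ?thesis using that by (intro exI[of _ "insert N R"]) auto
    qed
  qed
  have "\<exists>R. \<forall>N. ?P N (R N) \<and> R (Suc N) \<inter> {..<N} = R N"
    by (rule dependent_nat_choice) (use step in auto)
  then obtain R where R: "\<And>N. ?P N (R N)" "\<And>N. R (Suc N) \<inter> {..<N} = R N" by blast
  define Q where "Q = {i. i \<in> R (Suc i)}"
  have "Q \<inter> {..<N} = R N" for N
  proof (induction N)
    case 0 then show ?case using R(1)[of 0] by auto
  next
    case (Suc N)
    have "Q \<inter> {..<Suc N} = (Q \<inter> {..<N}) \<union> (Q \<inter> {N})" by auto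
    also have "\<dots> = (R (Suc N) \<inter> {..<N}) \<union> (R (Suc N) \<inter> {N})"
      using Suc R(2)[of N] by (auto simp: Q_def)
    also have "\<dots> = R (Suc N)" using R(1)[of "Suc N"] by auto
    finally show ?case .
  qed
  then show ?thesis
    using R(1) by (metis (mono_tags, lifting) infinite_nat_iff_unbounded_le mem_Collect_eq)
qed

section \<open>Moments of the randomly rotated basis\<close>

lemma prod_le_sum_power:
  fixes a :: "'b \<Rightarrow> real"
  assumes "finite J" "J \<noteq> {}" "\<And>j. j \<in> J \<Longrightarrow> a j \<ge> 0"
  shows "(\<Prod>j\<in>J. a j) \<le> (\<Sum>j\<in>J. a j ^ card J)"
proof -
  obtain m where m: "m \<in> J" "\<And>j. j \<in> J \<Longrightarrow> a j \<le> a m"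
    using finite_imageI[OF assms(1), of a] assms(2) Max_in[of "a ` J"] Max_ge[of "a ` J"] by fastforce
  have "(\<Prod>j\<in>J. a j) \<le> (\<Prod>j\<in>J. a m)" using m assms by (intro prod_mono) auto
  also have "\<dots> = a m ^ card J" by simp
  also have "\<dots> \<le> (\<Sum>j\<in>J. a j ^ card J)" using m assms by (intro member_le_sum) auto
  finally show ?thesis .
qed

lemma one_plus_power_le:
  fixes a :: real assumes "a \<ge> 0" shows "(1 + a) ^ k \<le> 2 ^ k * (1 + a ^ k)"
proof -
  have "(1 + a) ^ k \<le> (2 * max 1 a) ^ k" using assms by (intro power_mono) auto
  also have "\<dots> = 2 ^ k * max 1 a ^ k" by (rule power_mult_distrib)
  also have "max 1 a ^ k \<le> 1 + a ^ k" using assms by (auto simp: max_def)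
  finally show ?thesis by simp
qed

text \<open>
The result of applying \<open>good_block_basis\<close> to every degree. The final basis is obtained from \<open>F\<close> by one
more random rotation in each block, with independent signs for all natural numbers.
\<close>
locale flat_blocks = finite_measure M for M :: "'a measure" +
  fixes F :: "nat \<Rightarrow> 'a \<Rightarrow> real" and T :: real
  assumes T: "T > 0"
    and on: "orthonormal UNIV F"
    and sumsq: "\<And>l x. x \<in> space M \<Longrightarrow> (\<Sum>i\<in>block l. (F i x)\<^sup>2) \<le> real (2 * l + 1)"
    and four: "\<And>l. (\<Sum>i\<in>block l. \<integral>x. F i x ^ 4 \<partial>M) \<le> T * real (2 * l + 1)"
    and flat: "\<And>l. pair_flat (2 * l + 1) (T * (1 + ln (real (2 * l + 1)))\<^sup>2 / real (2 * l + 1)) (\<lambda>i. F (l\<^sup>2 + i))"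
begin

definition coef :: "nat \<Rightarrow> nat \<Rightarrow> real" where
  "coef K i = (if level i = level K then hartley (2 * level K + 1) (K - (level K)\<^sup>2) (i - (level K)\<^sup>2) else 0)"

definition e :: "nat set \<Rightarrow> nat \<Rightarrow> 'a \<Rightarrow> real" where
  "e S K x = (\<Sum>i\<in>block (level K). coef K i * sg S i * F i x)"

lemma F_bdd_meas [simp]: "bdd_meas M (F i)"
  using orthonormal_bdd_meas[OF on] by simp

lemma e_bdd_meas [simp]: "bdd_meas M (e S K)"
  unfolding e_def by (intro bdd_meas_sum bdd_meas_mult bdd_meas_const) simp

lemma coef_square_le: "(coef K i)\<^sup>2 \<le> 4 / real (2 * level K + 1)"
proof (cases "level i = level K")
  case True
  then show ?thesis using hartley_square_le[of "2 * level K + 1"] by (simp add: coef_def)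
next
  case False
  then show ?thesis by (simp add: coef_def)
qed

lemma coef_outside: "i \<notin> block (level K) \<Longrightarrow> coef K i = 0"
  by (simp add: coef_def level_eq_iff)

lemma e_superset:
  assumes "finite B" "block (level K) \<subseteq> B"
  shows "e S K x = (\<Sum>i\<in>B. coef K i * sg S i * F i x)"
  unfolding e_def using assms coef_outside by (intro sum.mono_neutral_left) auto

lemma e_flip: "e (flip i S) K x = e S K x - 2 * sg S i * (coef K i * F i x)"
proof -
  have "e (flip i S) K x = (\<Sum>j\<in>insert i (block (level K)). coef K j * sg (flip i S) j * F j x)"
    by (rule e_superset) auto
  also have "\<dots> = (\<Sum>j\<in>insert i (block (level K)). coef K j * sg S j * F j x - (if j = i then 2 * sg S i * (coef K i * F i x) else 0))"
    by (intro sum.cong refl) (simp add: sg_flip)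
  also have "\<dots> = (\<Sum>j\<in>insert i (block (level K)). coef K j * sg S j * F j x) - 2 * sg S i * (coef K i * F i x)"
    by (simp only: sum_subtractf) (simp)
  also have "(\<Sum>j\<in>insert i (block (level K)). coef K j * sg S j * F j x) = e S K x"
    by (rule e_superset[symmetric]) auto
  finally show ?thesis .
qed

lemma e_cong: "S \<inter> B = S' \<inter> B \<Longrightarrow> block (level K) \<subseteq> B \<Longrightarrow> e S K x = e S' K x"
  unfolding e_def by (intro sum.cong refl) (auto simp: sg_def)

lemma e_random_rotation:
  assumes "m < 2 * l + 1"
  shows "e S (l\<^sup>2 + m) x = random_rotation (2 * l + 1) {i. l\<^sup>2 + i \<in> S} (\<lambda>i. F (l\<^sup>2 + i)) m x"
  using assms unfolding e_def level_add[OF assms] sum_block random_rotation_def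
  by (intro sum.cong refl) (simp add: coef_def level_add[OF assms] level_add sg_def)

lemma coef_flat:
  assumes "K \<noteq> K'"
  shows "(\<integral>x. (\<Sum>i\<in>block (level K). coef K i * coef K' i * (F i x)\<^sup>2)\<^sup>2 \<partial>M)
      \<le> T * (1 + ln (real (2 * level K + 1)))\<^sup>2 / real (2 * level K + 1)"
proof (cases "level K' = level K")
  case False
  then have "(\<Sum>i\<in>block (level K). coef K i * coef K' i * (F i x)\<^sup>2) = 0" for x
    by (intro sum.neutral) (auto simp: coef_def)
  then show ?thesis using T by simp
next
  case True
  define l where "l = level K"
  have "K \<in> block l" "K' \<in> block l" using True by (simp_all add: l_def level_eq_iff[symmetric])
  then obtain m m' where m: "K = l\<^sup>2 + m" "m < 2 * l + 1" "K' = l\<^sup>2 + m'" "m' < 2 * l + 1"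
    unfolding block_eq by blast
  have "(\<Sum>i\<in>block l. coef K i * coef K' i * (F i x)\<^sup>2) =
      (\<Sum>i<2 * l + 1. hartley (2 * l + 1) m i * hartley (2 * l + 1) m' i * (F (l\<^sup>2 + i) x)\<^sup>2)" for x
  proof -
    have "coef K (l\<^sup>2 + i) = hartley (2 * l + 1) m i" "coef K' (l\<^sup>2 + i) = hartley (2 * l + 1) m' i"
      if "i < 2 * l + 1" for i
      unfolding coef_def level_add[OF that] True l_def[symmetric] by (simp_all add: m)
    then show ?thesis unfolding sum_block by (intro sum.cong refl) simp
  qed
  then show ?thesis
    using flat[of l] m assms unfolding pair_flat_def l_def[symmetric] by simp
qed

text \<open>
At a fixed point the coefficients of the signs have square sum at most \<open>4\<close>, whatever the level.
\<close>
lemma e_moment: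
  assumes "finite B" "block (level K) \<subseteq> B" "s \<ge> 1" "x \<in> space M"
  shows "sign_avg B (\<lambda>S. e S K x ^ (2 * s)) \<le> ((2 * real s - 1) * 4) ^ s"
proof -
  define N where "N = real (2 * level K + 1)"
  have N: "N \<ge> 1" by (simp add: N_def)
  have "(\<Sum>i\<in>B. (coef K i * F i x)\<^sup>2) = (\<Sum>i\<in>block (level K). (coef K i * F i x)\<^sup>2)"
    using assms coef_outside by (intro sum.mono_neutral_right) auto
  also have "\<dots> \<le> (\<Sum>i\<in>block (level K). 4 / N * (F i x)\<^sup>2)"
    unfolding power_mult_distrib N_def by (intro sum_mono mult_right_mono coef_square_le) auto
  also have "\<dots> = 4 / N * (\<Sum>i\<in>block (level K). (F i x)\<^sup>2)" by (simp add: sum_distrib_left)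
  also have "\<dots> \<le> 4 / N * N" using sumsq[OF assms(4), of "level K"] N by (intro mult_left_mono) (auto simp: N_def)
  finally have "(\<Sum>i\<in>B. (coef K i * F i x)\<^sup>2) \<le> 4" using N by simp
  from sign_avg_linear_moment[OF assms(1,3) this] show ?thesis
    by (simp add: e_superset[OF assms(1,2)] mult_ac)
qed

lemma sign_avg_integral_e_power_le:
  assumes "finite B" "block (level K) \<subseteq> B" "s \<ge> 1"
  shows "sign_avg B (\<lambda>S. \<integral>x. e S K x ^ (2 * s) \<partial>M) \<le> measure M (space M) * ((2 * real s - 1) * 4) ^ s"
proof -
  have "sign_avg B (\<lambda>S. \<integral>x. e S K x ^ (2 * s) \<partial>M) = (\<integral>x. sign_avg B (\<lambda>S. e S K x ^ (2 * s)) \<partial>M)"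
    by (rule integral_sign_avg[symmetric]) simp
  also have "\<dots> \<le> (\<integral>x. ((2 * real s - 1) * 4) ^ s \<partial>M)"
    by (rule bdd_meas_integral_mono[OF _ _ e_moment[OF assms]]) (auto intro!: bdd_meas_sign_avg)
  finally show ?thesis by simp
qed

definition power_integral :: "nat \<Rightarrow> nat set \<Rightarrow> nat \<Rightarrow> real" where
  "power_integral q S K = (\<integral>x. e S K x ^ (2 * q) \<partial>M)"

lemma power_integral_tail:
  assumes q: "q \<ge> 1"
  shows "\<exists>C\<ge>0. \<forall>K B. finite B \<longrightarrow> block (level K) \<subseteq> B \<longrightarrow>
    sign_avg B (\<lambda>S. (power_integral q S K - sign_avg B (\<lambda>S. power_integral q S K)) ^ 6) \<le> C / real (2 * level K + 1) ^ 3"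
proof -
  define C where "C = 32 * (real q)\<^sup>2 * (measure M (space M) * ((2 * real (2 * q - 1) - 1) * 4) ^ (2 * q - 1))"
  have C: "C \<ge> 0" using q by (auto simp: C_def intro!: mult_nonneg_nonneg)
  show ?thesis
  proof (rule exI[of _ "5 ^ (6 * q) * C ^ 3"], intro conjI allI impI)
    show "0 \<le> 5 ^ (6 * q) * C ^ 3" using C by simp
    fix K and B :: "nat set" assume B: "finite B" "block (level K) \<subseteq> B"
    define N where "N = real (2 * level K + 1)"
    have N: "N \<ge> 1" by (simp add: N_def)
    define m where "m = sign_avg B (\<lambda>S. power_integral q S K)"
    have X: "power_integral q S K = (\<integral>x. (\<Sum>i\<in>B. coef K i * sg S i * F i x) ^ (2 * q) \<partial>M)" for S
      unfolding power_integral_def by (simp add: e_superset[OF B])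
    have ch: "chaos B (2 * q) (\<lambda>S. power_integral q S K - m)"
    proof -
      have "chaos B (card {..<2 * q}) (\<lambda>S. \<integral>x. 1 * (\<Prod>j\<in>{..<2 * q}. \<Sum>i\<in>B. coef K i * sg S i * F i x) \<partial>M)"
        by (rule chaos_integral) (use B in auto)
      then have "chaos B (2 * q) (\<lambda>S. power_integral q S K)" by (simp add: X)
      then show ?thesis by (rule chaos_diff_const)
    qed
    have "sign_avg B (\<lambda>S. (power_integral q S K - m)\<^sup>2) \<le> 32 * (real q)\<^sup>2 / N *
        sign_avg B (\<lambda>S. \<integral>x. (\<Sum>i\<in>B. coef K i * sg S i * F i x) ^ (2 * (2 * q - 1)) \<partial>M)"
      unfolding m_def X
      by (rule variance_even_power_integral[OF orthonormal_subset[OF on] B(1) N q])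
        (simp_all only: N_def coef_square_le subset_UNIV)
    also have "sign_avg B (\<lambda>S. \<integral>x. (\<Sum>i\<in>B. coef K i * sg S i * F i x) ^ (2 * (2 * q - 1)) \<partial>M) =
        sign_avg B (\<lambda>S. \<integral>x. e S K x ^ (2 * (2 * q - 1)) \<partial>M)"
      by (simp add: e_superset[OF B])
    also have "32 * (real q)\<^sup>2 / N * \<dots> \<le> 32 * (real q)\<^sup>2 / N * (measure M (space M) * ((2 * real (2 * q - 1) - 1) * 4) ^ (2 * q - 1))"
      using q N by (intro mult_left_mono sign_avg_integral_e_power_le B) auto
    also have "\<dots> = C / N" by (simp add: C_def)
    finally have var: "sign_avg B (\<lambda>S. (power_integral q S K - m)\<^sup>2) \<le> C / N" .
    have "sign_avg B (\<lambda>S. (power_integral q S K - m) ^ (2 * 3)) \<le> (2 * real 3 - 1) ^ (2 * q * 3) * sign_avg B (\<lambda>S. (power_integral q S K - m)\<^sup>2) ^ 3"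
      by (rule chaos_hypercontractive[OF B(1) ch]) simp
    also have "\<dots> \<le> (2 * real 3 - 1) ^ (2 * q * 3) * (C / N) ^ 3"
      using var by (intro mult_left_mono power_mono sign_avg_nonneg) auto
    also have "\<dots> = 5 ^ (6 * q) * C ^ 3 / N ^ 3" by (simp add: power_divide mult.commute)
    finally show "sign_avg B (\<lambda>S. (power_integral q S K - sign_avg B (\<lambda>S. power_integral q S K)) ^ 6) \<le> 5 ^ (6 * q) * C ^ 3 / real (2 * level K + 1) ^ 3"
      by (simp add: m_def N_def)
  qed
qed

definition product_integral :: "('a \<Rightarrow> real) \<Rightarrow> nat \<Rightarrow> nat set \<Rightarrow> (nat \<Rightarrow> nat) \<Rightarrow> real" where
  "product_integral g p S \<kappa> = (\<integral>x. g x * (\<Prod>j\<in>{1..p}. e S (\<kappa> j) x) \<partial>M)"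

lemma product_integral_chaos:
  assumes "finite B" "\<And>j. j \<in> {1..p} \<Longrightarrow> block (level (\<kappa> j)) \<subseteq> B" "bdd_meas M g"
  shows "chaos B p (\<lambda>S. product_integral g p S \<kappa>)"
proof -
  have "chaos B (card {1..p}) (\<lambda>S. \<integral>x. g x * (\<Prod>j\<in>{1..p}. \<Sum>i\<in>B. coef (\<kappa> j) i * sg S i * F i x) \<partial>M)"
    by (rule chaos_integral) (use assms in auto)
  moreover have "(\<Prod>j\<in>{1..p}. \<Sum>i\<in>B. coef (\<kappa> j) i * sg S i * F i x) = (\<Prod>j\<in>{1..p}. e S (\<kappa> j) x)" for S x
    using assms by (intro prod.cong refl) (simp add: e_superset)
  ultimately show ?thesis by (simp add: product_integral_def)
qed

text \<open>
The signs of the block of the index that occurs once are averaged first, the other signs being fixed. The weight \<open>W\<close> that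
\<open>level_second_moment\<close> leaves is then averaged over all signs, and its mean is bounded because all moments of the
basis functions are.
\<close>
lemma product_integral_second_moment:
  assumes p: "p \<ge> 1" and g: "bdd_meas M g" and gb: "\<And>x. x \<in> space M \<Longrightarrow> \<bar>g x\<bar> \<le> b"
  shows "\<exists>C>0. \<forall>B \<kappa> j0. finite B \<longrightarrow> (\<forall>j\<in>{1..p}. block (level (\<kappa> j)) \<subseteq> B) \<longrightarrow> j0 \<in> {1..p} \<longrightarrow>
     (\<forall>j\<in>{1..p}. j \<noteq> j0 \<longrightarrow> \<kappa> j \<noteq> \<kappa> j0) \<longrightarrow>
     sign_avg B (\<lambda>S. (product_integral g p S \<kappa>)\<^sup>2) \<le> C * (1 + ln (real (2 * level (\<kappa> j0) + 1)))\<^sup>2 / real (2 * level (\<kappa> j0) + 1)"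
proof -
  define \<mu> where "\<mu> = measure M (space M)"
  define K1 where "K1 = 8 * (real p)\<^sup>2 + 128 * 36 ^ p + 512 * 36 ^ p * T"
  define W0 where "W0 = b\<^sup>2 * (4 ^ p * (real p * (\<mu> * (1 + ((2 * real p - 1) * 4) ^ p))))"
  have W0: "W0 \<ge> 0" using p by (auto simp: W0_def \<mu>_def intro!: mult_nonneg_nonneg add_nonneg_nonneg)
  have K1: "K1 \<ge> 0" using T by (simp add: K1_def)
  show ?thesis
  proof (rule exI[of _ "(K1 + 2 * (real p)\<^sup>2 * T) * W0 + 1"], intro conjI allI impI)
    show "0 < (K1 + 2 * (real p)\<^sup>2 * T) * W0 + 1"
      using K1 W0 T by (intro add_nonneg_pos mult_nonneg_nonneg add_nonneg_nonneg) auto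
    fix B \<kappa> j0
    assume B: "finite B" "\<forall>j\<in>{1..p}. block (level (\<kappa> j)) \<subseteq> B" and j0: "j0 \<in> {1..p}"
      and uniq: "\<forall>j\<in>{1..p}. j \<noteq> j0 \<longrightarrow> \<kappa> j \<noteq> \<kappa> j0"
    define A where "A = block (level (\<kappa> j0))"
    define N where "N = real (2 * level (\<kappa> j0) + 1)"
    have N: "N \<ge> 1" by (simp add: N_def)
    define Y where "Y = T * (1 + ln N)\<^sup>2 / N"
    have Y0: "Y \<ge> 0" using T N by (simp add: Y_def)
    have AB: "A \<subseteq> B" using B j0 by (auto simp: A_def)
    define J where "J = {1..p}"
    define W where "W S x = \<bar>g x\<bar> * (\<Prod>j\<in>J. 1 + \<bar>e S (\<kappa> j) x\<bar>)" for S x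
    have Wb: "bdd_meas M (W S)" for S unfolding W_def by (intro bdd_meas_mult bdd_meas_abs bdd_meas_prod bdd_meas_add bdd_meas_const g e_bdd_meas)
    have lev1: "sign_avg A (\<lambda>S. (product_integral g p (S \<union> R) \<kappa>)\<^sup>2) \<le> (K1 / N + 2 * (real p)\<^sup>2 * Y) * sign_avg A (\<lambda>S. \<integral>x. (W (S \<union> R) x)\<^sup>2 \<partial>M)"
      if R: "R \<subseteq> B - A" for R
    proof -
      have fl: "flip i (S \<union> R) = flip i S \<union> R" "sg (S \<union> R) i = sg S i" if "i \<in> A" for i S
        using that R by (auto simp: flip_def sg_def)
      have "sign_avg A (\<lambda>S. (\<integral>x. g x * (\<Prod>j\<in>J. e (S \<union> R) (\<kappa> j) x) \<partial>M)\<^sup>2)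
        \<le> ((8 * (real (card J))\<^sup>2 + 128 * 36 ^ card J + 512 * 36 ^ card J * T) / N + 2 * (real (card J))\<^sup>2 * Y) *
           sign_avg A (\<lambda>S. \<integral>x. (\<bar>g x\<bar> * (\<Prod>b\<in>J. 1 + \<bar>e (S \<union> R) (\<kappa> b) x\<bar>))\<^sup>2 \<partial>M)"
      proof (rule level_second_moment[where f = F and m = j0 and c = "\<lambda>b i. if i \<in> A then coef (\<kappa> b) i else 0" and E = "\<lambda>b S. e (S \<union> R) (\<kappa> b)"])
        show "orthonormal A F" by (rule orthonormal_subset[OF on]) simp
        show "(\<Sum>i\<in>A. (F i x)\<^sup>2) \<le> N" if "x \<in> space M" for x
          using sumsq[OF that] by (simp add: A_def N_def)
        show "(\<Sum>i\<in>A. \<integral>x. F i x ^ 4 \<partial>M) \<le> T * N" using four by (simp add: A_def N_def)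
        show "e (flip i S \<union> R) (\<kappa> b) x = e (S \<union> R) (\<kappa> b) x - 2 * sg S i * ((if i \<in> A then coef (\<kappa> b) i else 0) * F i x)"
          if "i \<in> A" for b i S x
          using e_flip[of i "S \<union> R" "\<kappa> b" x] that by (simp add: fl)
        show "e (S \<union> R) (\<kappa> j0) x = (\<Sum>i\<in>A. (if i \<in> A then coef (\<kappa> j0) i else 0) * sg S i * F i x)" for S x
          unfolding e_def A_def[symmetric] by (intro sum.cong refl) (simp add: fl)
        show "(if i \<in> A then coef (\<kappa> b) i else 0)\<^sup>2 \<le> 4 / N" if "b \<in> J" "i \<in> A" for b i
        proof (cases "level (\<kappa> b) = level (\<kappa> j0)")
          case True
          then show ?thesis using coef_square_le[of "\<kappa> b" i] that by (simp add: N_def)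
        next
          case False
          then have "coef (\<kappa> b) i = 0" using that(2) by (auto simp: coef_def A_def level_eq_iff[symmetric])
          then show ?thesis using N by simp
        qed
        show "(\<integral>x. (\<Sum>i\<in>A. (if i \<in> A then coef (\<kappa> j0) i else 0) * (if i \<in> A then coef (\<kappa> b) i else 0) * (F i x)\<^sup>2)\<^sup>2 \<partial>M) \<le> Y"
          if "b \<in> J" "b \<noteq> j0" for b
          using coef_flat[of "\<kappa> j0" "\<kappa> b"] uniq that by (fastforce simp: A_def N_def Y_def J_def cong: sum.cong)
      qed (use N g j0 Y0 in \<open>auto simp: A_def J_def\<close>)
      then show ?thesis by (simp add: product_integral_def W_def J_def K1_def)
    qed
    have split: "sign_avg B H = sign_avg (B - A) (\<lambda>R. sign_avg A (\<lambda>S. H (S \<union> R)))" for H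
      using sign_avg_Un[of A "B - A" H] AB B by (simp add: A_def Un_absorb1 finite_subset)
    have "sign_avg B (\<lambda>S. (product_integral g p S \<kappa>)\<^sup>2) \<le> (K1 / N + 2 * (real p)\<^sup>2 * Y) * sign_avg B (\<lambda>S. \<integral>x. (W S x)\<^sup>2 \<partial>M)"
    proof -
      have "sign_avg (B - A) (\<lambda>R. sign_avg A (\<lambda>S. (product_integral g p (S \<union> R) \<kappa>)\<^sup>2)) \<le>
        sign_avg (B - A) (\<lambda>R. (K1 / N + 2 * (real p)\<^sup>2 * Y) * sign_avg A (\<lambda>S. \<integral>x. (W (S \<union> R) x)\<^sup>2 \<partial>M))"
        by (rule sign_avg_mono) (rule lev1)
      then show ?thesis
        unfolding split[of "\<lambda>S. (product_integral g p S \<kappa>)\<^sup>2"] split[of "\<lambda>S. \<integral>x. (W S x)\<^sup>2 \<partial>M"] by (simp only: sign_avg_cmult)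
    qed
    also have "sign_avg B (\<lambda>S. \<integral>x. (W S x)\<^sup>2 \<partial>M) \<le> W0"
    proof -
      have "sign_avg B (\<lambda>S. \<integral>x. (W S x)\<^sup>2 \<partial>M) \<le> sign_avg B (\<lambda>S. \<integral>x. b\<^sup>2 * (4 ^ p * (\<Sum>j\<in>J. 1 + e S (\<kappa> j) x ^ (2 * p))) \<partial>M)"
      proof (intro sign_avg_mono bdd_meas_integral_mono)
        fix S x assume x: "x \<in> space M"
        have "(W S x)\<^sup>2 = \<bar>g x\<bar>\<^sup>2 * (\<Prod>j\<in>J. (1 + \<bar>e S (\<kappa> j) x\<bar>)\<^sup>2)"
          by (simp only: W_def power_mult_distrib prod_power_distrib)
        also have "\<dots> \<le> b\<^sup>2 * (\<Sum>j\<in>J. ((1 + \<bar>e S (\<kappa> j) x\<bar>)\<^sup>2) ^ card J)"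
          using gb[OF x] p by (intro mult_mono power_mono prod_le_sum_power) (auto simp: J_def intro!: prod_nonneg)
        also have "\<dots> \<le> b\<^sup>2 * (\<Sum>j\<in>J. 4 ^ p * (1 + e S (\<kappa> j) x ^ (2 * p)))"
        proof (intro mult_left_mono sum_mono)
          fix j
          have "((1 + \<bar>e S (\<kappa> j) x\<bar>)\<^sup>2) ^ card J = (1 + \<bar>e S (\<kappa> j) x\<bar>) ^ (2 * p)" by (simp add: J_def power_mult)
          also have "\<dots> \<le> 2 ^ (2 * p) * (1 + \<bar>e S (\<kappa> j) x\<bar> ^ (2 * p))" by (rule one_plus_power_le) simp
          finally show "((1 + \<bar>e S (\<kappa> j) x\<bar>)\<^sup>2) ^ card J \<le> 4 ^ p * (1 + e S (\<kappa> j) x ^ (2 * p))"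
            by (simp add: power_mult power_even_abs)
        qed simp
        finally show "(W S x)\<^sup>2 \<le> b\<^sup>2 * (4 ^ p * (\<Sum>j\<in>J. 1 + e S (\<kappa> j) x ^ (2 * p)))"
          by (simp add: sum_distrib_left)
      qed (auto intro!: bdd_meas_power Wb bdd_meas_mult bdd_meas_sum bdd_meas_add)
      also have "\<dots> = b\<^sup>2 * (4 ^ p * (\<Sum>j\<in>J. \<mu> + sign_avg B (\<lambda>S. \<integral>x. e S (\<kappa> j) x ^ (2 * p) \<partial>M)))"
      proof -
        have "(\<integral>x. b\<^sup>2 * (4 ^ p * (\<Sum>j\<in>J. 1 + e S (\<kappa> j) x ^ (2 * p))) \<partial>M) =
            b\<^sup>2 * (4 ^ p * (\<Sum>j\<in>J. \<mu> + (\<integral>x. e S (\<kappa> j) x ^ (2 * p) \<partial>M)))" for S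
          unfolding integral_mult_right_zero
          by (subst Bochner_Integration.integral_sum) (auto simp: \<mu>_def)
        then show ?thesis by (simp only: sign_avg_cmult sign_avg_sum sign_avg_add sign_avg_const[OF B(1)])
      qed
      also have "\<dots> \<le> b\<^sup>2 * (4 ^ p * (\<Sum>j\<in>J. \<mu> + \<mu> * ((2 * real p - 1) * 4) ^ p))"
        unfolding \<mu>_def using B p by (intro mult_left_mono sum_mono add_left_mono sign_avg_integral_e_power_le) (auto simp: J_def)
      also have "\<dots> = W0" by (simp add: W0_def J_def algebra_simps)
      finally show ?thesis .
    qed
    also have "K1 / N + 2 * (real p)\<^sup>2 * Y \<le> (K1 + 2 * (real p)\<^sup>2 * T) * ((1 + ln N)\<^sup>2 / N)"
    proof -
      have "1 \<le> (1 + ln N)\<^sup>2" using N by (intro one_le_power) auto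
      then have "K1 / N * 1 \<le> K1 / N * (1 + ln N)\<^sup>2" using K1 N by (intro mult_left_mono) auto
      then show ?thesis by (simp add: Y_def algebra_simps)
    qed
    finally have "sign_avg B (\<lambda>S. (product_integral g p S \<kappa>)\<^sup>2) \<le> (K1 + 2 * (real p)\<^sup>2 * T) * ((1 + ln N)\<^sup>2 / N) * W0"
      using W0 K1 N Y0 by (simp add: mult_left_mono mult_right_mono)
    also have "\<dots> = ((K1 + 2 * (real p)\<^sup>2 * T) * W0) * ((1 + ln N)\<^sup>2 / N)" by simp
    also have "\<dots> \<le> ((K1 + 2 * (real p)\<^sup>2 * T) * W0 + 1) * ((1 + ln N)\<^sup>2 / N)"
      using N by (intro mult_right_mono) auto
    finally show "sign_avg B (\<lambda>S. (product_integral g p S \<kappa>)\<^sup>2) \<le> ((K1 + 2 * (real p)\<^sup>2 * T) * W0 + 1) * (1 + ln (real (2 * level (\<kappa> j0) + 1)))\<^sup>2 / real (2 * level (\<kappa> j0) + 1)"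
      by (simp add: N_def)
  qed
qed

end

section \<open>Choice of the signs\<close>

lemma sum_inverse_squares_le: "(\<Sum>l\<le>L. 1 / (real l + 2)\<^sup>2) \<le> 1"
proof -
  have "(\<Sum>l\<le>L. 1 / (real l + 2)\<^sup>2) \<le> 1 - 1 / (real L + 2)"
  proof (induction L)
    case 0 then show ?case by (simp add: power2_eq_square)
  next
    case (Suc L)
    have "1 / (real L + 3)\<^sup>2 \<le> 1 / (real L + 2) - 1 / (real L + 3)"
      by (simp add: divide_simps power2_eq_square)
    then show ?case using Suc by (simp add: add.commute)
  qed
  then show ?thesis by (smt (verit) divide_nonneg_nonneg of_nat_0_le_iff)
qed

lemma ln_two_plus_ge_half: "ln (2 + real r) \<ge> 1 / 2"
proof -
  have "(1::real) / 2 \<le> 2 / 3" by simp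
  also have "\<dots> \<le> ln 2" by (rule ln2_ge_two_thirds)
  also have "ln 2 \<le> ln (2 + real r)" by (subst ln_le_cancel_iff) auto
  finally show ?thesis .
qed

context flat_blocks
begin

lemma sum_level:
  "(\<Sum>K<(L + 1)\<^sup>2. h (level K)) = (\<Sum>l\<le>L. real (2 * l + 1) * (h l :: real))"
proof -
  have "(\<Sum>K\<in>block l. h (level K)) = real (2 * l + 1) * h l" for l
  proof -
    have "(\<Sum>K\<in>block l. h (level K)) = (\<Sum>K\<in>block l. h l)"
      by (intro sum.cong refl) (simp add: level_eq_iff[symmetric])
    then show ?thesis by (simp only: sum_block) simp
  qed
  then show ?thesis unfolding sum_square_blocks by simp
qed

text \<open>
Hypercontractivity with exponent \<open>s \<approx> \<Lambda> = ln (2 + r)\<close>. The factor \<open>(2 * s) ^ p\<close> and the square of the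
logarithm from the second moment are together at most a multiple of \<open>\<Lambda> ^ (p + 2)\<close>, hence of
\<open>\<Lambda> ^ (2 * p)\<close>. The constant \<open>D\<close> is chosen so that a factor \<open>exp (- (3 * p + 3))\<close> is gained in each of the
\<open>s\<close> powers. The exponent \<open>3 * p + 3\<close> leaves a summable series after \<open>2 * p\<close> powers are spent on the
number of tuples and \<open>p\<close> powers on the number of positions.
\<close>
lemma product_integral_tail:
  assumes p: "p \<ge> 3" and g: "bdd_meas M g" and gb: "\<And>x. x \<in> space M \<Longrightarrow> \<bar>g x\<bar> \<le> b"
  shows "\<exists>D>0. \<forall>B \<kappa> j0 r. finite B \<longrightarrow> (\<forall>j\<in>{1..p}. block (level (\<kappa> j)) \<subseteq> B \<and> level (\<kappa> j) \<le> r) \<longrightarrow> j0 \<in> {1..p} \<longrightarrow>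
     (\<forall>j\<in>{1..p}. j \<noteq> j0 \<longrightarrow> \<kappa> j \<noteq> \<kappa> j0) \<longrightarrow>
     sign_avg B (\<lambda>S. (product_integral g p S \<kappa> / (D * ln (2 + real r) ^ p / sqrt (real (2 * level (\<kappa> j0) + 1)))) ^ (2 * nat \<lceil>ln (2 + real r)\<rceil>))
       \<le> 1 / (2 + real r) ^ (3 * p + 3)"
proof -
  have p1: "p \<ge> 1" using p by simp
  obtain C where C: "C > 0" and Cle: "\<And>B \<kappa> j0. finite B \<Longrightarrow> \<forall>j\<in>{1..p}. block (level (\<kappa> j)) \<subseteq> B \<Longrightarrow> j0 \<in> {1..p} \<Longrightarrow>
     \<forall>j\<in>{1..p}. j \<noteq> j0 \<longrightarrow> \<kappa> j \<noteq> \<kappa> j0 \<Longrightarrow>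
     sign_avg B (\<lambda>S. (product_integral g p S \<kappa>)\<^sup>2) \<le> C * (1 + ln (real (2 * level (\<kappa> j0) + 1)))\<^sup>2 / real (2 * level (\<kappa> j0) + 1)"
    using product_integral_second_moment[OF p1 g gb] by blast
  define D where "D = sqrt (12 ^ p * 16 * C * exp (real (3 * p + 3)))"
  have D2: "D\<^sup>2 = 12 ^ p * 16 * C * exp (real (3 * p + 3))" using C by (simp add: D_def)
  have D: "D > 0" using C by (simp add: D_def)
  show ?thesis
  proof (rule exI[of _ D], intro conjI allI impI D)
    fix B \<kappa> j0 r
    assume B: "finite B" and \<kappa>: "\<forall>j\<in>{1..p}. block (level (\<kappa> j)) \<subseteq> B \<and> level (\<kappa> j) \<le> r" and j0: "j0 \<in> {1..p}"
      and uniq: "\<forall>j\<in>{1..p}. j \<noteq> j0 \<longrightarrow> \<kappa> j \<noteq> \<kappa> j0"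
    define n where "n = real (2 * level (\<kappa> j0) + 1)"
    define \<Lambda> where "\<Lambda> = ln (2 + real r)"
    define s where "s = nat \<lceil>\<Lambda>\<rceil>"
    have n1: "n \<ge> 1" by (simp add: n_def)
    have \<Lambda>: "\<Lambda> \<ge> 1 / 2" unfolding \<Lambda>_def by (rule ln_two_plus_ge_half)
    have s\<Lambda>: "\<Lambda> \<le> real s" unfolding s_def using real_nat_ceiling_ge by blast
    have s3: "real s \<le> 3 * \<Lambda>" unfolding s_def using \<Lambda> by linarith
    have s1: "s \<ge> 1" using s\<Lambda> \<Lambda> by (cases s) auto
    have lnn: "1 + ln n \<le> 4 * \<Lambda>"
    proof -
      have "level (\<kappa> j0) \<le> r" using \<kappa> j0 by blast
      then have "n \<le> 2 * real r + 1" by (simp add: n_def)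
      also have "\<dots> \<le> (2 + real r)\<^sup>2" by (simp add: power2_eq_square algebra_simps)
      finally have "n \<le> (2 + real r)\<^sup>2" .
      then have "ln n \<le> ln ((2 + real r)\<^sup>2)" using n1 by (subst ln_le_cancel_iff) auto
      also have "\<dots> = 2 * \<Lambda>" by (simp add: \<Lambda>_def ln_realpow)
      finally show ?thesis using \<Lambda> by linarith
    qed
    have second: "sign_avg B (\<lambda>S. (product_integral g p S \<kappa>)\<^sup>2) \<le> C * (4 * \<Lambda>)\<^sup>2 / n"
    proof -
      have "sign_avg B (\<lambda>S. (product_integral g p S \<kappa>)\<^sup>2) \<le> C * (1 + ln n)\<^sup>2 / n"
        unfolding n_def using \<kappa> by (intro Cle B j0 uniq) auto
      also have "\<dots> \<le> C * (4 * \<Lambda>)\<^sup>2 / n"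
        using C n1 lnn by (intro divide_right_mono mult_left_mono power_mono add_nonneg_nonneg) auto
      finally show ?thesis .
    qed
    define \<theta> where "\<theta> = D * \<Lambda> ^ p / sqrt n"
    have \<theta>2: "\<theta>\<^sup>2 = D\<^sup>2 * (\<Lambda>\<^sup>2) ^ p / n" using n1 by (simp add: \<theta>_def power_divide power_mult_distrib flip: power_mult) (simp add: mult.commute)
    have \<theta>: "\<theta> > 0" using D \<Lambda> n1 by (simp add: \<theta>_def)
    have "sign_avg B (\<lambda>S. product_integral g p S \<kappa> ^ (2 * s)) \<le> (2 * real s - 1) ^ (p * s) * sign_avg B (\<lambda>S. (product_integral g p S \<kappa>)\<^sup>2) ^ s"
      by (rule chaos_hypercontractive[OF B product_integral_chaos[OF B _ g] s1]) (use \<kappa> in auto)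
    also have "\<dots> \<le> (6 * \<Lambda>) ^ (p * s) * (C * (4 * \<Lambda>)\<^sup>2 / n) ^ s"
    proof -
      have "sign_avg B (\<lambda>S. (product_integral g p S \<kappa>)\<^sup>2) \<ge> 0" by (rule sign_avg_nonneg) simp
      then show ?thesis using s1 s3 second \<Lambda> by (intro mult_mono power_mono) auto
    qed
    also have "\<dots> = ((6 * \<Lambda>) ^ p * (C * (4 * \<Lambda>)\<^sup>2 / n)) ^ s"
      by (simp only: power_mult power_mult_distrib)
    also have "\<dots> \<le> (exp (- real (3 * p + 3)) * \<theta>\<^sup>2) ^ s"
    proof (rule power_mono)
      have "\<Lambda>\<^sup>2 \<le> (2 * \<Lambda>)\<^sup>2" using \<Lambda> by (intro power_mono) auto
      also have "\<dots> \<le> (2 * \<Lambda>) ^ p" using p \<Lambda> by (intro power_increasing) auto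
      finally have L2: "\<Lambda>\<^sup>2 \<le> 2 ^ p * \<Lambda> ^ p" by (simp add: power_mult_distrib)
      have "(6 * \<Lambda>) ^ p * (C * (4 * \<Lambda>)\<^sup>2 / n) = 6 ^ p * 16 * C / n * \<Lambda> ^ p * \<Lambda>\<^sup>2"
        by (simp add: power_mult_distrib)
      also have "\<dots> \<le> 6 ^ p * 16 * C / n * \<Lambda> ^ p * (2 ^ p * \<Lambda> ^ p)"
        using C n1 \<Lambda> by (intro mult_left_mono L2) auto
      also have "\<dots> = (6 * 2) ^ p * 16 * C * (\<Lambda>\<^sup>2) ^ p / n"
        unfolding power_mult_distrib power2_eq_square by simp
      also have "\<dots> = exp (- real (3 * p + 3)) * \<theta>\<^sup>2"
      proof -
        have E: "exp (- real (3 * p + 3)) * exp (real (3 * p + 3)) = 1" by (simp only: exp_add[symmetric]) simp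
        have "u * \<theta>\<^sup>2 = (u * exp (real (3 * p + 3))) * (12 ^ p * 16 * C * (\<Lambda>\<^sup>2) ^ p / n)" for u
          unfolding \<theta>2 D2 by simp
        from this[of "exp (- real (3 * p + 3))", unfolded E]
        show ?thesis by simp
      qed
      finally show "(6 * \<Lambda>) ^ p * (C * (4 * \<Lambda>)\<^sup>2 / n) \<le> exp (- real (3 * p + 3)) * \<theta>\<^sup>2" .
    qed (use \<Lambda> C n1 in auto)
    finally have mom: "sign_avg B (\<lambda>S. product_integral g p S \<kappa> ^ (2 * s)) \<le> exp (- real (3 * p + 3)) ^ s * \<theta> ^ (2 * s)"
      by (simp add: power_mult_distrib power_mult)
    have "sign_avg B (\<lambda>S. (product_integral g p S \<kappa> / \<theta>) ^ (2 * s)) = sign_avg B (\<lambda>S. product_integral g p S \<kappa> ^ (2 * s)) / \<theta> ^ (2 * s)"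
      by (simp add: power_divide sign_avg_divide)
    also have "\<dots> \<le> exp (- real (3 * p + 3)) ^ s"
      using mom \<theta> by (simp add: divide_le_eq)
    also have "\<dots> = exp (- (real s * real (3 * p + 3)))"
      by (simp only: exp_of_nat_mult[symmetric] mult_minus_right)
    also have "\<dots> \<le> exp (- (\<Lambda> * real (3 * p + 3)))" using s\<Lambda> by (simp add: mult_right_mono)
    also have "\<dots> = 1 / (2 + real r) ^ (3 * p + 3)"
    proof -
      have "exp (real (3 * p + 3) * \<Lambda>) = exp \<Lambda> ^ (3 * p + 3)" by (rule exp_of_nat_mult)
      also have "exp \<Lambda> = 2 + real r" unfolding \<Lambda>_def by (rule exp_ln) auto
      finally show ?thesis by (simp only: exp_minus mult.commute[of \<Lambda>] inverse_eq_divide)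
    qed
    finally show "sign_avg B (\<lambda>S. (product_integral g p S \<kappa> / (D * ln (2 + real r) ^ p / sqrt (real (2 * level (\<kappa> j0) + 1)))) ^ (2 * nat \<lceil>ln (2 + real r)\<rceil>))
       \<le> 1 / (2 + real r) ^ (3 * p + 3)"
      by (simp only: \<theta>_def \<Lambda>_def s_def n_def)
  qed
qed

definition unique_at :: "nat \<Rightarrow> (nat \<Rightarrow> nat) \<Rightarrow> nat \<Rightarrow> bool" where
  "unique_at p \<kappa> j0 \<longleftrightarrow> (\<forall>j\<in>{1..p}. j \<noteq> j0 \<longrightarrow> \<kappa> j \<noteq> \<kappa> j0)"

text \<open>
The union bound. \<open>G1\<close> and \<open>G2\<close> add up the normalised moments of all quantities that have to be controlled, so a
choice of signs for which \<open>G1 + G2\<close> is at most its average controls all of them at once. The sums over the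
levels converge, so the constants do not depend on \<open>L\<close>.
\<close>
lemma selection_up_to_level:
  assumes p: "p \<ge> 3" and g: "bdd_meas M g" and gb: "\<And>x. x \<in> space M \<Longrightarrow> \<bar>g x\<bar> \<le> b"
  shows "\<exists>X D. D > 0 \<and> (\<forall>L. \<exists>S. (\<forall>K<(L + 1)\<^sup>2. power_integral p S K \<le> X) \<and>
     (\<forall>r\<le>L. \<forall>\<kappa>\<in>{1..p} \<rightarrow>\<^sub>E {..<(r + 1)\<^sup>2}. \<forall>j0\<in>{1..p}. unique_at p \<kappa> j0 \<longrightarrow>
        \<bar>product_integral g p S \<kappa>\<bar> \<le> D * ln (2 + real r) ^ p / sqrt (real (2 * level (\<kappa> j0) + 1))))"
proof -
  have p1: "p \<ge> 1" using p by simp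
  obtain C where C: "C \<ge> 0" and Cle: "\<And>K B. finite B \<Longrightarrow> block (level K) \<subseteq> B \<Longrightarrow>
    sign_avg B (\<lambda>S. (power_integral p S K - sign_avg B (\<lambda>S. power_integral p S K)) ^ 6) \<le> C / real (2 * level K + 1) ^ 3"
    using power_integral_tail[OF p1] by blast
  obtain D where D: "D > 0" and Dle: "\<And>B \<kappa> j0 r. finite B \<Longrightarrow> \<forall>j\<in>{1..p}. block (level (\<kappa> j)) \<subseteq> B \<and> level (\<kappa> j) \<le> r \<Longrightarrow> j0 \<in> {1..p} \<Longrightarrow>
     \<forall>j\<in>{1..p}. j \<noteq> j0 \<longrightarrow> \<kappa> j \<noteq> \<kappa> j0 \<Longrightarrow>
     sign_avg B (\<lambda>S. (product_integral g p S \<kappa> / (D * ln (2 + real r) ^ p / sqrt (real (2 * level (\<kappa> j0) + 1)))) ^ (2 * nat \<lceil>ln (2 + real r)\<rceil>))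
       \<le> 1 / (2 + real r) ^ (3 * p + 3)"
    using product_integral_tail[OF p g gb] by blast
  \<comment> \<open>The sixth moments are of order \<open>n powr -3\<close>, so they are summable over the \<open>n\<close> functions of each level.\<close>
  define \<tau> where "\<tau> = 16 * (C + 1)"
  have \<tau>: "\<tau> > 0" using C by (simp add: \<tau>_def)
  define X0 where "X0 = measure M (space M) * ((2 * real p - 1) * 4) ^ p"
  show ?thesis
  proof (rule exI[of _ "X0 + 1 + \<tau>"], rule exI[of _ D], intro conjI D allI)
    fix L :: nat
    define B where "B = {..<(L + 1)\<^sup>2}"
    have B: "finite B" by (simp add: B_def)
    define \<theta> where "\<theta> r \<kappa> j = D * ln (2 + real r) ^ p / sqrt (real (2 * level (\<kappa> j) + 1))"
      for r :: nat and \<kappa> :: "nat \<Rightarrow> nat" and j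
    define s where "s r = nat \<lceil>ln (2 + real r)\<rceil>" for r :: nat
    define U where "U \<kappa> = {j\<in>{1..p}. unique_at p \<kappa> j}" for \<kappa>
    define Q where "Q r = ({1..p} \<rightarrow>\<^sub>E {..<(r + 1)\<^sup>2})" for r :: nat
    have finQ: "finite (Q r)" for r unfolding Q_def by (intro finite_PiE) auto
    have finU: "finite (U \<kappa>)" for \<kappa> by (simp add: U_def)
    define m where "m K = sign_avg B (\<lambda>S. power_integral p S K)" for K
    define G1 where "G1 S = (\<Sum>K<(L + 1)\<^sup>2. (power_integral p S K - m K) ^ 6 / \<tau>)" for S
    define G2 where "G2 S = (\<Sum>r\<le>L. \<Sum>\<kappa>\<in>Q r. \<Sum>j\<in>U \<kappa>. (product_integral g p S \<kappa> / \<theta> r \<kappa> j) ^ (2 * s r))" for S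
    have G10: "G1 S \<ge> 0" and G20: "G2 S \<ge> 0" for S
      using \<tau> unfolding G1_def G2_def by (auto intro!: sum_nonneg)
    have "sign_avg B G1 \<le> 1 / 4"
    proof -
      have "sign_avg B G1 = (\<Sum>K<(L + 1)\<^sup>2. sign_avg B (\<lambda>S. (power_integral p S K - m K) ^ 6) / \<tau>)"
        unfolding G1_def by (simp only: sign_avg_sum sign_avg_divide)
      also have "\<dots> \<le> (\<Sum>K<(L + 1)\<^sup>2. (C / real (2 * level K + 1) ^ 3) / \<tau>)"
      proof (intro sum_mono divide_right_mono)
        fix K assume "K \<in> {..<(L + 1)\<^sup>2}"
        then have "level K \<le> L" using less_square_level by simp
        then show "sign_avg B (\<lambda>S. (power_integral p S K - m K) ^ 6) \<le> C / real (2 * level K + 1) ^ 3"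
          unfolding m_def B_def by (intro Cle block_subset) simp_all
      qed (use \<tau> in auto)
      also have "\<dots> = (\<Sum>l\<le>L. real (2 * l + 1) * ((C / real (2 * l + 1) ^ 3) / \<tau>))"
        by (rule sum_level)
      also have "\<dots> \<le> (\<Sum>l\<le>L. (4 * C / \<tau>) * (1 / (real l + 2)\<^sup>2))"
      proof (rule sum_mono)
        fix l
        have "((real l + 2) / 2)\<^sup>2 \<le> (real (2 * l + 1))\<^sup>2" by (intro power_mono) auto
        then have "1 / (real (2 * l + 1))\<^sup>2 \<le> 1 / ((real l + 2) / 2)\<^sup>2" by (intro divide_left_mono) auto
        then have "(C / \<tau>) * (1 / (real (2 * l + 1))\<^sup>2) \<le> (C / \<tau>) * (1 / ((real l + 2) / 2)\<^sup>2)"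
          using C \<tau> by (intro mult_left_mono) auto
        moreover have "real (2 * l + 1) * ((C / real (2 * l + 1) ^ 3) / \<tau>) = (C / \<tau>) * (1 / (real (2 * l + 1))\<^sup>2)"
          unfolding power3_eq_cube power2_eq_square by (simp del: of_nat_add of_nat_mult)
        ultimately show "real (2 * l + 1) * ((C / real (2 * l + 1) ^ 3) / \<tau>) \<le> (4 * C / \<tau>) * (1 / (real l + 2)\<^sup>2)"
          by (simp add: power_divide mult.commute[of C])
      qed
      also have "\<dots> = (4 * C / \<tau>) * (\<Sum>l\<le>L. 1 / (real l + 2)\<^sup>2)" by (rule sum_distrib_left[symmetric])
      also have "\<dots> \<le> (4 * C / \<tau>) * 1" using C \<tau> by (intro mult_left_mono sum_inverse_squares_le) auto
      also have "\<dots> \<le> 1 / 4" using C by (simp add: \<tau>_def field_simps)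
      finally show ?thesis .
    qed
    moreover have "sign_avg B G2 \<le> 1 / 2"
    proof -
      have "sign_avg B G2 = (\<Sum>r\<le>L. \<Sum>\<kappa>\<in>Q r. \<Sum>j\<in>U \<kappa>. sign_avg B (\<lambda>S. (product_integral g p S \<kappa> / \<theta> r \<kappa> j) ^ (2 * s r)))"
        unfolding G2_def by (simp only: sign_avg_sum)
      also have "\<dots> \<le> (\<Sum>r\<le>L. \<Sum>\<kappa>\<in>Q r. \<Sum>j\<in>U \<kappa>. 1 / (2 + real r) ^ (3 * p + 3))"
      proof (intro sum_mono)
        fix r \<kappa> j assume r: "r \<in> {..L}" and \<kappa>: "\<kappa> \<in> Q r" and j: "j \<in> U \<kappa>"
        have "level (\<kappa> i) \<le> r" if "i \<in> {1..p}" for i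
          using \<kappa> that unfolding Q_def by (metis PiE_mem lessThan_iff less_square_level)
        then have "\<forall>i\<in>{1..p}. block (level (\<kappa> i)) \<subseteq> B \<and> level (\<kappa> i) \<le> r"
          using r block_subset unfolding B_def by (meson atMost_iff order_trans)
        then show "sign_avg B (\<lambda>S. (product_integral g p S \<kappa> / \<theta> r \<kappa> j) ^ (2 * s r)) \<le> 1 / (2 + real r) ^ (3 * p + 3)"
          unfolding \<theta>_def s_def using j by (intro Dle B) (auto simp: U_def unique_at_def)
      qed
      also have "\<dots> \<le> (\<Sum>r\<le>L. (1 / 2) * (1 / (real r + 2)\<^sup>2))"
      proof (rule sum_mono)
        fix r
        define z where "z = 2 + real r"
        have z: "z \<ge> 2" by (simp add: z_def)
        have "(\<Sum>\<kappa>\<in>Q r. \<Sum>j\<in>U \<kappa>. 1 / z ^ (3 * p + 3)) \<le> (\<Sum>\<kappa>\<in>Q r. \<Sum>j\<in>{1..p}. 1 / z ^ (3 * p + 3))"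
          using z by (intro sum_mono sum_mono2) (auto simp: U_def)
        also have "\<dots> = real (card (Q r)) * (real p / z ^ (3 * p + 3))" by simp
        also have "card (Q r) = ((r + 1)\<^sup>2) ^ p" unfolding Q_def by (subst card_PiE) auto
        also have "real (((r + 1)\<^sup>2) ^ p) * (real p / z ^ (3 * p + 3)) \<le> (z\<^sup>2) ^ p * (z ^ p / z ^ (3 * p + 3))"
        proof (intro mult_mono divide_right_mono)
          have "real (((r + 1)\<^sup>2) ^ p) = ((real r + 1)\<^sup>2) ^ p" by (simp add: add.commute)
          also have "\<dots> \<le> (z\<^sup>2) ^ p" by (intro power_mono) (auto simp: z_def)
          finally show "real (((r + 1)\<^sup>2) ^ p) \<le> (z\<^sup>2) ^ p" .
          have "real p \<le> 2 ^ p" by (metis less_exp less_imp_le of_nat_le_iff of_nat_numeral of_nat_power)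
          also have "\<dots> \<le> z ^ p" using z by (intro power_mono) auto
          finally show "real p \<le> z ^ p" .
        qed (use z in auto)
        also have "\<dots> = 1 / z ^ 3"
        proof -
          have "z ^ (3 * p + 3) = (z\<^sup>2) ^ p * z ^ p * z ^ 3"
            by (simp add: power_add flip: power_mult) (simp add: power_mult power3_eq_cube power2_eq_square power_mult_distrib)
          then show ?thesis using z by simp
        qed
        also have "\<dots> \<le> (1 / 2) * (1 / z\<^sup>2)"
          using z by (simp add: power3_eq_cube power2_eq_square field_simps)
        finally show "(\<Sum>\<kappa>\<in>Q r. \<Sum>j\<in>U \<kappa>. 1 / (2 + real r) ^ (3 * p + 3)) \<le> (1 / 2) * (1 / (real r + 2)\<^sup>2)"
          by (simp add: z_def add.commute)
      qed
      also have "\<dots> = (1 / 2) * (\<Sum>r\<le>L. 1 / (real r + 2)\<^sup>2)" by (rule sum_distrib_left[symmetric])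
      also have "\<dots> \<le> 1 / 2" using sum_inverse_squares_le[of L] by simp
      finally show ?thesis .
    qed
    ultimately have "sign_avg B (\<lambda>S. G1 S + G2 S) \<le> 1" by (simp add: sign_avg_add)
    then obtain S where S: "G1 S + G2 S \<le> 1" using finite_sign_avg_le_one_selection[OF B] by blast
    have G1: "G1 S \<le> 1" and G2: "G2 S \<le> 1" using S G10[of S] G20[of S] by linarith+
    show "\<exists>S. (\<forall>K<(L + 1)\<^sup>2. power_integral p S K \<le> X0 + 1 + \<tau>) \<and>
     (\<forall>r\<le>L. \<forall>\<kappa>\<in>{1..p} \<rightarrow>\<^sub>E {..<(r + 1)\<^sup>2}. \<forall>j0\<in>{1..p}. unique_at p \<kappa> j0 \<longrightarrow>
        \<bar>product_integral g p S \<kappa>\<bar> \<le> D * ln (2 + real r) ^ p / sqrt (real (2 * level (\<kappa> j0) + 1)))"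
    proof (intro exI[of _ S] conjI allI ballI impI)
      fix K assume K: "K < (L + 1)\<^sup>2"
      have "(power_integral p S K - m K) ^ 6 / \<tau> \<le> G1 S"
        unfolding G1_def using K \<tau> by (intro member_le_sum[of K]) auto
      then have "(power_integral p S K - m K) ^ 6 / \<tau> \<le> 1" using G1 by linarith
      then have six: "(power_integral p S K - m K) ^ 6 \<le> \<tau>" using \<tau> by (simp add: divide_le_eq)
      have "power_integral p S K - m K \<le> 1 + \<tau>"
      proof (rule ccontr)
        assume n: "\<not> power_integral p S K - m K \<le> 1 + \<tau>"
        then have "1 + \<tau> < (power_integral p S K - m K) ^ 1" by simp
        also have "\<dots> \<le> (power_integral p S K - m K) ^ 6" using n \<tau> by (intro power_increasing) auto
        finally show False using six by simp
      qed
      moreover have "m K \<le> X0"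
        unfolding m_def X0_def power_integral_def
        using K less_square_level[of K L]
        by (intro sign_avg_integral_e_power_le B p1) (simp only: B_def block_subset)
      ultimately show "power_integral p S K \<le> X0 + 1 + \<tau>" by simp
    next
      fix r \<kappa> j assume r: "r \<le> L" and \<kappa>: "\<kappa> \<in> {1..p} \<rightarrow>\<^sub>E {..<(r + 1)\<^sup>2}" and j: "j \<in> {1..p}" "unique_at p \<kappa> j"
      have "(product_integral g p S \<kappa> / \<theta> r \<kappa> j) ^ (2 * s r) \<le> (\<Sum>j\<in>U \<kappa>. (product_integral g p S \<kappa> / \<theta> r \<kappa> j) ^ (2 * s r))"
        using j finU by (intro member_le_sum[of j]) (auto simp: U_def)
      also have "\<dots> \<le> (\<Sum>\<kappa>\<in>Q r. \<Sum>j\<in>U \<kappa>. (product_integral g p S \<kappa> / \<theta> r \<kappa> j) ^ (2 * s r))"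
        using \<kappa> finQ by (intro member_le_sum[of \<kappa>]) (auto simp: Q_def intro!: sum_nonneg)
      also have "\<dots> \<le> G2 S"
        unfolding G2_def using r by (intro member_le_sum[of r]) (auto intro!: sum_nonneg)
      finally have "(product_integral g p S \<kappa> / \<theta> r \<kappa> j) ^ (2 * s r) \<le> 1" using G2 by simp
      then have "\<bar>product_integral g p S \<kappa> / \<theta> r \<kappa> j\<bar> ^ (2 * s r) \<le> 1" by (simp only: power_even_abs even_mult_iff even_numeral simp_thms)
      moreover have ln: "ln (2 + real r) > 0" by simp
      then have "s r > 0" by (simp add: s_def)
      ultimately have "\<bar>product_integral g p S \<kappa> / \<theta> r \<kappa> j\<bar> \<le> 1" by (subst (asm) power_le_one_iff) auto
      moreover have "\<theta> r \<kappa> j > 0" using D ln by (simp add: \<theta>_def)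
      ultimately show "\<bar>product_integral g p S \<kappa>\<bar> \<le> D * ln (2 + real r) ^ p / sqrt (real (2 * level (\<kappa> j) + 1))"
        unfolding \<theta>_def[symmetric] by (simp add: divide_le_eq)
    qed
  qed
qed

text \<open>
Each inequality involves only finitely many signs, so the bounds obtained up to every level \<open>L\<close> pass to a cluster point
of the corresponding sign choices.
\<close>
lemma selection:
  assumes p: "p \<ge> 3" and g: "bdd_meas M g" and gb: "\<And>x. x \<in> space M \<Longrightarrow> \<bar>g x\<bar> \<le> b"
  shows "\<exists>C>0. \<exists>S. \<forall>r \<kappa>. (\<forall>j\<in>{1..p}. level (\<kappa> j) \<le> r) \<longrightarrow> \<bar>product_integral g p S \<kappa>\<bar> \<le> C \<and>
     (\<forall>j0\<in>{1..p}. unique_at p \<kappa> j0 \<longrightarrow> \<bar>product_integral g p S \<kappa>\<bar> \<le> C * ln (2 + real r) ^ p / sqrt (real (2 * level (\<kappa> j0) + 1)))"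
proof -
  obtain X D where D: "D > 0" and ex: "\<And>L. \<exists>S. (\<forall>K<(L + 1)\<^sup>2. power_integral p S K \<le> X) \<and>
     (\<forall>r\<le>L. \<forall>\<kappa>\<in>{1..p} \<rightarrow>\<^sub>E {..<(r + 1)\<^sup>2}. \<forall>j0\<in>{1..p}. unique_at p \<kappa> j0 \<longrightarrow>
        \<bar>product_integral g p S \<kappa>\<bar> \<le> D * ln (2 + real r) ^ p / sqrt (real (2 * level (\<kappa> j0) + 1)))"
    using selection_up_to_level[OF assms] by blast
  then obtain S where SX: "\<And>L K. K < (L + 1)\<^sup>2 \<Longrightarrow> power_integral p (S L) K \<le> X"
    and SP: "\<And>L r \<kappa> j0. r \<le> L \<Longrightarrow> \<kappa> \<in> {1..p} \<rightarrow>\<^sub>E {..<(r + 1)\<^sup>2} \<Longrightarrow> j0 \<in> {1..p} \<Longrightarrow> unique_at p \<kappa> j0 \<Longrightarrow>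
        \<bar>product_integral g p (S L) \<kappa>\<bar> \<le> D * ln (2 + real r) ^ p / sqrt (real (2 * level (\<kappa> j0) + 1))"
    by metis
  obtain R where R: "\<And>N. \<exists>L\<ge>N. S L \<inter> {..<N} = R \<inter> {..<N}" using sets_cluster_point by blast
  have RX: "power_integral p R K \<le> X" for K
  proof -
    obtain L where L: "L \<ge> (level K + 1)\<^sup>2" "S L \<inter> {..<(level K + 1)\<^sup>2} = R \<inter> {..<(level K + 1)\<^sup>2}" using R by blast
    have "e R K x = e (S L) K x" for x
      by (rule e_cong[OF L(2)[symmetric]]) (rule block_subset, simp)
    then have "power_integral p R K = power_integral p (S L) K" by (simp add: power_integral_def)
    moreover have "level K \<le> L" using L(1) by (simp add: power2_eq_square)
    then have "K < (L + 1)\<^sup>2" by (simp only: less_square_level)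
    ultimately show ?thesis using SX by simp
  qed
  have RP: "\<bar>product_integral g p R \<kappa>\<bar> \<le> D * ln (2 + real r) ^ p / sqrt (real (2 * level (\<kappa> j0) + 1))"
    if \<kappa>: "\<forall>j\<in>{1..p}. level (\<kappa> j) \<le> r" and j0: "j0 \<in> {1..p}" "unique_at p \<kappa> j0" for r \<kappa> j0
  proof -
    obtain L where L: "L \<ge> (r + 1)\<^sup>2" "S L \<inter> {..<(r + 1)\<^sup>2} = R \<inter> {..<(r + 1)\<^sup>2}" using R by blast
    define \<kappa>' where "\<kappa>' = restrict \<kappa> {1..p}"
    have "e R (\<kappa> j) x = e (S L) (\<kappa>' j) x" if "j \<in> {1..p}" for j x
      using that \<kappa> unfolding \<kappa>'_def restrict_apply if_P[OF that]
      by (intro e_cong[OF L(2)[symmetric]] block_subset) auto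
    then have "product_integral g p R \<kappa> = product_integral g p (S L) \<kappa>'"
      unfolding product_integral_def by (intro Bochner_Integration.integral_cong refl arg_cong2[where f = "(*)"] prod.cong) auto
    moreover have "r \<le> L" using L(1) by (simp add: power2_eq_square)
    moreover have "\<kappa>' \<in> {1..p} \<rightarrow>\<^sub>E {..<(r + 1)\<^sup>2}" unfolding \<kappa>'_def using \<kappa> less_square_level by auto
    moreover have "unique_at p \<kappa>' j0" "\<kappa>' j0 = \<kappa> j0" using j0 by (auto simp: unique_at_def \<kappa>'_def)
    ultimately show ?thesis using SP[of r L \<kappa>' j0] j0 by simp
  qed
  define C where "C = \<bar>b\<bar> * (real p * (measure M (space M) + X)) + D + 1"
  have X0: "X \<ge> 0" using RX[of 0] by (rule order_trans[rotated]) (simp add: power_integral_def)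
  have C0: "\<bar>b\<bar> * (real p * (measure M (space M) + X)) \<ge> 0" using X0 by simp
  have bnd: "\<bar>product_integral g p R \<kappa>\<bar> \<le> C" for \<kappa>
  proof -
    have "\<bar>product_integral g p R \<kappa>\<bar> \<le> (\<integral>x. \<bar>g x * (\<Prod>j\<in>{1..p}. e R (\<kappa> j) x)\<bar> \<partial>M)"
      unfolding product_integral_def by (rule integral_abs_bound)
    also have "\<dots> \<le> (\<integral>x. \<bar>b\<bar> * (\<Sum>j\<in>{1..p}. 1 + e R (\<kappa> j) x ^ (2 * p)) \<partial>M)"
    proof (rule bdd_meas_integral_mono)
      fix x assume x: "x \<in> space M"
      have "\<bar>g x * (\<Prod>j\<in>{1..p}. e R (\<kappa> j) x)\<bar> = \<bar>g x\<bar> * (\<Prod>j\<in>{1..p}. \<bar>e R (\<kappa> j) x\<bar>)"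
        by (simp add: abs_mult abs_prod)
      also have "\<dots> \<le> \<bar>b\<bar> * (\<Sum>j\<in>{1..p}. \<bar>e R (\<kappa> j) x\<bar> ^ card {1..p})"
        using gb[OF x] p by (intro mult_mono prod_le_sum_power) (auto intro!: prod_nonneg)
      also have "\<dots> \<le> \<bar>b\<bar> * (\<Sum>j\<in>{1..p}. 1 + e R (\<kappa> j) x ^ (2 * p))"
      proof (intro mult_left_mono sum_mono)
        fix j
        have "u \<le> 1 + u\<^sup>2" for u :: real using zero_le_power2[of "u - 1 / 2"] by (simp add: power2_eq_square algebra_simps)
        from this[of "\<bar>e R (\<kappa> j) x\<bar> ^ p"]
        show "\<bar>e R (\<kappa> j) x\<bar> ^ card {1..p} \<le> 1 + e R (\<kappa> j) x ^ (2 * p)"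
          by (simp add: power_even_abs flip: power_mult) (simp add: mult.commute power_even_abs)
      qed simp
      finally show "\<bar>g x * (\<Prod>j\<in>{1..p}. e R (\<kappa> j) x)\<bar> \<le> \<bar>b\<bar> * (\<Sum>j\<in>{1..p}. 1 + e R (\<kappa> j) x ^ (2 * p))" .
    qed (auto intro!: bdd_meas_abs bdd_meas_mult bdd_meas_prod bdd_meas_sum g)
    also have "\<dots> = \<bar>b\<bar> * (\<Sum>j\<in>{1..p}. measure M (space M) + power_integral p R (\<kappa> j))"
      unfolding integral_mult_right_zero power_integral_def
      by (subst Bochner_Integration.integral_sum) auto
    also have "\<dots> \<le> \<bar>b\<bar> * (\<Sum>j\<in>{1..p}. measure M (space M) + X)"
      by (intro mult_left_mono sum_mono add_left_mono RX) auto
    also have "\<dots> \<le> C" using D by (simp add: C_def)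
    finally show ?thesis .
  qed
  have "D \<le> C" using C0 by (simp add: C_def)
  then have RP': "\<bar>product_integral g p R \<kappa>\<bar> \<le> C * ln (2 + real r) ^ p / sqrt (real (2 * level (\<kappa> j0) + 1))"
    if "\<forall>j\<in>{1..p}. level (\<kappa> j) \<le> r" "j0 \<in> {1..p}" "unique_at p \<kappa> j0" for r \<kappa> j0
    by (intro order_trans[OF RP[OF that]] divide_right_mono mult_right_mono) auto
  have "C > 0" using C0 D by (simp add: C_def)
  then show ?thesis using bnd RP' by blast
qed

end

section \<open>Random bases of orthonormal systems\<close>

lemma block_lin_equiv:
  assumes "\<And>l. lin_equiv (2 * l + 1) (\<lambda>i. f (l\<^sup>2 + i)) (\<lambda>i. G (l\<^sup>2 + i))"
  shows "\<exists>R. \<forall>k x. G k x = (\<Sum>i\<in>block (level k). R k i * f i x)"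
    and "\<exists>R. \<forall>k x. f k x = (\<Sum>i\<in>block (level k). R k i * G i x)"
proof -
  have ex: "\<exists>R. \<forall>k x. H' k x = (\<Sum>i\<in>block (level k). R k i * H i x)"
    if rows: "\<forall>l. \<exists>R. \<forall>m<2 * l + 1. \<forall>x. H' (l\<^sup>2 + m) x = (\<Sum>i<2 * l + 1. R m i * H (l\<^sup>2 + i) x)" for H H' :: "nat \<Rightarrow> 'a \<Rightarrow> real"
  proof -
    obtain R where R0: "\<forall>l. \<forall>m<2 * l + 1. \<forall>x. H' (l\<^sup>2 + m) x = (\<Sum>i<2 * l + 1. R l m i * H (l\<^sup>2 + i) x)"
      using choice[OF rows] by blast
    then have R: "H' (l\<^sup>2 + m) x = (\<Sum>i<2 * l + 1. R l m i * H (l\<^sup>2 + i) x)" if "m < 2 * l + 1" for l m x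
      using that by blast
    have "H' k x = (\<Sum>i\<in>block (level k). R (level k) (k - (level k)\<^sup>2) (i - (level k)\<^sup>2) * H i x)" for k x
    proof -
      obtain m where m: "k = (level k)\<^sup>2 + m" "m < 2 * level k + 1"
        using level_block[of k] unfolding block_eq by blast
      have "k - (level k)\<^sup>2 = m" using m(1) by linarith
      then show ?thesis using R[OF m(2), of x] m(1) unfolding sum_block by simp
    qed
    then show ?thesis by (intro exI allI)
  qed
  have 1: "\<forall>l. \<exists>R. \<forall>m<2 * l + 1. \<forall>x. G (l\<^sup>2 + m) x = (\<Sum>i<2 * l + 1. R m i * f (l\<^sup>2 + i) x)"
    and 2: "\<forall>l. \<exists>R. \<forall>m<2 * l + 1. \<forall>x. f (l\<^sup>2 + m) x = (\<Sum>i<2 * l + 1. R m i * G (l\<^sup>2 + i) x)"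
    using assms unfolding lin_equiv_def by blast+
  show "\<exists>R. \<forall>k x. G k x = (\<Sum>i\<in>block (level k). R k i * f i x)" by (rule ex[OF 1])
  show "\<exists>R. \<forall>k x. f k x = (\<Sum>i\<in>block (level k). R k i * G i x)" by (rule ex[OF 2])
qed

lemma (in finite_measure) orthonormal_block_iff:
  "orthonormal (block l) G \<longleftrightarrow> orthonormal {..<2 * l + 1} (\<lambda>i. G (l\<^sup>2 + i))"
  unfolding orthonormal_def block_eq by (simp add: ball_simps)

text \<open>
The probabilistic part of the argument, for an arbitrary finite measure: all that it uses about the given orthonormal system is
that the squares of the functions in the block of level \<open>l\<close> sum to at most the size \<open>2 * l + 1\<close> of the
block.
\<close>
theorem (in finite_measure) random_orthonormal_basis:
  assumes p: "p \<ge> 3" and g: "bdd_meas M g" and gb: "\<And>x. x \<in> space M \<Longrightarrow> \<bar>g x\<bar> \<le> b"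
    and on: "orthonormal UNIV f"
    and sumsq: "\<And>l x. x \<in> space M \<Longrightarrow> (\<Sum>i\<in>block l. (f i x)\<^sup>2) \<le> real (2 * l + 1)"
  shows "\<exists>C>0. \<exists>e. orthonormal UNIV e \<and>
    (\<exists>R. \<forall>k x. e k x = (\<Sum>i\<in>block (level k). R k i * f i x)) \<and>
    (\<exists>R. \<forall>k x. f k x = (\<Sum>i\<in>block (level k). R k i * e i x)) \<and>
    (\<forall>r \<kappa>. (\<forall>j\<in>{1..p}. level (\<kappa> j) \<le> r) \<longrightarrow>
       \<bar>\<integral>x. g x * (\<Prod>j\<in>{1..p}. e (\<kappa> j) x) \<partial>M\<bar> \<le> C \<and>
       (\<forall>j0\<in>{1..p}. (\<forall>j\<in>{1..p}. j \<noteq> j0 \<longrightarrow> \<kappa> j \<noteq> \<kappa> j0) \<longrightarrow>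
          \<bar>\<integral>x. g x * (\<Prod>j\<in>{1..p}. e (\<kappa> j) x) \<partial>M\<bar> \<le> C * ln (2 + real r) ^ p / sqrt (real (2 * level (\<kappa> j0) + 1))))"
proof -
  obtain T where T: "T > 0" and good: "\<forall>n f. odd n \<longrightarrow> orthonormal {..<n} f \<longrightarrow> (\<forall>x\<in>space M. (\<Sum>i<n. (f i x)\<^sup>2) \<le> real n) \<longrightarrow>
    (\<exists>f'. orthonormal {..<n} f' \<and> (\<forall>x. (\<Sum>i<n. (f' i x)\<^sup>2) = (\<Sum>i<n. (f i x)\<^sup>2)) \<and> lin_equiv n f f' \<and>
      (\<Sum>i<n. \<integral>x. (f' i x) ^ 4 \<partial>M) \<le> T * real n \<and> pair_flat n (T * (1 + ln (real n))\<^sup>2 / real n) f')"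
    using good_block_basis by blast
  have "\<exists>f'. orthonormal {..<2 * l + 1} f' \<and> (\<forall>x. (\<Sum>i<2 * l + 1. (f' i x)\<^sup>2) = (\<Sum>i<2 * l + 1. (f (l\<^sup>2 + i) x)\<^sup>2)) \<and>
      lin_equiv (2 * l + 1) (\<lambda>i. f (l\<^sup>2 + i)) f' \<and>
      (\<Sum>i<2 * l + 1. \<integral>x. (f' i x) ^ 4 \<partial>M) \<le> T * real (2 * l + 1) \<and>
      pair_flat (2 * l + 1) (T * (1 + ln (real (2 * l + 1)))\<^sup>2 / real (2 * l + 1)) f'" for l
    using orthonormal_subset[OF on, of "block l"] sumsq[of _ l, unfolded sum_block]
    by (intro good[rule_format]) (auto simp only: orthonormal_block_iff even_mult_iff odd_add odd_one even_numeral subset_UNIV simp_thms)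
  then obtain h where h: "\<And>l. orthonormal {..<2 * l + 1} (h l)"
    "\<And>l x. (\<Sum>i<2 * l + 1. (h l i x)\<^sup>2) = (\<Sum>i<2 * l + 1. (f (l\<^sup>2 + i) x)\<^sup>2)"
    "\<And>l. lin_equiv (2 * l + 1) (\<lambda>i. f (l\<^sup>2 + i)) (h l)"
    "\<And>l. (\<Sum>i<2 * l + 1. \<integral>x. (h l i x) ^ 4 \<partial>M) \<le> T * real (2 * l + 1)"
    "\<And>l. pair_flat (2 * l + 1) (T * (1 + ln (real (2 * l + 1)))\<^sup>2 / real (2 * l + 1)) (h l)"
    by metis
  define F where "F k = h (level k) (k - (level k)\<^sup>2)" for k
  have F: "F (l\<^sup>2 + i) = h l i" if "i < 2 * l + 1" for l i
    unfolding F_def level_add[OF that] by simp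
  have F_block: "orthonormal (block l) F" for l
    using h(1)[of l] unfolding orthonormal_block_iff unfolding orthonormal_def by (simp add: F)
  have F_lin: "lin_equiv (2 * l + 1) (\<lambda>i. f (l\<^sup>2 + i)) (\<lambda>i. F (l\<^sup>2 + i))" for l
    using h(3)[of l] unfolding lin_equiv_def by (simp add: F)
  obtain R1 where R1: "\<And>k x. F k x = (\<Sum>i\<in>block (level k). R1 k i * f i x)"
    using block_lin_equiv(1)[OF F_lin] by blast
  have F_on: "orthonormal UNIV F"
    by (rule orthonormal_blockI[OF on R1 F_block])
  interpret fb: flat_blocks M F T
  proof
    show "T > 0" by (rule T)
    show "orthonormal UNIV F" by (rule F_on)
    fix l
    show "(\<Sum>i\<in>block l. (F i x)\<^sup>2) \<le> real (2 * l + 1)" if "x \<in> space M" for x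
      using sumsq[OF that, of l] h(2)[of l x] unfolding sum_block by (simp add: F)
    show "(\<Sum>i\<in>block l. \<integral>x. F i x ^ 4 \<partial>M) \<le> T * real (2 * l + 1)"
      using h(4)[of l] unfolding sum_block by (simp add: F)
    show "pair_flat (2 * l + 1) (T * (1 + ln (real (2 * l + 1)))\<^sup>2 / real (2 * l + 1)) (\<lambda>i. F (l\<^sup>2 + i))"
      using h(5)[of l] unfolding pair_flat_def by (simp add: F)
  qed
  obtain C S where C: "C > 0" and bound: "\<forall>r \<kappa>. (\<forall>j\<in>{1..p}. level (\<kappa> j) \<le> r) \<longrightarrow> \<bar>fb.product_integral g p S \<kappa>\<bar> \<le> C \<and>
     (\<forall>j0\<in>{1..p}. fb.unique_at p \<kappa> j0 \<longrightarrow> \<bar>fb.product_integral g p S \<kappa>\<bar> \<le> C * ln (2 + real r) ^ p / sqrt (real (2 * level (\<kappa> j0) + 1)))"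
    using fb.selection[OF p g gb] by blast
  define e where "e = fb.e S"
  have e_rot: "e (l\<^sup>2 + m) = random_rotation (2 * l + 1) {i. l\<^sup>2 + i \<in> S} (\<lambda>i. F (l\<^sup>2 + i)) m"
    if "m < 2 * l + 1" for l m
    unfolding e_def by (rule ext) (rule fb.e_random_rotation[OF that])
  have e_block: "orthonormal (block l) e" for l
  proof -
    have "orthonormal {..<2 * l + 1} (random_rotation (2 * l + 1) {i. l\<^sup>2 + i \<in> S} (\<lambda>i. F (l\<^sup>2 + i)))"
      using F_block[of l] unfolding orthonormal_block_iff by (rule random_rotation_orthonormal[rotated]) simp
    then show ?thesis unfolding orthonormal_block_iff unfolding orthonormal_def by (simp add: e_rot)
  qed
  have e_lin: "lin_equiv (2 * l + 1) (\<lambda>i. f (l\<^sup>2 + i)) (\<lambda>i. e (l\<^sup>2 + i))" for l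
  proof -
    have "lin_equiv (2 * l + 1) (\<lambda>i. F (l\<^sup>2 + i)) (random_rotation (2 * l + 1) {i. l\<^sup>2 + i \<in> S} (\<lambda>i. F (l\<^sup>2 + i)))"
      by (rule lin_equiv_random_rotation) simp
    then have "lin_equiv (2 * l + 1) (\<lambda>i. F (l\<^sup>2 + i)) (\<lambda>i. e (l\<^sup>2 + i))"
      unfolding lin_equiv_def by (simp add: e_rot)
    then show ?thesis by (rule lin_equiv_trans[OF F_lin])
  qed
  obtain R2 where R2: "\<And>k x. e k x = (\<Sum>i\<in>block (level k). R2 k i * f i x)"
    using block_lin_equiv(1)[OF e_lin] by blast
  have "orthonormal UNIV e"
    by (rule orthonormal_blockI[OF on R2 e_block])
  then show ?thesis
    using C bound block_lin_equiv[OF e_lin]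
    unfolding fb.product_integral_def fb.unique_at_def e_def[symmetric] by blast
qed

section \<open>Polynomials and the Laplacian of the sphere\<close>

text \<open>
Polynomial functions of degree less than \<open>d\<close>. With the strict inequality the zero space is the case \<open>d = 0\<close>, so that
statements on the lowering of the degree have no exception at the constants.
\<close>
inductive poly_lt :: "nat \<Rightarrow> (real ^ 3 \<Rightarrow> real) \<Rightarrow> bool" where
  poly_lt_zero: "poly_lt d (\<lambda>x. 0)"
| poly_lt_const: "poly_lt (Suc d) (\<lambda>x. c)"
| poly_lt_coord: "poly_lt d F \<Longrightarrow> poly_lt (Suc d) (\<lambda>x. x $ i * F x)"
| poly_lt_add: "poly_lt d F \<Longrightarrow> poly_lt d G \<Longrightarrow> poly_lt d (\<lambda>x. F x + G x)"

lemma poly_lt_0D: "poly_lt d F \<Longrightarrow> d = 0 \<Longrightarrow> F = (\<lambda>x. 0)"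
  by (induction rule: poly_lt.induct) auto

lemma poly_lt_cmult: "poly_lt d F \<Longrightarrow> poly_lt d (\<lambda>x. c * F x)"
proof (induction rule: poly_lt.induct)
  case (poly_lt_coord d F i)
  then show ?case using poly_lt.poly_lt_coord[of d "\<lambda>x. c * F x" i] by (simp add: mult_ac)
qed (auto intro: poly_lt.intros simp: distrib_left)

lemma poly_lt_uminus: "poly_lt d F \<Longrightarrow> poly_lt d (\<lambda>x. - F x)"
  using poly_lt_cmult[of d F "-1"] by simp

lemma poly_lt_diff: "poly_lt d F \<Longrightarrow> poly_lt d G \<Longrightarrow> poly_lt d (\<lambda>x. F x - G x)"
  using poly_lt_add[of d F "\<lambda>x. - G x"] poly_lt_uminus by simp

lemma poly_lt_sum: "(\<And>i. i \<in> I \<Longrightarrow> poly_lt d (F i)) \<Longrightarrow> poly_lt d (\<lambda>x. \<Sum>i\<in>I. F i x)"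
  by (induction I rule: infinite_finite_induct) (auto intro: poly_lt.intros)

lemma poly_lt_if: "poly_lt d F \<Longrightarrow> poly_lt d (\<lambda>x. if P then F x else 0)"
  by (cases P) (auto intro: poly_lt_zero)

lemma poly_lt_Suc: "poly_lt d F \<Longrightarrow> poly_lt (Suc d) F"
  by (induction rule: poly_lt.induct) (auto intro: poly_lt.intros)

lemma poly_lt_mono: "poly_lt d F \<Longrightarrow> d \<le> d' \<Longrightarrow> poly_lt d' F"
  by (rule dec_induct[of d d'], assumption, assumption) (rule poly_lt_Suc)

lemma poly_lt_mult: "poly_lt d F \<Longrightarrow> poly_lt (Suc d') G \<Longrightarrow> poly_lt (d + d') (\<lambda>x. F x * G x)"
proof (induction rule: poly_lt.induct)
  case (poly_lt_const d c)
  then show ?case using poly_lt_cmult[of "Suc d'" G c] by (auto intro: poly_lt_mono)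
next
  case (poly_lt_coord d F i)
  then show ?case using poly_lt.poly_lt_coord[of "d + d'" "\<lambda>x. F x * G x" i] by (simp add: mult_ac)
qed (auto intro: poly_lt.intros simp: distrib_right)

lemma poly_lt_differentiable: "poly_lt d F \<Longrightarrow> F differentiable (at x)"
proof (induction rule: poly_lt.induct)
  case (poly_lt_coord d F i)
  have "(\<lambda>x. x $ i) differentiable (at x)"
    using bounded_linear_vec_nth bounded_linear_imp_differentiable by blast
  then show ?case using poly_lt_coord.IH by (rule differentiable_mult)
qed auto

lemma poly_lt_continuous_on: "poly_lt d F \<Longrightarrow> continuous_on S F"
  by (simp add: continuous_at_imp_continuous_on differentiable_imp_continuous_within poly_lt_differentiable)

lemma partial_deriv_has_derivative: "(F has_derivative D) (at x) \<Longrightarrow> partial_deriv i F x = D (axis i 1)"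
  unfolding partial_deriv_def by (simp add: frechet_derivative_at[symmetric])

lemma partial_deriv_const [simp]: "partial_deriv i (\<lambda>x. c) = (\<lambda>x. 0)"
  by (rule ext) (simp add: partial_deriv_def)

lemma partial_deriv_add:
  assumes "F differentiable (at x)" "G differentiable (at x)"
  shows "partial_deriv i (\<lambda>x. F x + G x) x = partial_deriv i F x + partial_deriv i G x"
proof -
  obtain D E where DE: "(F has_derivative D) (at x)" "(G has_derivative E) (at x)"
    using assms unfolding differentiable_def by blast
  show ?thesis
    using partial_deriv_has_derivative[OF has_derivative_add[OF DE]]
    by (simp add: partial_deriv_has_derivative[OF DE(1)] partial_deriv_has_derivative[OF DE(2)])
qed

lemma partial_deriv_mult:
  assumes "F differentiable (at x)" "G differentiable (at x)"
  shows "partial_deriv i (\<lambda>x. F x * G x) x = F x * partial_deriv i G x + partial_deriv i F x * G x"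
proof -
  obtain D E where DE: "(F has_derivative D) (at x)" "(G has_derivative E) (at x)"
    using assms unfolding differentiable_def by blast
  show ?thesis
    using partial_deriv_has_derivative[OF has_derivative_mult[OF DE]]
    by (simp add: partial_deriv_has_derivative[OF DE(1)] partial_deriv_has_derivative[OF DE(2)])
qed

lemma partial_deriv_coord: "partial_deriv i (\<lambda>x :: real ^ 'n. x $ j) x = (if i = j then 1 else 0)"
proof -
  have "((\<lambda>x::real^'n. x $ j) has_derivative (\<lambda>x. x $ j)) (at x)"
    by (rule bounded_linear_imp_has_derivative[OF bounded_linear_vec_nth])
  then show ?thesis by (simp add: partial_deriv_has_derivative axis_def)
qed

lemma partial_deriv_coord_mult:
  assumes "poly_lt d F"
  shows "partial_deriv i (\<lambda>x. x $ j * F x) = (\<lambda>x. (if i = j then F x else 0) + x $ j * partial_deriv i F x)"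
proof
  fix x
  have "(\<lambda>x::real^3. x $ j) differentiable (at x)"
    using bounded_linear_vec_nth bounded_linear_imp_differentiable by blast
  then show "partial_deriv i (\<lambda>x. x $ j * F x) x = (if i = j then F x else 0) + x $ j * partial_deriv i F x"
    using poly_lt_differentiable[OF assms] by (simp add: partial_deriv_mult partial_deriv_coord)
qed

lemma partial_deriv_poly_lt_add:
  assumes "poly_lt d F" "poly_lt d' G"
  shows "partial_deriv i (\<lambda>x. F x + G x) = (\<lambda>x. partial_deriv i F x + partial_deriv i G x)"
  by (rule ext) (intro partial_deriv_add poly_lt_differentiable[OF assms(1)] poly_lt_differentiable[OF assms(2)])

lemma partial_deriv_poly_lt_cmult:
  assumes "poly_lt d F"
  shows "partial_deriv i (\<lambda>x. c * F x) = (\<lambda>x. c * partial_deriv i F x)"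
  by (rule ext) (simp add: partial_deriv_mult poly_lt_differentiable[OF assms])

lemma partial_deriv_poly_lt_diff:
  assumes "poly_lt d F" "poly_lt d' G"
  shows "partial_deriv i (\<lambda>x. F x - G x) = (\<lambda>x. partial_deriv i F x - partial_deriv i G x)"
  using partial_deriv_poly_lt_add[OF assms(1) poly_lt_cmult[OF assms(2), of "-1"], of i] partial_deriv_poly_lt_cmult[OF assms(2), of i "-1"]
  by simp

lemma partial_deriv_poly_lt_sum:
  assumes "\<And>k. k \<in> I \<Longrightarrow> poly_lt d (F k)"
  shows "partial_deriv i (\<lambda>x. \<Sum>k\<in>I. F k x) = (\<lambda>x. \<Sum>k\<in>I. partial_deriv i (F k) x)"
  using assms
proof (induction I rule: infinite_finite_induct)
  case (insert k I)
  have "partial_deriv i (\<lambda>x. F k x + (\<Sum>k\<in>I. F k x)) = (\<lambda>x. partial_deriv i (F k) x + partial_deriv i (\<lambda>x. \<Sum>k\<in>I. F k x) x)"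
    by (rule partial_deriv_poly_lt_add[OF _ poly_lt_sum]) (use insert.prems in auto)
  then show ?case using insert by simp
qed simp_all

lemma poly_lt_partial_deriv: "poly_lt d F \<Longrightarrow> poly_lt (d - 1) (partial_deriv i F)"
proof (induction rule: poly_lt.induct)
  case (poly_lt_coord d F j)
  show ?case
  proof (cases d)
    case 0
    then have "F = (\<lambda>x. 0)" using poly_lt_0D poly_lt_coord by blast
    then show ?thesis by (simp add: poly_lt_zero)
  next
    case (Suc e)
    then have "poly_lt d (\<lambda>x. x $ j * partial_deriv i F x)" using poly_lt_coord.IH by (auto intro: poly_lt.poly_lt_coord)
    moreover have "poly_lt d (\<lambda>x. if i = j then F x else 0)" using poly_lt_coord.hyps by (rule poly_lt_if)
    ultimately show ?thesis
      unfolding partial_deriv_coord_mult[OF poly_lt_coord.hyps] by (auto intro: poly_lt_add)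
  qed
next
  case (poly_lt_add d F G)
  then show ?case by (simp add: partial_deriv_poly_lt_add poly_lt.poly_lt_add)
qed (auto intro: poly_lt.intros)

lemma poly_lt_partial_deriv': "poly_lt d F \<Longrightarrow> poly_lt d (partial_deriv i F)"
  using poly_lt_partial_deriv poly_lt_mono diff_le_self by blast

lemma partial_deriv_commute: "poly_lt d F \<Longrightarrow> partial_deriv i (partial_deriv j F) = partial_deriv j (partial_deriv i F)"
proof (induction rule: poly_lt.induct)
  case (poly_lt_coord d F k)
  note P = poly_lt_partial_deriv'[OF poly_lt_coord.hyps]
  have Q: "poly_lt (Suc d) (\<lambda>x. x $ k * partial_deriv j F x)" for j using P by (rule poly_lt.poly_lt_coord)
  have I: "poly_lt d (\<lambda>x. if j = k then F x else 0)" for j using poly_lt_coord.hyps by (rule poly_lt_if)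
  have *: "partial_deriv i (partial_deriv j (\<lambda>x. x $ k * F x)) =
    (\<lambda>x. (if j = k then partial_deriv i F x else 0) + ((if i = k then partial_deriv j F x else 0) + x $ k * partial_deriv i (partial_deriv j F) x))" for i j
    unfolding partial_deriv_coord_mult[OF poly_lt_coord.hyps] partial_deriv_poly_lt_add[OF I Q] partial_deriv_coord_mult[OF P]
    by (cases "j = k") auto
  show ?case unfolding * by (rule ext) (simp add: poly_lt_coord.IH)
next
  case (poly_lt_add d F G)
  then show ?case by (simp add: partial_deriv_poly_lt_add poly_lt_partial_deriv' partial_deriv_poly_lt_add[OF poly_lt_partial_deriv' poly_lt_partial_deriv'])
qed auto

lemma poly_lt_C_k_on: "poly_lt d F \<Longrightarrow> C_k_on k F U"
  by (induction k arbitrary: F) (auto intro: poly_lt_continuous_on poly_lt_differentiable poly_lt_partial_deriv')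

lemma poly_lt_smooth_on_S2: "poly_lt d F \<Longrightarrow> smooth_on_S2 F"
  unfolding smooth_on_S2_def by (intro exI[of _ UNIV] exI[of _ F]) (auto intro: poly_lt_C_k_on)

lemma linear_axis_expansion:
  fixes f :: "real ^ 'n \<Rightarrow> 'b :: real_vector"
  assumes "linear f"
  shows "f x = (\<Sum>j\<in>UNIV. (x $ j) *\<^sub>R f (axis j 1))"
proof -
  have "f x = f (\<Sum>j\<in>UNIV. (x $ j) *\<^sub>R axis j 1)"
    using basis_expansion[of x] by (simp only: scalar_mult_eq_scaleR)
  then show ?thesis by (simp add: linear_sum[OF assms] linear_scale[OF assms])
qed

lemma poly_lt_linear_compose:
  assumes R: "linear R" and F: "poly_lt d F"
  shows "poly_lt d (\<lambda>x. F (R x))"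
  using F
proof (induction rule: poly_lt.induct)
  case (poly_lt_coord d F i)
  have Ri: "R x $ i = (\<Sum>j\<in>UNIV. R (axis j 1) $ i * x $ j)" for x
    by (subst linear_axis_expansion[OF R]) (simp add: mult.commute)
  have "(\<lambda>x. R x $ i * F (R x)) = (\<lambda>x. \<Sum>j\<in>UNIV. R (axis j 1) $ i * (x $ j * F (R x)))"
    by (rule ext, subst Ri) (simp add: sum_distrib_left sum_distrib_right mult_ac)
  then show ?case using poly_lt_coord.IH by (auto intro!: poly_lt_sum poly_lt_cmult poly_lt.poly_lt_coord)
qed (auto intro: poly_lt.intros)

lemma ex_poly_lt_real_polynomial_function:
  "real_polynomial_function (F :: real ^ 3 \<Rightarrow> real) \<Longrightarrow> \<exists>d. poly_lt d F"
proof (induction rule: real_polynomial_function.induct)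
  case (linear f)
  have "poly_lt 2 (\<lambda>x. f x)"
  proof -
    have lin: "linear f" using linear by (rule bounded_linear.linear)
    have "f x = (\<Sum>j\<in>UNIV. f (axis j 1) * (x $ j * 1))" for x
      by (subst linear_axis_expansion[OF lin]) (simp add: mult.commute)
    then have "f = (\<lambda>x. \<Sum>j\<in>UNIV. f (axis j 1) * (x $ j * 1))" by (rule ext)
    moreover have "poly_lt (Suc (Suc 0)) (\<lambda>x. \<Sum>j\<in>UNIV. f (axis j 1) * (x $ j * 1))"
      by (intro poly_lt_sum poly_lt_cmult poly_lt_coord poly_lt_const)
    ultimately show ?thesis by (simp add: numeral_2_eq_2)
  qed
  then show ?case by blast
next
  case (const c)
  then show ?case using poly_lt_const by blast
next
  case (add f g)
  then obtain d d' where "poly_lt d f" "poly_lt d' g" by blast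
  then have "poly_lt (max d d') f" "poly_lt (max d d') g" by (auto intro: poly_lt_mono)
  then show ?case using poly_lt_add by blast
next
  case (mult f g)
  then obtain d d' where "poly_lt d f" "poly_lt d' g" by blast
  then show ?case using poly_lt_mult[of d f d' g] poly_lt_Suc by blast
qed

text \<open>
The Euler field \<open>x \<bullet> \<nabla>\<close>, which multiplies a homogeneous polynomial by its degree.
\<close>
definition euler :: "(real ^ 3 \<Rightarrow> real) \<Rightarrow> real ^ 3 \<Rightarrow> real" where
  "euler F x = (\<Sum>j\<in>UNIV. x $ j * partial_deriv j F x)"

text \<open>
In terms of the Euler field \<open>E\<close>, the Laplacian of the unit sphere of \<open>\<real>\<^sup>3\<close> is
\<open>\<Delta> - E\<^sup>2 - E\<close>. On a homogeneous polynomial of degree \<open>d\<close> the last two terms give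
\<open>- d * (d + 1)\<close>.
\<close>
definition lap_poly :: "(real ^ 3 \<Rightarrow> real) \<Rightarrow> real ^ 3 \<Rightarrow> real" where
  "lap_poly F x = (\<Sum>i\<in>UNIV. partial_deriv i (partial_deriv i F) x) - euler (euler F) x - euler F x"

lemma poly_lt_euler: "poly_lt d F \<Longrightarrow> poly_lt d (euler F)"
proof -
  assume F: "poly_lt d F"
  have "poly_lt d (\<lambda>x. x $ j * partial_deriv j F x)" for j
  proof (cases d)
    case 0
    then have "F = (\<lambda>x. 0)" using poly_lt_0D F by blast
    then show ?thesis by (simp add: poly_lt_zero)
  next
    case (Suc e)
    then show ?thesis using poly_lt_partial_deriv[OF F] by (auto intro: poly_lt_coord)
  qed
  then show ?thesis unfolding euler_def[abs_def] by (intro poly_lt_sum) auto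
qed

lemma euler_add: "poly_lt d F \<Longrightarrow> poly_lt d' G \<Longrightarrow> euler (\<lambda>x. F x + G x) = (\<lambda>x. euler F x + euler G x)"
  by (rule ext) (simp add: euler_def partial_deriv_poly_lt_add sum.distrib distrib_left)

lemma euler_cmult: "poly_lt d F \<Longrightarrow> euler (\<lambda>x. c * F x) = (\<lambda>x. c * euler F x)"
  by (rule ext) (simp add: euler_def partial_deriv_poly_lt_cmult sum_distrib_left mult_ac)

lemma euler_coord: "poly_lt d F \<Longrightarrow> euler (\<lambda>x. x $ i * F x) = (\<lambda>x. x $ i * F x + x $ i * euler F x)"
proof
  fix x assume F: "poly_lt d F"
  have "euler (\<lambda>x. x $ i * F x) x = (\<Sum>j\<in>UNIV. (if j = i then x $ i * F x else 0) + x $ i * (x $ j * partial_deriv j F x))"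
    unfolding euler_def partial_deriv_coord_mult[OF F] by (intro sum.cong refl) (auto simp: distrib_left mult_ac)
  then show "euler (\<lambda>x. x $ i * F x) x = x $ i * F x + x $ i * euler F x"
    by (simp add: euler_def sum.distrib sum_distrib_left)
qed

lemma euler_euler:
  assumes F: "poly_lt d F"
  shows "euler (euler F) x = euler F x + (\<Sum>j\<in>UNIV. \<Sum>i\<in>UNIV. x $ j * (x $ i * partial_deriv j (partial_deriv i F) x))"
proof -
  note P = poly_lt_partial_deriv'[OF F]
  have "partial_deriv j (euler F) = (\<lambda>x. \<Sum>i\<in>UNIV. partial_deriv j (\<lambda>x. x $ i * partial_deriv i F x) x)" for j
    unfolding euler_def[abs_def] by (rule partial_deriv_poly_lt_sum[OF poly_lt_coord[OF P]])
  then have "partial_deriv j (euler F) x = partial_deriv j F x + (\<Sum>i\<in>UNIV. x $ i * partial_deriv j (partial_deriv i F) x)" for j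
    by (simp add: partial_deriv_coord_mult[OF P] sum.distrib)
  then show ?thesis
    unfolding euler_def[of "euler F"] by (simp add: distrib_left sum.distrib sum_distrib_left euler_def[of F])
qed

text \<open>
The Euler field acts on the top-degree part as multiplication by the degree. The induction over the construction of the
polynomial avoids its decomposition into homogeneous parts.
\<close>
lemma poly_lt_euler_drop: "poly_lt d F \<Longrightarrow> poly_lt (d - 1) (\<lambda>x. euler F x - real (d - 1) * F x)"
proof (induction rule: poly_lt.induct)
  case (poly_lt_zero d)
  then show ?case by (simp add: euler_def poly_lt.poly_lt_zero)
next
  case (poly_lt_const d c)
  then show ?case by (cases d) (auto simp: euler_def intro: poly_lt.poly_lt_zero poly_lt.poly_lt_const)
next
  case (poly_lt_coord d F i)
  show ?case
  proof (cases d)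
    case 0
    then have "F = (\<lambda>x. 0)" using poly_lt_0D poly_lt_coord by blast
    then show ?thesis by (simp add: euler_def poly_lt.poly_lt_zero)
  next
    case (Suc e)
    have "poly_lt (Suc e) (\<lambda>x. x $ i * (euler F x - real e * F x))" using poly_lt_coord.IH Suc by (auto intro: poly_lt.poly_lt_coord)
    moreover have "(\<lambda>x. x $ i * (euler F x - real e * F x)) = (\<lambda>x. euler (\<lambda>x. x $ i * F x) x - real d * (x $ i * F x))"
      unfolding euler_coord[OF poly_lt_coord.hyps] Suc by (simp add: algebra_simps)
    ultimately show ?thesis using Suc by simp
  qed
next
  case (poly_lt_add d F G)
  have "(\<lambda>x. euler (\<lambda>x. F x + G x) x - real (d - 1) * (F x + G x)) =
    (\<lambda>x. (euler F x - real (d - 1) * F x) + (euler G x - real (d - 1) * G x))"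
    unfolding euler_add[OF poly_lt_add.hyps] by (simp add: algebra_simps)
  then show ?case using poly_lt.poly_lt_add[OF poly_lt_add.IH] by simp
qed

text \<open>
Here \<open>E\<^sup>2 + E - d * (d + 1) = (E + d + 1) * (E - d)\<close>, and \<open>E - d\<close> lowers the degree.
\<close>
lemma poly_lt_lap_drop:
  assumes F: "poly_lt (Suc d) F"
  shows "poly_lt d (\<lambda>x. lap_poly F x + real d * (real d + 1) * F x)"
proof -
  define G where "G x = euler F x - real d * F x" for x
  have G: "poly_lt d G" using poly_lt_euler_drop[OF F] by (simp add: G_def[abs_def])
  have "euler (euler F) x = euler G x + real d * euler F x" for x
  proof -
    have "euler F = (\<lambda>x. G x + real d * F x)" by (simp add: G_def)
    then have "euler (euler F) = (\<lambda>x. euler G x + real d * euler F x)"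
      using euler_add[OF G poly_lt_cmult[OF F]] euler_cmult[OF F] by metis
    then show ?thesis by simp
  qed
  then have "(\<lambda>x. lap_poly F x + real d * (real d + 1) * F x) =
     (\<lambda>x. (\<Sum>i\<in>UNIV. partial_deriv i (partial_deriv i F) x) - euler G x - (real d + 1) * G x)"
    by (simp add: lap_poly_def G_def algebra_simps)
  moreover have "poly_lt d (partial_deriv i (partial_deriv i F))" for i
    using poly_lt_partial_deriv'[OF poly_lt_partial_deriv[OF F]] by simp
  ultimately show ?thesis
    using poly_lt_euler[OF G] poly_lt_cmult[OF G] by (auto intro!: poly_lt_diff poly_lt_sum)
qed

lemma poly_lt_lap: "poly_lt d F \<Longrightarrow> poly_lt d (lap_poly F)"
  unfolding lap_poly_def[abs_def] by (intro poly_lt_diff poly_lt_sum poly_lt_partial_deriv' poly_lt_euler)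

lemma has_derivative_sgn:
  fixes x :: "real ^ 3"
  assumes "norm x = 1"
  shows "(sgn has_derivative (\<lambda>v. v - (x \<bullet> v) *\<^sub>R x)) (at x)"
proof -
  have "((\<lambda>y. inverse (norm y) *\<^sub>R y) has_derivative
      (\<lambda>v. inverse (norm x) *\<^sub>R v + (- (inverse (norm x) * (sgn x \<bullet> v) * inverse (norm x))) *\<^sub>R x)) (at x)"
  proof -
    have n: "(norm has_derivative (\<lambda>h. h \<bullet> sgn x)) (at x)"
      using assms by (intro has_derivative_norm) auto
    show ?thesis
      using assms by (auto intro!: derivative_eq_intros n simp: inner_commute)
  qed
  moreover have "sgn x = x" using assms by (simp add: sgn_div_norm)
  ultimately show ?thesis using assms by (simp add: sgn_div_norm[abs_def])
qed

lemma partial_deriv_sgn: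
  assumes x: "norm x = 1" and H: "H differentiable (at x)"
  shows "(\<lambda>y. H (sgn y)) differentiable (at x)"
    and "partial_deriv i (\<lambda>y. H (sgn y)) x = partial_deriv i H x - x $ i * euler H x"
proof -
  obtain D where D: "(H has_derivative D) (at x)" using H unfolding differentiable_def by blast
  have sx: "sgn x = x" using x by (simp add: sgn_div_norm)
  have c: "((\<lambda>y. H (sgn y)) has_derivative (\<lambda>v. D (v - (x \<bullet> v) *\<^sub>R x))) (at x)"
    using has_derivative_compose[OF has_derivative_sgn[OF x], of H D] D sx by simp
  then show "(\<lambda>y. H (sgn y)) differentiable (at x)" unfolding differentiable_def by blast
  have lin: "linear D" using D by (rule has_derivative_linear)
  have "D x = euler H x"
    by (subst linear_axis_expansion[OF lin]) (simp add: euler_def partial_deriv_has_derivative[OF D])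
  moreover have "x \<bullet> axis i 1 = x $ i" by (simp add: inner_axis)
  ultimately show "partial_deriv i (\<lambda>y. H (sgn y)) x = partial_deriv i H x - x $ i * euler H x"
    unfolding partial_deriv_has_derivative[OF c] partial_deriv_has_derivative[OF D]
    by (simp add: linear_diff[OF lin] linear_scale[OF lin])
qed

text \<open>
Composition with the radial projection replaces the gradient by its tangential part. Applying this twice gives the
divergence of the field \<open>X = \<nabla>F - x * E F\<close> minus the radial component of its radial derivative.
\<close>
lemma laplace_S2_poly_lt:
  assumes F: "poly_lt d F" and x: "x \<in> S2"
  shows "laplace_S2 F x = lap_poly F x"
proof -
  have nx: "norm x = 1" using x by simp
  define X where "X i y = partial_deriv i F y - y $ i * euler F y" for i y
  have EF: "poly_lt d (euler F)" by (rule poly_lt_euler[OF F])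
  have Xp: "poly_lt (Suc d) (X i)" for i
    unfolding X_def[abs_def] by (intro poly_lt_diff poly_lt_coord EF poly_lt_Suc poly_lt_partial_deriv'[OF F])
  have grad: "grad_S2 F y $ i = X i y" if "norm y = 1" for y i
    using partial_deriv_sgn(2)[OF that poly_lt_differentiable[OF F]] by (simp add: grad_S2_def X_def)
  have "partial_deriv i (\<lambda>y. grad_S2 F (sgn y) $ i) x = partial_deriv i (X i) x - x $ i * euler (X i) x" for i
  proof -
    have "frechet_derivative (\<lambda>y. X i (sgn y)) (at x) = frechet_derivative (\<lambda>y. grad_S2 F (sgn y) $ i) (at x)"
    proof (rule frechet_derivative_transform_within_open[where X = "- {0}"])
      show "(\<lambda>y. X i (sgn y)) differentiable at x"
        by (rule partial_deriv_sgn(1)[OF nx poly_lt_differentiable[OF Xp]])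
      show "x \<in> - {0}" using nx by auto
      show "X i (sgn y) = grad_S2 F (sgn y) $ i" if "y \<in> - {0}" for y
        using that by (simp add: grad norm_sgn)
    qed auto
    then have "partial_deriv i (\<lambda>y. grad_S2 F (sgn y) $ i) x = partial_deriv i (\<lambda>y. X i (sgn y)) x"
      by (simp add: partial_deriv_def)
    then show ?thesis using partial_deriv_sgn(2)[OF nx poly_lt_differentiable[OF Xp]] by simp
  qed
  then have lap: "laplace_S2 F x = (\<Sum>i\<in>UNIV. partial_deriv i (X i) x) - (\<Sum>i\<in>UNIV. x $ i * euler (X i) x)"
    by (simp add: laplace_S2_def div_S2_def sum_subtractf)
  have nsq: "(\<Sum>i\<in>UNIV. x $ i * x $ i) = 1"
    using nx by (simp add: norm_eq_1 inner_vec_def)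
  have dX: "partial_deriv i (X i) x = partial_deriv i (partial_deriv i F) x - euler F x - x $ i * partial_deriv i (euler F) x" for i
    unfolding X_def[abs_def] partial_deriv_poly_lt_diff[OF poly_lt_partial_deriv'[OF F] poly_lt_coord[OF EF]] partial_deriv_coord_mult[OF EF] by simp
  have eX: "euler (X i) x = euler (partial_deriv i F) x - (x $ i * euler F x + x $ i * euler (euler F) x)" for i
  proof -
    have "euler (X i) = (\<lambda>y. euler (partial_deriv i F) y + (-1) * euler (\<lambda>y. y $ i * euler F y) y)"
      using euler_add[OF poly_lt_partial_deriv'[OF F] poly_lt_cmult[OF poly_lt_coord[OF EF], of "-1"]] euler_cmult[OF poly_lt_coord[OF EF], of "-1"]
      by (simp add: X_def[abs_def])
    then show ?thesis by (simp add: euler_coord[OF EF])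
  qed
  have eD: "(\<Sum>i\<in>UNIV. x $ i * euler (partial_deriv i F) x) = euler (euler F) x - euler F x"
  proof -
    have "euler (euler F) x = euler F x + (\<Sum>j\<in>UNIV. \<Sum>i\<in>UNIV. x $ j * (x $ i * partial_deriv j (partial_deriv i F) x))"
      by (rule euler_euler[OF F])
    also have "(\<Sum>j\<in>UNIV. \<Sum>i\<in>UNIV. x $ j * (x $ i * partial_deriv j (partial_deriv i F) x)) = (\<Sum>i\<in>UNIV. x $ i * euler (partial_deriv i F) x)"
      unfolding euler_def sum_distrib_left by (subst sum.swap) (simp add: mult_ac)
    finally show ?thesis by simp
  qed
  have "(\<Sum>i\<in>UNIV. partial_deriv i (X i) x) = (\<Sum>i\<in>UNIV. partial_deriv i (partial_deriv i F) x) - 3 * euler F x - euler (euler F) x"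
    unfolding dX by (simp add: sum_subtractf euler_def[of "euler F"])
  moreover have "(\<Sum>i\<in>UNIV. x $ i * euler (X i) x) = (euler (euler F) x - euler F x) - (\<Sum>i\<in>UNIV. x $ i * x $ i) * (euler F x + euler (euler F) x)"
    unfolding eX eD[symmetric] by (simp add: right_diff_distrib sum_subtractf sum_distrib_right distrib_left sum.distrib mult.assoc)
  ultimately show ?thesis
    unfolding lap nsq by (simp add: lap_poly_def)
qed

text \<open>
The generator of the rotations in the plane of the coordinates \<open>i\<close> and \<open>j\<close>.
\<close>
definition rot_field :: "3 \<Rightarrow> 3 \<Rightarrow> (real ^ 3 \<Rightarrow> real) \<Rightarrow> real ^ 3 \<Rightarrow> real" where
  "rot_field i j F x = x $ i * partial_deriv j F x - x $ j * partial_deriv i F x"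

lemma poly_lt_rot_field: "poly_lt d F \<Longrightarrow> poly_lt d (rot_field i j F)"
proof -
  assume F: "poly_lt d F"
  have "poly_lt d (\<lambda>x. x $ i * partial_deriv j F x)" for i j
  proof (cases d)
    case 0
    then have "F = (\<lambda>x. 0)" using poly_lt_0D F by blast
    then show ?thesis by (simp add: poly_lt_zero)
  next
    case (Suc e)
    then show ?thesis using poly_lt_partial_deriv[OF F] by (auto intro: poly_lt_coord)
  qed
  then show ?thesis unfolding rot_field_def[abs_def] by (intro poly_lt_diff)
qed

lemma rot_field_mult:
  assumes "poly_lt d F" "poly_lt d' G"
  shows "rot_field i j (\<lambda>x. F x * G x) x = rot_field i j F x * G x + F x * rot_field i j G x"
  using poly_lt_differentiable[OF assms(1)] poly_lt_differentiable[OF assms(2)]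
  by (simp add: rot_field_def partial_deriv_mult algebra_simps)

text \<open>
The Casimir identity: \<open>\<bar>x\<bar>\<^sup>2 * \<Delta> - E\<^sup>2 - E\<close> is the sum of the squares of the rotation fields. It makes the
symmetry of the Laplacian visible.
\<close>
lemma lap_poly_rot_field:
  assumes F: "poly_lt d F" and x: "norm x = 1"
  shows "lap_poly F x = rot_field 1 2 (rot_field 1 2 F) x + rot_field 1 3 (rot_field 1 3 F) x + rot_field 2 3 (rot_field 2 3 F) x"
proof -
  note P = poly_lt_partial_deriv'[OF F]
  have nsq: "x $ 1 * x $ 1 + x $ 2 * x $ 2 + x $ 3 * x $ 3 = 1"
    using x by (simp add: norm_eq_1 inner_vec_def sum_3)
  have L: "rot_field i j (rot_field i j F) x =
      x $ i * x $ i * partial_deriv j (partial_deriv j F) x + x $ j * x $ j * partial_deriv i (partial_deriv i F) x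
      - 2 * (x $ i * x $ j * partial_deriv i (partial_deriv j F) x) - x $ i * partial_deriv i F x - x $ j * partial_deriv j F x"
    if "i \<noteq> j" for i j
  proof -
    have D: "partial_deriv k (rot_field i j F) x = (if k = i then partial_deriv j F x else 0) + x $ i * partial_deriv k (partial_deriv j F) x
        - ((if k = j then partial_deriv i F x else 0) + x $ j * partial_deriv k (partial_deriv i F) x)" for k
      unfolding rot_field_def[abs_def] partial_deriv_poly_lt_diff[OF poly_lt_coord[OF P] poly_lt_coord[OF P]] partial_deriv_coord_mult[OF P] by simp
    show ?thesis
      unfolding rot_field_def[of i j "rot_field i j F"] D partial_deriv_commute[OF F, of j i]
      using that by (simp add: algebra_simps)
  qed
  have c: "partial_deriv 2 (partial_deriv 1 F) = partial_deriv 1 (partial_deriv 2 F)"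
    "partial_deriv 3 (partial_deriv 1 F) = partial_deriv 1 (partial_deriv 3 F)"
    "partial_deriv 3 (partial_deriv 2 F) = partial_deriv 2 (partial_deriv 3 F)"
    using partial_deriv_commute[OF F] by auto
  define a b c' where "a = partial_deriv 1 (partial_deriv 1 F) x" and "b = partial_deriv 2 (partial_deriv 2 F) x"
    and "c' = partial_deriv 3 (partial_deriv 3 F) x"
  have "a + b + c' = (x $ 1 * x $ 1 + x $ 2 * x $ 2 + x $ 3 * x $ 3) * a + (x $ 1 * x $ 1 + x $ 2 * x $ 2 + x $ 3 * x $ 3) * b
     + (x $ 1 * x $ 1 + x $ 2 * x $ 2 + x $ 3 * x $ 3) * c'" unfolding nsq by simp
  then show ?thesis
    by (simp add: L lap_poly_def euler_euler[OF F] sum_3 c a_def b_def c'_def euler_def[of F]) (simp add: algebra_simps)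
qed

section \<open>Integration over the sphere\<close>

interpretation vol: finite_measure vol_S2
  by standard (simp add: emeasure_vol_S2_space)

lemma measure_vol_S2: "measure vol_S2 S2 = 4 * pi"
  using emeasure_vol_S2_space by (simp add: measure_def)

lemma continuous_on_bdd_meas:
  assumes "continuous_on S2 F"
  shows "bdd_meas vol_S2 F"
proof -
  have "compact (F ` S2)" using assms by (intro compact_continuous_image) auto
  then have "bounded (F ` S2)" by (rule compact_imp_bounded)
  then obtain B where "\<forall>x\<in>S2. \<bar>F x\<bar> \<le> B" by (auto simp: bounded_iff)
  moreover have "F \<in> borel_measurable vol_S2"
    using borel_measurable_continuous_on_restrict[OF assms]
    by (simp add: measurable_cong_sets[OF sets_vol_S2 refl])
  ultimately show ?thesis by (auto simp: bdd_meas_def)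
qed

lemma poly_lt_bdd_meas: "poly_lt d F \<Longrightarrow> bdd_meas vol_S2 F"
  by (intro continuous_on_bdd_meas poly_lt_continuous_on)

lemma orthogonal_transformation_inv_image:
  assumes R: "orthogonal_transformation (R :: real ^ 3 \<Rightarrow> real ^ 3)"
  shows "R -` A = inv R ` A"
  using orthogonal_transformation_bij[OF R] by (simp add: bij_vimage_eq_inv_image)

lemma distr_vol_S2_orthogonal:
  assumes R: "orthogonal_transformation (R :: real ^ 3 \<Rightarrow> real ^ 3)"
  shows "R \<in> vol_S2 \<rightarrow>\<^sub>M vol_S2" "distr vol_S2 vol_S2 R = vol_S2"
proof -
  have lin: "linear R" using R by (simp add: orthogonal_transformation_def)
  have "R \<in> borel_measurable borel"
    by (intro borel_measurable_continuous_onI linear_continuous_on linear_linear[THEN iffD2] lin)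
  then have "R \<in> restrict_space borel S2 \<rightarrow>\<^sub>M restrict_space borel S2"
    using R by (intro measurable_restrict_space3) (auto simp: orthogonal_transformation_norm)
  then show meas: "R \<in> vol_S2 \<rightarrow>\<^sub>M vol_S2"
    by (simp add: measurable_cong_sets[OF sets_vol_S2 sets_vol_S2])
  show "distr vol_S2 vol_S2 R = vol_S2"
  proof (rule measure_eqI)
    fix A assume "A \<in> sets (distr vol_S2 vol_S2 R)"
    then have A: "A \<in> sets vol_S2" by simp
    have AS: "A \<subseteq> S2" using sets.sets_into_space[OF A] by simp
    have "R -` A \<inter> S2 = R -` A"
      using AS R by (auto simp: orthogonal_transformation_norm)
    then have "R -` A \<inter> space vol_S2 = inv R ` A"
      by (simp add: orthogonal_transformation_inv_image[OF R])
    then show "emeasure (distr vol_S2 vol_S2 R) A = emeasure vol_S2 A"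
      using emeasure_vol_S2_orthogonal[OF orthogonal_transformation_inv[OF R] A]
      by (simp add: emeasure_distr[OF meas A])
  qed simp
qed

lemma integral_orthogonal_invariant:
  fixes F :: "real ^ 3 \<Rightarrow> real"
  assumes R: "orthogonal_transformation R" and F: "F \<in> borel_measurable vol_S2"
  shows "(\<integral>x. F (R x) \<partial>vol_S2) = (\<integral>x. F x \<partial>vol_S2)"
  using integral_distr[OF distr_vol_S2_orthogonal(1)[OF R] F] distr_vol_S2_orthogonal(2)[OF R] by simp

definition plane_rotation :: "3 \<Rightarrow> 3 \<Rightarrow> real \<Rightarrow> real ^ 3 \<Rightarrow> real ^ 3" where
  "plane_rotation i j t x = (\<chi> k. if k = i then cos t * x $ i - sin t * x $ j
     else if k = j then sin t * x $ i + cos t * x $ j else x $ k)"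

lemma plane_rotation_orthogonal:
  assumes "i \<noteq> j"
  shows "orthogonal_transformation (plane_rotation i j t)"
  unfolding orthogonal_transformation
proof (intro conjI allI)
  show "linear (plane_rotation i j t)"
    by (rule linearI) (auto simp: plane_rotation_def vec_eq_iff algebra_simps)
  fix x
  have tr: "(cos t * a - sin t * b) * (cos t * a - sin t * b) + (sin t * a + cos t * b) * (sin t * a + cos t * b) = a * a + b * b" for a b
  proof -
    have "(cos t * a - sin t * b) * (cos t * a - sin t * b) + (sin t * a + cos t * b) * (sin t * a + cos t * b) =
       ((sin t)\<^sup>2 + (cos t)\<^sup>2) * (a * a + b * b)"
      by (simp only: power2_eq_square) (simp only: algebra_simps)
    then show ?thesis by (simp only: sin_cos_squared_add mult_1_left)
  qed
  have "plane_rotation i j t x \<bullet> plane_rotation i j t x = x \<bullet> x"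
    using assms exhaust_3[of i] exhaust_3[of j] tr[of "x $ i" "x $ j"]
    by (auto simp: inner_vec_def sum_3 plane_rotation_def)
  then show "norm (plane_rotation i j t x) = norm x" by (simp add: norm_eq)
qed

lemma plane_rotation_0 [simp]: "plane_rotation i j 0 x = x"
  by (simp add: plane_rotation_def vec_eq_iff)

lemma plane_rotation_has_derivative:
  assumes F: "poly_lt d F" and ij: "i \<noteq> j"
  shows "((\<lambda>t. F (plane_rotation i j t x)) has_real_derivative rot_field i j F (plane_rotation i j t x)) (at t)"
proof -
  let ?y = "plane_rotation i j t x"
  obtain D where D: "(F has_derivative D) (at ?y)"
    using poly_lt_differentiable[OF F] unfolding differentiable_def by blast
  have lin: "linear D" using D by (rule has_derivative_linear)
  define v where "v = (\<chi> k. if k = i then - ?y $ j else if k = j then ?y $ i else 0)"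
  have "((\<lambda>t. plane_rotation i j t x) has_derivative (\<lambda>s. s *\<^sub>R v)) (at t)"
  proof (subst has_derivative_componentwise_within, rule ballI)
    fix b :: "real ^ 3" assume "b \<in> Basis"
    then obtain k where k: "b = axis k 1" by (auto simp: Basis_vec_def)
    have "((\<lambda>t. plane_rotation i j t x $ k) has_derivative (\<lambda>s. s * v $ k)) (at t)"
      using ij unfolding plane_rotation_def v_def
      by (cases "k = i"; cases "k = j") (auto intro!: derivative_eq_intros simp: algebra_simps)
    then show "((\<lambda>t. plane_rotation i j t x \<bullet> b) has_derivative (\<lambda>s. s *\<^sub>R v \<bullet> b)) (at t)"
      by (simp add: k inner_axis)
  qed
  then have "((\<lambda>t. F (plane_rotation i j t x)) has_derivative (\<lambda>s. D (s *\<^sub>R v))) (at t)"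
    using D by (rule has_derivative_compose)
  moreover have "D (s *\<^sub>R v) = rot_field i j F ?y * s" for s
  proof -
    have "D v = (\<Sum>k\<in>UNIV. v $ k *\<^sub>R D (axis k 1))" by (rule linear_axis_expansion[OF lin])
    also have "\<dots> = (\<Sum>k\<in>UNIV. (if k = i then - ?y $ j * partial_deriv i F ?y else 0) + (if k = j then ?y $ i * partial_deriv j F ?y else 0))"
      using ij by (intro sum.cong refl) (auto simp: v_def partial_deriv_has_derivative[OF D])
    also have "\<dots> = rot_field i j F ?y" by (simp add: sum.distrib rot_field_def)
    finally show ?thesis by (simp add: linear_scale[OF lin] mult.commute)
  qed
  ultimately show ?thesis by (simp add: has_field_derivative_def)
qed

text \<open>
The integral of \<open>F\<close> over the rotated sphere does not depend on the angle of rotation, and the integral of the rotation field is its derivative. The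
difference quotients are bounded by the mean value theorem, so dominated convergence applies.
\<close>
lemma integral_rot_field:
  assumes F: "poly_lt d F" and ij: "i \<noteq> j"
  shows "(\<integral>x. rot_field i j F x \<partial>vol_S2) = 0"
proof -
  define h where "h n = 1 / real (Suc n)" for n
  have h: "h n > 0" for n by (simp add: h_def)
  define q where "q n x = (F (plane_rotation i j (h n) x) - F x) / h n" for n x
  note L = poly_lt_rot_field[OF F, of i j]
  obtain B where B: "\<And>x. x \<in> S2 \<Longrightarrow> \<bar>rot_field i j F x\<bar> \<le> B"
    using poly_lt_bdd_meas[OF L] unfolding bdd_meas_def space_vol_S2 by blast
  have rb: "bdd_meas vol_S2 (\<lambda>x. F (plane_rotation i j t x))" for t
    using plane_rotation_orthogonal[OF ij, of t]
    by (intro poly_lt_bdd_meas[OF poly_lt_linear_compose[OF _ F]]) (simp add: orthogonal_transformation_def)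
  have "(\<lambda>n. \<integral>x. q n x \<partial>vol_S2) \<longlonglongrightarrow> (\<integral>x. rot_field i j F x \<partial>vol_S2)"
  proof (rule integral_dominated_convergence[where w = "\<lambda>x. B"])
    show "rot_field i j F \<in> borel_measurable vol_S2" using poly_lt_bdd_meas[OF L] by (rule bdd_meas_measurable)
    show "q n \<in> borel_measurable vol_S2" for n
      unfolding q_def using rb poly_lt_bdd_meas[OF F] by (intro bdd_meas_measurable bdd_meas_divide bdd_meas_diff)
    show "AE x in vol_S2. (\<lambda>n. q n x) \<longlonglongrightarrow> rot_field i j F x"
    proof (rule AE_I2)
      fix x
      have "((\<lambda>s. (F (plane_rotation i j (0 + s) x) - F (plane_rotation i j 0 x)) / s) \<longlongrightarrow> rot_field i j F (plane_rotation i j 0 x)) (at 0)"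
        using plane_rotation_has_derivative[OF F ij, of x 0] unfolding DERIV_def by simp
      moreover have "filterlim h (at 0) sequentially"
        unfolding filterlim_at h_def using LIMSEQ_inverse_real_of_nat by (auto simp: inverse_eq_divide)
      ultimately have "(\<lambda>n. (F (plane_rotation i j (0 + h n) x) - F (plane_rotation i j 0 x)) / h n) \<longlonglongrightarrow> rot_field i j F (plane_rotation i j 0 x)"
        by (rule filterlim_compose)
      then show "(\<lambda>n. q n x) \<longlonglongrightarrow> rot_field i j F x" by (simp add: q_def)
    qed
    show "AE x in vol_S2. norm (q n x) \<le> B" for n
    proof (rule AE_I2)
      fix x assume x: "x \<in> space vol_S2"
      obtain z where z: "F (plane_rotation i j (h n) x) - F (plane_rotation i j 0 x) = (h n - 0) * rot_field i j F (plane_rotation i j z x)"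
        using MVT2[OF h[of n], of "\<lambda>t. F (plane_rotation i j t x)" "\<lambda>t. rot_field i j F (plane_rotation i j t x)"]
          plane_rotation_has_derivative[OF F ij] by blast
      have "plane_rotation i j z x \<in> S2"
        using x plane_rotation_orthogonal[OF ij, of z] by (simp add: orthogonal_transformation_norm)
      moreover have "q n x = rot_field i j F (plane_rotation i j z x)" using z h[of n] by (simp add: q_def)
      ultimately show "norm (q n x) \<le> B" using B by simp
    qed
  qed simp
  moreover have "(\<integral>x. q n x \<partial>vol_S2) = 0" for n
  proof -
    have "(\<integral>x. q n x \<partial>vol_S2) = ((\<integral>x. F (plane_rotation i j (h n) x) \<partial>vol_S2) - (\<integral>x. F x \<partial>vol_S2)) / h n"
      unfolding q_def using rb[of "h n"] poly_lt_bdd_meas[OF F] by simp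
    then show ?thesis
      using integral_orthogonal_invariant[OF plane_rotation_orthogonal[OF ij] bdd_meas_measurable[OF poly_lt_bdd_meas[OF F]]] by simp
  qed
  ultimately have "(\<lambda>n::nat. 0) \<longlonglongrightarrow> (\<integral>x. rot_field i j F x \<partial>vol_S2)" by simp
  then show ?thesis using LIMSEQ_unique tendsto_const by blast
qed

lemma rot_field_skew:
  assumes F: "poly_lt d F" and G: "poly_lt d' G" and ij: "i \<noteq> j"
  shows "(\<integral>x. rot_field i j F x * G x \<partial>vol_S2) = - (\<integral>x. F x * rot_field i j G x \<partial>vol_S2)"
proof -
  have "poly_lt (d + d') (\<lambda>x. F x * G x)" using poly_lt_mult[OF F poly_lt_Suc[OF G]] .
  from integral_rot_field[OF this ij]
  have "(\<integral>x. rot_field i j F x * G x + F x * rot_field i j G x \<partial>vol_S2) = 0"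
    by (simp add: rot_field_mult[OF F G])
  moreover have "bdd_meas vol_S2 (\<lambda>x. rot_field i j F x * G x)" "bdd_meas vol_S2 (\<lambda>x. F x * rot_field i j G x)"
    by (intro bdd_meas_mult poly_lt_bdd_meas[OF F] poly_lt_bdd_meas[OF G] poly_lt_bdd_meas[OF poly_lt_rot_field[OF F]] poly_lt_bdd_meas[OF poly_lt_rot_field[OF G]])+
  ultimately show ?thesis by simp
qed

lemma lap_poly_symmetric:
  assumes F: "poly_lt d F" and G: "poly_lt d' G"
  shows "(\<integral>x. lap_poly F x * G x \<partial>vol_S2) = (\<integral>x. F x * lap_poly G x \<partial>vol_S2)"
proof -
  have L2: "(\<integral>x. rot_field i j (rot_field i j F) x * G x \<partial>vol_S2) = (\<integral>x. F x * rot_field i j (rot_field i j G) x \<partial>vol_S2)"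
    if ij: "i \<noteq> j" for i j
    using rot_field_skew[OF poly_lt_rot_field[OF F] G ij] rot_field_skew[OF F poly_lt_rot_field[OF G] ij] by simp
  have b: "bdd_meas vol_S2 (\<lambda>x. rot_field i j (rot_field i j F) x * G x)" "bdd_meas vol_S2 (\<lambda>x. F x * rot_field i j (rot_field i j G) x)" for i j
    by (intro bdd_meas_mult poly_lt_bdd_meas[OF F] poly_lt_bdd_meas[OF G] poly_lt_bdd_meas[OF poly_lt_rot_field[OF poly_lt_rot_field[OF F]]] poly_lt_bdd_meas[OF poly_lt_rot_field[OF poly_lt_rot_field[OF G]]])+
  have "(\<integral>x. lap_poly F x * G x \<partial>vol_S2) = (\<integral>x. rot_field 1 2 (rot_field 1 2 F) x * G x +
      rot_field 1 3 (rot_field 1 3 F) x * G x + rot_field 2 3 (rot_field 2 3 F) x * G x \<partial>vol_S2)"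
    by (intro Bochner_Integration.integral_cong refl) (simp add: lap_poly_rot_field[OF F] distrib_right)
  also have "\<dots> = (\<integral>x. F x * rot_field 1 2 (rot_field 1 2 G) x +
      F x * rot_field 1 3 (rot_field 1 3 G) x + F x * rot_field 2 3 (rot_field 2 3 G) x \<partial>vol_S2)"
    using b by (simp add: L2)
  also have "\<dots> = (\<integral>x. F x * lap_poly G x \<partial>vol_S2)"
    by (intro Bochner_Integration.integral_cong refl) (simp add: lap_poly_rot_field[OF G] distrib_left)
  finally show ?thesis .
qed

text \<open>
A nonempty relatively open subset of the sphere is the radial projection of a nonempty open subset of the ball, hence not a null set.
\<close>
lemma integral_square_zero_imp_zero:
  fixes F :: "real ^ 3 \<Rightarrow> real"
  assumes F: "continuous_on S2 F" and z: "(\<integral>x. (F x)\<^sup>2 \<partial>vol_S2) = 0" and x: "x \<in> S2"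
  shows "F x = 0"
proof (rule ccontr)
  assume Fx: "F x \<noteq> 0"
  note Fb = continuous_on_bdd_meas[OF F]
  define U where "U = {y \<in> S2. F y \<noteq> 0}"
  have "AE y in vol_S2. (F y)\<^sup>2 = 0"
    using z Fb by (subst (asm) integral_nonneg_eq_0_iff_AE) auto
  then have ae: "AE y in vol_S2. \<not> F y \<noteq> 0" by simp
  have Um: "U \<in> sets vol_S2"
  proof -
    have "{y \<in> space vol_S2. F y \<noteq> 0} \<in> sets vol_S2" using Fb by measurable
    then show ?thesis by (simp add: U_def)
  qed
  have "emeasure vol_S2 U = 0"
    using ae Um by (subst (asm) AE_iff_measurable[of U]) (auto simp: U_def)
  define V where "V = {y \<in> ball 0 1 - {0}. sgn y \<in> U}"
  have "emeasure lborel V = 0"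
    using \<open>emeasure vol_S2 U = 0\<close> unfolding emeasure_vol_S2[OF Um] V_def by simp
  moreover have "open V"
  proof -
    have "continuous_on (ball 0 1 - {0}) (sgn :: real ^ 3 \<Rightarrow> _)"
      unfolding sgn_div_norm by (intro continuous_intros) auto
    then have "continuous_on (ball 0 1 - {0}) (\<lambda>y. F (sgn y))"
      by (rule continuous_on_compose2[OF F]) (auto simp: norm_sgn split: if_splits)
    then have "open ((ball 0 1 - {0}) \<inter> (\<lambda>y. F (sgn y)) -` (- {0}))"
      by (intro continuous_open_preimage) auto
    moreover have "V = (ball 0 1 - {0}) \<inter> (\<lambda>y. F (sgn y)) -` (- {0})"
      by (auto simp: V_def U_def norm_sgn)
    ultimately show ?thesis by simp
  qed
  moreover have "(1 / 2) *\<^sub>R x \<in> V"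
  proof -
    have "sgn ((1 / 2) *\<^sub>R x) = x" using x by (simp add: sgn_div_norm)
    then show ?thesis using x Fx by (auto simp: V_def U_def)
  qed
  ultimately have "\<not> negligible V" "V \<in> sets borel"
    using open_not_negligible by auto
  with \<open>emeasure lborel V = 0\<close> show False
    by (simp add: negligible_iff_emeasure0)
qed

section \<open>Monomials on the sphere\<close>

definition S2_span :: "(nat \<Rightarrow> real ^ 3 \<Rightarrow> real) \<Rightarrow> nat \<Rightarrow> (real ^ 3 \<Rightarrow> real) \<Rightarrow> bool" where
  "S2_span h N F \<longleftrightarrow> (\<exists>c. \<forall>x\<in>S2. F x = (\<Sum>k<N. c k * h k x))"

lemma S2_spanI: "(\<And>x. x \<in> S2 \<Longrightarrow> F x = (\<Sum>k<N. c k * h k x)) \<Longrightarrow> S2_span h N F"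
  unfolding S2_span_def by blast

lemma S2_span_zero: "S2_span h N (\<lambda>x. 0)"
  by (rule S2_spanI[where c = "\<lambda>k. 0"]) simp

lemma S2_span_base: assumes "k < N" shows "S2_span h N (h k)"
proof (rule S2_spanI[where c = "\<lambda>i. if i = k then 1 else 0"])
  fix x
  have "(\<Sum>i<N. (if i = k then 1 else 0) * h i x) = (\<Sum>i<N. if i = k then h k x else 0)"
    by (intro sum.cong refl) auto
  then show "h k x = (\<Sum>i<N. (if i = k then 1 else 0) * h i x)" using assms by simp
qed

lemma S2_span_add:
  assumes "S2_span h N F" "S2_span h N G" shows "S2_span h N (\<lambda>x. F x + G x)"
proof -
  obtain c d where "\<forall>x\<in>S2. F x = (\<Sum>k<N. c k * h k x)" "\<forall>x\<in>S2. G x = (\<Sum>k<N. d k * h k x)"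
    using assms unfolding S2_span_def by blast
  then show ?thesis
    by (intro S2_spanI[where c = "\<lambda>k. c k + d k"]) (simp add: distrib_right sum.distrib)
qed

lemma S2_span_cmult:
  assumes "S2_span h N F" shows "S2_span h N (\<lambda>x. a * F x)"
proof -
  obtain c where "\<forall>x\<in>S2. F x = (\<Sum>k<N. c k * h k x)"
    using assms unfolding S2_span_def by blast
  then show ?thesis
    by (intro S2_spanI[where c = "\<lambda>k. a * c k"]) (simp add: sum_distrib_left mult_ac)
qed

lemma S2_span_diff:
  "S2_span h N F \<Longrightarrow> S2_span h N G \<Longrightarrow> S2_span h N (\<lambda>x. F x - G x)"
  using S2_span_add[of h N F "\<lambda>x. -1 * G x"] S2_span_cmult[of h N G "-1"] by simp

lemma S2_span_sum: "(\<And>i. i \<in> I \<Longrightarrow> S2_span h N (F i)) \<Longrightarrow> S2_span h N (\<lambda>x. \<Sum>i\<in>I. F i x)"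
  by (induction I rule: infinite_finite_induct) (auto intro: S2_span_zero S2_span_add)

lemma S2_span_cong:
  assumes "S2_span h N F" "\<And>x. x \<in> S2 \<Longrightarrow> G x = F x"
  shows "S2_span h N G"
proof -
  obtain c where "\<forall>x\<in>S2. F x = (\<Sum>k<N. c k * h k x)"
    using assms(1) unfolding S2_span_def by blast
  then have "G x = (\<Sum>k<N. c k * h k x)" if "x \<in> S2" for x using assms(2)[OF that] that by metis
  then show ?thesis by (rule S2_spanI)
qed

lemma S2_span_mono:
  assumes "S2_span h N F" "N \<le> N'" shows "S2_span h N' F"
proof -
  obtain c where c: "\<And>x. x \<in> S2 \<Longrightarrow> F x = (\<Sum>k<N. c k * h k x)"
    using assms unfolding S2_span_def by blast
  have "S2_span h N' (\<lambda>x. \<Sum>k<N. c k * h k x)"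
    by (intro S2_span_sum S2_span_cmult S2_span_base) (use assms in auto)
  then show ?thesis using c by (rule S2_span_cong)
qed

lemma S2_span_trans:
  assumes "S2_span h N F" "\<And>k. k < N \<Longrightarrow> S2_span h' N' (h k)" shows "S2_span h' N' F"
proof -
  obtain c where c: "\<And>x. x \<in> S2 \<Longrightarrow> F x = (\<Sum>k<N. c k * h k x)"
    using assms unfolding S2_span_def by blast
  have "S2_span h' N' (\<lambda>x. \<Sum>k<N. c k * h k x)"
    by (intro S2_span_sum S2_span_cmult assms) auto
  then show ?thesis using c by (rule S2_span_cong)
qed

text \<open>
On the sphere the square of the third coordinate can be eliminated, so the monomials of degree at most one in it
span all polynomials. Exactly \<open>2 * l + 1\<close> of them have degree \<open>l\<close>, which fill the block of level \<open>l\<close>.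
\<close>
definition S2_monomial :: "nat \<Rightarrow> real ^ 3 \<Rightarrow> real" where
  "S2_monomial k x = (let l = level k; r = k - l\<^sup>2 in
     if r \<le> l then (x $ 1) ^ r * (x $ 2) ^ (l - r)
     else x $ 3 * ((x $ 1) ^ (r - l - 1) * (x $ 2) ^ (2 * l - r)))"

lemma S2_monomial_planar:
  "S2_monomial ((a + b)\<^sup>2 + a) = (\<lambda>x. (x $ 1) ^ a * (x $ 2) ^ b)" "level ((a + b)\<^sup>2 + a) = a + b"
proof -
  show l: "level ((a + b)\<^sup>2 + a) = a + b" by (rule level_add) simp
  show "S2_monomial ((a + b)\<^sup>2 + a) = (\<lambda>x. (x $ 1) ^ a * (x $ 2) ^ b)"
    by (rule ext) (simp add: S2_monomial_def l)
qed

lemma S2_monomial_odd: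
  "S2_monomial ((a + b + 1)\<^sup>2 + (a + b + 1) + 1 + a) = (\<lambda>x. x $ 3 * ((x $ 1) ^ a * (x $ 2) ^ b))"
  "level ((a + b + 1)\<^sup>2 + (a + b + 1) + 1 + a) = a + b + 1"
proof -
  have "level ((a + b + 1)\<^sup>2 + ((a + b + 1) + 1 + a)) = a + b + 1" by (rule level_add) simp
  then show l: "level ((a + b + 1)\<^sup>2 + (a + b + 1) + 1 + a) = a + b + 1" by (simp only: add.assoc)
  have "2 * (a + b + 1) - ((a + b + 1) + 1 + a) = b" by simp
  then show "S2_monomial ((a + b + 1)\<^sup>2 + (a + b + 1) + 1 + a) = (\<lambda>x. x $ 3 * ((x $ 1) ^ a * (x $ 2) ^ b))"
    unfolding S2_monomial_def l by (intro ext) (simp add: Let_def)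
qed

lemma S2_monomial_cases:
  obtains (planar) a b where "k = (a + b)\<^sup>2 + a" "level k = a + b"
  | (odd) a b where "k = (a + b + 1)\<^sup>2 + (a + b + 1) + 1 + a" "level k = a + b + 1"
proof -
  define l where "l = level k"
  obtain r where r: "k = l\<^sup>2 + r" "r < 2 * l + 1"
    using level_block[of k] unfolding block_eq l_def by blast
  show ?thesis
  proof (cases "r \<le> l")
    case True
    then have l: "r + (l - r) = l" by simp
    show ?thesis
      by (rule planar[of r "l - r"], unfold l) (rule r(1), rule l_def[symmetric])
  next
    case False
    define a where "a = r - l - 1"
    define b where "b = 2 * l - r"
    have a: "r = l + 1 + a" and b: "l = a + b + 1"
      using False r by (simp_all add: a_def b_def)
    have "k = (a + b + 1)\<^sup>2 + ((a + b + 1) + 1 + a)" using r(1) unfolding a b .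
    then have "k = (a + b + 1)\<^sup>2 + (a + b + 1) + 1 + a" by (simp only: add.assoc)
    moreover have "level k = a + b + 1" using b l_def by simp
    ultimately show ?thesis by (rule odd)
  qed
qed

lemma poly_lt_power_mult: "poly_lt d F \<Longrightarrow> poly_lt (n + d) (\<lambda>x. (x $ i) ^ n * F x)"
  by (induction n) (auto simp: mult.assoc intro: poly_lt_coord)

lemma poly_lt_planar_monomial: "poly_lt (Suc (a + b)) (\<lambda>x. (x $ 1) ^ a * (x $ 2) ^ b)"
  using poly_lt_power_mult[OF poly_lt_power_mult[OF poly_lt_const[of 0 1], of b 2], of a 1] by simp

lemma poly_lt_S2_monomial: "poly_lt (Suc (level k)) (S2_monomial k)"
proof (cases k rule: S2_monomial_cases)
  case (planar a b)
  then show ?thesis using poly_lt_planar_monomial[of a b] S2_monomial_planar(1) by simp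
next
  case (odd a b)
  then show ?thesis using poly_lt_coord[OF poly_lt_planar_monomial[of a b], of 3] S2_monomial_odd(1) by simp
qed

lemma S2_span_planar:
  assumes "a + b < d" shows "S2_span S2_monomial (d\<^sup>2) (\<lambda>x. (x $ 1) ^ a * (x $ 2) ^ b)"
proof -
  obtain L where d: "d = L + 1" using assms by (cases d) auto
  have "(a + b)\<^sup>2 + a < d\<^sup>2"
    unfolding d less_square_level S2_monomial_planar(2) using assms d by simp
  then show ?thesis using S2_span_base[of "(a + b)\<^sup>2 + a" "d\<^sup>2" S2_monomial] by (simp only: S2_monomial_planar(1))
qed

lemma S2_span_odd:
  assumes "a + b + 1 < d" shows "S2_span S2_monomial (d\<^sup>2) (\<lambda>x. x $ 3 * ((x $ 1) ^ a * (x $ 2) ^ b))"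
proof -
  obtain L where d: "d = L + 1" using assms by (cases d) auto
  have "(a + b + 1)\<^sup>2 + (a + b + 1) + 1 + a < d\<^sup>2"
    unfolding d less_square_level S2_monomial_odd(2) using assms d by simp
  then show ?thesis using S2_span_base[of "(a + b + 1)\<^sup>2 + (a + b + 1) + 1 + a" "d\<^sup>2" S2_monomial]
    by (simp only: S2_monomial_odd(1))
qed

lemma S2_norm_sq: "x \<in> S2 \<Longrightarrow> (x $ 1)\<^sup>2 + (x $ 2)\<^sup>2 + (x $ 3)\<^sup>2 = 1"
  by (simp add: norm_eq_1 inner_vec_def sum_3 power2_eq_square)

lemma S2_span_coord_monomial:
  assumes "level k < d" shows "S2_span S2_monomial ((Suc d)\<^sup>2) (\<lambda>x. x $ i * S2_monomial k x)"
proof (cases k rule: S2_monomial_cases)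
  case (planar a b)
  have m: "S2_monomial k = (\<lambda>x. (x $ 1) ^ a * (x $ 2) ^ b)"
    unfolding planar(1) by (rule S2_monomial_planar(1))
  have lt: "a + b < d" using planar assms by simp
  consider "i = 1" | "i = 2" | "i = 3" using exhaust_3 by blast
  then show ?thesis
  proof cases
    case 1
    then show ?thesis using S2_span_planar[of "Suc a" b "Suc d"] lt by (simp add: m mult.assoc)
  next
    case 2
    then show ?thesis using S2_span_planar[of a "Suc b" "Suc d"] lt by (simp add: m mult_ac)
  next
    case 3
    then show ?thesis using S2_span_odd[of a b "Suc d"] lt by (simp add: m)
  qed
next
  case (odd a b)
  have m: "S2_monomial k = (\<lambda>x. x $ 3 * ((x $ 1) ^ a * (x $ 2) ^ b))"
    unfolding odd(1) by (rule S2_monomial_odd(1))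
  have lt: "a + b + 1 < d" using odd assms by simp
  consider "i = 1" | "i = 2" | "i = 3" using exhaust_3 by blast
  then show ?thesis
  proof cases
    case 1
    then show ?thesis using S2_span_odd[of "Suc a" b "Suc d"] lt by (simp add: m mult_ac)
  next
    case 2
    then show ?thesis using S2_span_odd[of a "Suc b" "Suc d"] lt by (simp add: m mult_ac)
  next
    case 3
    \<comment> \<open>The equation of the sphere removes the square of the third coordinate.\<close>
    have "S2_span S2_monomial ((Suc d)\<^sup>2) (\<lambda>x. (x $ 1) ^ a * (x $ 2) ^ b - (x $ 1) ^ (a + 2) * (x $ 2) ^ b - (x $ 1) ^ a * (x $ 2) ^ (b + 2))"
      by (intro S2_span_diff S2_span_planar) (use lt in auto)
    moreover have "x $ i * S2_monomial k x = (x $ 1) ^ a * (x $ 2) ^ b - (x $ 1) ^ (a + 2) * (x $ 2) ^ b - (x $ 1) ^ a * (x $ 2) ^ (b + 2)"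
      if "x \<in> S2" for x
    proof -
      have "x $ i * S2_monomial k x = (x $ 3)\<^sup>2 * ((x $ 1) ^ a * (x $ 2) ^ b)" by (simp add: 3 m power2_eq_square)
      also have "(x $ 3)\<^sup>2 = 1 - (x $ 1)\<^sup>2 - (x $ 2)\<^sup>2" using S2_norm_sq[OF that] by simp
      finally show ?thesis by (simp add: power2_eq_square algebra_simps)
    qed
    ultimately show ?thesis by (rule S2_span_cong)
  qed
qed

lemma poly_lt_S2_span: "poly_lt d F \<Longrightarrow> S2_span S2_monomial (d\<^sup>2) F"
proof (induction rule: poly_lt.induct)
  case (poly_lt_const d c)
  show ?case using S2_span_cmult[OF S2_span_planar[of 0 0 "Suc d"], of c] by simp
next
  case (poly_lt_coord d F i)
  obtain c where c: "\<And>x. x \<in> S2 \<Longrightarrow> F x = (\<Sum>k<d\<^sup>2. c k * S2_monomial k x)"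
    using poly_lt_coord.IH unfolding S2_span_def by blast
  have "S2_span S2_monomial ((Suc d)\<^sup>2) (\<lambda>x. \<Sum>k<d\<^sup>2. c k * (x $ i * S2_monomial k x))"
  proof (intro S2_span_sum S2_span_cmult S2_span_coord_monomial)
    fix k assume k: "k \<in> {..<d\<^sup>2}"
    then have "d \<noteq> 0" by (cases d) auto
    then obtain L where "d = L + 1" by (cases d) auto
    then show "level k < d" using k less_square_level[of k L] by simp
  qed
  moreover have "x $ i * F x = (\<Sum>k<d\<^sup>2. c k * (x $ i * S2_monomial k x))" if "x \<in> S2" for x
    using c[OF that] by (simp add: sum_distrib_left mult_ac)
  ultimately show ?case by (rule S2_span_cong)
qed (auto intro: S2_span_zero S2_span_add)

lemma polynomial_coeffs_zero:
  fixes a :: "nat \<Rightarrow> real"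
  assumes "e > 0" "\<And>t. 0 < t \<Longrightarrow> t < e \<Longrightarrow> (\<Sum>i\<le>n. a i * t ^ i) = 0" "i \<le> n"
  shows "a i = 0"
proof (rule ccontr)
  assume "a i \<noteq> 0"
  then have "finite {z. (\<Sum>i\<le>n. a i * z ^ i) = 0}" using assms(3) polyfun_finite_roots by blast
  moreover have "{0<..<e} \<subseteq> {z. (\<Sum>i\<le>n. a i * z ^ i) = 0}" using assms(2) by auto
  ultimately have "finite {0<..<e}" by (rule finite_subset[rotated])
  then show False using assms(1) infinite_Ioo by blast
qed

text \<open>
Along each ray a polynomial is a polynomial in the radius whose coefficients are the homogeneous parts. Each homogeneous part,
restricted to the line \<open>v = 1 / 2\<close>, is a polynomial in one variable.
\<close>
lemma homogeneous_coeffs_zero: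
  fixes a :: "nat \<Rightarrow> nat \<Rightarrow> real"
  assumes z: "\<And>u v. u\<^sup>2 + v\<^sup>2 < 1 \<Longrightarrow> (\<Sum>l\<le>L. \<Sum>r\<le>l. a l r * (u ^ r * v ^ (l - r))) = 0"
    and "l \<le> L" "r \<le> l"
  shows "a l r = 0"
proof -
  have "(\<Sum>r\<le>l. a l r * (u ^ r * (1 / 2) ^ (l - r))) = 0" if u: "0 < u" "u < 1 / 2" for u
  proof (rule polynomial_coeffs_zero[where e = 1 and n = L and a = "\<lambda>l. \<Sum>r\<le>l. a l r * (u ^ r * (1 / 2) ^ (l - r))"])
    fix t :: real assume t: "0 < t" "t < 1"
    have tu: "t * u < 1 / 2" "t * (1 / 2) < 1 / 2" "0 < t * u" using t u
      by (auto intro: mult_strict_mono[of t 1 u "1 / 2", simplified])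
    have "(t * u)\<^sup>2 < (1 / 2)\<^sup>2" "(t * (1 / 2))\<^sup>2 < (1 / 2)\<^sup>2" using tu t by (auto intro!: power_strict_mono simp del: times_divide_eq_right)
    then have "(t * u)\<^sup>2 + (t * (1 / 2))\<^sup>2 < 1" by (simp add: power2_eq_square)
    then have "(\<Sum>l\<le>L. \<Sum>r\<le>l. a l r * ((t * u) ^ r * (t * (1 / 2)) ^ (l - r))) = 0" by (rule z)
    moreover have "(\<Sum>r\<le>l. a l r * ((t * u) ^ r * (t * (1 / 2)) ^ (l - r))) = (\<Sum>r\<le>l. a l r * (u ^ r * (1 / 2) ^ (l - r))) * t ^ l" for l
      unfolding sum_distrib_right
    proof (intro sum.cong refl)
      fix r assume "r \<in> {..l}"
      then have "t ^ l = t ^ r * t ^ (l - r)" by (simp flip: power_add)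
      then show "a l r * ((t * u) ^ r * (t * (1 / 2)) ^ (l - r)) = a l r * (u ^ r * (1 / 2) ^ (l - r)) * t ^ l"
        by (simp only: power_mult_distrib) simp
    qed
    ultimately show "(\<Sum>l\<le>L. (\<Sum>r\<le>l. a l r * (u ^ r * (1 / 2) ^ (l - r))) * t ^ l) = 0" by simp
  qed (use assms in auto)
  then have P: "(\<Sum>r\<le>l. (a l r * (1 / 2) ^ (l - r)) * u ^ r) = 0" if "0 < u" "u < 1 / 2" for u
    using that by (simp add: mult_ac)
  have "a l r * (1 / 2) ^ (l - r) = 0"
    by (rule polynomial_coeffs_zero[where e = "1 / 2" and n = l and a = "\<lambda>r. a l r * (1 / 2) ^ (l - r)", OF _ P]) (use assms in auto)
  then show ?thesis by simp
qed

text \<open>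
A vanishing combination has the form \<open>A + x\<^sub>3 * B\<close> with polynomials \<open>A\<close>, \<open>B\<close> in the first two coordinates.
Both signs of the third coordinate occur over each interior point of the unit disc, so \<open>A\<close> and \<open>B\<close> vanish there.
\<close>
lemma S2_monomial_independent:
  assumes z: "\<And>x. x \<in> S2 \<Longrightarrow> (\<Sum>k<N. c k * S2_monomial k x) = 0" and k: "k < N"
  shows "c k = 0"
proof -
  define L where "L = N"
  define d where "d k = (if k < N then c k else 0)" for k
  have "N \<le> (L + 1)\<^sup>2" by (simp add: L_def power2_eq_square)
  then have z': "(\<Sum>k<(L + 1)\<^sup>2. d k * S2_monomial k x) = 0" if "x \<in> S2" for x
    using z[OF that] by (subst sum.mono_neutral_cong_right[of _ "{..<N}" _ "\<lambda>k. c k * S2_monomial k x"]) (auto simp: d_def)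
  define A where "A u v = (\<Sum>l\<le>L. \<Sum>r\<le>l. d (l\<^sup>2 + r) * (u ^ r * v ^ (l - r)))" for u v :: real
  define B where "B u v = (\<Sum>l\<le>L. \<Sum>r<l. d (l\<^sup>2 + l + 1 + r) * (u ^ r * v ^ (l - 1 - r)))" for u v :: real
  have split: "(\<Sum>k<(L + 1)\<^sup>2. d k * S2_monomial k x) = A (x $ 1) (x $ 2) + x $ 3 * B (x $ 1) (x $ 2)" for x
  proof -
    have "(\<Sum>k\<in>block l. d k * S2_monomial k x) =
       (\<Sum>r\<le>l. d (l\<^sup>2 + r) * ((x $ 1) ^ r * (x $ 2) ^ (l - r))) +
       (\<Sum>r<l. x $ 3 * (d (l\<^sup>2 + l + 1 + r) * ((x $ 1) ^ r * (x $ 2) ^ (l - 1 - r))))" for l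
    proof -
      have "(\<Sum>k\<in>block l. d k * S2_monomial k x) = (\<Sum>r<2 * l + 1. d (l\<^sup>2 + r) * S2_monomial (l\<^sup>2 + r) x)"
        by (rule sum_block)
      also have "{..<2 * l + 1} = {..l} \<union> (\<lambda>r. l + 1 + r) ` {..<l}"
      proof -
        have "(\<lambda>r. l + 1 + r) ` {..<l} = {l + 1..<2 * l + 1}"
          using image_add_atLeastLessThan[of "l + 1" 0 l] by (simp add: lessThan_atLeast0 add.commute mult_2)
        then show ?thesis by auto
      qed
      also have "(\<Sum>r\<in>{..l} \<union> (\<lambda>r. l + 1 + r) ` {..<l}. d (l\<^sup>2 + r) * S2_monomial (l\<^sup>2 + r) x) =
        (\<Sum>r\<le>l. d (l\<^sup>2 + r) * S2_monomial (l\<^sup>2 + r) x) + (\<Sum>r<l. d (l\<^sup>2 + (l + 1 + r)) * S2_monomial (l\<^sup>2 + (l + 1 + r)) x)"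
      proof -
        have "(\<Sum>r\<in>(\<lambda>r. l + 1 + r) ` {..<l}. d (l\<^sup>2 + r) * S2_monomial (l\<^sup>2 + r) x) =
            (\<Sum>r<l. d (l\<^sup>2 + (l + 1 + r)) * S2_monomial (l\<^sup>2 + (l + 1 + r)) x)"
          by (subst sum.reindex) auto
        moreover have "{..l} \<inter> (\<lambda>r. l + 1 + r) ` {..<l} = {}" by auto
        ultimately show ?thesis by (subst sum.union_disjoint) (simp_all only: finite_atMost finite_imageI finite_lessThan)
      qed
      also have "(\<Sum>r\<le>l. d (l\<^sup>2 + r) * S2_monomial (l\<^sup>2 + r) x) = (\<Sum>r\<le>l. d (l\<^sup>2 + r) * ((x $ 1) ^ r * (x $ 2) ^ (l - r)))"
      proof (intro sum.cong refl)
        fix r assume "r \<in> {..l}"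
        then show "d (l\<^sup>2 + r) * S2_monomial (l\<^sup>2 + r) x = d (l\<^sup>2 + r) * ((x $ 1) ^ r * (x $ 2) ^ (l - r))"
          using S2_monomial_planar(1)[of r "l - r"] by simp
      qed
      also have "(\<Sum>r<l. d (l\<^sup>2 + (l + 1 + r)) * S2_monomial (l\<^sup>2 + (l + 1 + r)) x) =
         (\<Sum>r<l. x $ 3 * (d (l\<^sup>2 + l + 1 + r) * ((x $ 1) ^ r * (x $ 2) ^ (l - 1 - r))))"
      proof (intro sum.cong refl)
        fix r assume "r \<in> {..<l}"
        then have "r + (l - 1 - r) + 1 = l" by auto
        then show "d (l\<^sup>2 + (l + 1 + r)) * S2_monomial (l\<^sup>2 + (l + 1 + r)) x = x $ 3 * (d (l\<^sup>2 + l + 1 + r) * ((x $ 1) ^ r * (x $ 2) ^ (l - 1 - r)))"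
          using S2_monomial_odd(1)[of r "l - 1 - r"] by (simp only: add.assoc) (simp add: fun_eq_iff)
      qed
      finally show ?thesis .
    qed
    then show ?thesis
      unfolding sum_square_blocks A_def B_def by (simp add: sum.distrib sum_distrib_left)
  qed
  have AB: "A u v = 0 \<and> B u v = 0" if uv: "u\<^sup>2 + v\<^sup>2 < 1" for u v
  proof -
    define w where "w = sqrt (1 - u\<^sup>2 - v\<^sup>2)"
    have w: "w > 0" "u\<^sup>2 + v\<^sup>2 + w\<^sup>2 = 1" using uv by (auto simp: w_def)
    have v1: "A u v + w' * B u v = 0" if "w'\<^sup>2 = w\<^sup>2" for w'
    proof -
      define x :: "real ^ 3" where "x = vector [u, v, w']"
      have "x \<in> S2" using w(2) that by (simp add: x_def norm_eq_1 inner_vec_def sum_3 power2_eq_square)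
      then show ?thesis using z' split[of x] by (simp add: x_def)
    qed
    from v1[of w] v1[of "-w"] have "A u v = 0" "w * B u v = 0" by simp_all
    then show ?thesis using w by simp
  qed
  have dk: "d k = 0"
  proof (cases k rule: S2_monomial_cases)
    case (planar a b)
    have "k < (L + 1)\<^sup>2" using k \<open>N \<le> (L + 1)\<^sup>2\<close> by linarith
    then have "a + b \<le> L" using planar less_square_level[of k L] by simp
    then show ?thesis
      using homogeneous_coeffs_zero[where L = L and a = "\<lambda>l r. d (l\<^sup>2 + r)" and l = "a + b" and r = a] AB planar by (simp add: A_def)
  next
    case (odd a b)
    have "k < (L + 1)\<^sup>2" using k \<open>N \<le> (L + 1)\<^sup>2\<close> by linarith
    then have ab: "a + b + 1 \<le> L" using odd less_square_level[of k L] by simp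
    then obtain L' where L': "L = Suc L'" by (cases L) auto
    have "B u v = (\<Sum>l\<le>L'. \<Sum>r\<le>l. d ((l + 1)\<^sup>2 + (l + 1) + 1 + r) * (u ^ r * v ^ (l - r)))" for u v
      unfolding B_def L' sum.atMost_Suc_shift by (simp add: lessThan_Suc_atMost)
    then have "d ((a + b + 1)\<^sup>2 + (a + b + 1) + 1 + a) = 0"
      using homogeneous_coeffs_zero[where L = L' and a = "\<lambda>l r. d ((l + 1)\<^sup>2 + (l + 1) + 1 + r)" and l = "a + b" and r = a] AB ab L' by simp
    then show ?thesis using odd by simp
  qed
  then show ?thesis using k by (simp add: d_def)
qed

fun gram_schmidt :: "nat \<Rightarrow> real ^ 3 \<Rightarrow> real" where
  "gram_schmidt k = (let u = (\<lambda>x. S2_monomial k x -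
      (\<Sum>i<k. (\<integral>y. S2_monomial k y * gram_schmidt i y \<partial>vol_S2) * gram_schmidt i x))
    in (\<lambda>x. u x / sqrt (\<integral>y. (u y)\<^sup>2 \<partial>vol_S2)))"

section \<open>Spherical harmonics\<close>

declare gram_schmidt.simps [simp del]

definition gs_residual :: "nat \<Rightarrow> real ^ 3 \<Rightarrow> real" where
  "gs_residual k x = S2_monomial k x -
     (\<Sum>i<k. (\<integral>y. S2_monomial k y * gram_schmidt i y \<partial>vol_S2) * gram_schmidt i x)"

lemma gram_schmidt_residual:
  "gram_schmidt k x = gs_residual k x / sqrt (\<integral>y. (gs_residual k y)\<^sup>2 \<partial>vol_S2)"
  by (subst gram_schmidt.simps) (simp add: gs_residual_def[abs_def] Let_def)

lemma gram_schmidt_properties: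
  "(\<forall>k<N. S2_span S2_monomial (Suc k) (gram_schmidt k) \<and> poly_lt (Suc (level k)) (gram_schmidt k)
     \<and> (\<integral>y. (gs_residual k y)\<^sup>2 \<partial>vol_S2) > 0) \<and> vol.orthonormal {..<N} gram_schmidt"
proof (induction N)
  case 0 then show ?case by (simp add: vol.orthonormal_def)
next
  case (Suc N)
  define c where "c i = (\<integral>y. S2_monomial N y * gram_schmidt i y \<partial>vol_S2)" for i
  define u where "u = gs_residual N"
  have u: "u x = S2_monomial N x - (\<Sum>i<N. c i * gram_schmidt i x)" for x
    by (simp add: u_def gs_residual_def c_def)
  have on: "vol.orthonormal {..<N} gram_schmidt" using Suc by simp
  have poly_lt_i: "poly_lt (Suc (level N)) (gram_schmidt i)" if "i < N" for i
  proof -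
    have "level i \<le> level N"
    proof -
      have "N < (level N + 1)\<^sup>2" using level_block[of N] by (simp add: block_def)
      then show ?thesis using that less_square_level[of i "level N"] by simp
    qed
    moreover have "poly_lt (Suc (level i)) (gram_schmidt i)" using Suc that by simp
    ultimately show ?thesis by (auto intro: poly_lt_mono)
  qed
  have u_poly_lt: "poly_lt (Suc (level N)) u"
    unfolding u[abs_def] by (intro poly_lt_diff poly_lt_S2_monomial poly_lt_sum poly_lt_cmult) (simp add: poly_lt_i)
  have ub [simp]: "bdd_meas vol_S2 u" and mb [simp]: "bdd_meas vol_S2 (S2_monomial N)"
    by (rule poly_lt_bdd_meas[OF u_poly_lt], rule poly_lt_bdd_meas[OF poly_lt_S2_monomial])
  have gb [simp]: "bdd_meas vol_S2 (gram_schmidt i)" if "i < N" for i using poly_lt_i[OF that] by (rule poly_lt_bdd_meas)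
  have span_i: "S2_span S2_monomial N (gram_schmidt i)" if "i < N" for i
    using Suc that S2_span_mono[of S2_monomial "Suc i" _ N] by simp
  have pos: "(\<integral>y. (u y)\<^sup>2 \<partial>vol_S2) > 0"
  proof (rule ccontr)
    assume "\<not> ?thesis"
    moreover have "(\<integral>y. (u y)\<^sup>2 \<partial>vol_S2) \<ge> 0" by simp
    ultimately have "(\<integral>y. (u y)\<^sup>2 \<partial>vol_S2) = 0" by linarith
    then have u0: "u x = 0" if "x \<in> S2" for x
      using integral_square_zero_imp_zero[OF poly_lt_continuous_on[OF u_poly_lt]] that by blast
    have "S2_span S2_monomial N (\<lambda>x. \<Sum>i<N. c i * gram_schmidt i x)"
      by (intro S2_span_sum S2_span_cmult span_i) simp
    then obtain d where d: "\<And>x. x \<in> S2 \<Longrightarrow> (\<Sum>i<N. c i * gram_schmidt i x) = (\<Sum>k<N. d k * S2_monomial k x)"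
      unfolding S2_span_def by blast
    have "(\<Sum>k<Suc N. (if k = N then 1 else - d k) * S2_monomial k x) = 0" if "x \<in> S2" for x
    proof -
      have "(\<Sum>k<Suc N. (if k = N then 1 else - d k) * S2_monomial k x) = (\<Sum>k<N. - d k * S2_monomial k x) + S2_monomial N x"
        by simp
      also have "\<dots> = u x" by (simp add: u d[OF that] sum_negf)
      finally show ?thesis using u0[OF that] by simp
    qed
    from S2_monomial_independent[OF this, of N] show False by simp
  qed
  have gN: "gram_schmidt N x = u x * (1 / sqrt (\<integral>y. (u y)\<^sup>2 \<partial>vol_S2))" for x
    by (simp add: gram_schmidt_residual u_def)
  define a where "a = 1 / sqrt (\<integral>y. (u y)\<^sup>2 \<partial>vol_S2)"
  have a: "gram_schmidt N = (\<lambda>x. a * u x)" by (rule ext) (simp add: gN a_def)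
  have 1: "S2_span S2_monomial (Suc N) (gram_schmidt N)"
    unfolding a u[abs_def]
    by (intro S2_span_cmult S2_span_diff S2_span_base S2_span_sum S2_span_mono[OF span_i]) auto
  have 2: "poly_lt (Suc (level N)) (gram_schmidt N)" unfolding a by (rule poly_lt_cmult[OF u_poly_lt])
  have orth: "(\<integral>x. u x * gram_schmidt i x \<partial>vol_S2) = 0" if i: "i < N" for i
  proof -
    have "(\<integral>x. u x * gram_schmidt i x \<partial>vol_S2) =
      (\<integral>x. S2_monomial N x * gram_schmidt i x - (\<Sum>j<N. c j * (gram_schmidt j x * gram_schmidt i x)) \<partial>vol_S2)"
      by (intro Bochner_Integration.integral_cong refl) (simp add: u left_diff_distrib sum_distrib_right mult.assoc)
    also have "\<dots> = c i - (\<Sum>j<N. c j * (\<integral>x. gram_schmidt j x * gram_schmidt i x \<partial>vol_S2))"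
    proof -
      have "(\<integral>x. (\<Sum>j<N. c j * (gram_schmidt j x * gram_schmidt i x)) \<partial>vol_S2) = (\<Sum>j<N. c j * (\<integral>x. gram_schmidt j x * gram_schmidt i x \<partial>vol_S2))"
        using i by (subst Bochner_Integration.integral_sum) auto
      moreover have "bdd_meas vol_S2 (\<lambda>x. \<Sum>j<N. c j * (gram_schmidt j x * gram_schmidt i x))"
        using i by (intro bdd_meas_sum bdd_meas_mult bdd_meas_const gb) auto
      ultimately show ?thesis using i
        by (subst Bochner_Integration.integral_diff) (auto simp: c_def)
    qed
    also have "\<dots> = c i - (\<Sum>j<N. if j = i then c i else 0)"
      using on i by (intro arg_cong2[where f = "(-)"] sum.cong refl) (auto simp: vol.orthonormal_def)
    finally show ?thesis using i by simp
  qed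
  have norm: "(\<integral>x. gram_schmidt N x * gram_schmidt N x \<partial>vol_S2) = 1"
  proof -
    have "(\<integral>x. gram_schmidt N x * gram_schmidt N x \<partial>vol_S2) = (\<integral>x. (a * a) * (u x)\<^sup>2 \<partial>vol_S2)"
      by (simp add: a power2_eq_square mult_ac)
    also have "\<dots> = (a * a) * (\<integral>x. (u x)\<^sup>2 \<partial>vol_S2)" by simp
    finally show ?thesis using pos by (simp add: a_def)
  qed
  have o1: "(\<integral>x. gram_schmidt N x * gram_schmidt i x \<partial>vol_S2) = 0" if "i < N" for i
    unfolding a using orth[OF that] by (simp add: mult.assoc)
  have o2: "(\<integral>x. gram_schmidt i x * gram_schmidt N x \<partial>vol_S2) = 0" if "i < N" for i
    using o1[OF that] by (simp add: mult.commute)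
  have "vol.orthonormal {..<Suc N} gram_schmidt"
    unfolding vol.orthonormal_def
  proof (intro conjI ballI)
    fix i assume i: "i \<in> {..<Suc N}"
    show "bdd_meas vol_S2 (gram_schmidt i)" using i poly_lt_bdd_meas[OF 2] gb by (cases "i = N") auto
    fix j assume j: "j \<in> {..<Suc N}"
    show "(\<integral>x. gram_schmidt i x * gram_schmidt j x \<partial>vol_S2) = (if i = j then 1 else 0)"
      using i j on norm o1 o2 by (cases "i = N"; cases "j = N") (auto simp: vol.orthonormal_def)
  qed
  then show ?case using Suc 1 2 pos by (auto simp: less_Suc_eq u_def)
qed

lemma gram_schmidt_orthonormal: "vol.orthonormal UNIV gram_schmidt"
  unfolding vol.orthonormal_def
proof (intro conjI ballI)
  fix i j
  have "vol.orthonormal {..<Suc (max i j)} gram_schmidt" using gram_schmidt_properties by blast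
  then show "bdd_meas vol_S2 (gram_schmidt i)"
    "(\<integral>x. gram_schmidt i x * gram_schmidt j x \<partial>vol_S2) = (if i = j then 1 else 0)"
    by (auto simp: vol.orthonormal_def)
qed

lemma poly_lt_gram_schmidt: "poly_lt (Suc (level k)) (gram_schmidt k)"
  using gram_schmidt_properties[of "Suc k"] by simp

lemma gram_schmidt_bdd_meas [simp]: "bdd_meas vol_S2 (gram_schmidt k)"
  by (rule poly_lt_bdd_meas[OF poly_lt_gram_schmidt])

lemma S2_monomial_span_gram_schmidt: "S2_span gram_schmidt (Suc k) (S2_monomial k)"
proof -
  define a where "a = sqrt (\<integral>y. (gs_residual k y)\<^sup>2 \<partial>vol_S2)"
  have a: "a > 0" using gram_schmidt_properties[of "Suc k"] by (simp add: a_def)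
  have "S2_monomial k x = a * gram_schmidt k x +
     (\<Sum>i<k. (\<integral>y. S2_monomial k y * gram_schmidt i y \<partial>vol_S2) * gram_schmidt i x)" for x
  proof -
    have "gram_schmidt k x = gs_residual k x / a" unfolding a_def by (rule gram_schmidt_residual)
    then have "a * gram_schmidt k x = gs_residual k x" using a by simp
    then show ?thesis by (simp add: gs_residual_def)
  qed
  then have *: "S2_monomial k = (\<lambda>x. a * gram_schmidt k x +
     (\<Sum>i<k. (\<integral>y. S2_monomial k y * gram_schmidt i y \<partial>vol_S2) * gram_schmidt i x))" by (rule ext)
  show ?thesis by (subst *) (intro S2_span_add S2_span_cmult S2_span_sum S2_span_base; simp)
qed

lemma poly_lt_span_gram_schmidt: "poly_lt d F \<Longrightarrow> S2_span gram_schmidt (d\<^sup>2) F"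
  by (rule S2_span_trans[OF poly_lt_S2_span]) (auto intro: S2_span_mono[OF S2_monomial_span_gram_schmidt])

lemma vol_integral_cong: "(\<And>x. x \<in> S2 \<Longrightarrow> F x = G x) \<Longrightarrow> (\<integral>x. F x \<partial>vol_S2) = (\<integral>x. G x \<partial>vol_S2)"
  by (intro Bochner_Integration.integral_cong) auto

lemma gram_schmidt_orthogonal_poly_lt:
  assumes F: "poly_lt l F" and k: "l \<le> level k"
  shows "(\<integral>x. gram_schmidt k x * F x \<partial>vol_S2) = 0"
proof -
  obtain c where c: "\<And>x. x \<in> S2 \<Longrightarrow> F x = (\<Sum>i<l\<^sup>2. c i * gram_schmidt i x)"
    using poly_lt_span_gram_schmidt[OF F] unfolding S2_span_def by blast
  have "(level k)\<^sup>2 \<le> k" using level_block[of k] by (simp add: block_def)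
  moreover have "l\<^sup>2 \<le> (level k)\<^sup>2" using k by (rule power_mono) simp
  ultimately have kl: "l\<^sup>2 \<le> k" by linarith
  have "(\<integral>x. gram_schmidt k x * F x \<partial>vol_S2) = (\<integral>x. (\<Sum>i<l\<^sup>2. c i * (gram_schmidt k x * gram_schmidt i x)) \<partial>vol_S2)"
    by (rule vol_integral_cong) (simp add: c sum_distrib_left mult_ac)
  also have "\<dots> = (\<Sum>i<l\<^sup>2. c i * (\<integral>x. gram_schmidt k x * gram_schmidt i x \<partial>vol_S2))"
    by (subst Bochner_Integration.integral_sum) auto
  also have "\<dots> = 0"
    using gram_schmidt_orthonormal kl by (intro sum.neutral) (auto simp: vol.orthonormal_def)
  finally show ?thesis .
qed

text \<open>
The polynomial \<open>G = \<Delta>F + l * (l + 1) * F\<close> has degree less than \<open>l\<close>, and the symmetry of the Laplacian makes it orthogonal to all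
polynomials of degree less than \<open>l\<close>, in particular to itself.
\<close>
lemma harmonic_eigenfunction:
  assumes F: "poly_lt (Suc l) F" and orth: "\<And>H. poly_lt l H \<Longrightarrow> (\<integral>x. F x * H x \<partial>vol_S2) = 0" and x: "x \<in> S2"
  shows "laplace_S2 F x = - (real l * (real l + 1)) * F x"
proof -
  define G where "G x = lap_poly F x + real l * (real l + 1) * F x" for x
  have G: "poly_lt l G" unfolding G_def[abs_def] by (rule poly_lt_lap_drop[OF F])
  have "(\<integral>x. (G x)\<^sup>2 \<partial>vol_S2) = (\<integral>x. lap_poly F x * G x + real l * (real l + 1) * (F x * G x) \<partial>vol_S2)"
    by (intro Bochner_Integration.integral_cong refl) (subst (1) G_def, simp add: power2_eq_square G_def algebra_simps)
  also have "\<dots> = (\<integral>x. lap_poly F x * G x \<partial>vol_S2) + real l * (real l + 1) * (\<integral>x. F x * G x \<partial>vol_S2)"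
    by (subst Bochner_Integration.integral_add) (auto intro!: bdd_meas_mult vol.bdd_meas_integrable poly_lt_bdd_meas[OF F] poly_lt_bdd_meas[OF G] poly_lt_bdd_meas[OF poly_lt_lap[OF F]])
  also have "\<dots> = 0" using orth[OF G] orth[OF poly_lt_lap[OF G]] lap_poly_symmetric[OF F G] by simp
  finally have "G x = 0"
    using integral_square_zero_imp_zero[OF poly_lt_continuous_on[OF G]] x by blast
  then show ?thesis using laplace_S2_poly_lt[OF F x] by (simp add: G_def)
qed

text \<open>
The function \<open>h\<close> is the reproducing kernel of the space of degree \<open>l\<close> with pole \<open>R x\<close>. Its rotate has the same norm and
lies in the same space, because rotations preserve degrees and orthogonality. The Cauchy--Schwarz inequality at \<open>x\<close> gives
\<open>K (R x)\<^sup>2 \<le> K (R x) * K x\<close>.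
\<close>
lemma kernel_rotation_le:
  assumes R: "orthogonal_transformation (R :: real ^ 3 \<Rightarrow> real ^ 3)" and x: "x \<in> S2"
  shows "(\<Sum>k\<in>block l. (gram_schmidt k (R x))\<^sup>2) \<le> (\<Sum>k\<in>block l. (gram_schmidt k x)\<^sup>2)"
proof -
  define K where "K x = (\<Sum>k\<in>block l. (gram_schmidt k x)\<^sup>2)" for x
  define h where "h y = (\<Sum>k\<in>block l. gram_schmidt k (R x) * gram_schmidt k y)" for y
  have K0: "K y \<ge> 0" for y unfolding K_def by (intro sum_nonneg) auto
  have linR: "linear R" using R by (simp add: orthogonal_transformation_def)
  have h_poly_lt: "poly_lt (Suc l) h"
    unfolding h_def[abs_def] using poly_lt_gram_schmidt by (intro poly_lt_sum poly_lt_cmult) (metis level_eq_iff)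
  note hR_poly_lt = poly_lt_linear_compose[OF linR h_poly_lt]
  note hb [simp] = poly_lt_bdd_meas[OF h_poly_lt] poly_lt_bdd_meas[OF hR_poly_lt]
  obtain d where d: "\<And>y. y \<in> S2 \<Longrightarrow> h (R y) = (\<Sum>k<(Suc l)\<^sup>2. d k * gram_schmidt k y)"
    using poly_lt_span_gram_schmidt[OF hR_poly_lt] unfolding S2_span_def by blast
  have on: "vol.orthonormal {..<(Suc l)\<^sup>2} gram_schmidt" using gram_schmidt_properties by blast
  have d_int: "d j = (\<integral>y. h (R y) * gram_schmidt j y \<partial>vol_S2)" if j: "j < (Suc l)\<^sup>2" for j
  proof -
    have "(\<integral>y. h (R y) * gram_schmidt j y \<partial>vol_S2) =
      (\<integral>y. (\<Sum>k<(Suc l)\<^sup>2. d k * gram_schmidt k y) * (\<Sum>k<(Suc l)\<^sup>2. (if k = j then 1 else 0) * gram_schmidt k y) \<partial>vol_S2)"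
    proof (rule vol_integral_cong)
      fix y assume "y \<in> S2"
      moreover have "(\<Sum>k<(Suc l)\<^sup>2. (if k = j then 1 else 0) * gram_schmidt k y) = (\<Sum>k<(Suc l)\<^sup>2. if k = j then gram_schmidt j y else 0)"
        by (intro sum.cong refl) auto
      ultimately show "h (R y) * gram_schmidt j y = (\<Sum>k<(Suc l)\<^sup>2. d k * gram_schmidt k y) * (\<Sum>k<(Suc l)\<^sup>2. (if k = j then 1 else 0) * gram_schmidt k y)"
        using j d by simp
    qed
    also have "\<dots> = (\<Sum>k<(Suc l)\<^sup>2. d k * (if k = j then 1 else 0))"
      by (rule vol.orthonormal_integral_sums[OF on]) simp
    also have "\<dots> = (\<Sum>k<(Suc l)\<^sup>2. if k = j then d j else 0)" by (intro sum.cong refl) auto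
    finally show ?thesis using j by simp
  qed
  have d0: "d j = 0" if j: "j < l\<^sup>2" for j
  proof -
    obtain l' where l': "l = l' + 1" using j by (cases l) auto
    then have "level j < l" using j less_square_level[of j l'] by simp
    then have G: "poly_lt l (gram_schmidt j)" using poly_lt_gram_schmidt[of j] by (auto intro: poly_lt_mono)
    have Rinv: "orthogonal_transformation (inv R)" by (rule orthogonal_transformation_inv[OF R])
    have Rinv': "inv R (R y) = y" for y using orthogonal_transformation_inj[OF R] by simp
    have GR: "poly_lt l (\<lambda>y. gram_schmidt j (inv R y))"
      using Rinv by (intro poly_lt_linear_compose[OF _ G]) (simp add: orthogonal_transformation_def)
    have "j < (Suc l)\<^sup>2" using j by (simp add: power2_eq_square)
    then have "d j = (\<integral>y. h (R y) * gram_schmidt j (inv R (R y)) \<partial>vol_S2)" by (simp add: d_int Rinv')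
    also have "\<dots> = (\<integral>y. h y * gram_schmidt j (inv R y) \<partial>vol_S2)"
      by (rule integral_orthogonal_invariant[OF R, of "\<lambda>y. h y * gram_schmidt j (inv R y)"])
        (intro bdd_meas_measurable bdd_meas_mult hb(1) poly_lt_bdd_meas[OF GR])
    also have "\<dots> = (\<integral>y. (\<Sum>k\<in>block l. gram_schmidt k (R x) * (gram_schmidt k y * gram_schmidt j (inv R y))) \<partial>vol_S2)"
      by (simp add: h_def sum_distrib_right mult.assoc)
    also have "\<dots> = (\<Sum>k\<in>block l. gram_schmidt k (R x) * (\<integral>y. gram_schmidt k y * gram_schmidt j (inv R y) \<partial>vol_S2))"
      using poly_lt_bdd_meas[OF GR] by (subst Bochner_Integration.integral_sum) auto
    also have "\<dots> = 0"
      by (intro sum.neutral ballI) (simp add: gram_schmidt_orthogonal_poly_lt[OF GR] level_eq_iff[symmetric])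
    finally show ?thesis .
  qed
  have sub: "block l \<subseteq> {..<(Suc l)\<^sup>2}" using block_subset[of l l] by simp
  have rest: "k < l\<^sup>2" if "k \<in> {..<(Suc l)\<^sup>2} - block l" for k
    using that by (auto simp: block_def)
  have hR: "h (R y) = (\<Sum>k\<in>block l. d k * gram_schmidt k y)" if "y \<in> S2" for y
    unfolding d[OF that] using sub rest d0 by (intro sum.mono_neutral_right) auto
  have d2: "(\<Sum>k\<in>block l. (d k)\<^sup>2) = K (R x)"
  proof -
    have "(\<Sum>k\<in>block l. (d k)\<^sup>2) = (\<Sum>k\<in>block l. d k * d k)" by (simp add: power2_eq_square)
    also have "\<dots> = (\<integral>y. (\<Sum>k\<in>block l. d k * gram_schmidt k y) * (\<Sum>k\<in>block l. d k * gram_schmidt k y) \<partial>vol_S2)"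
      by (rule vol.orthonormal_integral_sums[symmetric, OF vol.orthonormal_subset[OF gram_schmidt_orthonormal]]) auto
    also have "\<dots> = (\<integral>y. h (R y) * h (R y) \<partial>vol_S2)" by (rule vol_integral_cong) (simp add: hR)
    also have "\<dots> = (\<integral>y. h y * h y \<partial>vol_S2)"
      by (rule integral_orthogonal_invariant[OF R, of "\<lambda>y. h y * h y"]) (intro bdd_meas_measurable bdd_meas_mult hb)
    also have "\<dots> = (\<Sum>k\<in>block l. gram_schmidt k (R x) * gram_schmidt k (R x))"
      unfolding h_def by (rule vol.orthonormal_integral_sums[OF vol.orthonormal_subset[OF gram_schmidt_orthonormal]]) auto
    finally show ?thesis by (simp add: K_def power2_eq_square)
  qed
  have "(K (R x))\<^sup>2 = (h (R x))\<^sup>2" by (simp add: K_def h_def power2_eq_square)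
  also have "\<dots> = (\<Sum>k\<in>block l. d k * gram_schmidt k x)\<^sup>2" by (simp add: hR[OF x])
  also have "\<dots> \<le> (\<Sum>k\<in>block l. (d k)\<^sup>2) * (\<Sum>k\<in>block l. (gram_schmidt k x)\<^sup>2)" by (rule Cauchy_Schwarz_ineq_sum)
  also have "\<dots> = K (R x) * K x" by (simp add: d2) (simp add: K_def)
  finally have "K (R x) * K (R x) \<le> K (R x) * K x" by (simp add: power2_eq_square)
  then have "K (R x) \<le> K x" using K0[of "R x"] K0[of x] by (cases "K (R x) = 0") auto
  then show ?thesis by (simp add: K_def)
qed

text \<open>
Rotations act transitively on the sphere, so the sum is constant. Its value follows from its integral, which counts the functions.
\<close>
lemma sum_gram_schmidt_squares:
  assumes x: "x \<in> S2"
  shows "(\<Sum>k\<in>block l. (gram_schmidt k x)\<^sup>2) = real (2 * l + 1) / (4 * pi)"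
proof -
  define K where "K x = (\<Sum>k\<in>block l. (gram_schmidt k x)\<^sup>2)" for x
  have le: "K y \<le> K x" if y: "y \<in> S2" and x: "x \<in> S2" for x y
  proof -
    have "norm x = norm y" using x y by simp
    then obtain R where "orthogonal_transformation R" "R x = y"
      by (rule orthogonal_transformation_exists)
    then show ?thesis using kernel_rotation_le[of R x l] x by (simp add: K_def)
  qed
  have const: "K y = K x" if "y \<in> S2" for y using le[OF that x] le[OF x that] by simp
  have "(\<integral>y. K y \<partial>vol_S2) = (\<Sum>k\<in>block l. \<integral>y. (gram_schmidt k y)\<^sup>2 \<partial>vol_S2)"
    unfolding K_def by (rule Bochner_Integration.integral_sum) auto
  also have "\<dots> = real (2 * l + 1)"
    unfolding sum_block using vol.orthonormal_square[OF gram_schmidt_orthonormal] by simp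
  also have "(\<integral>y. K y \<partial>vol_S2) = (\<integral>y. K x \<partial>vol_S2)" by (rule vol_integral_cong) (rule const)
  also have "\<dots> = 4 * pi * K x" by (simp add: measure_vol_S2)
  finally show ?thesis by (simp add: K_def field_simps)
qed

section \<open>Density of polynomials\<close>

definition poly_approximable :: "(real ^ 3 \<Rightarrow> real) \<Rightarrow> bool" where
  "poly_approximable f \<longleftrightarrow> L2_fun vol_S2 f \<and>
     (\<forall>\<epsilon>>0. \<exists>d q. poly_lt d q \<and> (\<integral>x. (f x - q x)\<^sup>2 \<partial>vol_S2) < \<epsilon>)"

lemma bdd_meas_L2_fun: "bdd_meas vol_S2 f \<Longrightarrow> L2_fun vol_S2 f"
  by (simp add: L2_fun_def bdd_meas_measurable)

lemma L2_fun_add: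
  assumes "L2_fun vol_S2 f" "L2_fun vol_S2 g" shows "L2_fun vol_S2 (\<lambda>x. f x + g x)"
  unfolding L2_fun_def
proof
  have [measurable]: "f \<in> borel_measurable vol_S2" "g \<in> borel_measurable vol_S2" using assms by (auto simp: L2_fun_def)
  show "(\<lambda>x. f x + g x) \<in> borel_measurable vol_S2" by measurable
  have "integrable vol_S2 (\<lambda>x. 2 * (f x)\<^sup>2 + 2 * (g x)\<^sup>2)" using assms by (auto simp: L2_fun_def)
  then show "integrable vol_S2 (\<lambda>x. (f x + g x)\<^sup>2)"
  proof (rule Bochner_Integration.integrable_bound)
    show "AE x in vol_S2. norm ((f x + g x)\<^sup>2) \<le> norm (2 * (f x)\<^sup>2 + 2 * (g x)\<^sup>2)"
    proof (rule AE_I2)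
      fix x
      have "(f x + g x)\<^sup>2 \<le> 2 * (f x)\<^sup>2 + 2 * (g x)\<^sup>2"
        using sum_squares_bound[of "f x" "g x"] by (simp add: power2_sum)
      also have "\<dots> \<le> norm \<dots>" by simp
      finally show "norm ((f x + g x)\<^sup>2) \<le> norm (2 * (f x)\<^sup>2 + 2 * (g x)\<^sup>2)" by simp
    qed
  qed measurable
qed

lemma L2_fun_cmult: "L2_fun vol_S2 f \<Longrightarrow> L2_fun vol_S2 (\<lambda>x. c * f x)"
  unfolding L2_fun_def by (auto simp: power_mult_distrib)

lemma L2_fun_diff: "L2_fun vol_S2 f \<Longrightarrow> L2_fun vol_S2 g \<Longrightarrow> L2_fun vol_S2 (\<lambda>x. f x - g x)"
  using L2_fun_add[of f "\<lambda>x. -1 * g x"] L2_fun_cmult[of g "-1"] by simp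

lemma integral_square_add_le:
  assumes "L2_fun vol_S2 f" "L2_fun vol_S2 g"
  shows "(\<integral>x. (f x + g x)\<^sup>2 \<partial>vol_S2) \<le> 2 * (\<integral>x. (f x)\<^sup>2 \<partial>vol_S2) + 2 * (\<integral>x. (g x)\<^sup>2 \<partial>vol_S2)"
proof -
  have "(\<integral>x. (f x + g x)\<^sup>2 \<partial>vol_S2) \<le> (\<integral>x. 2 * (f x)\<^sup>2 + 2 * (g x)\<^sup>2 \<partial>vol_S2)"
  proof (rule integral_mono)
    fix x show "(f x + g x)\<^sup>2 \<le> 2 * (f x)\<^sup>2 + 2 * (g x)\<^sup>2"
      using sum_squares_bound[of "f x" "g x"] by (simp add: power2_sum)
  qed (use assms L2_fun_add[OF assms] in \<open>auto simp: L2_fun_def\<close>)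
  also have "\<dots> = 2 * (\<integral>x. (f x)\<^sup>2 \<partial>vol_S2) + 2 * (\<integral>x. (g x)\<^sup>2 \<partial>vol_S2)"
    using assms by (simp add: L2_fun_def)
  finally show ?thesis .
qed

lemma poly_approximable_limit:
  assumes f: "L2_fun vol_S2 f"
    and ex: "\<And>\<epsilon>. \<epsilon> > 0 \<Longrightarrow> \<exists>h. poly_approximable h \<and> (\<integral>x. (f x - h x)\<^sup>2 \<partial>vol_S2) < \<epsilon>"
  shows "poly_approximable f"
  unfolding poly_approximable_def
proof (intro conjI f allI impI)
  fix \<epsilon> :: real assume e: "\<epsilon> > 0"
  obtain h where h: "poly_approximable h" "(\<integral>x. (f x - h x)\<^sup>2 \<partial>vol_S2) < \<epsilon> / 4" using ex[of "\<epsilon> / 4"] e by auto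
  obtain d q where q: "poly_lt d q" "(\<integral>x. (h x - q x)\<^sup>2 \<partial>vol_S2) < \<epsilon> / 4"
    using h(1) e unfolding poly_approximable_def by (meson divide_pos_pos zero_less_numeral)
  have "L2_fun vol_S2 h" "L2_fun vol_S2 q"
    using h(1) bdd_meas_L2_fun[OF poly_lt_bdd_meas[OF q(1)]] by (auto simp: poly_approximable_def)
  then have "(\<integral>x. ((f x - h x) + (h x - q x))\<^sup>2 \<partial>vol_S2) \<le> 2 * (\<integral>x. (f x - h x)\<^sup>2 \<partial>vol_S2) + 2 * (\<integral>x. (h x - q x)\<^sup>2 \<partial>vol_S2)"
    using f by (intro integral_square_add_le L2_fun_diff)
  then have "(\<integral>x. (f x - q x)\<^sup>2 \<partial>vol_S2) < \<epsilon>" using h(2) q(2) by simp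
  then show "\<exists>d q. poly_lt d q \<and> (\<integral>x. (f x - q x)\<^sup>2 \<partial>vol_S2) < \<epsilon>" using q(1) by blast
qed

lemma poly_approximable_add:
  assumes "poly_approximable f" "poly_approximable g" shows "poly_approximable (\<lambda>x. f x + g x)"
  unfolding poly_approximable_def
proof (intro conjI allI impI)
  have fg: "L2_fun vol_S2 f" "L2_fun vol_S2 g" using assms by (auto simp: poly_approximable_def)
  then show "L2_fun vol_S2 (\<lambda>x. f x + g x)" by (rule L2_fun_add)
  fix \<epsilon> :: real assume e: "\<epsilon> > 0"
  obtain d q where q: "poly_lt d q" "(\<integral>x. (f x - q x)\<^sup>2 \<partial>vol_S2) < \<epsilon> / 4"
    using assms(1) e unfolding poly_approximable_def by (meson divide_pos_pos zero_less_numeral)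
  obtain d' r where r: "poly_lt d' r" "(\<integral>x. (g x - r x)\<^sup>2 \<partial>vol_S2) < \<epsilon> / 4"
    using assms(2) e unfolding poly_approximable_def by (meson divide_pos_pos zero_less_numeral)
  have "L2_fun vol_S2 q" "L2_fun vol_S2 r" using q r by (auto intro: bdd_meas_L2_fun poly_lt_bdd_meas)
  then have "(\<integral>x. ((f x - q x) + (g x - r x))\<^sup>2 \<partial>vol_S2) \<le> 2 * (\<integral>x. (f x - q x)\<^sup>2 \<partial>vol_S2) + 2 * (\<integral>x. (g x - r x)\<^sup>2 \<partial>vol_S2)"
    using fg by (intro integral_square_add_le L2_fun_diff)
  then have "(\<integral>x. ((f x - q x) + (g x - r x))\<^sup>2 \<partial>vol_S2) < \<epsilon>" using q(2) r(2) by simp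
  moreover have "(\<lambda>x. (f x - q x) + (g x - r x)) = (\<lambda>x. (f x + g x) - (q x + r x))" by auto
  ultimately have "(\<integral>x. ((f x + g x) - (q x + r x))\<^sup>2 \<partial>vol_S2) < \<epsilon>" by (simp add: algebra_simps)
  moreover have "poly_lt (max d d') (\<lambda>x. q x + r x)"
    using q(1) r(1) by (intro poly_lt_add) (auto intro: poly_lt_mono)
  ultimately show "\<exists>d q. poly_lt d q \<and> (\<integral>x. (f x + g x - q x)\<^sup>2 \<partial>vol_S2) < \<epsilon>" by blast
qed

lemma poly_approximable_poly_lt: "poly_lt d q \<Longrightarrow> poly_approximable q"
  unfolding poly_approximable_def
  by (intro conjI allI impI exI[of _ d] exI[of _ q]) (auto intro: bdd_meas_L2_fun poly_lt_bdd_meas)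

lemma poly_approximable_cmult:
  assumes "poly_approximable f" shows "poly_approximable (\<lambda>x. c * f x)"
proof (cases "c = 0")
  case True
  then show ?thesis using poly_approximable_poly_lt[OF poly_lt_zero] by simp
next
  case False
  show ?thesis
    unfolding poly_approximable_def
  proof (intro conjI allI impI)
    show "L2_fun vol_S2 (\<lambda>x. c * f x)" using assms by (intro L2_fun_cmult) (simp add: poly_approximable_def)
    fix \<epsilon> :: real assume e: "\<epsilon> > 0"
    have "\<epsilon> / c\<^sup>2 > 0" using e False by simp
    then obtain d q where q: "poly_lt d q" "(\<integral>x. (f x - q x)\<^sup>2 \<partial>vol_S2) < \<epsilon> / c\<^sup>2"
      using assms unfolding poly_approximable_def by blast
    have "(\<integral>x. (c * f x - c * q x)\<^sup>2 \<partial>vol_S2) = c\<^sup>2 * (\<integral>x. (f x - q x)\<^sup>2 \<partial>vol_S2)"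
      by (simp add: power_mult_distrib flip: right_diff_distrib)
    also have "\<dots> < \<epsilon>" using q(2) False by (simp add: field_simps)
    finally show "\<exists>d q. poly_lt d q \<and> (\<integral>x. (c * f x - q x)\<^sup>2 \<partial>vol_S2) < \<epsilon>"
      using poly_lt_cmult[OF q(1), of c] by blast
  qed
qed

lemma poly_approximable_sum:
  "(\<And>i. i \<in> I \<Longrightarrow> poly_approximable (f i)) \<Longrightarrow> poly_approximable (\<lambda>x. \<Sum>i\<in>I. f i x)"
  by (induction I rule: infinite_finite_induct)
    (auto intro: poly_approximable_add poly_approximable_poly_lt[OF poly_lt_zero])

lemma poly_approximable_dominated:
  assumes f: "f \<in> borel_measurable vol_S2" and w: "integrable vol_S2 w"
    and h: "\<And>n. poly_approximable (h n)"
    and lim: "\<And>x. x \<in> S2 \<Longrightarrow> (\<lambda>n. h n x) \<longlonglongrightarrow> f x"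
    and dom: "\<And>n x. x \<in> S2 \<Longrightarrow> (f x - h n x)\<^sup>2 \<le> w x" and fL: "L2_fun vol_S2 f"
  shows "poly_approximable f"
proof (rule poly_approximable_limit[OF fL])
  fix \<epsilon> :: real assume e: "\<epsilon> > 0"
  have hm: "h n \<in> borel_measurable vol_S2" for n using h by (simp add: poly_approximable_def L2_fun_def)
  have "(\<lambda>n. \<integral>x. (f x - h n x)\<^sup>2 \<partial>vol_S2) \<longlonglongrightarrow> (\<integral>x. 0 \<partial>vol_S2)"
  proof (rule integral_dominated_convergence[where w = w])
    show "AE x in vol_S2. (\<lambda>n. (f x - h n x)\<^sup>2) \<longlonglongrightarrow> 0"
    proof (rule AE_I2)
      fix x assume "x \<in> space vol_S2"
      then have "(\<lambda>n. (f x - h n x)\<^sup>2) \<longlonglongrightarrow> (f x - f x)\<^sup>2" by (intro tendsto_intros lim) simp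
      then show "(\<lambda>n. (f x - h n x)\<^sup>2) \<longlonglongrightarrow> 0" by simp
    qed
    show "AE x in vol_S2. norm ((f x - h n x)\<^sup>2) \<le> w x" for n
      using dom by (intro AE_I2) simp
  qed (use f hm w in auto)
  then have L: "(\<lambda>n. \<integral>x. (f x - h n x)\<^sup>2 \<partial>vol_S2) \<longlonglongrightarrow> 0" by simp
  obtain n where "(\<integral>x. (f x - h n x)\<^sup>2 \<partial>vol_S2) < \<epsilon>"
    using eventually_happens'[OF sequentially_bot order_tendstoD(2)[OF L e]] by blast
  then show "\<exists>h. poly_approximable h \<and> (\<integral>x. (f x - h x)\<^sup>2 \<partial>vol_S2) < \<epsilon>" using h by blast
qed

lemma poly_approximable_continuous:
  fixes f :: "real ^ 3 \<Rightarrow> real"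
  assumes f: "continuous_on S2 f"
  shows "poly_approximable f"
  unfolding poly_approximable_def
proof (intro conjI allI impI)
  note fb = continuous_on_bdd_meas[OF f]
  show "L2_fun vol_S2 f" by (rule bdd_meas_L2_fun[OF fb])
  fix \<epsilon> :: real assume e: "\<epsilon> > 0"
  define \<delta> where "\<delta> = sqrt (\<epsilon> / (8 * pi))"
  have \<delta>: "\<delta> > 0" "\<delta>\<^sup>2 = \<epsilon> / (8 * pi)" using e by (simp_all add: \<delta>_def)
  obtain g where g: "real_polynomial_function g" "\<And>x. x \<in> S2 \<Longrightarrow> \<bar>f x - g x\<bar> < \<delta>"
    using Stone_Weierstrass_real_polynomial_function[OF compact_sphere f \<delta>(1)] by blast
  obtain d where d: "poly_lt d g" using ex_poly_lt_real_polynomial_function[OF g(1)] by blast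
  have "(\<integral>x. (f x - g x)\<^sup>2 \<partial>vol_S2) \<le> (\<integral>x. \<delta>\<^sup>2 \<partial>vol_S2)"
  proof (rule vol.bdd_meas_integral_mono)
    fix x assume "x \<in> space vol_S2"
    then have "\<bar>f x - g x\<bar> \<le> \<bar>\<delta>\<bar>" using g(2)[of x] \<delta>(1) by simp
    then show "(f x - g x)\<^sup>2 \<le> \<delta>\<^sup>2" by (rule abs_le_square_iff[THEN iffD1])
  qed (intro bdd_meas_power bdd_meas_diff fb poly_lt_bdd_meas[OF d] bdd_meas_const)+
  also have "\<dots> = \<epsilon> / 2" by (simp add: measure_vol_S2 \<delta>(2))
  also have "\<dots> < \<epsilon>" using e by simp
  finally show "\<exists>d q. poly_lt d q \<and> (\<integral>x. (f x - q x)\<^sup>2 \<partial>vol_S2) < \<epsilon>" using d by blast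
qed

text \<open>
The continuous functions \<open>max 0 (1 - n * infdist x K)\<close> decrease to the indicator of \<open>K\<close>.
\<close>
lemma poly_approximable_compact_indicator:
  fixes K :: "(real ^ 3) set"
  assumes K: "compact K"
  shows "poly_approximable (indicator K)"
proof (cases "K = {}")
  case True
  then show ?thesis using poly_approximable_poly_lt[OF poly_lt_zero] by (simp add: indicator_def[abs_def])
next
  case False
  define h where "h n x = max 0 (1 - real n * infdist x K)" for n x
  have hc: "continuous_on S2 (h n)" for n
    unfolding h_def by (intro continuous_intros)
  have h01: "0 \<le> h n x" "h n x \<le> 1" for n x
    unfolding h_def using infdist_nonneg[of x K] by (auto simp: max_def)
  have KS: "K \<inter> S2 \<in> sets vol_S2"
    using K by (auto simp: sets_vol_S2 sets_restrict_space_iff intro!: borel_closed compact_imp_closed)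
  have indm: "(indicator K :: real ^ 3 \<Rightarrow> real) \<in> borel_measurable vol_S2"
    by (subst measurable_cong[of _ _ "indicator (K \<inter> S2)"]) (auto simp: indicator_def KS intro!: borel_measurable_indicator)
  then have indb: "bdd_meas vol_S2 (indicator K)"
    unfolding bdd_meas_def by (intro conjI exI[of _ 1]) (auto simp: indicator_def)
  show ?thesis
  proof (rule poly_approximable_dominated[where h = h and w = "\<lambda>x. 1"])
    show "poly_approximable (h n)" for n by (rule poly_approximable_continuous[OF hc])
    show "(indicator K x - h n x)\<^sup>2 \<le> 1" for n x
      using h01[of n x] by (auto simp: indicator_def abs_square_le_1 abs_le_iff)
    show "(\<lambda>n. h n x) \<longlonglongrightarrow> indicator K x" for x
    proof (cases "x \<in> K")
      case True
      then show ?thesis by (simp add: h_def)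
    next
      case x: False
      have "infdist x K > 0"
        using infdist_pos_not_in_closed[OF compact_imp_closed[OF K] False x] .
      then obtain m where m: "1 < real m * infdist x K" using reals_Archimedean3 by blast
      have "h n x = 0" if "n \<ge> m" for n
      proof -
        have "real m * infdist x K \<le> real n * infdist x K" using that infdist_nonneg by (intro mult_right_mono) auto
        then show ?thesis using m by (simp add: h_def)
      qed
      then have "eventually (\<lambda>n. h n x = 0) sequentially" unfolding eventually_sequentially by blast
      then show ?thesis using x by (simp add: tendsto_eventually)
    qed
  qed (auto intro: indm bdd_meas_L2_fun[OF indb])
qed

lemma poly_approximable_indicator:
  assumes A: "A \<in> sets vol_S2"
  shows "poly_approximable (indicator A)"
proof -
  define N where "N = distr vol_S2 borel (\<lambda>x. x)"
  have id: "(\<lambda>x. x) \<in> vol_S2 \<rightarrow>\<^sub>M borel"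
    using measurable_restrict_space1[of "\<lambda>x. x" borel borel S2]
    by (simp add: measurable_cong_sets[OF sets_vol_S2 refl])
  have AS: "A \<subseteq> S2" using sets.sets_into_space[OF A] by simp
  have Ab: "A \<in> sets borel" using A by (auto simp: sets_vol_S2 sets_restrict_space_iff)
  have N: "emeasure N B = emeasure vol_S2 B" if "B \<in> sets borel" "B \<subseteq> S2" for B
    using that emeasure_distr[OF id that(1)] by (simp add: N_def Int_absorb2)
  have fin: "emeasure N (space N) \<noteq> \<infinity>"
    using emeasure_distr[OF id, of UNIV] by (simp add: N_def emeasure_vol_S2_space)
  have inner: "emeasure N A = (SUP K \<in> {K. K \<subseteq> A \<and> compact K}. emeasure N K)"
    by (rule inner_regular) (use fin Ab in \<open>auto simp: N_def\<close>)
  have indb: "bdd_meas vol_S2 (indicator B)" if "B \<in> sets vol_S2" for B :: "(real ^ 3) set"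
    unfolding bdd_meas_def using that by (intro conjI exI[of _ 1]) (auto simp: indicator_def intro!: borel_measurable_indicator)
  show ?thesis
  proof (rule poly_approximable_limit)
    show "L2_fun vol_S2 (indicator A)" by (rule bdd_meas_L2_fun[OF indb[OF A]])
    fix \<epsilon> :: real assume e: "\<epsilon> > 0"
    have "\<exists>K. K \<subseteq> A \<and> compact K \<and> measure vol_S2 A - \<epsilon> < measure vol_S2 K"
    proof (cases "measure vol_S2 A - \<epsilon> < 0")
      case True
      then show ?thesis by (intro exI[of _ "{}"]) auto
    next
      case False
      have "ennreal (measure vol_S2 A - \<epsilon>) < ennreal (measure vol_S2 A)"
        using e False by (subst ennreal_less_iff) auto
      also have "\<dots> = emeasure N A" by (simp add: N[OF Ab AS] vol.emeasure_eq_measure)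
      finally obtain K where K: "K \<subseteq> A" "compact K" "ennreal (measure vol_S2 A - \<epsilon>) < emeasure N K"
        unfolding inner less_SUP_iff by blast
      have "K \<in> sets borel" using K(2) by (simp add: borel_closed compact_imp_closed)
      then have "emeasure N K = ennreal (measure vol_S2 K)"
        using N K AS by (simp add: vol.emeasure_eq_measure)
      then show ?thesis using K False by (auto simp: ennreal_less_iff)
    qed
    then obtain K where K: "K \<subseteq> A" "compact K" "measure vol_S2 A - \<epsilon> < measure vol_S2 K" by blast
    have Ks: "K \<in> sets vol_S2"
      using K AS by (auto simp: sets_vol_S2 sets_restrict_space_iff intro!: borel_closed compact_imp_closed)
    have "(\<integral>x. (indicator A x - indicator K x :: real)\<^sup>2 \<partial>vol_S2) = (\<integral>x. indicator A x - indicator K x \<partial>vol_S2)"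
      using K(1) by (intro Bochner_Integration.integral_cong) (auto simp: indicator_def)
    also have "\<dots> = (\<integral>x. indicator A x \<partial>vol_S2) - (\<integral>x. indicator K x \<partial>vol_S2)"
      by (rule Bochner_Integration.integral_diff) (auto intro: vol.bdd_meas_integrable indb A Ks)
    also have "\<dots> = measure vol_S2 A - measure vol_S2 K" using A Ks AS K(1) by (simp add: Int_absorb1 Int_absorb2 order_trans)
    finally have "(\<integral>x. (indicator A x - indicator K x :: real)\<^sup>2 \<partial>vol_S2) < \<epsilon>" using K(3) by simp
    then show "\<exists>h. poly_approximable h \<and> (\<integral>x. (indicator A x - h x)\<^sup>2 \<partial>vol_S2) < \<epsilon>"
      using poly_approximable_compact_indicator[OF K(2)] by blast
  qed
qed

text \<open>
The usual chain: continuous functions by the Stone--Weierstrass theorem, indicators of compact sets, indicators of Borel sets by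
inner regularity, simple functions, and finally all of \<open>L\<^sup>2\<close> by dominated convergence.
\<close>
theorem L2_poly_approximable:
  assumes f: "L2_fun vol_S2 f"
  shows "poly_approximable f"
proof -
  have fm: "f \<in> borel_measurable vol_S2" and fi: "integrable vol_S2 (\<lambda>x. (f x)\<^sup>2)"
    using f by (auto simp: L2_fun_def)
  obtain s where s: "\<And>i. simple_function vol_S2 (s i)" "\<And>x. x \<in> space vol_S2 \<Longrightarrow> (\<lambda>i. s i x) \<longlonglongrightarrow> f x"
    "\<And>i x. x \<in> space vol_S2 \<Longrightarrow> dist (s i x) 0 \<le> 2 * dist (f x) 0"
    using borel_measurable_implies_sequence_metric[OF fm, of 0] by blast
  have sa: "poly_approximable (s i)" for i
  proof -
    define V where "V = s i ` space vol_S2"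
    have finV: "finite V" using s(1)[of i] by (simp add: V_def simple_function_def)
    have "poly_approximable (\<lambda>x. \<Sum>y\<in>V. y * indicator (s i -` {y} \<inter> space vol_S2) x)"
      using s(1)[of i] by (intro poly_approximable_sum poly_approximable_cmult poly_approximable_indicator)
        (auto simp: V_def simple_function_def)
    then show ?thesis
    proof (rule poly_approximable_limit[rotated, OF exI, OF conjI])
      fix \<epsilon> :: real assume "\<epsilon> > 0"
      have "(\<integral>x. (s i x - (\<Sum>y\<in>V. y * indicator (s i -` {y} \<inter> space vol_S2) x))\<^sup>2 \<partial>vol_S2) = (\<integral>x. 0 \<partial>vol_S2)"
      proof (rule Bochner_Integration.integral_cong[OF refl])
        fix x assume x: "x \<in> space vol_S2"
        have "(\<Sum>y\<in>V. y * indicator (s i -` {y} \<inter> space vol_S2) x) = (\<Sum>y\<in>V. if y = s i x then s i x else 0)"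
          using x by (intro sum.cong refl) (auto simp: indicator_def)
        also have "\<dots> = s i x" using finV x by (simp add: V_def)
        finally show "(s i x - (\<Sum>y\<in>V. y * indicator (s i -` {y} \<inter> space vol_S2) x))\<^sup>2 = 0" by simp
      qed
      then show "(\<integral>x. (s i x - (\<Sum>y\<in>V. y * indicator (s i -` {y} \<inter> space vol_S2) x))\<^sup>2 \<partial>vol_S2) < \<epsilon>"
        using \<open>\<epsilon> > 0\<close> by simp
    next
      have "bdd_meas vol_S2 (s i)"
        unfolding bdd_meas_def
      proof (intro conjI exI[of _ "\<Sum>y\<in>V. \<bar>y\<bar>"] ballI)
        show "s i \<in> borel_measurable vol_S2" using s(1) by (rule borel_measurable_simple_function)
        fix x assume "x \<in> space vol_S2"
        then show "\<bar>s i x\<bar> \<le> (\<Sum>y\<in>V. \<bar>y\<bar>)" using finV by (intro member_le_sum[of "s i x" V abs]) (auto simp: V_def)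
      qed
      then show "L2_fun vol_S2 (s i)" by (rule bdd_meas_L2_fun)
    qed
  qed
  show ?thesis
  proof (rule poly_approximable_dominated[where h = s and w = "\<lambda>x. 9 * (f x)\<^sup>2"])
    show "(f x - s n x)\<^sup>2 \<le> 9 * (f x)\<^sup>2" if "x \<in> S2" for n x
    proof -
      have "\<bar>s n x\<bar> \<le> 2 * \<bar>f x\<bar>" using s(3)[of x n] that by (simp add: dist_norm)
      then have "\<bar>f x - s n x\<bar> \<le> \<bar>3 * f x\<bar>" by linarith
      then have "(f x - s n x)\<^sup>2 \<le> (3 * f x)\<^sup>2" by (rule abs_le_square_iff[THEN iffD1])
      then show ?thesis by (simp add: power_mult_distrib)
    qed
  qed (use fm fi sa s(2) f in auto)
qed

section \<open>Random bases of spherical harmonics\<close>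

text \<open>
The bijection from the index set onto the natural numbers that maps degree \<open>l\<close> onto the block of level \<open>l\<close>.
\<close>
definition harmonic_index :: "nat \<times> int \<Rightarrow> nat" where
  "harmonic_index = (\<lambda>(l, m). nat (int (l\<^sup>2) + int l + m))"

lemma level_harmonic_index:
  assumes "k \<in> T_infty" shows "level (harmonic_index k) = fst k"
proof -
  obtain l m where k: "k = (l, m)" by (cases k)
  have m: "- int l \<le> m" "m \<le> int l" using assms by (auto simp: T_infty_def k)
  have "int (l\<^sup>2) + int l + m = int (l\<^sup>2 + nat (int l + m))" using m by simp
  then have "harmonic_index k = l\<^sup>2 + nat (int l + m)"
    by (simp only: harmonic_index_def k case_prod_conv nat_int)
  moreover have "nat (int l + m) < 2 * l + 1" using m by linarith
  ultimately show ?thesis using level_add[of "nat (int l + m)" l] by (simp only: k fst_conv)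
qed

lemma harmonic_index_inj: "inj_on harmonic_index T_infty"
proof (rule inj_onI)
  fix k k' assume k: "k \<in> T_infty" "k' \<in> T_infty" "harmonic_index k = harmonic_index k'"
  then have f: "fst k = fst k'" using level_harmonic_index by metis
  have "- int (fst k) \<le> snd k" "- int (fst k') \<le> snd k'" using k by (auto simp: T_infty_def)
  moreover have "0 \<le> int ((fst k)\<^sup>2)" "0 \<le> int ((fst k')\<^sup>2)" by (rule of_nat_0_le_iff)+
  ultimately have "0 \<le> int ((fst k)\<^sup>2) + int (fst k) + snd k" "0 \<le> int ((fst k')\<^sup>2) + int (fst k') + snd k'"
    by linarith+
  then have "int ((fst k)\<^sup>2) + int (fst k) + snd k = int ((fst k')\<^sup>2) + int (fst k') + snd k'"
    using k(3) unfolding harmonic_index_def case_prod_beta by simp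
  then show "k = k'" using f by (simp add: prod_eq_iff)
qed

lemma harmonic_index_surj: "\<exists>k\<in>T_infty. harmonic_index k = n"
proof -
  obtain i where i: "n = (level n)\<^sup>2 + i" "i < 2 * level n + 1"
    using level_block[of n] unfolding block_eq by blast
  have "(level n, int i - int (level n)) \<in> T_infty" using i(2) by (auto simp: T_infty_def)
  moreover have "harmonic_index (level n, int i - int (level n)) = n"
  proof -
    have "int ((level n)\<^sup>2) + int (level n) + (int i - int (level n)) = int ((level n)\<^sup>2 + i)" by simp
    then show ?thesis by (simp only: harmonic_index_def case_prod_conv nat_int i(1)[symmetric])
  qed
  ultimately show ?thesis by blast
qed

theorem theorem2p1:
  fixes g :: "real ^ 3 \<Rightarrow> real" and p :: nat
  assumes g: "Linfty_fun vol_S2 g"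
    and p: "p \<ge> 3"
  shows "\<exists>(C::real) (e :: nat \<times> int \<Rightarrow> real ^ 3 \<Rightarrow> real).
    C > 0 \<and>
    (\<forall>k\<in>T_infty. smooth_on_S2 (e k)) \<and>
    orthonormal_basis_L2 vol_S2 T_infty e \<and>
    (\<forall>(l, m)\<in>T_infty. \<forall>x\<in>S2.
       laplace_S2 (e (l, m)) x = - (real l * (real l + 1)) * e (l, m) x) \<and>
    (\<forall>k :: nat \<Rightarrow> nat \<times> int. (\<forall>j\<in>{1..p}. k j \<in> T_infty) \<longrightarrow>
       \<bar>\<integral>x. (\<Prod>j=1..p. e (k j) x) * g x \<partial>vol_S2\<bar>
         \<le> C * min 1 (ln (2 + real (ell_max p k)) ^ p / sqrt (Upsilon p k)))"
proof -
  obtain B0 where gm: "g \<in> borel_measurable vol_S2" and B0: "AE x in vol_S2. \<bar>g x\<bar> \<le> B0"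
    using g by (auto simp: Linfty_fun_def)
  define b where "b = \<bar>B0\<bar>"
  \<comment> \<open>The random construction works with a weight that is bounded everywhere, not just almost everywhere.\<close>
  define g' where "g' x = max (- b) (min b (g x))" for x
  have g'b: "\<bar>g' x\<bar> \<le> b" for x by (auto simp: g'_def b_def max_def min_def)
  have g'm: "g' \<in> borel_measurable vol_S2" unfolding g'_def using gm by measurable
  have g': "bdd_meas vol_S2 g'" unfolding bdd_meas_def using g'm g'b by blast
  have gg': "AE x in vol_S2. g x = g' x"
    using B0 by (rule AE_mp) (auto simp: g'_def b_def max_def min_def intro!: AE_I2)
  have sumsq: "(\<Sum>i\<in>block l. (gram_schmidt i x)\<^sup>2) \<le> real (2 * l + 1)" if "x \<in> space vol_S2" for l x
  proof -
    have "real (2 * l + 1) / (4 * pi) \<le> real (2 * l + 1) / 1"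
      using pi_gt3 by (intro divide_left_mono) auto
    then show ?thesis using sum_gram_schmidt_squares[of x l] that by simp
  qed
  obtain C E where C: "C > 0" and E: "vol.orthonormal UNIV E"
    and E_R: "\<exists>R. \<forall>k x. E k x = (\<Sum>i\<in>block (level k). R k i * gram_schmidt i x)"
    and E_R': "\<exists>R. \<forall>k x. gram_schmidt k x = (\<Sum>i\<in>block (level k). R k i * E i x)"
    and bound: "\<forall>r \<kappa>. (\<forall>j\<in>{1..p}. level (\<kappa> j) \<le> r) \<longrightarrow>
       \<bar>\<integral>x. g' x * (\<Prod>j\<in>{1..p}. E (\<kappa> j) x) \<partial>vol_S2\<bar> \<le> C \<and>
       (\<forall>j0\<in>{1..p}. (\<forall>j\<in>{1..p}. j \<noteq> j0 \<longrightarrow> \<kappa> j \<noteq> \<kappa> j0) \<longrightarrow>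
          \<bar>\<integral>x. g' x * (\<Prod>j\<in>{1..p}. E (\<kappa> j) x) \<partial>vol_S2\<bar> \<le> C * ln (2 + real r) ^ p / sqrt (real (2 * level (\<kappa> j0) + 1)))"
    using vol.random_orthonormal_basis[OF p g' g'b gram_schmidt_orthonormal sumsq] by blast
  obtain R where R: "\<And>k. E k = (\<lambda>x. \<Sum>i\<in>block (level k). R k i * gram_schmidt i x)"
    using E_R by blast
  have E_poly_lt: "poly_lt (Suc (level k)) (E k)" for k
  proof -
    have "poly_lt (Suc (level k)) (gram_schmidt i)" if "i \<in> block (level k)" for i
      using poly_lt_gram_schmidt[of i] that by (simp add: level_eq_iff[symmetric])
    then show ?thesis unfolding R by (intro poly_lt_sum poly_lt_cmult)
  qed
  have Eb [simp]: "bdd_meas vol_S2 (E k)" for k by (rule poly_lt_bdd_meas[OF E_poly_lt])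
  have E_orth: "(\<integral>x. E k x * H x \<partial>vol_S2) = 0" if H: "poly_lt (level k) H" for k H
  proof -
    have "(\<integral>x. E k x * H x \<partial>vol_S2) = (\<integral>x. (\<Sum>i\<in>block (level k). R k i * (gram_schmidt i x * H x)) \<partial>vol_S2)"
      by (simp add: R sum_distrib_right mult.assoc)
    also have "\<dots> = (\<Sum>i\<in>block (level k). R k i * (\<integral>x. gram_schmidt i x * H x \<partial>vol_S2))"
      using poly_lt_bdd_meas[OF H] by (subst Bochner_Integration.integral_sum) auto
    also have "\<dots> = 0"
      by (intro sum.neutral ballI) (simp add: gram_schmidt_orthogonal_poly_lt[OF H] level_eq_iff[symmetric])
    finally show ?thesis .
  qed
  have E_span: "S2_span E ((d + 1)\<^sup>2) (gram_schmidt k)" if k: "k < (d + 1)\<^sup>2" for k d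
  proof -
    obtain R' where R': "\<And>k x. gram_schmidt k x = (\<Sum>i\<in>block (level k). R' k i * E i x)" using E_R' by blast
    have "S2_span E ((d + 1)\<^sup>2) (\<lambda>x. \<Sum>i\<in>block (level k). R' k i * E i x)"
    proof (intro S2_span_sum S2_span_cmult S2_span_base)
      fix i assume "i \<in> block (level k)"
      moreover have "level k \<le> d" using k less_square_level by blast
      ultimately show "i < (d + 1)\<^sup>2" using block_subset[of "level k" d] by blast
    qed
    then show ?thesis by (rule S2_span_cong) (rule R')
  qed
  define e where "e k = E (harmonic_index k)" for k
  have basis: "orthonormal_basis_L2 vol_S2 T_infty e"
    unfolding orthonormal_basis_L2_def
  proof (intro conjI ballI allI impI)
    show "L2_fun vol_S2 (e i)" for i unfolding e_def by (intro bdd_meas_L2_fun) simp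
    show "(\<integral>x. e i x * e j x \<partial>vol_S2) = (if i = j then 1 else 0)" if "i \<in> T_infty" "j \<in> T_infty" for i j
      using E inj_on_eq_iff[OF harmonic_index_inj that] by (simp add: e_def vol.orthonormal_def)
    fix f and \<epsilon> :: real assume f: "L2_fun vol_S2 f" and \<epsilon>: "\<epsilon> > 0"
    obtain d q where q: "poly_lt d q" "(\<integral>x. (f x - q x)\<^sup>2 \<partial>vol_S2) < \<epsilon>\<^sup>2"
      using L2_poly_approximable[OF f] \<epsilon> unfolding poly_approximable_def by (meson zero_less_power)
    have "S2_span E ((d + 1)\<^sup>2) q"
      by (rule S2_span_trans[OF poly_lt_span_gram_schmidt]) (use poly_lt_Suc[OF q(1)] E_span in auto)
    then obtain c where c: "\<And>x. x \<in> S2 \<Longrightarrow> q x = (\<Sum>k<(d + 1)\<^sup>2. c k * E k x)"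
      unfolding S2_span_def by blast
    define J where "J = {k \<in> T_infty. harmonic_index k < (d + 1)\<^sup>2}"
    have im: "harmonic_index ` J = {..<(d + 1)\<^sup>2}"
    proof
      show "harmonic_index ` J \<subseteq> {..<(d + 1)\<^sup>2}" unfolding J_def by blast
      show "{..<(d + 1)\<^sup>2} \<subseteq> harmonic_index ` J"
      proof
        fix n assume n: "n \<in> {..<(d + 1)\<^sup>2}"
        obtain k where "k \<in> T_infty" "harmonic_index k = n" using harmonic_index_surj by blast
        then show "n \<in> harmonic_index ` J" using n by (intro image_eqI[of _ _ k]) (simp_all add: J_def)
      qed
    qed
    have inj: "inj_on harmonic_index J" by (rule inj_on_subset[OF harmonic_index_inj]) (auto simp: J_def)
    have finJ: "finite J" using finite_imageD[of harmonic_index J] inj im by simp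
    have q_e: "q x = (\<Sum>k\<in>J. c (harmonic_index k) * e k x)" if "x \<in> S2" for x
      unfolding c[OF that] e_def im[symmetric] using inj by (subst sum.reindex) auto
    have "(\<integral>x. (f x - (\<Sum>k\<in>J. c (harmonic_index k) * e k x))\<^sup>2 \<partial>vol_S2) = (\<integral>x. (f x - q x)\<^sup>2 \<partial>vol_S2)"
      by (rule vol_integral_cong) (simp add: q_e)
    then have "L2_norm vol_S2 (\<lambda>x. f x - (\<Sum>k\<in>J. c (harmonic_index k) * e k x)) < \<epsilon>"
      unfolding L2_norm_def using q(2) \<epsilon> by (intro real_less_lsqrt) auto
    then show "\<exists>J c. finite J \<and> J \<subseteq> T_infty \<and> L2_norm vol_S2 (\<lambda>x. f x - (\<Sum>j\<in>J. c j * e j x)) < \<epsilon>"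
      using finJ by (intro exI[of _ J] exI[of _ "\<lambda>k. c (harmonic_index k)"]) (auto simp: J_def)
  qed
  have eigen: "laplace_S2 (e (l, m)) x = - (real l * (real l + 1)) * e (l, m) x"
    if "(l, m) \<in> T_infty" "x \<in> S2" for l m x
  proof -
    have "level (harmonic_index (l, m)) = l" using level_harmonic_index[OF that(1)] by simp
    then show ?thesis
      using harmonic_eigenfunction[of l "e (l, m)" x] E_poly_lt[of "harmonic_index (l, m)"] E_orth[of "harmonic_index (l, m)"] that(2)
      by (simp add: e_def)
  qed
  have multi: "\<bar>\<integral>x. (\<Prod>j=1..p. e (k j) x) * g x \<partial>vol_S2\<bar>
         \<le> (C * 2 ^ p) * min 1 (ln (2 + real (ell_max p k)) ^ p / sqrt (Upsilon p k))"
    if k: "\<forall>j\<in>{1..p}. k j \<in> T_infty" for k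
  proof -
    define \<kappa> where "\<kappa> j = harmonic_index (k j)" for j
    define I where "I = \<bar>\<integral>x. g' x * (\<Prod>j\<in>{1..p}. E (\<kappa> j) x) \<partial>vol_S2\<bar>"
    define \<Lambda> where "\<Lambda> = ln (2 + real (ell_max p k))"
    have \<kappa>_lev: "level (\<kappa> j) = fst (k j)" if "j \<in> {1..p}" for j
      unfolding \<kappa>_def using k that by (intro level_harmonic_index) blast
    have level_le: "\<forall>j\<in>{1..p}. level (\<kappa> j) \<le> ell_max p k"
      unfolding ell_max_def by (auto simp: \<kappa>_lev)
    have "(\<integral>x. (\<Prod>j=1..p. e (k j) x) * g x \<partial>vol_S2) = (\<integral>x. g' x * (\<Prod>j\<in>{1..p}. E (\<kappa> j) x) \<partial>vol_S2)"
    proof (rule integral_cong_AE)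
      show "(\<lambda>x. (\<Prod>j=1..p. e (k j) x) * g x) \<in> borel_measurable vol_S2"
        using gm by (intro borel_measurable_times borel_measurable_prod) (auto simp: e_def intro: bdd_meas_measurable)
      show "(\<lambda>x. g' x * (\<Prod>j\<in>{1..p}. E (\<kappa> j) x)) \<in> borel_measurable vol_S2"
        by (intro bdd_meas_measurable bdd_meas_mult bdd_meas_prod g' Eb)
      show "AE x in vol_S2. (\<Prod>j=1..p. e (k j) x) * g x = g' x * (\<Prod>j\<in>{1..p}. E (\<kappa> j) x)"
        using gg' by (rule AE_mp) (auto simp: e_def \<kappa>_def)
    qed
    then have I_eq: "\<bar>\<integral>x. (\<Prod>j=1..p. e (k j) x) * g x \<partial>vol_S2\<bar> = I" by (simp add: I_def)
    have I1: "I \<le> C" using bound level_le unfolding I_def by blast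
    have \<Lambda>: "\<Lambda> \<ge> 1 / 2" unfolding \<Lambda>_def by (rule ln_two_plus_ge_half)
    have C2: "C \<le> C * 2 ^ p" using C by simp
    define S where "S = {jbracket (real (fst (k j))) | j. j \<in> {1..p} \<and> (\<forall>j'\<in>{1..p}. j' \<noteq> j \<longrightarrow> k j' \<noteq> k j)}"
    have finS: "finite S"
      by (rule finite_subset[of _ "(\<lambda>j. jbracket (real (fst (k j)))) ` {1..p}"]) (auto simp: S_def)
    have "Upsilon p k \<in> {1} \<union> S" unfolding Upsilon_def S_def[symmetric] using finS by (intro Max_in) auto
    moreover have "1 \<le> Upsilon p k" unfolding Upsilon_def S_def[symmetric] using finS by (intro Max_ge) auto
    ultimately consider "Upsilon p k = 1" | j where "j \<in> {1..p}" "\<forall>j'\<in>{1..p}. j' \<noteq> j \<longrightarrow> k j' \<noteq> k j"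
      "Upsilon p k = jbracket (real (fst (k j)))" by (auto simp: S_def)
    then have I2: "I \<le> (C * 2 ^ p) * (\<Lambda> ^ p / sqrt (Upsilon p k))"
    proof cases
      \<comment> \<open>No index occurs only once. The factor \<open>2 ^ p\<close> compensates for \<open>\<Lambda> < 1\<close>, which happens for level \<open>0\<close>.\<close>
      case 1
      have "1 \<le> (2 * \<Lambda>) ^ p" using \<Lambda> by (intro one_le_power) simp
      then have "C * 1 \<le> C * (2 ^ p * \<Lambda> ^ p)" using C by (intro mult_left_mono) (auto simp: power_mult_distrib)
      then show ?thesis using I1 1 by simp
    next
      case (2 j)
      have "\<forall>j'\<in>{1..p}. j' \<noteq> j \<longrightarrow> \<kappa> j' \<noteq> \<kappa> j"
        using 2 k inj_onD[OF harmonic_index_inj] unfolding \<kappa>_def by metis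
      then have "I \<le> C * \<Lambda> ^ p / sqrt (real (2 * level (\<kappa> j) + 1))"
        using bound level_le 2(1) unfolding I_def \<Lambda>_def by blast
      also have "\<dots> \<le> C * \<Lambda> ^ p / sqrt (Upsilon p k)"
      proof (intro divide_left_mono real_sqrt_le_mono)
        have "sqrt (1 + (real (fst (k j)))\<^sup>2) \<le> sqrt ((1 + real (fst (k j)))\<^sup>2)"
          by (intro real_sqrt_le_mono) (simp add: power2_sum)
        then show "Upsilon p k \<le> real (2 * level (\<kappa> j) + 1)"
          by (simp add: 2(3) jbracket_def \<kappa>_lev[OF 2(1)])
        show "0 \<le> C * \<Lambda> ^ p" using C \<Lambda> by simp
        show "0 < sqrt (real (2 * level (\<kappa> j) + 1)) * sqrt (Upsilon p k)" using \<open>1 \<le> Upsilon p k\<close> by simp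
      qed
      also have "\<dots> = C * (\<Lambda> ^ p / sqrt (Upsilon p k))" by simp
      also have "\<dots> \<le> (C * 2 ^ p) * (\<Lambda> ^ p / sqrt (Upsilon p k))"
        using C2 \<Lambda> \<open>1 \<le> Upsilon p k\<close> by (intro mult_right_mono) auto
      finally show ?thesis .
    qed
    have "I \<le> (C * 2 ^ p) * 1" using I1 C2 by simp
    then show ?thesis using I2 unfolding I_eq \<Lambda>_def[symmetric] by (simp add: min_def)
  qed
  have smooth: "smooth_on_S2 (e k)" for k unfolding e_def by (rule poly_lt_smooth_on_S2[OF E_poly_lt])
  show ?thesis
    by (intro exI[of _ "C * 2 ^ p"] exI[of _ e] conjI) (use C smooth basis eigen multi in auto)
qed

end
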